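(* The discrete problem: find $U\in W_{h,\tau}$ such that $$\int_{\Omega_T}U'V+\sum_{j=0}^{J-1}\int_\Omega [\![U_j]\!]\,V_j^{+}+\int_{\Omega_T}\big((\kappa_1D_{0+}^{\alpha}+\kappa_2D_{0+}^{\beta})\partial_xU\big)\,\partial_xV=\int_\Omega (R_hu_0)\,V_0^{+}+\langle f,V\rangle_{L^\infty(0,T;H_0^1(\Omega))}\quad\text{for all }V\in W_{h,\tau},$$ admits a unique solution $U$. In addition, there is a constant $C>0$, depending only on $\alpha,\beta,m,n$, such that if $f\in L_\beta^2(0,T;H^{-1}(\Omega))$, then for each $1\leqslant j\leqslant J$, $$\|U(t_j)\|_{L^2(\Omega)}+\sqrt{\kappa_1}\,|U|_{H^{\alpha/2}(0,t_j;H_0^1(\Omega))}+\sqrt{\kappa_2}\,|U|_{H^{\beta/2}(0,t_j;H_0^1(\Omega))}\leqslant C\Big(\|u_0\|_{H_0^1(\Omega)}+\tfrac{1}{\sqrt{\kappa_2}}\|f\|_{L_\beta^2(0,t_j;H^{-1}(\Omega))}\Big).$$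
   Context: Data: $\Omega\subset\mathbb R$ is an open interval, $0<T<\infty$, $\Omega_T:=\Omega\times(0,T)$, $0<\alpha<\beta<1$, $\kappa_1,\kappa_2>0$ are constants, $u_0\in H_0^1(\Omega)$, $f\in L^1(0,T;H^{-1}(\Omega))$. $H_0^1(\Omega)$ and $H^{-1}(\Omega)$ are the standard Sobolev spaces. For a Banach space $X$, $\langle\cdot,\cdot\rangle_X$ is the duality pairing between $X'$ and $X$. Fractional derivative: for $0<\gamma<1$, $D_{0+}^\gamma v:=D\,I_{0+}^{1-\gamma}v$, where $D$ is the first-order time derivative in the distribution sense and $(I_{0+}^{\mu}v)(t)=\frac1{\Gamma(\mu)}\int_0^t(t-s)^{\mu-1}v(s)\,\mathrm ds$ for $0<t<T$. Discretization: $\mathcal K_h$ is a partition of $\Omega$ into open intervals with maximal length $h$; $J\in\mathbb N_{>0}$, $\sigma\geqslant1$, $t_j:=(j/J)^\sigma T$ for $0\leqslant j\leqslant J$, $I_j:=(t_{j-1},t_j)$, $\tau_j:=t_j-t_{j-1}$ for $1\leqslant j\leqslant J$, $\tau:=\tau_J$. For integers $m\geqslant0$, $n\geqslant1$, with $P_k$ denoting polynomials of degree $\leqslant k$, $S_h:=\{v_h\in H_0^1(\Omega): v_h|_K\in P_n(K)\ \forall K\in\mathcal K_h\}$ and $W_{h,\tau}:=\{V\in L^2(0,T;S_h): V|_{I_j}\in P_m(I_j;S_h),\ \forall\,1\leqslant j\leqslant J\}$. For $V\in W_{h,\tau}$: $V_j^+:=\lim_{t\to t_j+}V(t)$ for $0\leqslant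 j<J$; $V_j=V(t_j):=\lim_{t\to t_j-}V(t)$ for $0<j\leqslant J$; $V_0:=0$; $[\![V_j]\!]:=V_j^+-V_j$ for $0\leqslant j<J$; and $V'$ is the derivative in time taken separately on each $I_j$. The projection $R_h:H_0^1(\Omega)\to S_h$ is defined by $\int_\Omega\partial_x(v-R_hv)\,\partial_xv_h=0$ for all $v\in H_0^1(\Omega)$, $v_h\in S_h$. Norms: for an interval $\mathcal O$, $0\leqslant\delta<1$ and a separable Hilbert space $X$, $\|v\|_{L_\delta^2(\mathcal O;X)}:=\big(\int_{\mathcal O}|t|^\delta\|v(t)\|_X^2\,\mathrm dt\big)^{1/2}$, and $L_\delta^2(\mathcal O;X)$ is the set of $v\in L^1(\mathcal O;X)$ with finite such norm. For $0<\gamma<1/2$, $|v|_{H^\gamma(\mathcal O)}:=\big(\int_{\mathbb R}|\xi|^{2\gamma}|\mathcal F(v\chi_{\mathcal O})(\xi)|^2\,\mathrm d\xi\big)^{1/2}$, with $\mathcal F$ the Fourier transform on $L^2(\mathbb R)$ and $\chi_{\mathcal O}$ the indicator function of $\mathcal O$; for a separable Hilbert space $X$ with orthonormal basis $\{e_k\}$, $|v|_{H^\gamma(\mathcal O;X)}:=\big(\sum_k|(v,e_k)_X|_{H^\gamma(\mathcal O)}^2\big)^{1/2}$.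
   Formalization: The constant C may also depend on the (bounded) interval Ω; with C depending only on α, β, m, n the estimate fails for long intervals, e.g. n=1, mesh {0, L/2, L}, u_0 a unit-width hat at L/2, f=0, κ_1, κ_2→0, L→∞. *)

theory Defs
  imports "HOL-Analysis.Analysis"
begin

text \<open>
  Elements of Lebesgue and Sobolev spaces over an open interval \<open>(a, b)\<close> are represented by
  functions \<open>real \<Rightarrow> real\<close>; two functions represent the same element iff they agree almost
  everywhere on \<open>(a, b)\<close>. A function of time with values in such a space has type
  \<open>real \<Rightarrow> real \<Rightarrow> real\<close>, time first. All integrals are with respect to the (complete) Lebesgue
  measure, so that changing a representative on a null set never matters.
\<close>

definition test_fun :: "real \<Rightarrow> real \<Rightarrow> (real \<Rightarrow> real) \<Rightarrow> bool" where
  "test_fun a b \<phi> \<longleftrightarrow>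
     (\<forall>k x. (deriv ^^ k) \<phi> field_differentiable (at x)) \<and>
     (\<exists>c d. a < c \<and> d < b \<and> (\<forall>x. x \<notin> {c..d} \<longrightarrow> \<phi> x = 0))"

definition loc_integrable :: "real \<Rightarrow> real \<Rightarrow> (real \<Rightarrow> real) \<Rightarrow> bool" where
  "loc_integrable a b v \<longleftrightarrow> (\<forall>c d. a < c \<and> d < b \<longrightarrow> set_integrable lebesgue {c..d} v)"

definition is_distr_deriv :: "real \<Rightarrow> real \<Rightarrow> (real \<Rightarrow> real) \<Rightarrow> (real \<Rightarrow> real) \<Rightarrow> bool" where
  "is_distr_deriv a b v w \<longleftrightarrow>
     loc_integrable a b v \<and> loc_integrable a b w \<and>
     (\<forall>\<phi>. test_fun a b \<phi> \<longrightarrow>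
        (LINT x:{a<..<b}|lebesgue. v x * deriv \<phi> x) = - (LINT x:{a<..<b}|lebesgue. w x * \<phi> x))"

text \<open>
  The distributional derivative, when it is a regular distribution; it is determined up to a
  null set only.
\<close>

definition distr_deriv :: "real \<Rightarrow> real \<Rightarrow> (real \<Rightarrow> real) \<Rightarrow> real \<Rightarrow> real" where
  "distr_deriv a b v = (SOME w. is_distr_deriv a b v w)"

definition L2_space :: "real \<Rightarrow> real \<Rightarrow> (real \<Rightarrow> real) set" where
  "L2_space a b = {v. set_borel_measurable lebesgue {a<..<b} v \<and>
                      set_integrable lebesgue {a<..<b} (\<lambda>x. (v x)\<^sup>2)}"

definition L2_norm_on :: "real \<Rightarrow> real \<Rightarrow> (real \<Rightarrow> real) \<Rightarrow> real" where
  "L2_norm_on a b v = sqrt (LINT x:{a<..<b}|lebesgue. (v x)\<^sup>2)"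

definition H1_space :: "real \<Rightarrow> real \<Rightarrow> (real \<Rightarrow> real) set" where
  "H1_space a b = {v \<in> L2_space a b. \<exists>w \<in> L2_space a b. is_distr_deriv a b v w}"

definition H1_inner :: "real \<Rightarrow> real \<Rightarrow> (real \<Rightarrow> real) \<Rightarrow> (real \<Rightarrow> real) \<Rightarrow> real" where
  "H1_inner a b u v = (LINT x:{a<..<b}|lebesgue. u x * v x) +
     (LINT x:{a<..<b}|lebesgue. distr_deriv a b u x * distr_deriv a b v x)"

definition H1_norm :: "real \<Rightarrow> real \<Rightarrow> (real \<Rightarrow> real) \<Rightarrow> real" where
  "H1_norm a b v = sqrt (H1_inner a b v v)"

definition H01_space :: "real \<Rightarrow> real \<Rightarrow> (real \<Rightarrow> real) set" where
  "H01_space a b = {v \<in> H1_space a b.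
     \<forall>\<epsilon>>0. \<exists>\<phi>. test_fun a b \<phi> \<and> H1_norm a b (\<lambda>x. v x - \<phi> x) < \<epsilon>}"

definition H01_onb :: "real \<Rightarrow> real \<Rightarrow> (nat \<Rightarrow> real \<Rightarrow> real) \<Rightarrow> bool" where
  "H01_onb a b e \<longleftrightarrow>
     (\<forall>k. e k \<in> H01_space a b) \<and>
     (\<forall>k l. H1_inner a b (e k) (e l) = (if k = l then 1 else 0)) \<and>
     (\<forall>v \<in> H01_space a b. \<forall>\<epsilon>>0. \<exists>N c. H1_norm a b (\<lambda>x. v x - (\<Sum>k<N. c k * e k x)) < \<epsilon>)"

text \<open>
  A functional is only meaningful on \<open>H01_space a b\<close>; by boundedness it respects equality almost
  everywhere. The pairing of \<open>F\<close> with \<open>v\<close> is application \<open>F v\<close>.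
\<close>

definition Hm1_space :: "real \<Rightarrow> real \<Rightarrow> ((real \<Rightarrow> real) \<Rightarrow> real) set" where
  "Hm1_space a b = {F.
     (\<forall>u \<in> H01_space a b. \<forall>v \<in> H01_space a b. F (\<lambda>x. u x + v x) = F u + F v) \<and>
     (\<forall>c. \<forall>v \<in> H01_space a b. F (\<lambda>x. c * v x) = c * F v) \<and>
     (\<exists>M. \<forall>v \<in> H01_space a b. \<bar>F v\<bar> \<le> M * H1_norm a b v)}"

definition Hm1_norm :: "real \<Rightarrow> real \<Rightarrow> ((real \<Rightarrow> real) \<Rightarrow> real) \<Rightarrow> real" where
  "Hm1_norm a b F = Sup {\<bar>F v\<bar> |v. v \<in> H01_space a b \<and> H1_norm a b v \<le> 1}"

definition Hm1_simple ::
  "real \<Rightarrow> real \<Rightarrow> real \<Rightarrow> (real \<Rightarrow> (real \<Rightarrow> real) \<Rightarrow> real) \<Rightarrow> bool" where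
  "Hm1_simple a b T s \<longleftrightarrow>
     finite (s ` {0<..<T}) \<and> s ` {0<..<T} \<subseteq> Hm1_space a b \<and>
     (\<forall>F. {t \<in> {0<..<T}. s t = F} \<in> sets lebesgue)"

definition Hm1_strongly_measurable ::
  "real \<Rightarrow> real \<Rightarrow> real \<Rightarrow> (real \<Rightarrow> (real \<Rightarrow> real) \<Rightarrow> real) \<Rightarrow> bool" where
  "Hm1_strongly_measurable a b T f \<longleftrightarrow>
     (\<exists>s. (\<forall>i::nat. Hm1_simple a b T (s i)) \<and>
          (AE t in lebesgue. t \<in> {0<..<T} \<longrightarrow>
             (\<lambda>i. Hm1_norm a b (\<lambda>v. s i t v - f t v)) \<longlonglongrightarrow> 0))"

definition L1_Hm1 ::
  "real \<Rightarrow> real \<Rightarrow> real \<Rightarrow> (real \<Rightarrow> (real \<Rightarrow> real) \<Rightarrow> real) set" where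
  "L1_Hm1 a b T = {f.
     (AE t in lebesgue. t \<in> {0<..<T} \<longrightarrow> f t \<in> Hm1_space a b) \<and>
     Hm1_strongly_measurable a b T f \<and>
     set_integrable lebesgue {0<..<T} (\<lambda>t. Hm1_norm a b (f t))}"

definition L2w_Hm1 ::
  "real \<Rightarrow> real \<Rightarrow> real \<Rightarrow> real \<Rightarrow> (real \<Rightarrow> (real \<Rightarrow> real) \<Rightarrow> real) set" where
  "L2w_Hm1 a b \<delta> T = {f \<in> L1_Hm1 a b T.
     set_integrable lebesgue {0<..<T} (\<lambda>t. \<bar>t\<bar> powr \<delta> * (Hm1_norm a b (f t))\<^sup>2)}"

definition L2w_Hm1_norm ::
  "real \<Rightarrow> real \<Rightarrow> real \<Rightarrow> real \<Rightarrow> (real \<Rightarrow> (real \<Rightarrow> real) \<Rightarrow> real) \<Rightarrow> real" where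
  "L2w_Hm1_norm a b \<delta> r f =
     sqrt (LINT t:{0<..<r}|lebesgue. \<bar>t\<bar> powr \<delta> * (Hm1_norm a b (f t))\<^sup>2)"

text \<open>
  The fractional Sobolev seminorms are extended-valued, so that a bound on them includes their finiteness.
\<close>

definition enn_sqrt :: "ennreal \<Rightarrow> ennreal" where
  "enn_sqrt x = (if x = \<infinity> then \<infinity> else ennreal (sqrt (enn2real x)))"

text \<open>
  Unitary Fourier transform. The integral formula gives the $L^2$ transform on integrable
  square-integrable functions, in particular on square-integrable functions that vanish outside
  a bounded interval.
\<close>

definition fourier :: "(real \<Rightarrow> real) \<Rightarrow> real \<Rightarrow> complex" where
  "fourier g \<xi> =
     (LINT t|lebesgue. exp (- \<i> * complex_of_real (\<xi> * t)) * complex_of_real (g t)) /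
     complex_of_real (sqrt (2 * pi))"

definition frac_seminorm :: "real \<Rightarrow> real set \<Rightarrow> (real \<Rightarrow> real) \<Rightarrow> ennreal" where
  "frac_seminorm \<gamma> S v = enn_sqrt (\<integral>\<^sup>+ \<xi>.
     ennreal (\<bar>\<xi>\<bar> powr (2 * \<gamma>) * (cmod (fourier (\<lambda>t. v t * indicator S t) \<xi>))\<^sup>2) \<partial>lebesgue)"

definition frac_seminorm_H01 ::
  "real \<Rightarrow> real \<Rightarrow> (nat \<Rightarrow> real \<Rightarrow> real) \<Rightarrow> real \<Rightarrow> real set \<Rightarrow> (real \<Rightarrow> real \<Rightarrow> real) \<Rightarrow> ennreal" where
  "frac_seminorm_H01 a b e \<gamma> S V =
     enn_sqrt (\<Sum>k. (frac_seminorm \<gamma> S (\<lambda>t. H1_inner a b (V t) (e k)))\<^sup>2)"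

definition frac_int :: "real \<Rightarrow> (real \<Rightarrow> real) \<Rightarrow> real \<Rightarrow> real" where
  "frac_int \<mu> v t = (LINT s:{0<..<t}|lebesgue. (t - s) powr (\<mu> - 1) * v s) / Gamma \<mu>"

definition frac_deriv :: "real \<Rightarrow> real \<Rightarrow> (real \<Rightarrow> real) \<Rightarrow> real \<Rightarrow> real" where
  "frac_deriv T \<gamma> v = distr_deriv 0 T (frac_int (1 - \<gamma>) v)"

text \<open>The partition consists of the intervals \<open>(xs i, xs (Suc i))\<close> for \<open>i < N\<close>.\<close>

definition is_partition :: "real \<Rightarrow> real \<Rightarrow> nat \<Rightarrow> (nat \<Rightarrow> real) \<Rightarrow> bool" where
  "is_partition a b N xs \<longleftrightarrow> xs 0 = a \<and> xs N = b \<and> (\<forall>i<N. xs i < xs (Suc i))"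

definition time_node :: "real \<Rightarrow> nat \<Rightarrow> real \<Rightarrow> nat \<Rightarrow> real" where
  "time_node T J \<sigma> j = (real j / real J) powr \<sigma> * T"

text \<open>
  Piecewise polynomials are represented by functions that are equal to a polynomial everywhere
  on each open piece; the values at the nodes are irrelevant.
\<close>

definition Sh :: "real \<Rightarrow> real \<Rightarrow> nat \<Rightarrow> (nat \<Rightarrow> real) \<Rightarrow> nat \<Rightarrow> (real \<Rightarrow> real) set" where
  "Sh a b N xs n = {v \<in> H01_space a b.
     \<forall>i<N. \<exists>p :: real poly. degree p \<le> n \<and> (\<forall>x \<in> {xs i<..<xs (Suc i)}. v x = poly p x)}"

text \<open>
  Square integrability in time is automatic for functions that are \<open>Sh\<close>-valued polynomials on
  each of finitely many bounded intervals.
\<close>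

definition Wht ::
  "real \<Rightarrow> real \<Rightarrow> nat \<Rightarrow> (nat \<Rightarrow> real) \<Rightarrow> nat \<Rightarrow> nat \<Rightarrow> real \<Rightarrow> nat \<Rightarrow> real \<Rightarrow>
   (real \<Rightarrow> real \<Rightarrow> real) set" where
  "Wht a b N xs n m T J \<sigma> = {V.
     \<forall>j \<in> {1..J}. \<exists>c. (\<forall>i\<le>m. c i \<in> Sh a b N xs n) \<and>
       (\<forall>t \<in> {time_node T J \<sigma> (j - 1)<..<time_node T J \<sigma> j}. \<forall>x \<in> {a<..<b}.
          V t x = (\<Sum>i\<le>m. t ^ i * c i x))}"

text \<open>
  One-sided limits at the time nodes. On \<open>Wht\<close> the limit in the finite-dimensional space \<open>Sh\<close> is
  represented by the pointwise limit.
\<close>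

definition right_val :: "real \<Rightarrow> nat \<Rightarrow> real \<Rightarrow> (real \<Rightarrow> real \<Rightarrow> real) \<Rightarrow> nat \<Rightarrow> real \<Rightarrow> real" where
  "right_val T J \<sigma> V j x = Lim (at_right (time_node T J \<sigma> j)) (\<lambda>t. V t x)"

definition left_val :: "real \<Rightarrow> nat \<Rightarrow> real \<Rightarrow> (real \<Rightarrow> real \<Rightarrow> real) \<Rightarrow> nat \<Rightarrow> real \<Rightarrow> real" where
  "left_val T J \<sigma> V j x =
     (if j = 0 then 0 else Lim (at_left (time_node T J \<sigma> j)) (\<lambda>t. V t x))"

definition jump :: "real \<Rightarrow> nat \<Rightarrow> real \<Rightarrow> (real \<Rightarrow> real \<Rightarrow> real) \<Rightarrow> nat \<Rightarrow> real \<Rightarrow> real" where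
  "jump T J \<sigma> V j x = right_val T J \<sigma> V j x - left_val T J \<sigma> V j x"

definition is_ritz_proj ::
  "real \<Rightarrow> real \<Rightarrow> nat \<Rightarrow> (nat \<Rightarrow> real) \<Rightarrow> nat \<Rightarrow> (real \<Rightarrow> real) \<Rightarrow> (real \<Rightarrow> real) \<Rightarrow> bool" where
  "is_ritz_proj a b N xs n v r \<longleftrightarrow> r \<in> Sh a b N xs n \<and>
     (\<forall>w \<in> Sh a b N xs n.
        (LINT x:{a<..<b}|lebesgue.
           distr_deriv a b (\<lambda>y. v y - r y) x * distr_deriv a b w x) = 0)"

definition ritz_proj ::
  "real \<Rightarrow> real \<Rightarrow> nat \<Rightarrow> (nat \<Rightarrow> real) \<Rightarrow> nat \<Rightarrow> (real \<Rightarrow> real) \<Rightarrow> real \<Rightarrow> real" where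
  "ritz_proj a b N xs n v = (SOME r. is_ritz_proj a b N xs n v r)"

text \<open>
  Integration over \<open>(a, b) \<times> (0, T)\<close>. The time integral is the inner one because, for fixed \<open>x\<close>,
  \<open>frac_deriv\<close> is only determined up to a null set of times, so that joint measurability of the
  chosen representative is not available.
\<close>

definition spacetime_int ::
  "real \<Rightarrow> real \<Rightarrow> real \<Rightarrow> (real \<Rightarrow> real \<Rightarrow> real) \<Rightarrow> real" where
  "spacetime_int a b T F = (LINT x:{a<..<b}|lebesgue. LINT t:{0<..<T}|lebesgue. F t x)"

text \<open>
  For \<open>V\<close> in \<open>Wht\<close>, the weak derivative in space is represented by the elementwise classical
  derivative; unlike \<open>distr_deriv a b (V t)\<close>, this representative is chosen consistently in \<open>t\<close>,
  so that it can be integrated in time for fixed \<open>x\<close>.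
\<close>

definition dx :: "(real \<Rightarrow> real \<Rightarrow> real) \<Rightarrow> real \<Rightarrow> real \<Rightarrow> real" where
  "dx V t x = deriv (V t) x"

definition dt :: "(real \<Rightarrow> real \<Rightarrow> real) \<Rightarrow> real \<Rightarrow> real \<Rightarrow> real" where
  "dt V t x = deriv (\<lambda>s. V s x) t"

definition is_discrete_solution ::
  "real \<Rightarrow> real \<Rightarrow> real \<Rightarrow> real \<Rightarrow> real \<Rightarrow> nat \<Rightarrow> nat \<Rightarrow>
   real \<Rightarrow> real \<Rightarrow> nat \<Rightarrow> (nat \<Rightarrow> real) \<Rightarrow> nat \<Rightarrow> real \<Rightarrow>
   (real \<Rightarrow> real) \<Rightarrow> (real \<Rightarrow> (real \<Rightarrow> real) \<Rightarrow> real) \<Rightarrow> (real \<Rightarrow> real \<Rightarrow> real) \<Rightarrow> bool" where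
  "is_discrete_solution a b T \<alpha> \<beta> m n \<kappa>1 \<kappa>2 N xs J \<sigma> u0 f U \<longleftrightarrow>
     U \<in> Wht a b N xs n m T J \<sigma> \<and>
     (\<forall>V \<in> Wht a b N xs n m T J \<sigma>.
        spacetime_int a b T (\<lambda>t x. dt U t x * V t x) +
        (\<Sum>j<J. LINT x:{a<..<b}|lebesgue. jump T J \<sigma> U j x * right_val T J \<sigma> V j x) +
        spacetime_int a b T (\<lambda>t x.
          (\<kappa>1 * frac_deriv T \<alpha> (\<lambda>s. dx U s x) t +
           \<kappa>2 * frac_deriv T \<beta> (\<lambda>s. dx U s x) t) * dx V t x) =
        (LINT x:{a<..<b}|lebesgue. ritz_proj a b N xs n u0 x * right_val T J \<sigma> V 0 x) +
        (LINT t:{0<..<T}|lebesgue. f t (V t)))"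

definition ae_equal :: "real \<Rightarrow> real \<Rightarrow> real \<Rightarrow>
    (real \<Rightarrow> real \<Rightarrow> real) \<Rightarrow> (real \<Rightarrow> real \<Rightarrow> real) \<Rightarrow> bool" where
  "ae_equal a b T U V \<longleftrightarrow>
     (AE t in lebesgue. t \<in> {0<..<T} \<longrightarrow>
        (AE x in lebesgue. x \<in> {a<..<b} \<longrightarrow> U t x = V t x))"

end

theory Submission
  imports Defs "HOL-Probability.Characteristic_Functions"
begin

text \<open>
  Testing with the solution itself, cut off at a time node \<open>t\<^sub>r\<close>, the jump terms telescope to
  $\frac12\|U(t_r)\|^2$ plus half the squared jumps, the first of which absorbs the initial datum.
  For the fractional terms, zero extension in time and the Marchaud form of the derivative turn
  $\int_0^R D_{0+}^\gamma v\,v\,dt$ into $\frac12\int_0^\infty q(h)\,\|v - v(\cdot-h)\|^2\,dh$ with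
  $q(h) = \gamma h^{-\gamma-1}/\Gamma(1-\gamma)$. Restricted to \<open>h \<ge> t\<close> this energy contains Hardy's
  integral $\int t^{-\gamma}v^2$, which controls the load in the dual weight, and by Plancherel it
  dominates the Fourier seminorm. A basis of the finite element space that is orthonormal for the
  Dirichlet form decouples the fractional terms into scalar ones. Coercivity gives uniqueness, and
  existence follows because the discrete problem is a square linear system.
\<close>

subsection \<open>Smooth test functions\<close>

text \<open>The kernel h^(-\<gamma>-1) is not integrable at 0, so the two parts of the Marchaud
  integral cannot be separated, and Fubini does not apply to them directly. The energy identity is
  therefore shown for kernels cut off at \<epsilon>, and the passage to the limit needs an
  integrable majorant. Truncated powers supply it: they are increasing, so their cut-off derivatives
  are dominated by the derivative itself, and they span the piecewise polynomials in time.

  Cutting the test function at a node is admissible because the space is discontinuous in time. The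
  trial function is left uncut, since on (0, t_r) its fractional derivative depends on its past
  only.

  The time terms stay coupled through the L2 mass matrix; symmetrising them reduces them to squared
  L2 norms.

  Weak derivatives and nodal values are arbitrary on null sets. Pointwise identities are therefore
  stated on open mesh cells, and solutions are compared through coefficient vectors.

  The final constant combines the Poincare constant, the factor in Hardy's inequality and the lower
  bound \<open>cF\<close> of the Fourier symbol of the energy.\<close>

definition cdiff :: "nat \<Rightarrow> (real \<Rightarrow> real) \<Rightarrow> bool" where
  "cdiff k f \<longleftrightarrow> (\<forall>j\<le>k. \<forall>x. (deriv ^^ j) f field_differentiable (at x))"

lemma cdiff_0: "cdiff 0 f \<longleftrightarrow> (\<forall>x. f field_differentiable (at x))"
  by (simp add: cdiff_def)

lemma cdiff_Suc: "cdiff (Suc k) f \<longleftrightarrow> (\<forall>x. f field_differentiable (at x)) \<and> cdiff k (deriv f)"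
proof -
  have "(\<forall>j\<le>Suc k. P j) \<longleftrightarrow> P 0 \<and> (\<forall>j\<le>k. P (Suc j))" for P
    by (metis (full_types) Suc_le_mono le0 not0_implies_Suc)
  then show ?thesis
    unfolding cdiff_def by (simp add: funpow_Suc_right del: funpow.simps)
qed

text \<open>\<open>cdiff k\<close> asks for k + 1 derivatives. With a finite order, closure under
  sums, products and exponentials follows by induction, and this rule lets each induction step name
  a candidate for the derivative.\<close>

lemma cdiff_SucI:
  assumes "\<And>x. (f has_real_derivative f' x) (at x)" "cdiff k f'"
  shows "cdiff (Suc k) f"
proof -
  have "deriv f = f'" using assms(1) by (auto intro: DERIV_imp_deriv)
  then show ?thesis using assms unfolding cdiff_Suc
    by (auto simp: field_differentiable_def)
qed

lemma cdiff_Suc_imp: "cdiff (Suc k) f \<Longrightarrow> cdiff k f"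
  by (simp add: cdiff_def)

lemma cdiff_DERIV: "cdiff k f \<Longrightarrow> (f has_real_derivative deriv f x) (at x)"
  by (metis DERIV_deriv_iff_field_differentiable cdiff_def funpow_0 le0)

lemma cdiff_add: "cdiff k f \<Longrightarrow> cdiff k g \<Longrightarrow> cdiff k (\<lambda>x. f x + g x)"
proof (induction k arbitrary: f g)
  case 0 then show ?case by (auto simp: cdiff_0 intro: field_differentiable_add)
next
  case (Suc k)
  have "((\<lambda>x. f x + g x) has_real_derivative deriv f x + deriv g x) (at x)" for x
    using Suc.prems by (auto intro!: derivative_intros cdiff_DERIV)
  moreover have "cdiff k (deriv f)" "cdiff k (deriv g)" using Suc.prems by (auto simp: cdiff_Suc)
  ultimately show ?case using Suc.IH
    by (intro cdiff_SucI[where f'="\<lambda>x. deriv f x + deriv g x"]) auto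
qed

lemma cdiff_mult: "cdiff k f \<Longrightarrow> cdiff k g \<Longrightarrow> cdiff k (\<lambda>x. f x * g x)"
proof (induction k arbitrary: f g)
  case 0 then show ?case by (auto simp: cdiff_0 intro: field_differentiable_mult)
next
  case (Suc k)
  have "((\<lambda>x. f x * g x) has_real_derivative deriv f x * g x + deriv g x * f x) (at x)" for x
    using Suc.prems by (auto intro!: DERIV_mult cdiff_DERIV)
  moreover have "cdiff k f" "cdiff k g" "cdiff k (deriv f)" "cdiff k (deriv g)"
    using Suc.prems cdiff_Suc_imp by (auto simp: cdiff_Suc)
  ultimately show ?case using Suc.IH
    by (intro cdiff_SucI[where f'="\<lambda>x. deriv f x * g x + deriv g x * f x"] cdiff_add) auto
qed

lemma cdiff_const: "cdiff k (\<lambda>x. c)"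
  by (induction k arbitrary: c) (auto simp: cdiff_0 intro: cdiff_SucI[where f'="\<lambda>x. 0"])

lemma cdiff_exp: "cdiff k f \<Longrightarrow> cdiff k (\<lambda>x. exp (f x))"
proof (induction k)
  case 0 then show ?case
    by (auto simp: cdiff_0 field_differentiable_def intro: DERIV_fun_exp)
next
  case (Suc k)
  have "((\<lambda>x. exp (f x)) has_real_derivative exp (f x) * deriv f x) (at x)" for x
    using Suc.prems by (auto intro!: DERIV_fun_exp cdiff_DERIV)
  moreover have "cdiff k (deriv f)" "cdiff k f"
    using Suc.prems cdiff_Suc_imp by (auto simp: cdiff_Suc)
  ultimately show ?case using Suc.IH
    by (intro cdiff_SucI[where f'="\<lambda>x. exp (f x) * deriv f x"] cdiff_mult) auto
qed

lemma cdiff_affine: "cdiff k f \<Longrightarrow> cdiff k (\<lambda>x. f (p * x + q))"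
proof (induction k arbitrary: f)
  case 0
  have "((\<lambda>x. f (p * x + q)) has_real_derivative deriv f (p * x + q) * p) (at x)" for x
    by (rule DERIV_chain2[OF cdiff_DERIV[OF 0]]) (auto intro!: derivative_eq_intros)
  then show ?case by (auto simp: cdiff_0 field_differentiable_def)
next
  case (Suc k)
  have "((\<lambda>x. f (p * x + q)) has_real_derivative deriv f (p * x + q) * p) (at x)" for x
    by (rule DERIV_chain2[OF cdiff_DERIV[OF Suc.prems]]) (auto intro!: derivative_eq_intros)
  moreover have "cdiff k (deriv f)" using Suc.prems by (auto simp: cdiff_Suc)
  ultimately show ?case using Suc.IH
    by (intro cdiff_SucI[where f'="\<lambda>x. deriv f (p * x + q) * p"] cdiff_mult cdiff_const) auto
qed

text \<open>The classical flat function exp(-1/x), with a polynomial in 1/x as an extra factor. The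
  factor makes the family closed under differentiation, so that smoothness becomes an induction over
  all p at once.\<close>

definition flat_fun :: "real poly \<Rightarrow> real \<Rightarrow> real" where
  "flat_fun p x = (if 0 < x then poly p (1 / x) * exp (- (1 / x)) else 0)"

lemma poly_exp_decay: "((\<lambda>y::real. poly p y * exp (- y)) \<longlongrightarrow> 0) at_top"
proof -
  have "((\<lambda>y. \<Sum>i\<le>degree p. coeff p i * (y ^ i / exp y)) \<longlongrightarrow> (\<Sum>i\<le>degree p. coeff p i * 0)) at_top"
    by (intro tendsto_sum tendsto_mult tendsto_const tendsto_power_div_exp_0)
  then show ?thesis
    by (simp add: poly_altdef exp_minus field_simps sum_distrib_left sum_divide_distrib)
qed

text \<open>With y = 1/x, d/dx is -y^2 d/dy, which takes p(y) exp(-y) to y^2 (p(y) - p'(y)) exp(-y).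
  At 0 all derivatives vanish because exp(-y) beats every polynomial.\<close>

lemma flat_fun_DERIV:
  "(flat_fun p has_real_derivative flat_fun ([:0, 0, 1:] * (p - pderiv p)) x) (at x)"
proof -
  consider "x > 0" | "x < 0" | "x = 0" by linarith
  then show ?thesis
  proof cases
    case 1
    have "((\<lambda>x. poly p (1 / x) * exp (- (1 / x))) has_real_derivative
        flat_fun ([:0, 0, 1:] * (p - pderiv p)) x) (at x)"
    proof -
      have inv: "((\<lambda>x. 1 / x) has_real_derivative - (1 / x\<^sup>2)) (at x)"
        using 1 by (auto intro!: derivative_eq_intros simp: power2_eq_square)
      have "((\<lambda>x. poly p (1 / x)) has_real_derivative poly (pderiv p) (1 / x) * - (1 / x\<^sup>2)) (at x)"
        by (rule DERIV_chain2[OF poly_DERIV inv])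
      moreover have "((\<lambda>x. exp (- (1 / x))) has_real_derivative exp (- (1 / x)) * - (- (1 / x\<^sup>2))) (at x)"
        by (rule DERIV_fun_exp[OF DERIV_minus[OF inv]])
      ultimately have "((\<lambda>x. poly p (1 / x) * exp (- (1 / x))) has_real_derivative
          poly (pderiv p) (1 / x) * - (1 / x\<^sup>2) * exp (- (1 / x)) +
          exp (- (1 / x)) * - (- (1 / x\<^sup>2)) * poly p (1 / x)) (at x)"
        by (rule DERIV_mult)
      moreover have "poly (pderiv p) (1 / x) * - (1 / x\<^sup>2) * exp (- (1 / x)) +
          exp (- (1 / x)) * - (- (1 / x\<^sup>2)) * poly p (1 / x) = flat_fun ([:0, 0, 1:] * (p - pderiv p)) x"
        using 1 by (simp add: flat_fun_def field_simps power2_eq_square)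
      ultimately show ?thesis by simp
    qed
    then show ?thesis
    proof (rule has_field_derivative_transform_within_open[where S="{0<..}"])
    qed (use 1 in \<open>auto simp: flat_fun_def\<close>)
  next
    case 2
    have "((\<lambda>x. 0) has_real_derivative flat_fun ([:0, 0, 1:] * (p - pderiv p)) x) (at x)"
      using 2 by (auto simp: flat_fun_def)
    then show ?thesis
      by (rule has_field_derivative_transform_within_open[where S="{..<0}"])
        (use 2 in \<open>auto simp: flat_fun_def\<close>)
  next
    case 3
    have "((\<lambda>h. (flat_fun p (0 + h) - flat_fun p 0) / h) \<longlongrightarrow> 0) (at 0)"
    proof (rule filterlim_split_at)
      show "((\<lambda>h. (flat_fun p (0 + h) - flat_fun p 0) / h) \<longlongrightarrow> 0) (at_left 0)"
        by (rule tendsto_eventually) (auto simp: flat_fun_def eventually_at_filter)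
      \<comment> \<open>With y = 1/h the right difference quotient at 0 is y p(y) exp(-y);
        \<open>pCons 0 p\<close> carries the extra factor y.\<close>
      have "((\<lambda>h. poly (pCons 0 p) (inverse h) * exp (- inverse h)) \<longlongrightarrow> 0) (at_right 0)"
        by (rule filterlim_compose[OF poly_exp_decay filterlim_inverse_at_top_right])
      moreover have "\<forall>\<^sub>F h in at_right 0. poly (pCons 0 p) (inverse h) * exp (- inverse h) =
          (flat_fun p (0 + h) - flat_fun p 0) / h"
        by (auto simp: flat_fun_def eventually_at_filter field_simps)
      ultimately show "((\<lambda>h. (flat_fun p (0 + h) - flat_fun p 0) / h) \<longlongrightarrow> 0) (at_right 0)"
        by (rule Lim_transform_eventually)
    qed
    then show ?thesis using 3 by (simp add: DERIV_def flat_fun_def)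
  qed
qed

lemma cdiff_flat_fun: "cdiff k (flat_fun p)"
proof (induction k arbitrary: p)
  case 0 then show ?case using flat_fun_DERIV by (auto simp: cdiff_0 field_differentiable_def)
next
  case (Suc k) then show ?case using flat_fun_DERIV by (blast intro: cdiff_SucI)
qed

lemma flat_fun_1: "flat_fun 1 x \<ge> 0" "flat_fun 1 x > 0 \<longleftrightarrow> x > 0"
  by (auto simp: flat_fun_def)

text \<open>The product of the two flat functions is positive exactly on (c, d), so these smooth
  functions tend to the indicator of (c, d) as n grows. They take the place of mollified
  indicators.\<close>

definition bump :: "real \<Rightarrow> real \<Rightarrow> nat \<Rightarrow> real \<Rightarrow> real" where
  "bump c d n x = 1 - exp (- real n * (flat_fun 1 (x - c) * flat_fun 1 (d - x)))"

lemma cdiff_bump: "cdiff k (bump c d n)"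
proof -
  have 1: "cdiff k (\<lambda>x. flat_fun 1 (1 * x + (- c)))" "cdiff k (\<lambda>x. flat_fun 1 ((-1) * x + d))"
    by (intro cdiff_affine cdiff_flat_fun)+
  have "cdiff k (\<lambda>x. 1 + (-1) * exp (- real n * (flat_fun 1 (1 * x + (- c)) * flat_fun 1 ((-1) * x + d))))"
    by (intro cdiff_add cdiff_const cdiff_mult cdiff_exp 1)
  then show ?thesis by (simp add: bump_def[abs_def])
qed

lemma test_fun_iff: "test_fun a b \<phi> \<longleftrightarrow> (\<forall>k. cdiff k \<phi>) \<and>
     (\<exists>c d. a < c \<and> d < b \<and> (\<forall>x. x \<notin> {c..d} \<longrightarrow> \<phi> x = 0))"
  unfolding test_fun_def cdiff_def by auto

lemma bump_outside: "x \<notin> {c<..<d} \<Longrightarrow> bump c d n x = 0"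
  by (auto simp: bump_def flat_fun_def)

lemma test_fun_bump: "a < c \<Longrightarrow> d < b \<Longrightarrow> test_fun a b (bump c d n)"
  unfolding test_fun_iff using cdiff_bump bump_outside
  by (meson atLeastAtMost_iff greaterThanLessThan_iff less_imp_le)

lemma bump_bounds: "0 \<le> bump c d n x" "bump c d n x \<le> 1"
  using flat_fun_1 by (auto simp: bump_def)

lemma bump_tendsto: "(\<lambda>n. bump c d n x) \<longlonglongrightarrow> indicator {c<..<d} x"
proof (cases "x \<in> {c<..<d}")
  case True
  define B where "B = flat_fun 1 (x - c) * flat_fun 1 (d - x)"
  have B: "B > 0" using True flat_fun_1 by (auto simp: B_def)
  have "norm (exp (- B)) < 1" using B by simp
  then have "(\<lambda>n. exp (- B) ^ n) \<longlonglongrightarrow> 0" by (rule LIMSEQ_power_zero)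
  then have "(\<lambda>n. 1 - exp (- B) ^ n) \<longlonglongrightarrow> 1 - 0" by (rule tendsto_diff[OF tendsto_const])
  then show ?thesis using True by (simp add: bump_def B_def[symmetric] exp_of_nat_mult[symmetric])
next
  case False then show ?thesis by (simp add: bump_outside)
qed

lemma test_fun_DERIV: "test_fun a b \<phi> \<Longrightarrow> (\<phi> has_real_derivative deriv \<phi> x) (at x)"
  unfolding test_fun_iff using cdiff_DERIV by blast

lemma test_fun_deriv: assumes "test_fun a b \<phi>" shows "test_fun a b (deriv \<phi>)"
proof -
  obtain c d where cd: "a < c" "d < b" "\<And>x. x \<notin> {c..d} \<Longrightarrow> \<phi> x = 0" using assms by (auto simp: test_fun_iff)
  have "deriv \<phi> x = 0" if "x \<notin> {c..d}" for x
  proof -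
    have "open (- {c..d})" by auto
    then have "(\<phi> has_real_derivative 0) (at x)"
      using that cd(3) by (intro has_field_derivative_transform_within_open[of "\<lambda>_. 0" 0 x "- {c..d}" \<phi>]) auto
    then show ?thesis by (rule DERIV_imp_deriv)
  qed
  moreover have "cdiff k (deriv \<phi>)" for k using assms unfolding test_fun_iff by (metis cdiff_Suc)
  ultimately show ?thesis using cd unfolding test_fun_iff by blast
qed

lemma test_fun_continuous: "test_fun a b \<phi> \<Longrightarrow> continuous_on S \<phi>"
  using test_fun_DERIV by (meson DERIV_isCont continuous_at_imp_continuous_on)

lemma test_fun_add: assumes "test_fun a b \<phi>" "test_fun a b \<psi>" shows "test_fun a b (\<lambda>x. \<phi> x + \<psi> x)"
proof -
  obtain c d where cd: "a < c" "d < b" "\<And>x. x \<notin> {c..d} \<Longrightarrow> \<phi> x = 0" using assms by (auto simp: test_fun_iff)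
  obtain c' d' where cd': "a < c'" "d' < b" "\<And>x. x \<notin> {c'..d'} \<Longrightarrow> \<psi> x = 0" using assms by (auto simp: test_fun_iff)
  have "\<forall>x. x \<notin> {min c c'..max d d'} \<longrightarrow> \<phi> x + \<psi> x = 0"
    using cd(3) cd'(3) by (metis add_0 atLeastAtMost_iff max.boundedI max.cobounded1 max.cobounded2 min.cobounded1 min.cobounded2 order_trans)
  moreover have "a < min c c'" "max d d' < b" using cd cd' by auto
  ultimately show ?thesis using assms cdiff_add unfolding test_fun_iff by blast
qed

lemma test_fun_scale: assumes "test_fun a b \<phi>" shows "test_fun a b (\<lambda>x. r * \<phi> x)"
proof -
  obtain c d where cd: "a < c" "d < b" "\<And>x. x \<notin> {c..d} \<Longrightarrow> \<phi> x = 0" using assms by (auto simp: test_fun_iff)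
  have "\<forall>x. x \<notin> {c..d} \<longrightarrow> r * \<phi> x = 0" using cd by simp
  moreover have "cdiff k (\<lambda>x. r * \<phi> x)" for k
    using assms by (intro cdiff_mult cdiff_const) (simp add: test_fun_iff)
  ultimately show ?thesis using cd unfolding test_fun_iff by blast
qed

lemma test_fun_0: assumes "a < b" shows "test_fun a b (\<lambda>x. 0)"
proof -
  obtain c where "a < c" "c < b" using assms dense by blast
  then show ?thesis unfolding test_fun_iff using cdiff_const by blast
qed

lemma test_fun_mono:
  assumes "test_fun c d \<phi>" "a \<le> c" "d \<le> b" shows "test_fun a b \<phi>"
proof -
  obtain c' d' where cd: "c < c'" "d' < d" "\<And>x. x \<notin> {c'..d'} \<Longrightarrow> \<phi> x = 0" using assms(1) by (auto simp: test_fun_iff)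
  then have "a < c'" "d' < b" using assms by auto
  then show ?thesis using assms(1) cd(3) unfolding test_fun_iff by blast
qed

subsection \<open>Distributional derivatives\<close>

lemma set_integrable_cong_AE':
  fixes f g :: "real \<Rightarrow> real"
  assumes "set_integrable lebesgue A f" and "AE x in lebesgue. x \<in> A \<longrightarrow> f x = g x"
  shows "set_integrable lebesgue A g"
proof -
  have ae: "AE x in lebesgue. indicator A x *\<^sub>R f x = indicator A x *\<^sub>R g x"
    using assms(2) by eventually_elim (auto simp: indicator_def)
  have m: "(\<lambda>x. indicator A x *\<^sub>R f x) \<in> borel_measurable lebesgue" using assms(1) by (auto simp: set_integrable_def)
  then have "(\<lambda>x. indicator A x *\<^sub>R g x) \<in> borel_measurable lebesgue" by (rule borel_measurable_AE[OF _ ae])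
  then show ?thesis
    using assms(1) m ae unfolding set_integrable_def by (subst (asm) integrable_cong_AE) auto
qed

text \<open>Lebesgue measure is complete: f and g are measurable on A together or not at all, and in
  the second case both integrals have the default value 0. Integrands can thus be exchanged without
  first proving either of them measurable.\<close>

lemma set_integral_cong_AE':
  fixes f g :: "real \<Rightarrow> real"
  assumes ae: "AE x in lebesgue. x \<in> A \<longrightarrow> f x = g x"
  shows "(LINT x:A|lebesgue. f x) = (LINT x:A|lebesgue. g x)"
proof -
  have ae': "AE x in lebesgue. indicator A x *\<^sub>R f x = indicator A x *\<^sub>R g x"
    using ae by eventually_elim (auto simp: indicator_def)
  show ?thesis
  proof (cases "(\<lambda>x. indicator A x *\<^sub>R f x) \<in> borel_measurable lebesgue")
    case True
    then have "(\<lambda>x. indicator A x *\<^sub>R g x) \<in> borel_measurable lebesgue" by (rule borel_measurable_AE[OF _ ae'])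
    then show ?thesis using True ae' unfolding set_lebesgue_integral_def by (intro integral_cong_AE)
  next
    case False
    have "(\<lambda>x. indicator A x *\<^sub>R g x) \<notin> borel_measurable lebesgue"
    proof
      assume m: "(\<lambda>x. indicator A x *\<^sub>R g x) \<in> borel_measurable lebesgue"
      have "AE x in lebesgue. indicator A x *\<^sub>R g x = indicator A x *\<^sub>R f x"
        using ae' by eventually_elim (rule sym)
      from False borel_measurable_AE[OF m this] show False by (rule notE)
    qed
    then have "\<not> integrable lebesgue (\<lambda>x. indicator A x *\<^sub>R g x)"
      by (rule contrapos_nn) (rule borel_measurable_integrable)
    then have 1: "(LINT x|lebesgue. indicator A x *\<^sub>R g x) = 0" by (rule not_integrable_integral_eq)
    from False have "\<not> integrable lebesgue (\<lambda>x. indicator A x *\<^sub>R f x)"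
      by (rule contrapos_nn) (rule borel_measurable_integrable)
    then have "(LINT x|lebesgue. indicator A x *\<^sub>R f x) = 0" by (rule not_integrable_integral_eq)
    with 1 show ?thesis unfolding set_lebesgue_integral_def by (rule trans[OF _ sym, rotated])
  qed
qed

text \<open>For a Borel representative, the sets with vanishing integral contain the intervals and
  are closed under complements and disjoint unions, hence include all Borel sets. The complement
  step needs the integral over the whole line, which is the limit of those over [-i, i].\<close>

lemma AE_zero_if_interval_integrals_zero:
  fixes w :: "real \<Rightarrow> real"
  assumes int: "integrable lebesgue w"
    and zero: "\<And>c d. c \<le> d \<Longrightarrow> (LINT x:{c..d}|lebesgue. w x) = 0"
  shows "AE x in lebesgue. w x = 0"
proof -
  have "w \<in> borel_measurable lebesgue" using int by auto
  then obtain w' where w': "w' \<in> borel_measurable lborel" "AE x in lborel. w x = w' x"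
    using completion_ex_borel_measurable_real by blast
  have w'2: "AE x in lebesgue. w x = w' x" using w'(2) by (rule AE_completion)
  have "w' \<in> borel_measurable lebesgue" using w'(1) by (rule measurable_completion)
  then have "integrable lebesgue w'"
    using int w'2 by (subst integrable_cong_AE[where g=w]) (auto elim: eventually_mono)
  then have int': "integrable lborel w'" using w'(1) by (simp add: integrable_completion)
  have si: "set_integrable lborel A w'" if "A \<in> sets borel" for A
    using that int' unfolding set_integrable_def by (intro integrable_mult_indicator) auto
  have iv: "(LINT x:{c..d}|lborel. w' x) = 0" if "c \<le> d" for c d
  proof -
    have "(LINT x:{c..d}|lborel. w' x) = (LINT x:{c..d}|lebesgue. w' x)"
      unfolding set_lebesgue_integral_def using w'(1) by (subst integral_completion) auto
    also have "\<dots> = (LINT x:{c..d}|lebesgue. w x)"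
      using w'2 by (intro set_integral_cong_AE') (auto elim!: eventually_mono)
    finally show ?thesis using zero that by simp
  qed
  have "(LINT x|lborel. w' x) = 0"
  proof -
    have 1: "(\<lambda>i. LINT x:{- real i..real i}|lborel. w' x) \<longlonglongrightarrow> (LINT x:(\<Union>i. {- real i..real i})|lborel. w' x)"
      by (rule set_integral_cont_up) (auto simp: incseq_def intro: si)
    have 2: "(\<Union>i. {- real i..real i}) = UNIV"
    proof -
      have "\<exists>i. x \<in> {- real i..real i}" for x
      proof -
        obtain i :: nat where "\<bar>x\<bar> \<le> real i" using real_arch_simple by blast
        then have "x \<in> {- real i..real i}" by auto
        then show ?thesis ..
      qed
      then show ?thesis by blast
    qed
    have "(\<lambda>i. LINT x:{- real i..real i}|lborel. w' x) = (\<lambda>i. 0)" by (auto intro!: iv)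
    with 1 have "(\<lambda>i::nat. 0) \<longlonglongrightarrow> (LINT x:UNIV|lborel. w' x)" unfolding 2 by simp
    then show ?thesis by (simp add: set_lebesgue_integral_def LIMSEQ_const_iff)
  qed
  have "(LINT x:A|lborel. w' x) = 0" if "A \<in> sets borel" for A
    using that
  proof (induction rule: borel_set_induct)
    case empty then show ?case by (simp add: set_lebesgue_integral_def)
  next
    case (interval a b) then show ?case by (rule iv)
  next
    case (compl A)
    have "(LINT x|lborel. w' x) = (LINT x:A \<union> -A|lborel. w' x)" by (simp add: set_lebesgue_integral_def)
    also have "\<dots> = (LINT x:A|lborel. w' x) + (LINT x:-A|lborel. w' x)"
      using compl(1) by (intro set_integral_Un si) auto
    finally show ?case using compl \<open>(LINT x|lborel. w' x) = 0\<close> by simp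
  next
    case (union f)
    have "(LINT x:(\<Union>i. f i)|lborel. w' x) = (\<Sum>i. LINT x:f i|lborel. w' x)"
      using union by (intro lebesgue_integral_countable_add si) (auto simp: disjoint_family_on_def)
    then show ?case using union by simp
  qed
  then have "AE x in lborel. w' x = 0" by (intro sigma_finite_measure.density_zero[OF sigma_finite_lborel] int') simp
  then have "AE x in lebesgue. w' x = 0" by (rule AE_completion)
  then show ?thesis using w'2 by eventually_elim simp
qed

lemma loc_integrableD: "loc_integrable a b v \<Longrightarrow> a < c \<Longrightarrow> d < b \<Longrightarrow> set_integrable lebesgue {c..d} v"
  by (auto simp: loc_integrable_def)

lemma set_integrable_mult_bounded:
  fixes w \<phi> :: "real \<Rightarrow> real"
  assumes w: "set_integrable lebesgue A w" and m: "set_borel_measurable lebesgue A \<phi>"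
    and b: "\<And>x. x \<in> A \<Longrightarrow> \<bar>\<phi> x\<bar> \<le> M"
  shows "set_integrable lebesgue A (\<lambda>x. w x * \<phi> x)"
  unfolding set_integrable_def
proof (rule Bochner_Integration.integrable_bound)
  show "integrable lebesgue (\<lambda>x. M * (indicator A x *\<^sub>R w x))"
    using w by (simp add: set_integrable_def)
  have "(\<lambda>x. (indicator A x *\<^sub>R w x) * (indicator A x *\<^sub>R \<phi> x)) \<in> borel_measurable lebesgue"
    using w m unfolding set_integrable_def set_borel_measurable_def by (intro borel_measurable_times) auto
  also have "(\<lambda>x. (indicator A x *\<^sub>R w x) * (indicator A x *\<^sub>R \<phi> x)) = (\<lambda>x. indicator A x *\<^sub>R (w x * \<phi> x))"
    by (auto simp: indicator_def)
  finally show "(\<lambda>x. indicator A x *\<^sub>R (w x * \<phi> x)) \<in> borel_measurable lebesgue" .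
  show "AE x in lebesgue. norm (indicator A x *\<^sub>R (w x * \<phi> x)) \<le> norm (M * (indicator A x *\<^sub>R w x))"
  proof (rule AE_I2)
    fix x
    have "\<bar>w x\<bar> * \<bar>\<phi> x\<bar> \<le> \<bar>w x\<bar> * \<bar>M\<bar>" if "x \<in> A"
      using b[OF that] by (intro mult_left_mono) auto
    then show "norm (indicator A x *\<^sub>R (w x * \<phi> x)) \<le> norm (M * (indicator A x *\<^sub>R w x))"
      by (auto simp: indicator_def abs_mult mult.commute)
  qed
qed

lemma continuous_set_borel_measurable:
  fixes \<phi> :: "real \<Rightarrow> real"
  assumes "continuous_on UNIV \<phi>" "A \<in> sets lebesgue"
  shows "set_borel_measurable lebesgue A \<phi>"
proof -
  have "\<phi> \<in> borel_measurable borel" using assms(1) by (rule borel_measurable_continuous_onI)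
  then have "\<phi> \<in> borel_measurable lebesgue" by (simp add: measurable_completion)
  then show ?thesis using assms(2) unfolding set_borel_measurable_def by measurable
qed

lemma test_fun_bounded_support:
  assumes "test_fun a b \<phi>"
  obtains c d M where "a < c" "d < b" "\<And>x. x \<notin> {c..d} \<Longrightarrow> \<phi> x = 0" "\<And>x. \<bar>\<phi> x\<bar> \<le> M"
proof -
  obtain c d where cd: "a < c" "d < b" "\<And>x. x \<notin> {c..d} \<Longrightarrow> \<phi> x = 0" using assms by (auto simp: test_fun_iff)
  have "compact (\<phi> ` {c..d})" using test_fun_continuous[OF assms] by (intro compact_continuous_image) auto
  then obtain M where M: "\<And>x. x \<in> {c..d} \<Longrightarrow> \<bar>\<phi> x\<bar> \<le> M"
    by (metis bounded_real compact_imp_bounded imageI)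
  have "\<bar>\<phi> x\<bar> \<le> max M 0" for x using M cd(3) by (cases "x \<in> {c..d}") (auto intro: le_max_iff_disj[THEN iffD2])
  then show thesis using that cd by blast
qed

lemma loc_integrable_mult_test:
  assumes v: "loc_integrable a b v" and t: "test_fun a b \<phi>"
  shows "set_integrable lebesgue {a<..<b} (\<lambda>x. v x * \<phi> x)"
proof -
  obtain c d M where cd: "a < c" "d < b" "\<And>x. x \<notin> {c..d} \<Longrightarrow> \<phi> x = 0" "\<And>x. \<bar>\<phi> x\<bar> \<le> M"
    using test_fun_bounded_support[OF t] by metis
  have "set_integrable lebesgue {c..d} (\<lambda>x. v x * \<phi> x)"
    using cd v by (intro set_integrable_mult_bounded[where M=M] continuous_set_borel_measurable
        test_fun_continuous[OF t]) (auto simp: loc_integrable_def)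
  moreover have "(\<lambda>x. indicator {c..d} x *\<^sub>R (v x * \<phi> x)) = (\<lambda>x. indicator {a<..<b} x *\<^sub>R (v x * \<phi> x))"
    using cd by (fastforce simp: indicator_def)
  ultimately show ?thesis by (simp add: set_integrable_def)
qed

lemma set_integral_cong':
  fixes f g :: "real \<Rightarrow> real"
  assumes "\<And>x. indicator A x *\<^sub>R f x = indicator B x *\<^sub>R g x"
  shows "(LINT x:A|M. f x) = (LINT x:B|M. g x)"
  using assms by (simp add: set_lebesgue_integral_def)

lemma set_integral_support:
  fixes f :: "real \<Rightarrow> real"
  assumes "A \<subseteq> B" "\<And>x. x \<in> B - A \<Longrightarrow> f x = 0"
  shows "(LINT x:A|M. f x) = (LINT x:B|M. f x)"
proof (rule set_integral_cong')
  fix x show "indicator A x *\<^sub>R f x = indicator B x *\<^sub>R f x"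
    using assms by (cases "x \<in> A"; cases "x \<in> B") auto
qed

text \<open>Testing with \<open>bump\<close> and dominated convergence show that the integral of w
  over every interval well inside (a, b) is 0; the criterion above then applies.\<close>

lemma du_Bois_Reymond:
  assumes w: "loc_integrable a b w"
    and zero: "\<And>\<phi>. test_fun a b \<phi> \<Longrightarrow> (LINT x:{a<..<b}|lebesgue. w x * \<phi> x) = 0"
  shows "AE x in lebesgue. x \<in> {a<..<b} \<longrightarrow> w x = 0"
proof -
  have iv: "(LINT x:{c<..<d}|lebesgue. w x) = 0" if cd: "a < c" "d < b" for c d
  proof -
    have "(\<lambda>n. LINT x|lebesgue. indicator {c..d} x *\<^sub>R (w x * bump c d n x))
        \<longlonglongrightarrow> (LINT x|lebesgue. indicator {c..d} x *\<^sub>R (w x * indicator {c<..<d} x))"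
    proof (rule integral_dominated_convergence)
      show "integrable lebesgue (\<lambda>x. norm (indicator {c..d} x *\<^sub>R w x))"
        using w cd by (intro integrable_norm) (auto simp: loc_integrable_def set_integrable_def)
      have "set_integrable lebesgue {c..d} (\<lambda>x. w x * bump c d n x)" for n
      proof (rule set_integrable_mult_bounded[where M=1])
        have "continuous_on UNIV (bump c d n)"
          using test_fun_continuous[OF test_fun_bump[OF cd]] .
        then show "set_borel_measurable lebesgue {c..d} (bump c d n)"
          by (rule continuous_set_borel_measurable) auto
      qed (use w cd bump_bounds in \<open>auto simp: loc_integrable_def\<close>)
      then show "(\<lambda>x. indicator {c..d} x *\<^sub>R (w x * bump c d n x)) \<in> borel_measurable lebesgue" for n
        by (auto simp: set_integrable_def)
      have "set_integrable lebesgue {c..d} (\<lambda>x. w x * indicator {c<..<d} x)"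
        using w cd unfolding loc_integrable_def
        by (intro set_integrable_mult_bounded[where M=1])
          (auto simp: set_borel_measurable_def intro!: borel_measurable_times borel_measurable_indicator)
      then show "(\<lambda>x. indicator {c..d} x *\<^sub>R (w x * indicator {c<..<d} x)) \<in> borel_measurable lebesgue"
        by (auto simp: set_integrable_def)
      show "AE x in lebesgue. (\<lambda>n. indicator {c..d} x *\<^sub>R (w x * bump c d n x))
          \<longlonglongrightarrow> indicator {c..d} x *\<^sub>R (w x * indicator {c<..<d} x)"
        by (intro AE_I2 tendsto_intros bump_tendsto)
      show "AE x in lebesgue. norm (indicator {c..d} x *\<^sub>R (w x * bump c d n x)) \<le> norm (indicator {c..d} x *\<^sub>R w x)" for n
      proof (rule AE_I2)
        fix x
        have "\<bar>w x\<bar> * \<bar>bump c d n x\<bar> \<le> \<bar>w x\<bar> * 1"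
          using bump_bounds by (intro mult_left_mono) auto
        then show "norm (indicator {c..d} x *\<^sub>R (w x * bump c d n x)) \<le> norm (indicator {c..d} x *\<^sub>R w x)"
          by (auto simp: indicator_def abs_mult)
      qed
    qed
    moreover have "(LINT x|lebesgue. indicator {c..d} x *\<^sub>R (w x * bump c d n x)) = 0" for n
    proof -
      have "(LINT x:{c..d}|lebesgue. w x * bump c d n x) = (LINT x:{a<..<b}|lebesgue. w x * bump c d n x)"
        using cd bump_outside[of _ c d n] by (intro set_integral_support) auto
      then show ?thesis using zero[OF test_fun_bump[OF cd]] by (simp add: set_lebesgue_integral_def)
    qed
    ultimately have "(LINT x|lebesgue. indicator {c..d} x *\<^sub>R (w x * indicator {c<..<d} x)) = 0"
      by (simp add: LIMSEQ_const_iff)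
    moreover have "(\<lambda>x. indicator {c..d} x *\<^sub>R (w x * indicator {c<..<d} x)) = (\<lambda>x. indicator {c<..<d} x *\<^sub>R w x)"
      by (auto simp: indicator_def)
    ultimately show ?thesis by (simp add: set_lebesgue_integral_def)
  qed
  \<comment> \<open>Local integrability says nothing up to the end points, so w is restricted to
    compact intervals that exhaust (a, b).\<close>
  define W where "W k x = indicator {a + 1 / real (Suc k)..b - 1 / real (Suc k)} x *\<^sub>R w x" for k x
  have W: "AE x in lebesgue. W k x = 0" for k
  proof (rule AE_zero_if_interval_integrals_zero)
    show "integrable lebesgue (W k)"
      unfolding W_def[abs_def] set_integrable_def[symmetric] using w by (auto simp: loc_integrable_def)
    fix c d :: real assume "c \<le> d"
    let ?c = "max c (a + 1 / real (Suc k))" and ?d = "min d (b - 1 / real (Suc k))"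
    have "(LINT x:{c..d}|lebesgue. W k x) = (LINT x:{?c..?d}|lebesgue. w x)"
      by (intro set_integral_cong') (auto simp: W_def indicator_def)
    also have "\<dots> = (LINT x:{?c<..<?d}|lebesgue. w x)"
    proof -
      have si: "set_integrable lebesgue {?c..?d} w"
        using w by (intro loc_integrableD) (auto simp: less_max_iff_disj min_less_iff_disj)
      have "AE x in lebesgue. x \<notin> {?c, ?d}" 
        using AE_conjI[OF AE_lborel_singleton[of ?c] AE_lborel_singleton[of ?d]] by (intro AE_completion) auto
      then have "AE x in lebesgue. indicator {?c..?d} x *\<^sub>R w x = indicator {?c<..<?d} x *\<^sub>R w x"
        by eventually_elim (auto simp: indicator_def)
      moreover have "set_integrable lebesgue {?c<..<?d} w"
        by (rule set_integrable_subset[OF si]) (auto simp del: less_max_iff_disj)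
      ultimately show ?thesis using si unfolding set_lebesgue_integral_def set_integrable_def
        by (intro integral_cong_AE) (rule borel_measurable_integrable, assumption)+
    qed
    also have "\<dots> = 0" by (intro iv) (auto simp: less_max_iff_disj min_less_iff_disj)
    finally show "(LINT x:{c..d}|lebesgue. W k x) = 0" .
  qed
  then have "AE x in lebesgue. \<forall>k. W k x = 0" by (subst AE_all_countable) simp
  then show ?thesis
  proof eventually_elim
    fix x assume x: "\<forall>k. W k x = 0"
    show "x \<in> {a<..<b} \<longrightarrow> w x = 0"
    proof
      assume "x \<in> {a<..<b}"
      then have "0 < min (x - a) (b - x)" by auto
      then obtain k where "1 / real (Suc k) < min (x - a) (b - x)" using nat_approx_posE by blast
      then have "x \<in> {a + 1 / real (Suc k)..b - 1 / real (Suc k)}" by auto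
      then show "w x = 0" using x by (metis W_def indicator_simps(1) scaleR_one)
    qed
  qed
qed

section \<open>Rules for distributional derivatives\<close>

lemma loc_integrable_lincomb:
  assumes "loc_integrable a b u" "loc_integrable a b v"
  shows "loc_integrable a b (\<lambda>x. r * u x + s * v x)"
  using assms unfolding loc_integrable_def by (auto intro!: set_integral_add set_integrable_mult_right)

lemma is_distr_deriv_lincomb:
  assumes u: "is_distr_deriv a b u w" and v: "is_distr_deriv a b v z"
  shows "is_distr_deriv a b (\<lambda>x. r * u x + s * v x) (\<lambda>x. r * w x + s * z x)"
  unfolding is_distr_deriv_def
proof (intro conjI allI impI)
  show "loc_integrable a b (\<lambda>x. r * u x + s * v x)" "loc_integrable a b (\<lambda>x. r * w x + s * z x)"
    using u v by (auto simp: is_distr_deriv_def intro: loc_integrable_lincomb)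
  fix \<phi> assume t: "test_fun a b \<phi>"
  have lc: "(LINT x:{a<..<b}|lebesgue. (r * f x + s * g x) * \<psi> x) =
      r * (LINT x:{a<..<b}|lebesgue. f x * \<psi> x) + s * (LINT x:{a<..<b}|lebesgue. g x * \<psi> x)"
    if "loc_integrable a b f" "loc_integrable a b g" "test_fun a b \<psi>" for f g \<psi>
  proof -
    have "(LINT x:{a<..<b}|lebesgue. (r * f x + s * g x) * \<psi> x) =
       (LINT x:{a<..<b}|lebesgue. r * (f x * \<psi> x) + s * (g x * \<psi> x))" by (simp add: algebra_simps)
    also have "\<dots> = r * (LINT x:{a<..<b}|lebesgue. f x * \<psi> x) + s * (LINT x:{a<..<b}|lebesgue. g x * \<psi> x)"
      using that by (subst set_integral_add(2)) (auto intro!: set_integrable_mult_right loc_integrable_mult_test)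
    finally show ?thesis .
  qed
  show "(LINT x:{a<..<b}|lebesgue. (r * u x + s * v x) * deriv \<phi> x) =
      - (LINT x:{a<..<b}|lebesgue. (r * w x + s * z x) * \<phi> x)"
    using u v t test_fun_deriv[OF t] by (simp add: lc is_distr_deriv_def)
qed

lemma is_distr_deriv_unique:
  assumes "is_distr_deriv a b v w" "is_distr_deriv a b v z"
  shows "AE x in lebesgue. x \<in> {a<..<b} \<longrightarrow> w x = z x"
proof -
  have "AE x in lebesgue. x \<in> {a<..<b} \<longrightarrow> 1 * w x + (-1) * z x = 0"
  proof (rule du_Bois_Reymond)
    have d: "is_distr_deriv a b (\<lambda>x. 1 * v x + (-1) * v x) (\<lambda>x. 1 * w x + (-1) * z x)"
      by (rule is_distr_deriv_lincomb[OF assms])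
    then show "loc_integrable a b (\<lambda>x. 1 * w x + (-1) * z x)" by (simp add: is_distr_deriv_def)
    fix \<phi> assume "test_fun a b \<phi>"
    then have "(LINT x:{a<..<b}|lebesgue. (1 * v x + (-1) * v x) * deriv \<phi> x) = - (LINT x:{a<..<b}|lebesgue. (1 * w x + (-1) * z x) * \<phi> x)"
      using d unfolding is_distr_deriv_def by blast
    then show "(LINT x:{a<..<b}|lebesgue. (1 * w x + (-1) * z x) * \<phi> x) = 0" by (simp add: set_lebesgue_integral_def)
  qed
  then show ?thesis by eventually_elim simp
qed

lemma is_distr_deriv_distr_deriv: "is_distr_deriv a b v w \<Longrightarrow> is_distr_deriv a b v (distr_deriv a b v)"
  unfolding distr_deriv_def by (rule someI[of "is_distr_deriv a b v"])

lemma distr_deriv_eq: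
  "is_distr_deriv a b v w \<Longrightarrow> AE x in lebesgue. x \<in> {a<..<b} \<longrightarrow> distr_deriv a b v x = w x"
  using is_distr_deriv_unique is_distr_deriv_distr_deriv by blast

lemma is_distr_deriv_restrict:
  assumes d: "is_distr_deriv a b v w" and "a \<le> c" "d \<le> b"
  shows "is_distr_deriv c d v w"
  unfolding is_distr_deriv_def
proof (intro conjI allI impI)
  show "loc_integrable c d v" "loc_integrable c d w"
    using assms unfolding is_distr_deriv_def loc_integrable_def by auto
  fix \<phi> assume t: "test_fun c d \<phi>"
  have ext: "(LINT x:{c<..<d}|lebesgue. f x * \<psi> x) = (LINT x:{a<..<b}|lebesgue. f x * \<psi> x)" if psi: "test_fun c d \<psi>" for f \<psi>
  proof -
    obtain c' d' where "c < c'" "d' < d" "\<And>x. x \<notin> {c'..d'} \<Longrightarrow> \<psi> x = 0" 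
      using test_fun_bounded_support[OF psi] by metis
    then show ?thesis using assms by (intro set_integral_support) auto
  qed
  show "(LINT x:{c<..<d}|lebesgue. v x * deriv \<phi> x) = - (LINT x:{c<..<d}|lebesgue. w x * \<phi> x)"
    using d test_fun_mono[OF t] assms(2,3) t test_fun_deriv[OF t] by (simp add: ext is_distr_deriv_def)
qed

lemma is_distr_deriv_cong:
  assumes d: "is_distr_deriv a b v w"
    and v: "AE x in lebesgue. x \<in> {a<..<b} \<longrightarrow> v x = v' x"
    and w: "AE x in lebesgue. x \<in> {a<..<b} \<longrightarrow> w x = w' x"
  shows "is_distr_deriv a b v' w'"
  unfolding is_distr_deriv_def
proof (intro conjI allI impI)
  have li: "loc_integrable a b g" if "loc_integrable a b f" "AE x in lebesgue. x \<in> {a<..<b} \<longrightarrow> f x = g x" for f g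
    unfolding loc_integrable_def
  proof (intro allI impI)
    fix c d assume cd: "a < c \<and> d < b"
    have ae: "AE x in lebesgue. x \<in> {c..d} \<longrightarrow> f x = g x"
      using that(2) by (rule AE_mp) (use cd in \<open>auto intro!: AE_I2\<close>)
    show "set_integrable lebesgue {c..d} g"
      by (rule set_integrable_cong_AE'[OF loc_integrableD[OF that(1)] ae]) (use cd in auto)
  qed
  show "loc_integrable a b v'" "loc_integrable a b w'" using d v w by (auto simp: is_distr_deriv_def intro: li)
  fix \<phi> assume t: "test_fun a b \<phi>"
  have "(LINT x:{a<..<b}|lebesgue. v' x * deriv \<phi> x) = (LINT x:{a<..<b}|lebesgue. v x * deriv \<phi> x)"
    using v by (intro set_integral_cong_AE') (auto elim!: eventually_mono)
  also have "\<dots> = - (LINT x:{a<..<b}|lebesgue. w x * \<phi> x)" using d t by (simp add: is_distr_deriv_def)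
  also have "(LINT x:{a<..<b}|lebesgue. w x * \<phi> x) = (LINT x:{a<..<b}|lebesgue. w' x * \<phi> x)"
    using w by (intro set_integral_cong_AE') (auto elim!: eventually_mono)
  finally show "(LINT x:{a<..<b}|lebesgue. v' x * deriv \<phi> x) = - (LINT x:{a<..<b}|lebesgue. w' x * \<phi> x)" .
qed

lemma continuous_loc_integrable:
  assumes "continuous_on {a<..<b} F" shows "loc_integrable a b F"
  unfolding loc_integrable_def
proof (intro allI impI)
  fix c d assume "a < c \<and> d < b"
  then have "{c..d} \<subseteq> {a<..<b}" by auto
  then have "continuous_on {c..d} F" using assms continuous_on_subset by blast
  then show "set_integrable lebesgue {c..d} F" by (rule absolutely_integrable_continuous_real)
qed

text \<open>Continuity on all of (a, b) excludes jumps at the exceptional points, where the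
  classical derivative may be missing or unbounded. Fractional integrals of truncated powers have
  exactly this form.\<close>

lemma is_distr_deriv_FTC:
  assumes ab: "a < b" and S: "finite S" and F: "continuous_on {a<..<b} F"
    and D: "\<And>x. x \<in> {a<..<b} - S \<Longrightarrow> (F has_real_derivative g x) (at x)"
    and g: "loc_integrable a b g"
  shows "is_distr_deriv a b F g"
  unfolding is_distr_deriv_def
proof (intro conjI allI impI)
  show F': "loc_integrable a b F" using F by (rule continuous_loc_integrable)
  show "loc_integrable a b g" by fact
  fix \<phi> assume t: "test_fun a b \<phi>"
  obtain c d where cd: "a < c" "d < b" "\<And>x. x \<notin> {c..d} \<Longrightarrow> \<phi> x = 0" using t by (auto simp: test_fun_iff)
  obtain c' d' where cd': "a < c'" "d' < b" "\<And>x. x \<notin> {c'..d'} \<Longrightarrow> deriv \<phi> x = 0"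
    using test_fun_deriv[OF t] by (auto simp: test_fun_iff)
  \<comment> \<open>The interval [c1, d1] contains the supports of \<phi> and of its derivative. The
    midpoint of (a, b) secures c1 < d1 even if the support bounds satisfy d < c.\<close>
  obtain c1 where c1: "a < c1" "c1 < c" "c1 < c'" "c1 < (a + b) / 2"
    using dense[of a "min (min c c') ((a+b)/2)"] cd cd' ab by auto
  obtain d1 where d1: "d1 < b" "d < d1" "d' < d1" "(a + b) / 2 < d1"
    using dense[of "max (max d d') ((a+b)/2)" b] cd cd' ab by auto
  have restr: "(LINT x:{a<..<b}|lebesgue. f x) = (LINT x:{c1..d1}|lebesgue. f x)"
    if "\<And>x. x \<notin> {c1..d1} \<Longrightarrow> f x = 0" for f :: "real \<Rightarrow> real"
    using that c1 d1 by (intro set_integral_support[symmetric]) auto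
  have int: "set_integrable lebesgue {c1..d1} (\<lambda>x. f x * \<psi> x)" if "loc_integrable a b f" "test_fun a b \<psi>" for f \<psi>
    using loc_integrable_mult_test[OF that] c1 d1 by (rule_tac set_integrable_subset) auto
  have "((\<lambda>x. g x * \<phi> x + F x * deriv \<phi> x) has_integral (F d1 * \<phi> d1 - F c1 * \<phi> c1)) {c1..d1}"
  proof (rule fundamental_theorem_of_calculus_interior_strong[OF S])
    show "c1 \<le> d1" using c1 d1 by auto
    have "continuous_on {c1..d1} F" using F c1 d1 by (rule_tac continuous_on_subset) auto
    then show "continuous_on {c1..d1} (\<lambda>x. F x * \<phi> x)"
      using test_fun_continuous[OF t] by (intro continuous_on_mult) auto
    fix x assume x: "x \<in> {c1<..<d1} - S"
    have "((\<lambda>x. F x * \<phi> x) has_real_derivative g x * \<phi> x + deriv \<phi> x * F x) (at x)"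
      using x c1 d1 by (intro DERIV_mult D test_fun_DERIV[OF t]) auto
    then show "((\<lambda>x. F x * \<phi> x) has_vector_derivative g x * \<phi> x + F x * deriv \<phi> x) (at x)"
      by (simp add: has_real_derivative_iff_has_vector_derivative mult.commute)
  qed
  then have hi: "((\<lambda>x. g x * \<phi> x + F x * deriv \<phi> x) has_integral 0) {c1..d1}"
    using cd(3) c1 d1 by auto
  have "(LINT x:{c1..d1}|lebesgue. g x * \<phi> x) + (LINT x:{c1..d1}|lebesgue. F x * deriv \<phi> x) =
      (LINT x:{c1..d1}|lebesgue. g x * \<phi> x + F x * deriv \<phi> x)"
    by (rule set_integral_add(2)[symmetric]) (intro int g F' t test_fun_deriv)+
  also have "\<dots> = integral {c1..d1} (\<lambda>x. g x * \<phi> x + F x * deriv \<phi> x)"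
    by (intro set_lebesgue_integral_eq_integral(2) set_integral_add(1) int g F' t test_fun_deriv)
  also have "\<dots> = 0" using hi by (rule integral_unique)
  finally show "(LINT x:{a<..<b}|lebesgue. F x * deriv \<phi> x) = - (LINT x:{a<..<b}|lebesgue. g x * \<phi> x)"
    using cd(3) cd'(3) c1 d1 by (subst (1 2) restr) auto
qed

lemma is_distr_deriv_classical:
  assumes "a < b" "\<And>x. x \<in> {a<..<b} \<Longrightarrow> (F has_real_derivative g x) (at x)" "continuous_on {a<..<b} g"
  shows "is_distr_deriv a b F g"
proof (rule is_distr_deriv_FTC[where S="{}"])
  show "continuous_on {a<..<b} F"
    using assms(2) by (intro continuous_at_imp_continuous_on ballI DERIV_isCont)
qed (use assms in \<open>auto intro: continuous_loc_integrable\<close>)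

subsection \<open>Sobolev spaces and the Poincare inequality\<close>

text \<open>Functions equal almost everywhere are not identified, so the L2, H1 and Dirichlet forms
  are only semidefinite on sets of functions. One locale provides Cauchy-Schwarz, Bessel and
  orthonormal families for all of them.\<close>

locale semi_ip =
  fixes V :: "('x \<Rightarrow> real) set" and ip :: "('x \<Rightarrow> real) \<Rightarrow> ('x \<Rightarrow> real) \<Rightarrow> real"
  assumes zero: "(\<lambda>x. 0) \<in> V"
    and lincomb: "u \<in> V \<Longrightarrow> v \<in> V \<Longrightarrow> (\<lambda>x. r * u x + s * v x) \<in> V"
    and sym: "u \<in> V \<Longrightarrow> v \<in> V \<Longrightarrow> ip u v = ip v u"
    and ip_lin: "u \<in> V \<Longrightarrow> v \<in> V \<Longrightarrow> w \<in> V \<Longrightarrow> ip (\<lambda>x. r * u x + s * v x) w = r * ip u w + s * ip v w"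
    and nonneg: "v \<in> V \<Longrightarrow> 0 \<le> ip v v"
begin

lemma add: "u \<in> V \<Longrightarrow> v \<in> V \<Longrightarrow> (\<lambda>x. u x + v x) \<in> V"
  using lincomb[of u v 1 1] by simp

lemma diff: "u \<in> V \<Longrightarrow> v \<in> V \<Longrightarrow> (\<lambda>x. u x - v x) \<in> V"
  using lincomb[of u v 1 "-1"] by simp

lemma scale: "u \<in> V \<Longrightarrow> (\<lambda>x. r * u x) \<in> V"
  using lincomb[of u u r 0] by simp

lemma ip_add: "u \<in> V \<Longrightarrow> v \<in> V \<Longrightarrow> w \<in> V \<Longrightarrow> ip (\<lambda>x. u x + v x) w = ip u w + ip v w"
  using ip_lin[of u v w 1 1] by simp

lemma ip_diff: "u \<in> V \<Longrightarrow> v \<in> V \<Longrightarrow> w \<in> V \<Longrightarrow> ip (\<lambda>x. u x - v x) w = ip u w - ip v w"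
  using ip_lin[of u v w 1 "-1"] by simp

lemma ip_scale: "u \<in> V \<Longrightarrow> w \<in> V \<Longrightarrow> ip (\<lambda>x. r * u x) w = r * ip u w"
  using ip_lin[of u u w r 0] by simp

lemma ip_zero: "w \<in> V \<Longrightarrow> ip (\<lambda>x. 0) w = 0"
  using ip_lin[OF zero zero, of w 0 0] by simp

lemma sum_mem: "(\<And>l. l < d \<Longrightarrow> w l \<in> V) \<Longrightarrow> (\<lambda>x. \<Sum>l<(d::nat). c l * w l x) \<in> V"
proof (induction d)
  case 0 then show ?case using zero by simp
next
  case (Suc d)
  then show ?case using add[OF Suc.IH scale[of "w d" "c d"]] by simp
qed

lemma ip_sum:
  "(\<And>l. l < d \<Longrightarrow> w l \<in> V) \<Longrightarrow> v \<in> V \<Longrightarrow> ip (\<lambda>x. \<Sum>l<(d::nat). c l * w l x) v = (\<Sum>l<d. c l * ip (w l) v)"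
proof (induction d)
  case 0 then show ?case using ip_zero by simp
next
  case (Suc d)
  then show ?case using ip_add[OF sum_mem scale[of "w d" "c d"], of d w v c] ip_scale[of "w d" v "c d"] by simp
qed

lemma ip_sum_right:
  "(\<And>l. l < d \<Longrightarrow> w l \<in> V) \<Longrightarrow> v \<in> V \<Longrightarrow> ip v (\<lambda>x. \<Sum>l<(d::nat). c l * w l x) = (\<Sum>l<d. c l * ip v (w l))"
  by (subst sym) (auto intro: sum_mem sum.cong simp: ip_sum sym[of v])

lemma ip_square_lincomb:
  assumes "u \<in> V" "v \<in> V"
  shows "ip (\<lambda>x. r * u x + s * v x) (\<lambda>x. r * u x + s * v x) = r\<^sup>2 * ip u u + 2 * r * s * ip u v + s\<^sup>2 * ip v v"
proof -
  let ?z = "\<lambda>x. r * u x + s * v x"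
  have z: "?z \<in> V" by (rule lincomb[OF assms])
  have "ip ?z ?z = r * ip u ?z + s * ip v ?z" by (rule ip_lin[OF assms z])
  also have "ip u ?z = r * ip u u + s * ip u v" using assms z by (simp add: sym[of u ?z] ip_lin sym[of v u])
  also have "ip v ?z = r * ip u v + s * ip v v" using assms z by (simp add: sym[of v ?z] ip_lin)
  finally show ?thesis by (simp add: algebra_simps power2_eq_square)
qed

lemma Cauchy_Schwarz: assumes "u \<in> V" "v \<in> V" shows "(ip u v)\<^sup>2 \<le> ip u u * ip v v"
proof -
  have q: "0 \<le> r\<^sup>2 * ip u u + 2 * r * s * ip u v + s\<^sup>2 * ip v v" for r s
    using nonneg[OF lincomb[OF assms]] by (simp add: ip_square_lincomb[OF assms])
  show ?thesis
  proof (cases "ip v v = 0")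
    case True
    have "ip u v = 0"
    proof (rule ccontr)
      assume n: "ip u v \<noteq> 0"
      \<comment> \<open>If \<open>ip v v\<close> vanishes, the quadratic form is affine in s; this s
        makes its value -1.\<close>
      show False using q[of 1 "- (ip u u + 1) / (2 * ip u v)"] n True by (simp add: field_simps)
    qed
    then show ?thesis using True by simp
  next
    case False
    then have pos: "ip v v > 0" using nonneg[OF assms(2)] by linarith
    have "0 \<le> (ip v v)\<^sup>2 * ip u u + 2 * ip v v * (- ip u v) * ip u v + (- ip u v)\<^sup>2 * ip v v" by (rule q)
    also have "\<dots> = ip v v * (ip u u * ip v v - (ip u v)\<^sup>2)" by (simp add: algebra_simps power2_eq_square)
    finally show ?thesis using pos by (simp add: zero_le_mult_iff)
  qed
qed

definition nrm where "nrm v = sqrt (ip v v)"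

lemma nrm_nonneg: "v \<in> V \<Longrightarrow> 0 \<le> nrm v" by (simp add: nrm_def nonneg)

lemma nrm_square: "v \<in> V \<Longrightarrow> (nrm v)\<^sup>2 = ip v v" by (simp add: nrm_def nonneg)

lemma abs_ip_le: assumes "u \<in> V" "v \<in> V" shows "\<bar>ip u v\<bar> \<le> nrm u * nrm v"
proof -
  have "\<bar>ip u v\<bar> = sqrt ((ip u v)\<^sup>2)" by simp
  also have "\<dots> \<le> sqrt (ip u u * ip v v)" by (intro real_sqrt_le_mono Cauchy_Schwarz assms)
  finally show ?thesis by (simp add: nrm_def real_sqrt_mult)
qed

lemma nrm_scale: assumes "u \<in> V" shows "nrm (\<lambda>x. r * u x) = \<bar>r\<bar> * nrm u"
  using ip_square_lincomb[OF assms assms, of r 0] by (simp add: nrm_def real_sqrt_mult)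

lemma nrm_triangle: assumes "u \<in> V" "v \<in> V" shows "nrm (\<lambda>x. u x + v x) \<le> nrm u + nrm v"
proof (rule power2_le_imp_le)
  have "(nrm (\<lambda>x. u x + v x))\<^sup>2 = ip u u + 2 * ip u v + ip v v"
    using ip_square_lincomb[OF assms, of 1 1] by (simp add: nrm_square add assms)
  also have "\<dots> \<le> (nrm u)\<^sup>2 + 2 * (nrm u * nrm v) + (nrm v)\<^sup>2"
    using abs_ip_le[OF assms] by (simp add: nrm_square assms)
  finally show "(nrm (\<lambda>x. u x + v x))\<^sup>2 \<le> (nrm u + nrm v)\<^sup>2" by (simp add: power2_sum)
  show "0 \<le> nrm u + nrm v" using nrm_nonneg assms by auto
qed

text \<open>The difference is the squared seminorm of v minus its projection. Later this bounds the
  partial sums over an arbitrary orthonormal basis of the Sobolev space.\<close>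

lemma Bessel:
  assumes e: "\<And>k. k < K \<Longrightarrow> e k \<in> V" "\<And>k l. k < K \<Longrightarrow> l < K \<Longrightarrow> ip (e k) (e l) = (if k = l then 1 else 0)"
    and v: "v \<in> V"
  shows "(\<Sum>k<(K::nat). (ip v (e k))\<^sup>2) \<le> ip v v"
proof -
  let ?s = "\<lambda>x. \<Sum>k<K. ip v (e k) * e k x"
  have s: "?s \<in> V" using e by (intro sum_mem) auto
  have a: "ip v ?s = (\<Sum>k<K. (ip v (e k))\<^sup>2)" using e v by (simp add: ip_sum_right power2_eq_square)
  have "ip (e l) ?s = ip v (e l)" if "l < K" for l
  proof -
    have "ip (e l) ?s = (\<Sum>k<K. ip v (e k) * ip (e l) (e k))" using e that by (simp add: ip_sum_right)
    also have "\<dots> = (\<Sum>k<K. if k = l then ip v (e k) else 0)" using e(2) that by (intro sum.cong) auto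
    finally show ?thesis using that by simp
  qed
  then have b: "ip ?s ?s = (\<Sum>k<K. (ip v (e k))\<^sup>2)"
    using e s by (simp add: ip_sum power2_eq_square)
  have "0 \<le> ip (\<lambda>x. 1 * v x + (-1) * ?s x) (\<lambda>x. 1 * v x + (-1) * ?s x)"
    by (intro nonneg lincomb v s)
  also have "\<dots> = ip v v - (\<Sum>k<K. (ip v (e k))\<^sup>2)"
    by (subst ip_square_lincomb[OF v s]) (simp add: a b)
  finally show ?thesis by simp
qed

lemma semi_ip_subset:
  assumes "W \<subseteq> V" "(\<lambda>x. 0) \<in> W" "\<And>u v r s. u \<in> W \<Longrightarrow> v \<in> W \<Longrightarrow> (\<lambda>x. r * u x + s * v x) \<in> W"
  shows "semi_ip W ip"
  by standard (use assms in \<open>auto intro: sym nonneg ip_lin\<close>)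

end

section \<open>L2, H1 and H01 as semi-inner-product spaces\<close>

definition L2_inner :: "real \<Rightarrow> real \<Rightarrow> (real \<Rightarrow> real) \<Rightarrow> (real \<Rightarrow> real) \<Rightarrow> real" where
  "L2_inner a b u v = (LINT x:{a<..<b}|lebesgue. u x * v x)"

definition Dir_inner :: "real \<Rightarrow> real \<Rightarrow> (real \<Rightarrow> real) \<Rightarrow> (real \<Rightarrow> real) \<Rightarrow> real" where
  "Dir_inner a b u v = L2_inner a b (distr_deriv a b u) (distr_deriv a b v)"

lemma H1_inner_eq: "H1_inner a b u v = L2_inner a b u v + Dir_inner a b u v"
  by (simp add: H1_inner_def L2_inner_def Dir_inner_def)

lemma L2_norm_eq: "L2_norm_on a b v = sqrt (L2_inner a b v v)"
  by (simp add: L2_norm_on_def L2_inner_def power2_eq_square)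

lemma L2_mult:
  assumes "u \<in> L2_space a b" "v \<in> L2_space a b"
  shows "set_integrable lebesgue {a<..<b} (\<lambda>x. u x * v x)"
  unfolding set_integrable_def
proof (rule Bochner_Integration.integrable_bound)
  let ?i = "indicator {a<..<b} :: real \<Rightarrow> real"
  show "integrable lebesgue (\<lambda>x. ?i x *\<^sub>R (u x)\<^sup>2 + ?i x *\<^sub>R (v x)\<^sup>2)"
    using assms by (intro Bochner_Integration.integrable_add) (auto simp: L2_space_def set_integrable_def)
  have "(\<lambda>x. (?i x *\<^sub>R u x) * (?i x *\<^sub>R v x)) \<in> borel_measurable lebesgue"
    using assms by (intro borel_measurable_times) (auto simp: L2_space_def set_borel_measurable_def)
  also have "(\<lambda>x. (?i x *\<^sub>R u x) * (?i x *\<^sub>R v x)) = (\<lambda>x. ?i x *\<^sub>R (u x * v x))"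
    by (auto simp: indicator_def)
  finally show "(\<lambda>x. ?i x *\<^sub>R (u x * v x)) \<in> borel_measurable lebesgue" .
  have "\<bar>p * q\<bar> \<le> p\<^sup>2 + q\<^sup>2" for p q :: real
  proof -
    have "2 * \<bar>p * q\<bar> \<le> p\<^sup>2 + q\<^sup>2"
      using zero_le_power2[of "\<bar>p\<bar> - \<bar>q\<bar>"] by (simp add: power2_diff abs_mult)
    then show ?thesis using abs_ge_zero[of "p * q"] by linarith
  qed
  then show "AE x in lebesgue. norm (?i x *\<^sub>R (u x * v x)) \<le> norm (?i x *\<^sub>R (u x)\<^sup>2 + ?i x *\<^sub>R (v x)\<^sup>2)"
    by (intro AE_I2) (auto simp: indicator_def)
qed

lemma L2_zero: "(\<lambda>x. 0) \<in> L2_space a b"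
  by (auto simp: L2_space_def set_borel_measurable_def set_integrable_def)

lemma L2_lincomb:
  assumes "u \<in> L2_space a b" "v \<in> L2_space a b"
  shows "(\<lambda>x. r * u x + s * v x) \<in> L2_space a b"
proof -
  let ?i = "indicator {a<..<b} :: real \<Rightarrow> real"
  have "(\<lambda>x. r * (?i x *\<^sub>R u x) + s * (?i x *\<^sub>R v x)) \<in> borel_measurable lebesgue"
    using assms by (intro borel_measurable_add borel_measurable_times) (auto simp: L2_space_def set_borel_measurable_def)
  also have "(\<lambda>x. r * (?i x *\<^sub>R u x) + s * (?i x *\<^sub>R v x)) = (\<lambda>x. ?i x *\<^sub>R (r * u x + s * v x))"
    by (auto simp: indicator_def)
  finally have m: "set_borel_measurable lebesgue {a<..<b} (\<lambda>x. r * u x + s * v x)"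
    by (simp add: set_borel_measurable_def)
  have "set_integrable lebesgue {a<..<b} (\<lambda>x. (r * r) * (u x * u x) + ((2 * r * s) * (u x * v x) + (s * s) * (v x * v x)))"
    using assms by (intro set_integral_add set_integrable_mult_right L2_mult)
  then have "set_integrable lebesgue {a<..<b} (\<lambda>x. (r * u x + s * v x)\<^sup>2)"
    by (rule back_subst[of "set_integrable lebesgue {a<..<b}"]) (auto simp: fun_eq_iff algebra_simps power2_eq_square)
  then show ?thesis using m by (simp add: L2_space_def)
qed

lemma semi_ip_L2: "semi_ip (L2_space a b) (L2_inner a b)"
proof
  fix u v w :: "real \<Rightarrow> real" and r s
  assume "u \<in> L2_space a b" "v \<in> L2_space a b" "w \<in> L2_space a b"
  then have "(LINT x:{a<..<b}|lebesgue. r * (u x * w x) + s * (v x * w x)) = r * L2_inner a b u w + s * L2_inner a b v w"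
    by (subst set_integral_add(2)) (auto simp: L2_inner_def intro!: set_integrable_mult_right L2_mult)
  then show "L2_inner a b (\<lambda>x. r * u x + s * v x) w = r * L2_inner a b u w + s * L2_inner a b v w"
    by (simp add: L2_inner_def algebra_simps)
next
  fix v :: "real \<Rightarrow> real"
  show "0 \<le> L2_inner a b v v" by (auto simp: L2_inner_def set_lebesgue_integral_def intro!: Bochner_Integration.integral_nonneg)
qed (auto simp: L2_zero L2_lincomb L2_inner_def mult.commute)

lemma L2_inner_cong:
  assumes "AE x in lebesgue. x \<in> {a<..<b} \<longrightarrow> u x = u' x" "AE x in lebesgue. x \<in> {a<..<b} \<longrightarrow> v x = v' x"
  shows "L2_inner a b u v = L2_inner a b u' v'"
  unfolding L2_inner_def
  using assms by (intro set_integral_cong_AE') (auto elim: AE_mp)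

lemma L2_space_cong:
  assumes "u \<in> L2_space a b" and ae: "AE x in lebesgue. x \<in> {a<..<b} \<longrightarrow> u x = v x"
  shows "v \<in> L2_space a b"
proof -
  have "AE x in lebesgue. indicator {a<..<b} x *\<^sub>R u x = indicator {a<..<b} x *\<^sub>R v x"
    using ae by (rule AE_mp) (auto intro!: AE_I2 simp: indicator_def)
  then have "set_borel_measurable lebesgue {a<..<b} v"
    using assms(1) unfolding set_borel_measurable_def L2_space_def by (auto intro: borel_measurable_AE)
  moreover have "set_integrable lebesgue {a<..<b} (\<lambda>x. (v x)\<^sup>2)"
    by (rule set_integrable_cong_AE'[of _ "\<lambda>x. (u x)\<^sup>2"]) (use assms in \<open>auto simp: L2_space_def elim: AE_mp\<close>)
  ultimately show ?thesis by (simp add: L2_space_def)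
qed

lemma continuous_imp_L2:
  assumes "continuous_on UNIV \<phi>" shows "\<phi> \<in> L2_space a b"
proof -
  have "set_integrable lebesgue {a..b} (\<lambda>x. (\<phi> x)\<^sup>2)"
    using assms continuous_on_subset by (intro absolutely_integrable_continuous_real continuous_intros) auto
  then have "set_integrable lebesgue {a<..<b} (\<lambda>x. (\<phi> x)\<^sup>2)" by (rule set_integrable_subset) auto
  then show ?thesis using continuous_set_borel_measurable[OF assms, of "{a<..<b}"] by (simp add: L2_space_def)
qed

lemma H1D:
  assumes "v \<in> H1_space a b"
  shows "v \<in> L2_space a b" "distr_deriv a b v \<in> L2_space a b" "is_distr_deriv a b v (distr_deriv a b v)"
proof -
  obtain w where w: "w \<in> L2_space a b" "is_distr_deriv a b v w" using assms by (auto simp: H1_space_def)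
  show "v \<in> L2_space a b" using assms by (simp add: H1_space_def)
  show "is_distr_deriv a b v (distr_deriv a b v)" using w by (blast intro: is_distr_deriv_distr_deriv)
  have "AE x in lebesgue. x \<in> {a<..<b} \<longrightarrow> w x = distr_deriv a b v x"
    using distr_deriv_eq[OF w(2)] by (rule AE_mp) (auto intro!: AE_I2)
  then show "distr_deriv a b v \<in> L2_space a b" by (rule L2_space_cong[OF w(1)])
qed

lemma H1_zero: "(\<lambda>x. 0) \<in> H1_space a b"
proof -
  have "is_distr_deriv a b (\<lambda>x. 0) (\<lambda>x. 0)"
    by (auto simp: is_distr_deriv_def loc_integrable_def set_integrable_def set_lebesgue_integral_def)
  then show ?thesis unfolding H1_space_def using L2_zero by blast
qed

lemma H1_lincomb:
  assumes "u \<in> H1_space a b" "v \<in> H1_space a b"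
  shows "(\<lambda>x. r * u x + s * v x) \<in> H1_space a b"
    and distr_deriv_lincomb: "AE x in lebesgue. x \<in> {a<..<b} \<longrightarrow>
      distr_deriv a b (\<lambda>x. r * u x + s * v x) x = r * distr_deriv a b u x + s * distr_deriv a b v x"
proof -
  have d: "is_distr_deriv a b (\<lambda>x. r * u x + s * v x) (\<lambda>x. r * distr_deriv a b u x + s * distr_deriv a b v x)"
    using assms by (intro is_distr_deriv_lincomb H1D)
  moreover have "(\<lambda>x. r * distr_deriv a b u x + s * distr_deriv a b v x) \<in> L2_space a b"
    using assms by (intro L2_lincomb H1D)
  ultimately show "(\<lambda>x. r * u x + s * v x) \<in> H1_space a b"
    using assms L2_lincomb[of u a b v r s] unfolding H1_space_def by blast
  show "AE x in lebesgue. x \<in> {a<..<b} \<longrightarrow>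
      distr_deriv a b (\<lambda>x. r * u x + s * v x) x = r * distr_deriv a b u x + s * distr_deriv a b v x"
    by (rule distr_deriv_eq[OF d])
qed

lemma semi_ip_Dir: "semi_ip (H1_space a b) (Dir_inner a b)"
proof -
  interpret L: semi_ip "L2_space a b" "L2_inner a b" by (rule semi_ip_L2)
  show ?thesis
  proof
    fix u v w :: "real \<Rightarrow> real" and r s
    assume *: "u \<in> H1_space a b" "v \<in> H1_space a b" "w \<in> H1_space a b"
    have "Dir_inner a b (\<lambda>x. r * u x + s * v x) w =
        L2_inner a b (\<lambda>x. r * distr_deriv a b u x + s * distr_deriv a b v x) (distr_deriv a b w)"
      unfolding Dir_inner_def using * by (intro L2_inner_cong distr_deriv_lincomb) auto
    then show "Dir_inner a b (\<lambda>x. r * u x + s * v x) w = r * Dir_inner a b u w + s * Dir_inner a b v w"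
      using * by (simp add: Dir_inner_def L.ip_lin H1D)
  qed (auto simp: H1_zero H1_lincomb Dir_inner_def intro: L.sym L.nonneg H1D)
qed

lemma semi_ip_H1: "semi_ip (H1_space a b) (H1_inner a b)"
proof -
  interpret L: semi_ip "L2_space a b" "L2_inner a b" by (rule semi_ip_L2)
  interpret D: semi_ip "H1_space a b" "Dir_inner a b" by (rule semi_ip_Dir)
  show ?thesis
  proof
    show "0 \<le> H1_inner a b v v" if "v \<in> H1_space a b" for v
      unfolding H1_inner_eq by (intro add_nonneg_nonneg L.nonneg D.nonneg H1D(1) that)
  qed (simp_all add: H1_zero H1_lincomb H1_inner_eq L.ip_lin D.ip_lin H1D L.sym D.sym algebra_simps)
qed

lemma test_fun_H1:
  assumes "a < b" "test_fun a b \<phi>"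
  shows "\<phi> \<in> H1_space a b" "AE x in lebesgue. x \<in> {a<..<b} \<longrightarrow> distr_deriv a b \<phi> x = deriv \<phi> x"
proof -
  have d: "is_distr_deriv a b \<phi> (deriv \<phi>)"
    using assms by (intro is_distr_deriv_classical test_fun_DERIV test_fun_continuous[OF test_fun_deriv])
  moreover have "\<phi> \<in> L2_space a b" "deriv \<phi> \<in> L2_space a b"
    using assms(2) by (auto intro!: continuous_imp_L2 test_fun_continuous test_fun_deriv)
  ultimately show "\<phi> \<in> H1_space a b" by (auto simp: H1_space_def)
  show "AE x in lebesgue. x \<in> {a<..<b} \<longrightarrow> distr_deriv a b \<phi> x = deriv \<phi> x" by (rule distr_deriv_eq[OF d])
qed

lemma H1_norm_eq: "H1_norm a b v = semi_ip.nrm (H1_inner a b) v"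
  by (simp add: H1_norm_def semi_ip.nrm_def[OF semi_ip_H1])

lemma H01_H1: "v \<in> H01_space a b \<Longrightarrow> v \<in> H1_space a b"
  by (simp add: H01_space_def)

lemma H01_lincomb:
  assumes ab: "a < b" and u: "u \<in> H01_space a b" and v: "v \<in> H01_space a b"
  shows "(\<lambda>x. r * u x + s * v x) \<in> H01_space a b"
  unfolding H01_space_def
proof (intro CollectI conjI allI impI)
  interpret H: semi_ip "H1_space a b" "H1_inner a b" by (rule semi_ip_H1)
  show "(\<lambda>x. r * u x + s * v x) \<in> H1_space a b" using u v by (intro H1_lincomb H01_H1)
  fix \<epsilon> :: real assume e: "0 < \<epsilon>"
  let ?e = "\<epsilon> / (\<bar>r\<bar> + \<bar>s\<bar> + 1)"
  have e': "0 < ?e" using e by (intro divide_pos_pos) auto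
  obtain \<phi> where p: "test_fun a b \<phi>" "H1_norm a b (\<lambda>x. u x - \<phi> x) < ?e"
    using u e' unfolding H01_space_def by blast
  obtain \<psi> where q: "test_fun a b \<psi>" "H1_norm a b (\<lambda>x. v x - \<psi> x) < ?e"
    using v e' unfolding H01_space_def by blast
  have mem: "(\<lambda>x. u x - \<phi> x) \<in> H1_space a b" "(\<lambda>x. v x - \<psi> x) \<in> H1_space a b"
    by (rule H.diff[OF H01_H1[OF u] test_fun_H1(1)[OF ab p(1)]] H.diff[OF H01_H1[OF v] test_fun_H1(1)[OF ab q(1)]])+
  have "H1_norm a b (\<lambda>x. r * u x + s * v x - (r * \<phi> x + s * \<psi> x)) =
      H.nrm (\<lambda>x. r * (u x - \<phi> x) + s * (v x - \<psi> x))"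
    by (simp add: H1_norm_eq algebra_simps)
  also have "\<dots> \<le> H.nrm (\<lambda>x. r * (u x - \<phi> x)) + H.nrm (\<lambda>x. s * (v x - \<psi> x))"
    using mem by (intro H.nrm_triangle H.scale)
  also have "\<dots> = \<bar>r\<bar> * H1_norm a b (\<lambda>x. u x - \<phi> x) + \<bar>s\<bar> * H1_norm a b (\<lambda>x. v x - \<psi> x)"
    using mem by (simp add: H.nrm_scale H1_norm_eq)
  also have "\<dots> \<le> \<bar>r\<bar> * ?e + \<bar>s\<bar> * ?e" using p q by (intro add_mono mult_left_mono) auto
  also have "\<dots> = (\<bar>r\<bar> + \<bar>s\<bar>) * ?e" by (rule distrib_right[symmetric])
  also have "\<dots> < (\<bar>r\<bar> + \<bar>s\<bar> + 1) * ?e" using e' by (intro mult_strict_right_mono) auto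
  also have "\<dots> = \<epsilon>" by (simp add: field_simps)
  finally have "H1_norm a b (\<lambda>x. r * u x + s * v x - (r * \<phi> x + s * \<psi> x)) < \<epsilon>" .
  moreover have "test_fun a b (\<lambda>x. r * \<phi> x + s * \<psi> x)" by (intro test_fun_add test_fun_scale p q)
  ultimately show "\<exists>\<eta>. test_fun a b \<eta> \<and> H1_norm a b (\<lambda>x. r * u x + s * v x - \<eta> x) < \<epsilon>"
    by (intro exI[of _ "\<lambda>x. r * \<phi> x + s * \<psi> x"]) simp
qed

lemma H01_zero: assumes "a < b" shows "(\<lambda>x. 0) \<in> H01_space a b"
proof -
  interpret H: semi_ip "H1_space a b" "H1_inner a b" by (rule semi_ip_H1)
  have "H1_norm a b (\<lambda>x. 0 - 0) = 0" using H.ip_zero[OF H.zero] by (simp add: H1_norm_def)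
  then show ?thesis using H1_zero test_fun_0[OF assms] unfolding H01_space_def by force
qed

lemma semi_ip_H01: "a < b \<Longrightarrow> semi_ip (H01_space a b) (H1_inner a b)"
  by (rule semi_ip.semi_ip_subset[OF semi_ip_H1]) (auto intro: H01_H1 H01_zero H01_lincomb)

section \<open>The Poincare inequality\<close>

lemma set_integral_Icc_Ioo:
  fixes f :: "real \<Rightarrow> real"
  shows "(LINT x:{a..b}|lebesgue. f x) = (LINT x:{a<..<b}|lebesgue. f x)"
proof -
  have "AE x in lebesgue. x \<noteq> a \<and> x \<noteq> b"
    using AE_conjI[OF AE_lborel_singleton[of a] AE_lborel_singleton[of b]] by (rule AE_completion)
  then have "AE x in lebesgue. x \<in> UNIV \<longrightarrow> indicator {a..b} x *\<^sub>R f x = indicator {a<..<b} x *\<^sub>R f x"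
    by eventually_elim (auto simp: indicator_def)
  from set_integral_cong_AE'[OF this] show ?thesis by (simp add: set_lebesgue_integral_def)
qed

text \<open>One factor b - a comes from Cauchy-Schwarz applied to \<phi>(x) as the integral of its
  derivative from a to x, the other from integrating the resulting uniform bound over (a,
  b).\<close>

lemma Poincare_test_fun:
  assumes ab: "a < b" and t: "test_fun a b \<phi>"
  shows "L2_inner a b \<phi> \<phi> \<le> (b - a)\<^sup>2 * Dir_inner a b \<phi> \<phi>"
proof -
  interpret L: semi_ip "L2_space a b" "L2_inner a b" by (rule semi_ip_L2)
  have c1: "continuous_on S (deriv \<phi>)" for S using t by (intro test_fun_continuous test_fun_deriv)
  have L2: "(\<lambda>x. \<bar>deriv \<phi> x\<bar>) \<in> L2_space a b" "(\<lambda>x. 1) \<in> L2_space a b" "\<phi> \<in> L2_space a b"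
    by (auto intro!: continuous_imp_L2 continuous_intros c1 test_fun_continuous[OF t])
  have D: "Dir_inner a b \<phi> \<phi> = L2_inner a b (\<lambda>x. \<bar>deriv \<phi> x\<bar>) (\<lambda>x. \<bar>deriv \<phi> x\<bar>)"
  proof -
    have "Dir_inner a b \<phi> \<phi> = L2_inner a b (deriv \<phi>) (deriv \<phi>)"
      unfolding Dir_inner_def by (intro L2_inner_cong test_fun_H1(2) ab t)
    then show ?thesis by (simp add: L2_inner_def flip: abs_mult)
  qed
  have one: "L2_inner a b (\<lambda>x. 1) (\<lambda>x. 1) = b - a"
    using ab by (simp add: L2_inner_def set_lebesgue_integral_def)
  have pt: "(\<phi> x)\<^sup>2 \<le> (b - a) * Dir_inner a b \<phi> \<phi>" if x: "x \<in> {a<..<b}" for x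
  proof -
    obtain c d where "a < c" "\<And>x. x \<notin> {c..d} \<Longrightarrow> \<phi> x = 0" using t by (auto simp: test_fun_iff)
    then have "\<phi> a = 0" by auto
    have "(deriv \<phi> has_integral (\<phi> x - \<phi> a)) {a..x}"
      using x by (intro fundamental_theorem_of_calculus)
        (auto simp: has_real_derivative_iff_has_vector_derivative[symmetric] intro: has_field_derivative_at_within test_fun_DERIV[OF t])
    then have "\<phi> x = integral {a..x} (deriv \<phi>)" using \<open>\<phi> a = 0\<close> by (simp add: integral_unique)
    also have "\<dots> = (LINT y:{a..x}|lebesgue. deriv \<phi> y)"
      by (intro set_lebesgue_integral_eq_integral(2)[symmetric] absolutely_integrable_continuous_real c1)
    finally have "\<bar>\<phi> x\<bar> \<le> (LINT y:{a..x}|lebesgue. \<bar>deriv \<phi> y\<bar>)"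
      unfolding set_lebesgue_integral_def
      using integral_norm_bound[of lebesgue "\<lambda>y. indicator {a..x} y *\<^sub>R deriv \<phi> y"] by (simp add: abs_mult)
    also have "\<dots> \<le> (LINT y:{a..b}|lebesgue. \<bar>deriv \<phi> y\<bar>)"
    proof -
      have "set_integrable lebesgue {a..y} (\<lambda>y. \<bar>deriv \<phi> y\<bar>)" for y
        by (intro absolutely_integrable_continuous_real continuous_intros c1)
      then show ?thesis using x unfolding set_lebesgue_integral_def set_integrable_def
        by (intro integral_mono) (auto simp: indicator_def)
    qed
    also have "\<dots> = (LINT y:{a<..<b}|lebesgue. \<bar>deriv \<phi> y\<bar>)"
      by (rule set_integral_Icc_Ioo)
    also have "\<dots> = L2_inner a b (\<lambda>x. \<bar>deriv \<phi> x\<bar>) (\<lambda>x. 1)" by (simp add: L2_inner_def)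
    finally have "(\<phi> x)\<^sup>2 \<le> (L2_inner a b (\<lambda>x. \<bar>deriv \<phi> x\<bar>) (\<lambda>x. 1))\<^sup>2"
      by (metis abs_ge_zero power2_abs power_mono)
    also have "\<dots> \<le> L2_inner a b (\<lambda>x. \<bar>deriv \<phi> x\<bar>) (\<lambda>x. \<bar>deriv \<phi> x\<bar>) * L2_inner a b (\<lambda>x. 1) (\<lambda>x. 1)"
      by (intro L.Cauchy_Schwarz L2)
    finally show ?thesis by (simp add: D one mult.commute)
  qed
  have "L2_inner a b \<phi> \<phi> = (LINT x:{a<..<b}|lebesgue. (\<phi> x)\<^sup>2)" by (simp add: L2_inner_def power2_eq_square)
  also have "\<dots> \<le> (LINT x:{a<..<b}|lebesgue. (b - a) * Dir_inner a b \<phi> \<phi>)"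
  proof (rule set_integral_mono)
    show "set_integrable lebesgue {a<..<b} (\<lambda>x. (\<phi> x)\<^sup>2)" using L2 by (simp add: L2_space_def)
    show "set_integrable lebesgue {a<..<b} (\<lambda>x. (b - a) * Dir_inner a b \<phi> \<phi>)"
      by (rule set_integrable_subset[OF absolutely_integrable_continuous_real[of a b]]) (auto intro: continuous_intros)
  qed (use pt in auto)
  also have "\<dots> = (b - a) * ((b - a) * Dir_inner a b \<phi> \<phi>)"
    using ab by (simp add: set_lebesgue_integral_def)
  finally show ?thesis by (simp add: power2_eq_square mult.assoc)
qed

lemma Poincare:
  assumes ab: "a < b" and v: "v \<in> H01_space a b"
  shows "L2_inner a b v v \<le> (b - a)\<^sup>2 * Dir_inner a b v v"
proof -
  interpret L: semi_ip "L2_space a b" "L2_inner a b" by (rule semi_ip_L2)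
  interpret D: semi_ip "H1_space a b" "Dir_inner a b" by (rule semi_ip_Dir)
  have v1: "v \<in> H1_space a b" using v by (rule H01_H1)
  have "L.nrm v \<le> (b - a) * D.nrm v + \<epsilon>" if e: "\<epsilon> > 0" for \<epsilon>
  proof -
    \<comment> \<open>Replacing v by a test function costs one error in the L2 norm and b - a times
      that error in the Dirichlet seminorm; this choice makes them add up to \<epsilon>.\<close>
    let ?e = "\<epsilon> / (1 + (b - a))"
    have "0 < ?e" using e ab by simp
    then obtain \<phi> where p: "test_fun a b \<phi>" "H1_norm a b (\<lambda>x. v x - \<phi> x) < ?e"
      using v unfolding H01_space_def by blast
    have p1: "\<phi> \<in> H1_space a b" by (rule test_fun_H1[OF ab p(1)])
    let ?w = "\<lambda>x. v x - \<phi> x"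
    have w: "?w \<in> H1_space a b" by (rule D.diff[OF v1 p1])
    have b1: "L.nrm ?w \<le> H1_norm a b ?w" "D.nrm ?w \<le> H1_norm a b ?w"
      using D.nonneg[OF w] L.nonneg[OF H1D(1)[OF w]] by (auto simp: L.nrm_def D.nrm_def H1_norm_def H1_inner_eq)
    have "L.nrm v = L.nrm (\<lambda>x. \<phi> x + ?w x)" by simp
    also have "\<dots> \<le> L.nrm \<phi> + L.nrm ?w" by (intro L.nrm_triangle H1D(1) p1 w)
    also have "L.nrm \<phi> \<le> (b - a) * D.nrm \<phi>"
      using real_sqrt_le_mono[OF Poincare_test_fun[OF ab p(1)]] ab
      by (simp add: L.nrm_def D.nrm_def real_sqrt_mult)
    also have "D.nrm \<phi> = D.nrm (\<lambda>x. v x + (-1) * ?w x)" by simp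
    also have "\<dots> \<le> D.nrm v + D.nrm (\<lambda>x. (-1) * ?w x)" by (intro D.nrm_triangle D.scale v1 w)
    also have "D.nrm (\<lambda>x. (-1) * ?w x) = D.nrm ?w" using D.nrm_scale[OF w, of "-1"] by simp
    finally have "L.nrm v \<le> (b - a) * (D.nrm v + D.nrm ?w) + L.nrm ?w" using ab by simp
    also have "\<dots> \<le> (b - a) * (D.nrm v + ?e) + ?e"
      using b1 p(2) ab by (intro add_mono mult_left_mono) auto
    also have "\<dots> = (b - a) * D.nrm v + (1 + (b - a)) * ?e" by (simp add: algebra_simps add_divide_distrib diff_divide_distrib)
    also have "(1 + (b - a)) * ?e = \<epsilon>" using ab by simp
    finally show ?thesis .
  qed
  then have "L.nrm v \<le> (b - a) * D.nrm v" by (rule field_le_epsilon)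
  then have "(L.nrm v)\<^sup>2 \<le> ((b - a) * D.nrm v)\<^sup>2" by (intro power_mono L.nrm_nonneg H1D(1) v1)
  then show ?thesis using v1 by (simp add: L.nrm_square D.nrm_square H1D power_mult_distrib)
qed

lemma H1_inner_le_Dir:
  assumes "a < b" "v \<in> H01_space a b"
  shows "H1_inner a b v v \<le> (1 + (b - a)\<^sup>2) * Dir_inner a b v v"
  using Poincare[OF assms] by (simp add: H1_inner_eq algebra_simps)

subsection \<open>The finite element space\<close>

text \<open>Gaussian elimination. It serves twice: for the dimension bound of the finite element
  space and for the solvability of square systems.\<close>

lemma underdetermined_nontrivial_solution:
  fixes A :: "nat \<Rightarrow> 'j \<Rightarrow> real"
  assumes "finite J" "m < card J"
  shows "\<exists>x. (\<exists>j\<in>J. x j \<noteq> 0) \<and> (\<forall>i<m. (\<Sum>j\<in>J. A i j * x j) = 0)"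
  using assms
proof (induction m arbitrary: J A)
  case 0
  then have "J \<noteq> {}" by auto
  then show ?case by (intro exI[of _ "\<lambda>_. 1"]) auto
next
  case (Suc m)
  show ?case
  proof (cases "\<forall>j\<in>J. A m j = 0")
    case True
    obtain x where "\<exists>j\<in>J. x j \<noteq> 0" "\<forall>i<m. (\<Sum>j\<in>J. A i j * x j) = 0"
      using Suc.IH[of J A] Suc.prems by auto
    moreover have "(\<Sum>j\<in>J. A m j * x j) = 0" using True by simp
    ultimately show ?thesis by (auto simp: less_Suc_eq)
  next
    case False
    then obtain p where p: "p \<in> J" "A m p \<noteq> 0" by auto
    \<comment> \<open>Equation m is solved for the unknown p and substituted into the others, which
      leaves one equation and one unknown fewer.\<close>
    have "m < card (J - {p})" using Suc.prems p by simp
    then obtain x where x: "\<exists>j\<in>J-{p}. x j \<noteq> 0"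
      "\<forall>i<m. (\<Sum>j\<in>J-{p}. (A i j - A i p * A m j / A m p) * x j) = 0"
      using Suc.IH[of "J - {p}" "\<lambda>i j. A i j - A i p * A m j / A m p"] Suc.prems by auto
    define s where "s = (\<Sum>j\<in>J-{p}. A m j * x j)"
    define y where "y = x(p := - s / A m p)"
    have split: "(\<Sum>j\<in>J. A i j * y j) = A i p * (- s / A m p) + (\<Sum>j\<in>J-{p}. A i j * x j)" for i
      using p Suc.prems by (subst sum.remove[of _ p]) (auto simp: y_def intro: sum.cong)
    have "(\<Sum>j\<in>J. A i j * y j) = 0" if "i < Suc m" for i
    proof (cases "i = m")
      case True then show ?thesis using p by (simp add: split s_def)
    next
      case False
      then have "0 = (\<Sum>j\<in>J-{p}. (A i j - A i p * A m j / A m p) * x j)" using x that by simp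
      also have "\<dots> = (\<Sum>j\<in>J-{p}. A i j * x j) - A i p / A m p * s"
        by (simp add: s_def sum_distrib_left sum_subtractf algebra_simps)
      finally show ?thesis by (simp add: split)
    qed
    moreover have "\<exists>j\<in>J. y j \<noteq> 0" using x(1) by (auto simp: y_def)
    ultimately show ?thesis by blast
  qed
qed

text \<open>The right-hand side becomes the column of an additional unknown \<open>None\<close>. The
  homogeneous system then has more unknowns than equations; by injectivity a nontrivial solution has
  a nonzero \<open>None\<close> component, and dividing by it solves the original system.\<close>

lemma square_system_solvable:
  fixes A :: "'i \<Rightarrow> 'i \<Rightarrow> real"
  assumes fin: "finite I"
    and inj: "\<And>x. (\<And>i. i \<in> I \<Longrightarrow> (\<Sum>j\<in>I. A i j * x j) = 0) \<Longrightarrow> (\<forall>j\<in>I. x j = 0)"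
  shows "\<exists>x. \<forall>i\<in>I. (\<Sum>j\<in>I. A i j * x j) = b i"
proof -
  obtain f where f: "bij_betw f {..<card I} I" using fin ex_bij_betw_nat_finite[of I] by (auto simp: atLeast0LessThan)
  define B where "B i j = (case j of Some j' \<Rightarrow> A (f i) j' | None \<Rightarrow> - b (f i))" for i j
  have card: "card (insert None (Some ` I)) = Suc (card I)"
    using fin by (subst card_insert_disjoint) (auto simp: card_image)
  then obtain x where x: "\<exists>j\<in>insert None (Some ` I). x j \<noteq> 0"
    "\<forall>i<card I. (\<Sum>j\<in>insert None (Some ` I). B i j * x j) = 0"
    using underdetermined_nontrivial_solution[of "insert None (Some ` I)" "card I" B] fin by auto
  have eq: "(\<Sum>j\<in>I. A i j * x (Some j)) = b i * x None" if "i \<in> I" for i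
  proof -
    have "i \<in> f ` {..<card I}" using f that by (simp add: bij_betw_def)
    then obtain r where r: "r < card I" "f r = i" by auto
    have "0 = (\<Sum>j\<in>insert None (Some ` I). B r j * x j)" using x r by simp
    also have "\<dots> = - b i * x None + (\<Sum>j\<in>I. A i j * x (Some j))"
      using fin r by (subst sum.insert) (auto simp: B_def sum.reindex)
    finally show ?thesis by simp
  qed
  have "x None \<noteq> 0"
  proof
    assume 0: "x None = 0"
    then have "\<forall>j\<in>I. x (Some j) = 0" using eq by (intro inj) simp
    then show False using x(1) 0 by auto
  qed
  then have "(\<Sum>j\<in>I. A i j * (x (Some j) / x None)) = b i" if "i \<in> I" for i
    using eq[OF that] by (simp flip: sum_divide_distrib)
  then show ?thesis by (intro exI[of _ "\<lambda>j. x (Some j) / x None"]) auto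
qed

text \<open>The bound D yields an orthonormal family of maximal length. A residual of positive
  seminorm could be normalised and appended to it. The form being semidefinite, the residual is only
  known to have seminorm zero, not to vanish.\<close>

lemma (in semi_ip) orthonormal_basis:
  assumes bound: "\<And>K e. (\<And>k. k < K \<Longrightarrow> e k \<in> V) \<Longrightarrow>
      (\<And>k l. k < K \<Longrightarrow> l < K \<Longrightarrow> ip (e k) (e l) = (if k = l then 1 else 0)) \<Longrightarrow> K \<le> (D::nat)"
  obtains d :: nat and w where "\<And>l. l < d \<Longrightarrow> w l \<in> V"
    "\<And>k l. k < d \<Longrightarrow> l < d \<Longrightarrow> ip (w k) (w l) = (if k = l then 1 else 0)"
    "\<And>v. v \<in> V \<Longrightarrow> nrm (\<lambda>x. v x - (\<Sum>l<d. ip v (w l) * w l x)) = 0"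
proof -
  define Q where "Q K \<longleftrightarrow> (\<exists>e. (\<forall>k<K. e k \<in> V) \<and> (\<forall>k<K. \<forall>l<K. ip (e k) (e l) = (if k = l then 1 else 0)))" for K :: nat
  have "Q 0" by (auto simp: Q_def)
  moreover have Qb: "K \<le> D" if "Q K" for K using that bound unfolding Q_def by blast
  ultimately obtain d where d: "Q d" "\<And>K. Q K \<Longrightarrow> K \<le> d"
    using Nat.ex_has_greatest_nat[of Q 0 D] by auto
  then obtain w where w: "\<And>k. k < d \<Longrightarrow> w k \<in> V"
    "\<And>k l. k < d \<Longrightarrow> l < d \<Longrightarrow> ip (w k) (w l) = (if k = l then 1 else 0)"
    unfolding Q_def by blast
  have z: "nrm (\<lambda>x. v x - (\<Sum>l<d. ip v (w l) * w l x)) = 0" if v: "v \<in> V" for v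
  proof (rule ccontr)
    let ?s = "\<lambda>x. \<Sum>l<d. ip v (w l) * w l x"
    let ?r = "\<lambda>x. v x - ?s x"
    assume n: "nrm ?r \<noteq> 0"
    have s: "?s \<in> V" using w by (intro sum_mem) auto
    have r: "?r \<in> V" by (rule diff[OF v s])
    have orth: "ip ?r (w k) = 0" if k: "k < d" for k
    proof -
      have "ip ?s (w k) = (\<Sum>l<d. ip v (w l) * ip (w l) (w k))" using w k by (simp add: ip_sum)
      also have "\<dots> = (\<Sum>l<d. if l = k then ip v (w l) else 0)" using w(2) k by (intro sum.cong) auto
      finally show ?thesis using k w v s by (simp add: ip_diff)
    qed
    define u where "u = (\<lambda>x. (1 / nrm ?r) * ?r x)"
    have u: "u \<in> V" unfolding u_def by (rule scale[OF r])
    have "ip u u = (1 / nrm ?r)\<^sup>2 * ip ?r ?r"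
      unfolding u_def using ip_square_lincomb[OF r r, of "1 / nrm ?r" 0] by simp
    also have "\<dots> = 1" using n by (simp add: nrm_square[OF r, symmetric] power_divide)
    finally have uu: "ip u u = 1" .
    have uw: "ip u (w k) = 0" "ip (w k) u = 0" if "k < d" for k
      using orth[OF that] ip_scale[OF r w(1)[OF that], of "1 / nrm ?r"] sym[OF u w(1)[OF that]] by (auto simp: u_def)
    have "Q (Suc d)"
      unfolding Q_def
      by (intro exI[of _ "w(d := u)"]) (auto simp: less_Suc_eq w u uu uw)
    then show False using d(2) by fastforce
  qed
  show thesis
  proof (rule that[of d w])
  qed (fact w(1), fact w(2), fact z)
qed

lemma poly_AE_zero:
  fixes p :: "real poly"
  assumes cd: "c < d" and ae: "AE x in lebesgue. x \<in> {c<..<d} \<longrightarrow> poly p x = 0"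
  shows "p = 0"
proof (rule ccontr)
  assume "p \<noteq> 0"
  then have "finite {x. poly p x = 0}" by (rule poly_roots_finite)
  then have "{x. poly p x = 0} \<in> null_sets lebesgue"
    using finite_imp_null_set_lborel null_sets_completionI by blast
  then have "AE x in lebesgue. x \<notin> {x. poly p x = 0}" by (rule AE_not_in)
  with ae have "AE x in lebesgue. x \<notin> {c<..<d}" by eventually_elim auto
  then have "{c<..<d} \<in> null_sets lebesgue" by (subst AE_iff_null_sets) auto
  then have "emeasure lebesgue {c<..<d} = 0" by (rule null_setsD1)
  then show False using cd by simp
qed

section \<open>Piecewise polynomials on a mesh\<close>

locale mesh =
  fixes a b :: real and N :: nat and xs :: "nat \<Rightarrow> real" and n :: nat
  assumes ab: "a < b" and part: "is_partition a b N xs"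
begin

text \<open>Values at the nodes are arbitrary, so identities between piecewise polynomials are
  stated on the union of the open cells, whose complement in (a, b) is a null set.\<close>

definition P where "P = (\<Union>i<N. {xs i<..<xs (Suc i)})"

lemma xs_mono: "i \<le> j \<Longrightarrow> j \<le> N \<Longrightarrow> xs i \<le> xs j"
proof (induction j rule: dec_induct)
  case (step j)
  then have "xs j < xs (Suc j)" using part by (auto simp: is_partition_def)
  then show ?case using step by auto
qed auto

lemma piece_subset: assumes "i < N" shows "a \<le> xs i" "xs i < xs (Suc i)" "xs (Suc i) \<le> b"
  using xs_mono[of 0 i] xs_mono[of "Suc i" N] part assms by (auto simp: is_partition_def)

lemma P_subset: "P \<subseteq> {a<..<b}"
  using piece_subset unfolding P_def by fastforce

lemma AE_P: "AE x in lebesgue. x \<in> {a<..<b} \<longrightarrow> x \<in> P"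
proof -
  have fin: "xs ` {..N} \<in> null_sets lebesgue"
    using finite_imp_null_set_lborel[of "xs ` {..N}"] null_sets_completionI by blast
  have "x \<in> P" if x: "x \<in> {a<..<b}" "x \<notin> xs ` {..N}" for x
  proof -
    define j where "j = (LEAST j. x < xs j)"
    have N: "x < xs N" using x part by (simp add: is_partition_def)
    then have j: "x < xs j" "j \<le> N" unfolding j_def by (auto intro: LeastI Least_le)
    have "j \<noteq> 0" using x part j(1) by (auto simp: is_partition_def)
    then obtain i where i: "j = Suc i" by (cases j) auto
    have "\<not> x < xs i" using not_less_Least[of i "\<lambda>j. x < xs j"] i by (auto simp: j_def)
    moreover have "x \<noteq> xs i" using x(2) i j by auto
    ultimately show ?thesis using i j unfolding P_def by (auto intro!: bexI[of _ i])
  qed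
  then show ?thesis using AE_not_in[OF fin] by (auto elim!: eventually_mono)
qed

lemma AE_P_imp: "(\<And>x. x \<in> P \<Longrightarrow> Q x) \<Longrightarrow> AE x in lebesgue. x \<in> {a<..<b} \<longrightarrow> Q x"
  using AE_P by (auto elim!: eventually_mono)

lemma Sh_poly:
  assumes "v \<in> Sh a b N xs n" "i < N"
  obtains p where "degree p \<le> n" "\<And>x. x \<in> {xs i<..<xs (Suc i)} \<Longrightarrow> v x = poly p x"
  using assms unfolding Sh_def by blast

lemma Sh_H01: "v \<in> Sh a b N xs n \<Longrightarrow> v \<in> H01_space a b" by (simp add: Sh_def)

lemma Sh_H1: "v \<in> Sh a b N xs n \<Longrightarrow> v \<in> H1_space a b" by (simp add: Sh_def H01_H1)

lemma Sh_L2: "v \<in> Sh a b N xs n \<Longrightarrow> v \<in> L2_space a b" by (intro H1D(1) Sh_H1)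

lemma Sh_DERIV:
  assumes v: "v \<in> Sh a b N xs n" and x: "x \<in> P"
  shows "(v has_real_derivative deriv v x) (at x)"
proof -
  obtain i where i: "i < N" "x \<in> {xs i<..<xs (Suc i)}" using x by (auto simp: P_def)
  obtain p where p: "\<And>x. x \<in> {xs i<..<xs (Suc i)} \<Longrightarrow> v x = poly p x" using Sh_poly[OF v i(1)] by metis
  have "(v has_real_derivative poly (pderiv p) x) (at x)"
    by (rule has_field_derivative_transform_within_open[OF poly_DERIV _ i(2)]) (auto simp: p)
  then show ?thesis by (simp add: DERIV_imp_deriv)
qed

text \<open>Membership in H1 already provides a weak derivative on all of (a, b). Restricted to one
  cell it must agree with the classical derivative there, by uniqueness, so the behaviour across
  nodes need not be examined.\<close>

lemma Sh_distr_deriv: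
  assumes v: "v \<in> Sh a b N xs n"
  shows "AE x in lebesgue. x \<in> {a<..<b} \<longrightarrow> distr_deriv a b v x = deriv v x"
proof -
  have piece: "AE x in lebesgue. x \<in> {xs i<..<xs (Suc i)} \<longrightarrow> distr_deriv a b v x = deriv v x" if i: "i < N" for i
  proof -
    obtain p where p: "\<And>x. x \<in> {xs i<..<xs (Suc i)} \<Longrightarrow> v x = poly p x" using Sh_poly[OF v i] by metis
    have D: "(v has_real_derivative poly (pderiv p) x) (at x)" if "x \<in> {xs i<..<xs (Suc i)}" for x
      by (rule has_field_derivative_transform_within_open[OF poly_DERIV _ that]) (auto simp: p)
    have "is_distr_deriv (xs i) (xs (Suc i)) v (poly (pderiv p))"
      by (rule is_distr_deriv_classical) (use D piece_subset[OF i] in \<open>auto intro: continuous_intros\<close>)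
    moreover have "is_distr_deriv (xs i) (xs (Suc i)) v (distr_deriv a b v)"
      by (rule is_distr_deriv_restrict[OF H1D(3)[OF Sh_H1[OF v]]]) (use piece_subset[OF i] in auto)
    ultimately have "AE x in lebesgue. x \<in> {xs i<..<xs (Suc i)} \<longrightarrow> distr_deriv a b v x = poly (pderiv p) x"
      by (blast intro: is_distr_deriv_unique)
    then show ?thesis by eventually_elim (use D in \<open>auto intro: DERIV_imp_deriv[symmetric]\<close>)
  qed
  have "AE x in lebesgue. \<forall>i\<in>{..<N}. x \<in> {xs i<..<xs (Suc i)} \<longrightarrow> distr_deriv a b v x = deriv v x"
    by (rule AE_finite_allI) (use piece in auto)
  with AE_P show ?thesis by eventually_elim (auto simp: P_def)
qed

lemma Sh_zero: "(\<lambda>x. 0) \<in> Sh a b N xs n"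
  using H01_zero[OF ab] by (auto simp: Sh_def intro!: exI[of _ 0])

lemma Sh_lincomb:
  assumes u: "u \<in> Sh a b N xs n" and v: "v \<in> Sh a b N xs n"
  shows "(\<lambda>x. r * u x + s * v x) \<in> Sh a b N xs n"
  unfolding Sh_def
proof (intro CollectI conjI allI impI)
  show "(\<lambda>x. r * u x + s * v x) \<in> H01_space a b" by (intro H01_lincomb ab Sh_H01 u v)
  fix i assume i: "i < N"
  obtain p where p: "degree p \<le> n" "\<And>x. x \<in> {xs i<..<xs (Suc i)} \<Longrightarrow> u x = poly p x" using Sh_poly[OF u i] by metis
  obtain q where q: "degree q \<le> n" "\<And>x. x \<in> {xs i<..<xs (Suc i)} \<Longrightarrow> v x = poly q x" using Sh_poly[OF v i] by metis
  have "degree (smult r p + smult s q) \<le> n"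
    using p q degree_smult_le[of r p] degree_smult_le[of s q] by (intro degree_add_le) linarith+
  then show "\<exists>p. degree p \<le> n \<and> (\<forall>x\<in>{xs i<..<xs (Suc i)}. r * u x + s * v x = poly p x)"
    using p q by (intro exI[of _ "smult r p + smult s q"]) auto
qed

lemma semi_ip_Sh: "semi_ip (Sh a b N xs n) (Dir_inner a b)"
  by (rule semi_ip.semi_ip_subset[OF semi_ip_Dir]) (auto intro: Sh_H1 Sh_zero Sh_lincomb)

lemma Dir_inner_Sh:
  assumes "u \<in> Sh a b N xs n" "v \<in> Sh a b N xs n"
  shows "Dir_inner a b u v = (LINT x:{a<..<b}|lebesgue. deriv u x * deriv v x)"
  unfolding Dir_inner_def L2_inner_def
  using Sh_distr_deriv[OF assms(1)] Sh_distr_deriv[OF assms(2)]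
  by (intro set_integral_cong_AE') (auto elim: AE_mp)

lemma Sh_deriv_L2: assumes "u \<in> Sh a b N xs n" shows "deriv u \<in> L2_space a b"
  by (rule L2_space_cong[OF H1D(2)[OF Sh_H1[OF assms]] Sh_distr_deriv[OF assms]])

lemma Sh_zero_AE:
  assumes v: "v \<in> Sh a b N xs n" and ae: "AE x in lebesgue. x \<in> {a<..<b} \<longrightarrow> v x = 0" and x: "x \<in> P"
  shows "v x = 0"
proof -
  obtain i where i: "i < N" "x \<in> {xs i<..<xs (Suc i)}" using x by (auto simp: P_def)
  obtain p where p: "\<And>x. x \<in> {xs i<..<xs (Suc i)} \<Longrightarrow> v x = poly p x" using Sh_poly[OF v i(1)] by metis
  have "AE x in lebesgue. x \<in> {xs i<..<xs (Suc i)} \<longrightarrow> poly p x = 0"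
    using ae by (rule AE_mp) (use piece_subset[OF i(1)] p in \<open>auto intro!: AE_I2\<close>)
  then have "p = 0" by (rule poly_AE_zero[rotated]) (use piece_subset[OF i(1)] in auto)
  then show ?thesis using p i by simp
qed

lemma L2_inner_zero_AE:
  assumes v: "v \<in> L2_space a b" and z: "L2_inner a b v v = 0"
  shows "AE x in lebesgue. x \<in> {a<..<b} \<longrightarrow> v x = 0"
proof -
  have "integrable lebesgue (\<lambda>x. indicator {a<..<b} x *\<^sub>R (v x * v x))"
    using L2_mult[OF v v] by (simp add: set_integrable_def)
  then have "(LINT x|lebesgue. indicator {a<..<b} x *\<^sub>R (v x * v x)) = 0 \<longleftrightarrow>
      (AE x in lebesgue. indicator {a<..<b} x *\<^sub>R (v x * v x) = 0)"
    by (intro integral_nonneg_eq_0_iff_AE) (auto intro!: AE_I2)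
  then have "AE x in lebesgue. indicator {a<..<b} x *\<^sub>R (v x * v x) = 0"
    using z by (simp add: L2_inner_def set_lebesgue_integral_def)
  then show ?thesis by eventually_elim (auto simp: indicator_def split: if_splits)
qed

text \<open>By the Poincare inequality v vanishes almost everywhere, hence so does the polynomial on
  each cell. The Dirichlet form is thus definite on the finite element space up to nodal
  values.\<close>

lemma Sh_Dir_zero:
  assumes v: "v \<in> Sh a b N xs n" and z: "Dir_inner a b v v = 0" and x: "x \<in> P"
  shows "v x = 0"
proof (rule Sh_zero_AE[OF v _ x], rule L2_inner_zero_AE)
  show v2: "v \<in> L2_space a b" by (rule Sh_L2[OF v])
  show "L2_inner a b v v = 0"
    using Poincare[OF ab Sh_H01[OF v]] z semi_ip.nonneg[OF semi_ip_L2 v2] by simp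
qed

lemma Dir_inner_zero_P:
  assumes v: "v \<in> H1_space a b" and z: "\<And>x. x \<in> P \<Longrightarrow> v x = 0"
  shows "Dir_inner a b v v = 0"
proof -
  have "is_distr_deriv a b (\<lambda>x. 0) (\<lambda>x. 0)"
    by (auto simp: is_distr_deriv_def loc_integrable_def set_integrable_def set_lebesgue_integral_def)
  then have "is_distr_deriv a b v (\<lambda>x. 0)"
    by (rule is_distr_deriv_cong[OF _ AE_P_imp]) (simp_all add: z)
  then have "AE x in lebesgue. x \<in> {a<..<b} \<longrightarrow> distr_deriv a b v x = 0" by (rule distr_deriv_eq)
  then have "L2_inner a b (distr_deriv a b v) (distr_deriv a b v) = L2_inner a b (\<lambda>x. 0) (\<lambda>x. 0)"
    by (intro L2_inner_cong)
  then show ?thesis by (simp add: Dir_inner_def L2_inner_def set_lebesgue_integral_def)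
qed

text \<open>A piecewise polynomial is fixed on the cells by N (n + 1) coefficients. More functions
  than that admit a nontrivial combination vanishing on all cells, but its Dirichlet square is the
  sum of the squared weights.\<close>

lemma orthonormal_bound:
  assumes e: "\<And>k. k < K \<Longrightarrow> e k \<in> Sh a b N xs n"
    and o: "\<And>k l. k < K \<Longrightarrow> l < K \<Longrightarrow> Dir_inner a b (e k) (e l) = (if k = l then 1 else 0)"
  shows "K \<le> N * Suc n"
proof (rule ccontr)
  interpret S: semi_ip "Sh a b N xs n" "Dir_inner a b" by (rule semi_ip_Sh)
  assume "\<not> K \<le> N * Suc n"
  have "\<exists>p. degree p \<le> n \<and> (\<forall>x\<in>{xs i<..<xs (Suc i)}. e k x = poly p x)" if "k < K" "i < N" for k i
    using Sh_poly[OF e[OF that(1)] that(2)] by metis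
  then obtain p where p: "\<And>k i. k < K \<Longrightarrow> i < N \<Longrightarrow> degree (p k i) \<le> n"
    "\<And>k i x. k < K \<Longrightarrow> i < N \<Longrightarrow> x \<in> {xs i<..<xs (Suc i)} \<Longrightarrow> e k x = poly (p k i) x"
    by metis
  obtain c where c: "\<exists>j\<in>{..<K}. c j \<noteq> 0"
    "\<forall>r<N * Suc n. (\<Sum>k<K. coeff (p k (r div Suc n)) (r mod Suc n) * c k) = 0"
    using underdetermined_nontrivial_solution[of "{..<K}" "N * Suc n" "\<lambda>r k. coeff (p k (r div Suc n)) (r mod Suc n)"]
      \<open>\<not> K \<le> N * Suc n\<close> by auto
  have co: "(\<Sum>k<K. c k * coeff (p k i) q) = 0" if "i < N" "q \<le> n" for i q
  proof -
    \<comment> \<open>Equation number i (n + 1) + q of the linear system expresses that coefficient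
      q on cell i vanishes.\<close>
    have "i * Suc n + q < N * Suc n"
    proof -
      have "i * Suc n + q < i * Suc n + Suc n" using that by simp
      also have "\<dots> = Suc i * Suc n" by simp
      also have "\<dots> \<le> N * Suc n" using that by (intro mult_le_mono1) auto
      finally show ?thesis .
    qed
    moreover have "(i * Suc n + q) div Suc n = i" "(i * Suc n + q) mod Suc n = q"
      using that by (simp_all del: mult_Suc_right)
    ultimately show ?thesis using c(2) by (metis (no_types, lifting) mult.commute sum.cong)
  qed
  let ?v = "\<lambda>x. \<Sum>k<K. c k * e k x"
  have v: "?v \<in> Sh a b N xs n" using e by (intro S.sum_mem)
  have "?v x = 0" if xP: "x \<in> P" for x
  proof -
    obtain i where i: "i < N" "x \<in> {xs i<..<xs (Suc i)}" using xP by (auto simp: P_def)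
    have "?v x = poly (\<Sum>k<K. smult (c k) (p k i)) x"
      using p i by (simp add: poly_sum)
    also have "(\<Sum>k<K. smult (c k) (p k i)) = 0"
    proof (rule poly_eqI)
      fix q show "coeff (\<Sum>k<K. smult (c k) (p k i)) q = coeff 0 q"
      proof (cases "q \<le> n")
        case True then show ?thesis using co i by (simp add: coeff_sum)
      next
        case False
        then have "coeff (p k i) q = 0" if "k < K" for k
          using p(1)[OF that i(1)] by (intro coeff_eq_0) simp
        then show ?thesis by (simp add: coeff_sum)
      qed
    qed
    finally show ?thesis by simp
  qed
  then have z: "Dir_inner a b ?v ?v = 0" by (intro Dir_inner_zero_P Sh_H1 v)
  have "Dir_inner a b (e l) ?v = c l" if "l < K" for l
  proof -
    have "Dir_inner a b (e l) ?v = (\<Sum>k<K. c k * Dir_inner a b (e l) (e k))" using e that by (simp add: S.ip_sum_right)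
    also have "\<dots> = (\<Sum>k<K. if k = l then c k else 0)" using o that by (intro sum.cong) auto
    finally show ?thesis using that by simp
  qed
  then have "Dir_inner a b ?v ?v = (\<Sum>k<K. (c k)\<^sup>2)" using e v by (simp add: S.ip_sum power2_eq_square)
  then have "\<forall>k<K. c k = 0" using z by (simp add: sum_nonneg_eq_0_iff)
  then show False using c(1) by auto
qed

text \<open>The residual of the Dirichlet expansion has seminorm zero, and definiteness turns this
  into equality at every point of the cells.\<close>

lemma basis:
  obtains d :: nat and w where "\<And>l. l < d \<Longrightarrow> w l \<in> Sh a b N xs n"
    "\<And>k l. k < d \<Longrightarrow> l < d \<Longrightarrow> Dir_inner a b (w k) (w l) = (if k = l then 1 else 0)"
    "\<And>v x. v \<in> Sh a b N xs n \<Longrightarrow> x \<in> P \<Longrightarrow> v x = (\<Sum>l<d. Dir_inner a b v (w l) * w l x)"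
proof -
  interpret S: semi_ip "Sh a b N xs n" "Dir_inner a b" by (rule semi_ip_Sh)
  obtain d :: nat and w where w: "\<And>l. l < d \<Longrightarrow> w l \<in> Sh a b N xs n"
    "\<And>k l. k < d \<Longrightarrow> l < d \<Longrightarrow> Dir_inner a b (w k) (w l) = (if k = l then 1 else 0)"
    "\<And>v. v \<in> Sh a b N xs n \<Longrightarrow> S.nrm (\<lambda>x. v x - (\<Sum>l<d. Dir_inner a b v (w l) * w l x)) = 0"
    by (rule S.orthonormal_basis[OF orthonormal_bound]) blast+
  have z: "v x = (\<Sum>l<d. Dir_inner a b v (w l) * w l x)" if v: "v \<in> Sh a b N xs n" and x: "x \<in> P" for v x
  proof -
    let ?r = "\<lambda>x. v x - (\<Sum>l<d. Dir_inner a b v (w l) * w l x)"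
    have r: "?r \<in> Sh a b N xs n" using w v S.sum_mem[of d w "\<lambda>l. Dir_inner a b v (w l)"] by (intro S.diff) auto
    have "Dir_inner a b ?r ?r = 0" using w(3)[OF v] S.nrm_square[OF r] by simp
    then show ?thesis using Sh_Dir_zero[OF r _ x] by simp
  qed
  show thesis
  proof (rule that[of d w])
  qed (fact w(1), fact w(2), fact z)
qed

end

subsection \<open>The energy of a fractional derivative\<close>

lemma integrable_lborel_pair_mult:
  fixes f g :: "real \<Rightarrow> real"
  assumes f: "integrable lborel f" and g: "integrable lborel g"
  shows "integrable (lborel \<Otimes>\<^sub>M lborel) (\<lambda>(x, y). f x * g y)"
proof (rule integrableI_bounded)
  have [measurable]: "f \<in> borel_measurable borel" "g \<in> borel_measurable borel" using f g by auto
  show "(\<lambda>(x, y). f x * g y) \<in> borel_measurable (lborel \<Otimes>\<^sub>M lborel)" by measurable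
  have "(\<integral>\<^sup>+z. ennreal (norm (case z of (x, y) \<Rightarrow> f x * g y)) \<partial>(lborel \<Otimes>\<^sub>M lborel)) =
      (\<integral>\<^sup>+x. \<integral>\<^sup>+y. ennreal (norm (f x)) * ennreal (norm (g y)) \<partial>lborel \<partial>lborel)"
    by (subst lborel.nn_integral_fst[symmetric]) (auto simp: abs_mult ennreal_mult)
  also have "\<dots> = (\<integral>\<^sup>+x. ennreal (norm (f x)) \<partial>lborel) * (\<integral>\<^sup>+y. ennreal (norm (g y)) \<partial>lborel)"
    by (simp add: nn_integral_cmult nn_integral_multc)
  also have "\<dots> < \<infinity>" using f g by (simp add: integrable_iff_bounded ennreal_mult_less_top)
  finally show "(\<integral>\<^sup>+z. ennreal (norm (case z of (x, y) \<Rightarrow> f x * g y)) \<partial>(lborel \<Otimes>\<^sub>M lborel)) < \<infinity>" .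
qed

lemma integrable_bounded_support:
  fixes v :: "real \<Rightarrow> real"
  assumes [measurable]: "v \<in> borel_measurable borel" and b: "\<And>t. \<bar>v t\<bar> \<le> M"
    and s: "\<And>t. t \<notin> {c..d} \<Longrightarrow> v t = 0"
  shows "integrable lborel v"
proof (rule Bochner_Integration.integrable_bound)
  show "integrable lborel (\<lambda>t. M * indicator {c..d} t)"
    by (intro integrable_mult_right integrable_real_indicator) (auto simp: emeasure_lborel_Icc_eq)
  show "AE t in lborel. norm (v t) \<le> norm (M * indicator {c..d} t)"
    using s order_trans[OF b abs_ge_self[of M]] by (intro AE_I2) (auto simp: indicator_def)
qed auto

lemma eventually_inverse_Suc_le:
  "\<forall>\<^sub>F k in sequentially. (1 / real (Suc k) \<le> h) = (0 < h)"
proof (cases "0 < h")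
  case True
  then obtain K where K: "1 / real (Suc K) < h" using nat_approx_posE by blast
  show ?thesis unfolding eventually_sequentially
  proof (intro exI[of _ K] allI impI)
    fix k assume "K \<le> k"
    then have "1 / real (Suc k) \<le> 1 / real (Suc K)" by (intro divide_left_mono) auto
    then show "(1 / real (Suc k) \<le> h) = (0 < h)" using K True by simp
  qed
next
  case False
  have "\<not> 1 / real (Suc k) \<le> h" for k using False less_le_trans[of 0 "1 / real (Suc k)" h] by auto
  then show ?thesis using False by simp
qed

locale frac_order =
  fixes \<gamma> :: real
  assumes g0: "0 < \<gamma>" and g1: "\<gamma> < 1"
begin

definition qk :: "real \<Rightarrow> real" where "qk h = \<gamma> * h powr (- \<gamma> - 1) / Gamma (1 - \<gamma>)"

lemma Gamma_pos: "0 < Gamma (1 - \<gamma>)" using g1 by (intro Gamma_real_pos) auto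

lemma qk_nonneg: "0 \<le> qk h" using g0 Gamma_pos by (simp add: qk_def)

lemma qk_measurable [measurable]: "qk \<in> borel_measurable borel" unfolding qk_def[abs_def] by measurable

text \<open>The primitive -h^(-\<gamma>)/\<Gamma>(1-\<gamma>) vanishes at infinity. This tail mass
  appears as the coefficient of v(t) in the cut-off derivative and, with c = t, as the weight in
  Hardy's inequality.\<close>

lemma nn_integral_qk:
  assumes c: "0 < c"
  shows "(\<integral>\<^sup>+h. ennreal (qk h * indicator {c..} h) \<partial>lborel) = ennreal (c powr (- \<gamma>) / Gamma (1 - \<gamma>))"
proof -
  have "(\<integral>\<^sup>+h. ennreal (qk h) * indicator {c..} h \<partial>lborel) = 0 - (- (c powr (- \<gamma>)) / Gamma (1 - \<gamma>))"
  proof (rule nn_integral_FTC_atLeast)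
    fix x assume "c \<le> x"
    then show "((\<lambda>h. - (h powr (- \<gamma>)) / Gamma (1 - \<gamma>)) has_real_derivative qk x) (at x)"
      using c Gamma_pos by (auto intro!: derivative_eq_intros simp: qk_def)
  next
    have "((\<lambda>h. h powr (- \<gamma>)) \<longlongrightarrow> 0) at_top" using g0 by (intro tendsto_neg_powr filterlim_ident) auto
    then have "((\<lambda>h. - (h powr (- \<gamma>)) / Gamma (1 - \<gamma>)) \<longlongrightarrow> - 0 / Gamma (1 - \<gamma>)) at_top"
      using Gamma_pos by (intro tendsto_divide tendsto_minus tendsto_const) auto
    then show "((\<lambda>h. - (h powr (- \<gamma>)) / Gamma (1 - \<gamma>)) \<longlongrightarrow> 0) at_top" by simp
  qed (auto simp: qk_nonneg)
  then show ?thesis by (simp add: ennreal_mult' ennreal_indicator qk_nonneg)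
qed

lemma qk_integral:
  assumes "0 < c"
  shows "integrable lborel (\<lambda>h. qk h * indicator {c..} h)"
    "(LINT h|lborel. qk h * indicator {c..} h) = c powr (- \<gamma>) / Gamma (1 - \<gamma>)"
proof -
  have "has_bochner_integral lborel (\<lambda>h. qk h * indicator {c..} h) (c powr (- \<gamma>) / Gamma (1 - \<gamma>))"
    by (rule has_bochner_integral_nn_integral) (use nn_integral_qk[OF assms] Gamma_pos qk_nonneg in auto)
  then show "integrable lborel (\<lambda>h. qk h * indicator {c..} h)"
    "(LINT h|lborel. qk h * indicator {c..} h) = c powr (- \<gamma>) / Gamma (1 - \<gamma>)"
    by (auto simp: has_bochner_integral_iff)
qed

text \<open>
  \<open>Gt \<epsilon> v t\<close> is $\int_\epsilon^\infty q(h)\,(v(t) - v(t-h))\,dh$, the Marchaud derivative with its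
  singular kernel cut off at \<open>\<epsilon>\<close>.
\<close>

definition Gt :: "real \<Rightarrow> (real \<Rightarrow> real) \<Rightarrow> real \<Rightarrow> real" where
  "Gt \<epsilon> v t = \<epsilon> powr (- \<gamma>) / Gamma (1 - \<gamma>) * v t - (LINT h|lborel. qk h * indicator {\<epsilon>..} h * v (t - h))"

text \<open>Only values of v up to time t - \<epsilon> enter. Bounding just these lets the lemma
  apply to truncated powers, which may grow without limit later on.\<close>

lemma integrable_qk_bounded:
  assumes e: "0 < \<epsilon>" and [measurable]: "v \<in> borel_measurable borel" and b: "\<And>s. s \<le> t - \<epsilon> \<Longrightarrow> \<bar>v s\<bar> \<le> M"
  shows "integrable lborel (\<lambda>h. qk h * indicator {\<epsilon>..} h * v (t - h))"
proof (rule Bochner_Integration.integrable_bound)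
  show "integrable lborel (\<lambda>h. M * (qk h * indicator {\<epsilon>..} h))" using qk_integral(1)[OF e] by simp
  have M: "0 \<le> M" using b[of "t - \<epsilon>"] by (meson abs_ge_zero order_trans order_refl)
  show "AE h in lborel. norm (qk h * indicator {\<epsilon>..} h * v (t - h)) \<le> norm (M * (qk h * indicator {\<epsilon>..} h))"
  proof (rule AE_I2)
    fix h
    have "qk h * \<bar>v (t - h)\<bar> \<le> qk h * M" if "\<epsilon> \<le> h" using b[of "t - h"] that qk_nonneg by (intro mult_left_mono) auto
    then show "norm (qk h * indicator {\<epsilon>..} h * v (t - h)) \<le> norm (M * (qk h * indicator {\<epsilon>..} h))"
      using qk_nonneg[of h] M by (auto simp: indicator_def abs_mult mult.commute)
  qed
qed auto

text \<open>Let A be the squared norm of v and C(h) its product with the shift by h. The left side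
  is the integral of q(h) (A - C(h)) over h \<ge> \<epsilon>, and the squared norm of the increment
  is 2A - 2C(h), which explains the factor 1/2.\<close>

lemma energy_identity:
  assumes e: "0 < \<epsilon>" and [measurable]: "v \<in> borel_measurable borel" and b: "\<And>t. \<bar>v t\<bar> \<le> M"
    and s: "\<And>t. t \<notin> {0..R} \<Longrightarrow> v t = 0"
  shows "0 \<le> (LINT t|lborel. Gt \<epsilon> v t * v t)"
    "ennreal (LINT t|lborel. Gt \<epsilon> v t * v t) =
      (\<integral>\<^sup>+h. ennreal (qk h / 2) * indicator {\<epsilon>..} h * (\<integral>\<^sup>+t. ennreal ((v t - v (t - h))\<^sup>2) \<partial>lborel) \<partial>lborel)"
proof -
  have M: "0 \<le> M" using b[of 0] by (meson abs_ge_zero order_trans)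
  have iv: "integrable lborel v" by (rule integrable_bounded_support[OF _ b s]) auto
  have ivv: "integrable lborel (\<lambda>t. v t * v (t - h))" for h
  proof (rule Bochner_Integration.integrable_bound[of _ "\<lambda>t. M * v t"])
    have "\<bar>v t\<bar> * \<bar>v (t - h)\<bar> \<le> \<bar>v t\<bar> * M" for t using b by (intro mult_left_mono) auto
    then show "AE t in lborel. norm (v t * v (t - h)) \<le> norm (M * v t)"
      using M by (intro AE_I2) (simp add: abs_mult mult.commute)
  qed (use iv in auto)
  have ishift: "integrable lborel (\<lambda>t. v (t - h) * v (t - h))" for h
    using lborel_integrable_real_affine[OF ivv[of 0], of 1 "- h"] by simp
  define A where "A = (LINT t|lborel. v t * v t)"
  define C where "C h = (LINT t|lborel. v t * v (t - h))" for h
  have Ash: "(LINT t|lborel. v (t - h) * v (t - h)) = A" for h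
    using lborel_integral_real_affine[of 1 "\<lambda>t. v t * v t" "- h"] by (simp add: A_def)
  have D: "(LINT t|lborel. (v t - v (t - h))\<^sup>2) = 2 * A - 2 * C h"
    and iD: "integrable lborel (\<lambda>t. (v t - v (t - h))\<^sup>2)" for h
  proof -
    have eq: "(\<lambda>t. (v t - v (t - h))\<^sup>2) = (\<lambda>t. v t * v t + v (t - h) * v (t - h) - 2 * (v t * v (t - h)))"
      by (auto simp: power2_eq_square algebra_simps)
    show "integrable lborel (\<lambda>t. (v t - v (t - h))\<^sup>2)"
      unfolding eq using ivv[of 0] ivv[of h] ishift[of h] by simp
    show "(LINT t|lborel. (v t - v (t - h))\<^sup>2) = 2 * A - 2 * C h"
      unfolding eq using ivv[of 0] ivv[of h] ishift[of h] Ash[of h] by (simp add: A_def C_def)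
  qed
  let ?q = "\<lambda>h. qk h * indicator {\<epsilon>..} h"
  have q: "integrable lborel ?q" by (rule qk_integral(1)[OF e])
  \<comment> \<open>This is where the cut-off is used: q is integrable on [\<epsilon>, \<infinity>),
    so the integrand has a product majorant and Fubini applies.\<close>
  have iF: "integrable (lborel \<Otimes>\<^sub>M lborel) (\<lambda>(t, h). ?q h * v (t - h) * v t)"
  proof (rule Bochner_Integration.integrable_bound)
    show "integrable (lborel \<Otimes>\<^sub>M lborel) (\<lambda>(t, h). (M * v t) * ?q h)"
      by (rule integrable_lborel_pair_mult) (use iv q in auto)
    show "AE x in lborel \<Otimes>\<^sub>M lborel. norm (case x of (t, h) \<Rightarrow> ?q h * v (t - h) * v t) \<le> norm (case x of (t, h) \<Rightarrow> (M * v t) * ?q h)"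
    proof (rule AE_I2, clarify)
      fix t h
      have "\<bar>?q h\<bar> * \<bar>v (t - h)\<bar> * \<bar>v t\<bar> \<le> \<bar>?q h\<bar> * M * \<bar>v t\<bar>"
        using b by (intro mult_right_mono mult_left_mono) auto
      then show "norm (?q h * v (t - h) * v t) \<le> norm ((M * v t) * ?q h)"
        using M by (simp add: abs_mult mult_ac)
    qed
  qed measurable
  have fub: "(LINT h|lborel. LINT t|lborel. ?q h * v (t - h) * v t) = (LINT t|lborel. LINT h|lborel. ?q h * v (t - h) * v t)"
    using lborel_pair.Fubini_integral[of "\<lambda>t h. ?q h * v (t - h) * v t"] iF by simp
  have in1: "integrable lborel (\<lambda>t. LINT h|lborel. ?q h * v (t - h) * v t)"
    using lborel_pair.integrable_fst[OF iF] by simp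
  have in2: "integrable lborel (\<lambda>h. LINT t|lborel. ?q h * v (t - h) * v t)"
    using lborel_pair.integrable_snd[OF iF] by simp
  have q1: "(\<lambda>h. LINT t|lborel. ?q h * v (t - h) * v t) = (\<lambda>h. ?q h * C h)"
  proof
    fix h
    have "(\<lambda>t. ?q h * v (t - h) * v t) = (\<lambda>t. ?q h * (v t * v (t - h)))" by (simp add: mult_ac)
    then show "(LINT t|lborel. ?q h * v (t - h) * v t) = ?q h * C h" by (simp add: C_def)
  qed
  have G: "Gt \<epsilon> v t * v t = \<epsilon> powr (- \<gamma>) / Gamma (1 - \<gamma>) * (v t * v t) - (LINT h|lborel. ?q h * v (t - h) * v t)" for t
  proof -
    have "(LINT h|lborel. ?q h * v (t - h)) * v t = (LINT h|lborel. ?q h * v (t - h) * v t)"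
      by (rule integral_mult_left_zero[symmetric])
    then show ?thesis by (simp add: Gt_def left_diff_distrib mult.assoc)
  qed
  have "(LINT t|lborel. Gt \<epsilon> v t * v t) = \<epsilon> powr (- \<gamma>) / Gamma (1 - \<gamma>) * A - (LINT h|lborel. ?q h * C h)"
    unfolding G using in1 ivv[of 0] fub q1 by (simp add: A_def)
  also have "\<dots> = (LINT h|lborel. A * ?q h) - (LINT h|lborel. ?q h * C h)"
    using qk_integral(2)[OF e] q by simp
  also have "\<dots> = (LINT h|lborel. A * ?q h - ?q h * C h)"
    using q in2 q1 by (intro Bochner_Integration.integral_diff[symmetric]) auto
  also have ADC: "(\<lambda>h. A * ?q h - ?q h * C h) = (\<lambda>h. ?q h / 2 * (LINT t|lborel. (v t - v (t - h))\<^sup>2))"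
    by (auto simp: D algebra_simps)
  finally have E: "(LINT t|lborel. Gt \<epsilon> v t * v t) = (LINT h|lborel. ?q h / 2 * (LINT t|lborel. (v t - v (t - h))\<^sup>2))" .
  have nn: "0 \<le> ?q h / 2 * (LINT t|lborel. (v t - v (t - h))\<^sup>2)" for h
    using qk_nonneg by (intro mult_nonneg_nonneg Bochner_Integration.integral_nonneg) (auto simp: indicator_def)
  show "0 \<le> (LINT t|lborel. Gt \<epsilon> v t * v t)" unfolding E by (intro Bochner_Integration.integral_nonneg nn)
  have int: "integrable lborel (\<lambda>h. ?q h / 2 * (LINT t|lborel. (v t - v (t - h))\<^sup>2))"
  proof -
    have "integrable lborel (\<lambda>h. A * ?q h - ?q h * C h)" using q in2 q1 by (intro Bochner_Integration.integrable_diff) auto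
    then show ?thesis unfolding ADC .
  qed
  have "ennreal (LINT t|lborel. Gt \<epsilon> v t * v t) = (\<integral>\<^sup>+h. ennreal (?q h / 2 * (LINT t|lborel. (v t - v (t - h))\<^sup>2)) \<partial>lborel)"
    unfolding E by (rule nn_integral_eq_integral[symmetric]) (use int nn in auto)
  also have "\<dots> = (\<integral>\<^sup>+h. ennreal (qk h / 2) * indicator {\<epsilon>..} h * (\<integral>\<^sup>+t. ennreal ((v t - v (t - h))\<^sup>2) \<partial>lborel) \<partial>lborel)"
  proof (rule nn_integral_cong)
    fix h
    have "(\<integral>\<^sup>+t. ennreal ((v t - v (t - h))\<^sup>2) \<partial>lborel) = ennreal (LINT t|lborel. (v t - v (t - h))\<^sup>2)"
      by (rule nn_integral_eq_integral) (use iD in auto)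
    then show "ennreal (?q h / 2 * (LINT t|lborel. (v t - v (t - h))\<^sup>2)) =
        ennreal (qk h / 2) * indicator {\<epsilon>..} h * (\<integral>\<^sup>+t. ennreal ((v t - v (t - h))\<^sup>2) \<partial>lborel)"
      using qk_nonneg[of h] ennreal_mult[of "qk h / 2" "LINT t|lborel. (v t - v (t - h))\<^sup>2"]
      by (auto simp: indicator_def)
  qed
  finally show "ennreal (LINT t|lborel. Gt \<epsilon> v t * v t) =
      (\<integral>\<^sup>+h. ennreal (qk h / 2) * indicator {\<epsilon>..} h * (\<integral>\<^sup>+t. ennreal ((v t - v (t - h))\<^sup>2) \<partial>lborel) \<partial>lborel)" .
qed

text \<open>What the energy argument requires of v and of a representative g of its fractional
  derivative: the cut-off Marchaud integrals converge to g under one integrable majorant. The notion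
  is stable under linear combinations, so it has to be verified for truncated powers only.\<close>

definition frac_ok :: "real \<Rightarrow> (real \<Rightarrow> real) \<Rightarrow> (real \<Rightarrow> real) \<Rightarrow> bool" where
  "frac_ok T v g \<longleftrightarrow> v \<in> borel_measurable borel \<and> (\<exists>M. \<forall>t<T. \<bar>v t\<bar> \<le> M) \<and> (\<forall>t\<le>0. v t = 0) \<and>
     is_distr_deriv 0 T (frac_int (1 - \<gamma>) v) g \<and> g \<in> borel_measurable borel \<and>
     (\<exists>H. set_integrable lborel {0<..<T} H \<and>
        (\<forall>t\<in>{0<..<T}. (\<forall>\<epsilon>>0. \<bar>Gt \<epsilon> v t\<bar> \<le> H t) \<and> (\<lambda>k. Gt (1 / Suc k) v t) \<longlonglongrightarrow> g t))"

definition energy :: "(real \<Rightarrow> real) \<Rightarrow> ennreal" where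
  "energy v = (\<integral>\<^sup>+h. ennreal (qk h / 2) * indicator {0<..} h * (\<integral>\<^sup>+t. ennreal ((v t - v (t - h))\<^sup>2) \<partial>lborel) \<partial>lborel)"

lemma Gt_measurable:
  assumes [measurable]: "v \<in> borel_measurable borel"
  shows "Gt \<epsilon> v \<in> borel_measurable borel"
  unfolding Gt_def[abs_def] by measurable

lemma frac_ok_integrable:
  assumes ok: "frac_ok T v g"
  shows "set_integrable lborel {0<..<T} g"
proof -
  obtain H where H: "set_integrable lborel {0<..<T} H"
    "\<And>t \<epsilon>. t \<in> {0<..<T} \<Longrightarrow> \<epsilon> > 0 \<Longrightarrow> \<bar>Gt \<epsilon> v t\<bar> \<le> H t" "\<And>t. t \<in> {0<..<T} \<Longrightarrow> (\<lambda>k. Gt (1 / Suc k) v t) \<longlonglongrightarrow> g t"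
    using ok unfolding frac_ok_def by blast
  have [measurable]: "g \<in> borel_measurable borel" using ok by (simp add: frac_ok_def)
  have le: "\<bar>g t\<bar> \<le> H t" if "t \<in> {0<..<T}" for t
    by (rule LIMSEQ_le_const2[OF tendsto_rabs[OF H(3)[OF that]]]) (use H(2)[OF that] in auto)
  show ?thesis unfolding set_integrable_def
  proof (rule Bochner_Integration.integrable_bound)
    show "integrable lborel (\<lambda>t. indicator {0<..<T} t *\<^sub>R H t)" using H(1) by (simp add: set_integrable_def)
    show "AE t in lborel. norm (indicator {0<..<T} t *\<^sub>R g t) \<le> norm (indicator {0<..<T} t *\<^sub>R H t)"
    proof (rule AE_I2)
      fix t show "norm (indicator {0<..<T} t *\<^sub>R g t) \<le> norm (indicator {0<..<T} t *\<^sub>R H t)"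
        using le[of t] by (cases "t \<in> {0<..<T}") auto
    qed
  qed auto
qed

text \<open>The identity for cut-off kernels is applied to v restricted to (0, R), and \<epsilon>
  tends to 0: dominated convergence on the left, monotone convergence on the right. In particular
  the energy is finite.\<close>

lemma frac_ok_energy:
  assumes ok: "frac_ok T v g" and R: "0 < R" "R \<le> T"
  shows "set_integrable lborel {0<..<R} (\<lambda>t. g t * v t)" "0 \<le> (LINT t:{0<..<R}|lborel. g t * v t)"
    "ennreal (LINT t:{0<..<R}|lborel. g t * v t) = energy (\<lambda>t. v t * indicator {0<..<R} t)"
proof -
  define vR where "vR t = v t * indicator {0<..<R} t" for t
  have [measurable]: "v \<in> borel_measurable borel" "g \<in> borel_measurable borel" using ok by (auto simp: frac_ok_def)
  have [measurable]: "vR \<in> borel_measurable borel" unfolding vR_def[abs_def] by measurable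
  obtain M where M: "\<And>t. t < T \<Longrightarrow> \<bar>v t\<bar> \<le> M" using ok unfolding frac_ok_def by blast
  have v0: "\<And>t. t \<le> 0 \<Longrightarrow> v t = 0" using ok by (simp add: frac_ok_def)
  have M0: "0 \<le> M" using M[of 0] R by (auto simp: v0)
  have bR: "\<bar>vR t\<bar> \<le> M" for t using M[of t] R M0 by (auto simp: vR_def indicator_def)
  obtain H where H: "set_integrable lborel {0<..<T} H"
    "\<And>t \<epsilon>. t \<in> {0<..<T} \<Longrightarrow> \<epsilon> > 0 \<Longrightarrow> \<bar>Gt \<epsilon> v t\<bar> \<le> H t" "\<And>t. t \<in> {0<..<T} \<Longrightarrow> (\<lambda>k. Gt (1 / Suc k) v t) \<longlonglongrightarrow> g t"
    using ok unfolding frac_ok_def by blast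
  \<comment> \<open>Causality: at t < R only values at times up to t enter, and v vanishes before 0,
    so restricting v to (0, R) changes nothing.\<close>
  have GR: "Gt \<epsilon> vR t = Gt \<epsilon> v t" if "t \<in> {0<..<R}" "\<epsilon> > 0" for t \<epsilon>
  proof -
    have "qk h * indicator {\<epsilon>..} h * vR (t - h) = qk h * indicator {\<epsilon>..} h * v (t - h)" for h
      using that v0[of "t - h"] by (auto simp: vR_def indicator_def)
    then have "(\<lambda>h. qk h * indicator {\<epsilon>..} h * vR (t - h)) = (\<lambda>h. qk h * indicator {\<epsilon>..} h * v (t - h))" by (rule ext)
    moreover have "vR t = v t" using that by (simp add: vR_def)
    ultimately show ?thesis by (simp only: Gt_def)
  qed
  have prod: "Gt \<epsilon> vR t * vR t = indicator {0<..<R} t * (Gt \<epsilon> v t * v t)" if "\<epsilon> > 0" for t \<epsilon>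
    using GR[of t \<epsilon>] that by (auto simp: vR_def indicator_def)
  have dom: "integrable lborel (\<lambda>t. M * norm (indicator {0<..<T} t *\<^sub>R H t))"
    using H(1) unfolding set_integrable_def by (intro integrable_mult_right integrable_norm)
  have m1: "(\<lambda>t. Gt (1 / Suc k) vR t * vR t) \<in> borel_measurable lborel" for k
    using Gt_measurable[of vR] by simp
  have m2: "(\<lambda>t. indicator {0<..<R} t * (g t * v t)) \<in> borel_measurable lborel" by measurable
  have c1: "AE t in lborel. (\<lambda>k. Gt (1 / Suc k) vR t * vR t) \<longlonglongrightarrow> indicator {0<..<R} t * (g t * v t)"
    proof (rule AE_I2)
      fix t
      show "(\<lambda>k. Gt (1 / Suc k) vR t * vR t) \<longlonglongrightarrow> indicator {0<..<R} t * (g t * v t)"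
      proof (cases "t \<in> {0<..<R}")
        case True
        then have "(\<lambda>k. Gt (1 / Suc k) v t * v t) \<longlonglongrightarrow> g t * v t"
          using R by (intro tendsto_mult tendsto_const H(3)) auto
        then show ?thesis using True by (simp add: prod)
      next
        case False then show ?thesis by (simp add: vR_def)
      qed
    qed
  have d1: "AE t in lborel. norm (Gt (1 / Suc k) vR t * vR t) \<le> M * norm (indicator {0<..<T} t *\<^sub>R H t)" for k
    proof (rule AE_I2)
      fix t
      show "norm (Gt (1 / Suc k) vR t * vR t) \<le> M * norm (indicator {0<..<T} t *\<^sub>R H t)"
      proof (cases "t \<in> {0<..<R}")
        case True
        then have t: "t \<in> {0<..<T}" using R by auto
        have "\<bar>Gt (1 / Suc k) v t\<bar> * \<bar>v t\<bar> \<le> \<bar>H t\<bar> * M"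
          using H(2)[OF t, of "1 / Suc k"] M[of t] t by (intro mult_mono) auto
        moreover have "Gt (1 / Suc k) vR t * vR t = indicator {0<..<R} t * (Gt (1 / Suc k) v t * v t)" by (rule prod) simp
        ultimately show ?thesis using True t by (simp only: abs_mult real_norm_def indicator_simps scaleR_one) (simp add: mult.commute)
      next
        case False then show ?thesis using M0 by (simp add: vR_def)
      qed
    qed
  note conv = integrable_dominated_convergence[OF m2 m1 dom c1 d1] integral_dominated_convergence[OF m2 m1 dom c1 d1]
  show "set_integrable lborel {0<..<R} (\<lambda>t. g t * v t)" using conv by (simp add: set_integrable_def)
  let ?a = "\<lambda>k. LINT t|lborel. Gt (1 / Suc k) vR t * vR t"
  have lim: "?a \<longlonglongrightarrow> (LINT t:{0<..<R}|lborel. g t * v t)" using conv by (simp add: set_lebesgue_integral_def)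
  have s: "\<And>t. t \<notin> {0..R} \<Longrightarrow> vR t = 0" by (auto simp: vR_def)
  note ei = energy_identity[OF _ _ bR s]
  have pos: "0 \<le> ?a k" for k by (rule ei) auto
  then show "0 \<le> (LINT t:{0<..<R}|lborel. g t * v t)" by (intro LIMSEQ_le_const[OF lim]) auto
  have "(\<lambda>k. ennreal (?a k)) \<longlonglongrightarrow> ennreal (LINT t:{0<..<R}|lborel. g t * v t)" by (rule tendsto_ennrealI[OF lim])
  moreover have "(\<lambda>k. ennreal (?a k)) \<longlonglongrightarrow> energy vR"
  proof -
    let ?D = "\<lambda>h. \<integral>\<^sup>+t. ennreal ((vR t - vR (t - h))\<^sup>2) \<partial>lborel"
    have "(\<lambda>k. \<integral>\<^sup>+h. ennreal (qk h / 2) * indicator {1 / real (Suc k)..} h * ?D h \<partial>lborel) \<longlonglongrightarrow> energy vR"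
      unfolding energy_def
    \<comment> \<open>The cut-off kernels increase as \<epsilon> decreases, so monotone convergence
      applies before the energy is known to be finite.\<close>
    proof (rule nn_integral_LIMSEQ)
      show "incseq (\<lambda>k h. ennreal (qk h / 2) * indicator {1 / real (Suc k)..} h * ?D h)"
      proof (rule incseq_SucI, rule le_funI)
        fix k h
        have "1 / real (Suc (Suc k)) \<le> 1 / real (Suc k)" by (rule divide_left_mono) auto
        then show "ennreal (qk h / 2) * indicator {1 / real (Suc k)..} h * ?D h \<le> ennreal (qk h / 2) * indicator {1 / real (Suc (Suc k))..} h * ?D h"
          by (intro mult_right_mono mult_left_mono) (auto simp: indicator_def)
      qed
      show "(\<lambda>k. ennreal (qk h / 2) * indicator {1 / real (Suc k)..} h * ?D h) \<longlonglongrightarrow> ennreal (qk h / 2) * indicator {0<..} h * ?D h" for h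
      proof (rule Lim_transform_eventually[OF tendsto_const])
        show "\<forall>\<^sub>F k in sequentially. ennreal (qk h / 2) * indicator {0<..} h * ?D h = ennreal (qk h / 2) * indicator {1 / real (Suc k)..} h * ?D h"
          using eventually_inverse_Suc_le[of h] by eventually_elim (simp add: indicator_def)
      qed
    qed measurable
    moreover have "ennreal (?a k) = (\<integral>\<^sup>+h. ennreal (qk h / 2) * indicator {1 / real (Suc k)..} h * ?D h \<partial>lborel)" for k
      by (rule ei) auto
    ultimately show ?thesis by (simp only:)
  qed
  ultimately have "ennreal (LINT t:{0<..<R}|lborel. g t * v t) = energy vR" by (rule LIMSEQ_unique)
  then show "ennreal (LINT t:{0<..<R}|lborel. g t * v t) = energy (\<lambda>t. v t * indicator {0<..<R} t)"
    by (simp add: vR_def[abs_def])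
qed

text \<open>For \<open>h \<ge> t\<close> the increment \<open>v(t) - v(t-h)\<close> is \<open>v(t)\<close>, so the energy controls Hardy's weight.\<close>

lemma Hardy:
  assumes [measurable]: "v \<in> borel_measurable borel" and v0: "\<And>t. t \<le> 0 \<Longrightarrow> v t = 0"
  shows "(\<integral>\<^sup>+t. ennreal (t powr (- \<gamma>) * (v t)\<^sup>2) \<partial>lborel) \<le> ennreal (2 * Gamma (1 - \<gamma>)) * energy v"
proof -
  have "ennreal (t powr (- \<gamma>) * (v t)\<^sup>2) =
      ennreal (2 * Gamma (1 - \<gamma>)) * (\<integral>\<^sup>+h. ennreal (qk h / 2 * indicator {t..} h) * ennreal ((v t)\<^sup>2) * indicator {0<..} t \<partial>lborel)" for t
  proof (cases "t > 0")
    case True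
    have "(\<integral>\<^sup>+h. ennreal (qk h / 2 * indicator {t..} h) * ennreal ((v t)\<^sup>2) * indicator {0<..} t \<partial>lborel) =
        (\<integral>\<^sup>+h. ennreal (1/2 * (v t)\<^sup>2) * ennreal (qk h * indicator {t..} h) \<partial>lborel)"
      using True qk_nonneg by (intro nn_integral_cong) (auto simp: indicator_def ennreal_mult[symmetric])
    also have "\<dots> = ennreal (1/2 * (v t)\<^sup>2) * ennreal (t powr (- \<gamma>) / Gamma (1 - \<gamma>))"
      using nn_integral_qk[OF True] by (simp add: nn_integral_cmult)
    finally have "ennreal (2 * Gamma (1 - \<gamma>)) * (\<integral>\<^sup>+h. ennreal (qk h / 2 * indicator {t..} h) * ennreal ((v t)\<^sup>2) * indicator {0<..} t \<partial>lborel)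
        = ennreal (2 * Gamma (1 - \<gamma>) * (1/2 * (v t)\<^sup>2 * (t powr (- \<gamma>) / Gamma (1 - \<gamma>))))"
      using Gamma_pos by (simp add: ennreal_mult[symmetric] del: ennreal_mult')
    also have "2 * Gamma (1 - \<gamma>) * (1/2 * (v t)\<^sup>2 * (t powr (- \<gamma>) / Gamma (1 - \<gamma>))) = t powr (- \<gamma>) * (v t)\<^sup>2"
      using Gamma_pos by simp
    finally show ?thesis by simp
  next
    case False then show ?thesis using v0[of t] by simp
  qed
  moreover have jm: "(\<lambda>(t, h). ennreal (qk h / 2 * indicator {t..} h) * ennreal ((v t)\<^sup>2) * indicator {0<..} t) \<in> borel_measurable (lborel \<Otimes>\<^sub>M lborel)"
  proof -
    \<comment> \<open>The indicator whose set depends on t is rewritten as that of the closed set t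
      \<le> h in the plane, which makes joint measurability evident.\<close>
    have "(\<lambda>(t::real, h). ennreal (qk h / 2 * indicator {p. fst p \<le> snd p} (t, h)) * ennreal ((v t)\<^sup>2) * indicator {0<..} t)
      \<in> borel_measurable (lborel \<Otimes>\<^sub>M lborel)" by measurable
    also have "(\<lambda>(t::real, h). ennreal (qk h / 2 * indicator {p. fst p \<le> snd p} (t, h)) * ennreal ((v t)\<^sup>2) * indicator {0<..} t) =
      (\<lambda>(t, h). ennreal (qk h / 2 * indicator {t..} h) * ennreal ((v t)\<^sup>2) * indicator {0<..} t)"
      by (auto simp: indicator_def fun_eq_iff)
    finally show ?thesis .
  qed
  ultimately have "(\<integral>\<^sup>+t. ennreal (t powr (- \<gamma>) * (v t)\<^sup>2) \<partial>lborel) =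
      (\<integral>\<^sup>+t. ennreal (2 * Gamma (1 - \<gamma>)) * (\<integral>\<^sup>+h. ennreal (qk h / 2 * indicator {t..} h) * ennreal ((v t)\<^sup>2) * indicator {0<..} t \<partial>lborel) \<partial>lborel)"
    by (simp only:)
  also have "\<dots> =
      ennreal (2 * Gamma (1 - \<gamma>)) * (\<integral>\<^sup>+t. \<integral>\<^sup>+h. ennreal (qk h / 2 * indicator {t..} h) * ennreal ((v t)\<^sup>2) * indicator {0<..} t \<partial>lborel \<partial>lborel)"
    by (rule nn_integral_cmult) (rule lborel.borel_measurable_nn_integral[OF jm])
  also have "(\<integral>\<^sup>+t. \<integral>\<^sup>+h. ennreal (qk h / 2 * indicator {t..} h) * ennreal ((v t)\<^sup>2) * indicator {0<..} t \<partial>lborel \<partial>lborel) =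
      (\<integral>\<^sup>+h. \<integral>\<^sup>+t. ennreal (qk h / 2 * indicator {t..} h) * ennreal ((v t)\<^sup>2) * indicator {0<..} t \<partial>lborel \<partial>lborel)"
    by (rule lborel_pair.Fubini'[OF jm, symmetric])
  also have "\<dots> \<le> energy v" unfolding energy_def
  proof (rule nn_integral_mono)
    fix h
    have "(\<integral>\<^sup>+t. ennreal (qk h / 2 * indicator {t..} h) * ennreal ((v t)\<^sup>2) * indicator {0<..} t \<partial>lborel) \<le>
       (\<integral>\<^sup>+t. (ennreal (qk h / 2) * indicator {0<..} h) * ennreal ((v t - v (t - h))\<^sup>2) \<partial>lborel)"
    proof (rule nn_integral_mono)
      fix t show "ennreal (qk h / 2 * indicator {t..} h) * ennreal ((v t)\<^sup>2) * indicator {0<..} t \<le>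
          (ennreal (qk h / 2) * indicator {0<..} h) * ennreal ((v t - v (t - h))\<^sup>2)"
        using v0[of "t - h"] by (auto simp: indicator_def)
    qed
    also have "\<dots> = ennreal (qk h / 2) * indicator {0<..} h * (\<integral>\<^sup>+t. ennreal ((v t - v (t - h))\<^sup>2) \<partial>lborel)"
      by (simp add: nn_integral_cmult)
    finally show "(\<integral>\<^sup>+t. ennreal (qk h / 2 * indicator {t..} h) * ennreal ((v t)\<^sup>2) * indicator {0<..} t \<partial>lborel) \<le>
       ennreal (qk h / 2) * indicator {0<..} h * (\<integral>\<^sup>+t. ennreal ((v t - v (t - h))\<^sup>2) \<partial>lborel)" .
  qed
  finally show ?thesis by (simp add: mult_left_mono)
qed

end

subsection \<open>Fractional derivatives of piecewise polynomials\<close>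

text \<open>Euler's integral, scaled by h = u r. Nonnegativity of the integrand turns the gauge
  integral into a Lebesgue integral, also for the negative exponents that occur below.\<close>

lemma Beta_has_bochner_integral:
  fixes p q u :: real
  assumes p: "-1 < p" and q: "-1 < q" and u: "0 < u"
  shows "has_bochner_integral lborel (\<lambda>h. indicator {0<..<u} h * (h powr p * (u - h) powr q))
    (u powr (p + q + 1) * Beta (p + 1) (q + 1))"
proof -
  let ?f = "\<lambda>r::real. r powr p * (1 - r) powr q"
  have "(?f has_integral Beta (p + 1) (q + 1)) {0..1}"
    using has_integral_Beta_real[of "p + 1" "q + 1"] p q by simp
  then have hi: "(?f has_integral Beta (p + 1) (q + 1)) {0<..<1}" by (simp add: has_integral_Icc_iff_Ioo)
  then have si: "set_integrable lebesgue {0<..<1} ?f"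
    by (intro nonnegative_absolutely_integrable_1) (auto simp: has_integral_iff)
  have LI: "(LINT r:{0<..<1}|lebesgue. ?f r) = Beta (p + 1) (q + 1)"
    using set_lebesgue_integral_eq_integral(2)[OF si] hi by (simp add: integral_unique)
  have B: "has_bochner_integral lborel (\<lambda>r. indicator {0<..<1} r * ?f r) (Beta (p + 1) (q + 1))"
    using si LI unfolding set_integrable_def set_lebesgue_integral_def has_bochner_integral_iff
    by (simp add: integrable_completion integral_completion)
  have eq: "indicator {0<..<u} (0 + u * r) * ((0 + u * r) powr p * (u - (0 + u * r)) powr q) =
      u powr (p + q) * (indicator {0<..<1} r * ?f r)" for r
  proof (cases "r \<in> {0<..<1}")
    case True
    then have "0 < u * r" "u * r < u" using u by auto
    moreover have "(u * r) powr p * (u - u * r) powr q = u powr (p + q) * ?f r"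
    proof -
      have "u - u * r = u * (1 - r)" by (simp add: algebra_simps)
      then show ?thesis using True u by (simp add: powr_mult powr_add)
    qed
    ultimately show ?thesis using True by simp
  next
    case False
    then have "u * r \<notin> {0<..<u}" using u by (auto simp: zero_less_mult_iff)
    then show ?thesis using False by simp
  qed
  have "integrable lborel (\<lambda>r. indicator {0<..<u} (0 + u * r) * ((0 + u * r) powr p * (u - (0 + u * r)) powr q))"
    unfolding eq using B by (simp add: has_bochner_integral_iff)
  then have "integrable lborel (\<lambda>h. indicator {0<..<u} h * (h powr p * (u - h) powr q))"
    using u by (subst (asm) lborel_integrable_real_affine_iff) auto
  moreover have "(LINT h|lborel. indicator {0<..<u} h * (h powr p * (u - h) powr q)) = \<bar>u\<bar> *\<^sub>R (LINT r|lborel. u powr (p + q) * (indicator {0<..<1} r * ?f r))"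
    unfolding eq[symmetric] by (rule lborel_integral_real_affine) (use u in auto)
  moreover have "\<bar>u\<bar> *\<^sub>R (LINT r|lborel. u powr (p + q) * (indicator {0<..<1} r * ?f r)) = u powr (p + q + 1) * Beta (p + 1) (q + 1)"
    using B u by (simp add: has_bochner_integral_iff powr_add)
  ultimately show ?thesis by (simp add: has_bochner_integral_iff)
qed

lemma powr_shift_integrable:
  fixes p c d :: real
  assumes "-1 < p"
  shows "integrable lborel (\<lambda>x. indicator {c<..<d} x * (x - c) powr p)"
proof (cases "c < d")
  case True
  have "integrable lborel (\<lambda>h. indicator {0<..<d - c} h * (h powr p * (d - c - h) powr 0))"
    using Beta_has_bochner_integral[of p 0 "d - c"] assms True by (simp add: has_bochner_integral_iff)
  then have "integrable lborel (\<lambda>x. indicator {0<..<d - c} (- c + 1 * x) * ((- c + 1 * x) powr p * (d - c - (- c + 1 * x)) powr 0))"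
    by (rule lborel_integrable_real_affine) simp
  moreover have "(\<lambda>x. indicator {0<..<d - c} (- c + 1 * x) * ((- c + 1 * x) powr p * (d - c - (- c + 1 * x)) powr 0))
      = (\<lambda>x. indicator {c<..<d} x * (x - c) powr p)"
    by (auto simp: indicator_def fun_eq_iff)
  ultimately show ?thesis by simp
qed simp

text \<open>Truncated powers. Their fractional integrals are explicit, and differences of their
  linear combinations give polynomials restricted to an interval.\<close>

definition tpow :: "real \<Rightarrow> nat \<Rightarrow> real \<Rightarrow> real" where
  "tpow c i t = (if c < t then (t - c) ^ i else 0)"

lemma tpow_measurable [measurable]: "tpow c i \<in> borel_measurable borel"
  unfolding tpow_def[abs_def] by measurable

lemma tpow_nonneg: "0 \<le> tpow c i t" by (simp add: tpow_def)

lemma tpow_mono: "s \<le> t \<Longrightarrow> tpow c i s \<le> tpow c i t"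
  by (auto simp: tpow_def intro: power_mono)

context frac_order
begin

lemma frac_int_integrable:
  assumes [measurable]: "v \<in> borel_measurable borel" and b: "\<And>s. s < t \<Longrightarrow> \<bar>v s\<bar> \<le> M"
  shows "set_integrable lebesgue {0<..<t} (\<lambda>s. (t - s) powr (1 - \<gamma> - 1) * v s)"
proof (rule set_integrable_mult_bounded)
  have "integrable lborel (\<lambda>x. indicator {0<..<t} x * (x - 0) powr (1 - \<gamma> - 1))"
    by (rule powr_shift_integrable) (use g1 in auto)
  then have "integrable lborel (\<lambda>x. indicator {0<..<t} (t + (-1) * x) * ((t + (-1) * x) - 0) powr (1 - \<gamma> - 1))"
    by (rule lborel_integrable_real_affine) simp
  moreover have "(\<lambda>x. indicator {0<..<t} (t + (-1) * x) * ((t + (-1) * x) - 0) powr (1 - \<gamma> - 1)) = (\<lambda>x. indicator {0<..<t} x *\<^sub>R (t - x) powr (1 - \<gamma> - 1))"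
    by (auto simp: indicator_def fun_eq_iff)
  ultimately show "set_integrable lebesgue {0<..<t} (\<lambda>s. (t - s) powr (1 - \<gamma> - 1))"
    unfolding set_integrable_def by (simp add: integrable_completion)
  have "v \<in> borel_measurable lebesgue" using assms(1) by (simp add: measurable_completion)
  then show "set_borel_measurable lebesgue {0<..<t} v"
    unfolding set_borel_measurable_def by (intro borel_measurable_scaleR borel_measurable_indicator) auto
qed (use b in auto)

lemma frac_ok_lincomb:
  assumes u: "frac_ok T u g" and v: "frac_ok T v g'"
  shows "frac_ok T (\<lambda>t. r * u t + s * v t) (\<lambda>t. r * g t + s * g' t)"
proof -
  have [measurable]: "u \<in> borel_measurable borel" "v \<in> borel_measurable borel" "g \<in> borel_measurable borel" "g' \<in> borel_measurable borel"
    using u v by (auto simp: frac_ok_def)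
  obtain M where M: "\<And>t. t < T \<Longrightarrow> \<bar>u t\<bar> \<le> M" using u unfolding frac_ok_def by blast
  obtain M' where M': "\<And>t. t < T \<Longrightarrow> \<bar>v t\<bar> \<le> M'" using v unfolding frac_ok_def by blast
  obtain H where H: "set_integrable lborel {0<..<T} H"
    "\<And>t \<epsilon>. t \<in> {0<..<T} \<Longrightarrow> \<epsilon> > 0 \<Longrightarrow> \<bar>Gt \<epsilon> u t\<bar> \<le> H t" "\<And>t. t \<in> {0<..<T} \<Longrightarrow> (\<lambda>k. Gt (1 / Suc k) u t) \<longlonglongrightarrow> g t"
    using u unfolding frac_ok_def by blast
  obtain H' where H': "set_integrable lborel {0<..<T} H'"
    "\<And>t \<epsilon>. t \<in> {0<..<T} \<Longrightarrow> \<epsilon> > 0 \<Longrightarrow> \<bar>Gt \<epsilon> v t\<bar> \<le> H' t" "\<And>t. t \<in> {0<..<T} \<Longrightarrow> (\<lambda>k. Gt (1 / Suc k) v t) \<longlonglongrightarrow> g' t"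
    using v unfolding frac_ok_def by blast
  have lin: "Gt \<epsilon> (\<lambda>t. r * u t + s * v t) t = r * Gt \<epsilon> u t + s * Gt \<epsilon> v t" if t: "t \<in> {0<..<T}" and e: "0 < \<epsilon>" for t \<epsilon>
  proof -
    have i: "integrable lborel (\<lambda>h. qk h * indicator {\<epsilon>..} h * u (t - h))" "integrable lborel (\<lambda>h. qk h * indicator {\<epsilon>..} h * v (t - h))"
      using t e by (auto intro!: integrable_qk_bounded M M')
    have "(\<lambda>h. qk h * indicator {\<epsilon>..} h * (r * u (t - h) + s * v (t - h))) =
        (\<lambda>h. r * (qk h * indicator {\<epsilon>..} h * u (t - h)) + s * (qk h * indicator {\<epsilon>..} h * v (t - h)))"
      by (auto simp: algebra_simps)
    then have "(LINT h|lborel. qk h * indicator {\<epsilon>..} h * (r * u (t - h) + s * v (t - h))) =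
        r * (LINT h|lborel. qk h * indicator {\<epsilon>..} h * u (t - h)) + s * (LINT h|lborel. qk h * indicator {\<epsilon>..} h * v (t - h))"
      using i by simp
    then show ?thesis by (simp add: Gt_def algebra_simps add_divide_distrib)
  qed
  show ?thesis
    unfolding frac_ok_def
  proof (intro conjI)
    show "(\<lambda>t. r * u t + s * v t) \<in> borel_measurable borel" "(\<lambda>t. r * g t + s * g' t) \<in> borel_measurable borel" by measurable
    have "\<bar>r * u t + s * v t\<bar> \<le> \<bar>r\<bar> * M + \<bar>s\<bar> * M'" if "t < T" for t
    proof -
      have "\<bar>r * u t + s * v t\<bar> \<le> \<bar>r\<bar> * \<bar>u t\<bar> + \<bar>s\<bar> * \<bar>v t\<bar>" by (metis abs_mult abs_triangle_ineq)
      also have "\<dots> \<le> \<bar>r\<bar> * M + \<bar>s\<bar> * M'" using M M' that by (intro add_mono mult_left_mono) auto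
      finally show ?thesis .
    qed
    then show "\<exists>M. \<forall>t<T. \<bar>r * u t + s * v t\<bar> \<le> M" by blast
    show "\<forall>t\<le>0. r * u t + s * v t = 0" using u v by (simp add: frac_ok_def)
    have "is_distr_deriv 0 T (\<lambda>t. r * frac_int (1 - \<gamma>) u t + s * frac_int (1 - \<gamma>) v t) (\<lambda>t. r * g t + s * g' t)"
      using u v by (intro is_distr_deriv_lincomb) (auto simp: frac_ok_def)
    moreover have "r * frac_int (1 - \<gamma>) u t + s * frac_int (1 - \<gamma>) v t = frac_int (1 - \<gamma>) (\<lambda>t. r * u t + s * v t) t"
      if t: "t \<in> {0<..<T}" for t
    proof -
      have i: "set_integrable lebesgue {0<..<t} (\<lambda>s. (t - s) powr (1 - \<gamma> - 1) * u s)"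
        by (rule frac_int_integrable[where M=M]) (use t M in auto)
      have i': "set_integrable lebesgue {0<..<t} (\<lambda>s. (t - s) powr (1 - \<gamma> - 1) * v s)"
        by (rule frac_int_integrable[where M=M']) (use t M' in auto)
      have "(LINT x:{0<..<t}|lebesgue. (t - x) powr (1 - \<gamma> - 1) * (r * u x + s * v x)) =
        (LINT x:{0<..<t}|lebesgue. r * ((t - x) powr (1 - \<gamma> - 1) * u x) + s * ((t - x) powr (1 - \<gamma> - 1) * v x))"
        by (simp add: algebra_simps)
      also have "\<dots> = r * (LINT x:{0<..<t}|lebesgue. (t - x) powr (1 - \<gamma> - 1) * u x) + s * (LINT x:{0<..<t}|lebesgue. (t - x) powr (1 - \<gamma> - 1) * v x)"
        using i i' by (subst set_integral_add(2)) (auto intro!: set_integrable_mult_right)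
      finally show ?thesis by (simp add: frac_int_def add_divide_distrib)
    qed
    ultimately show "is_distr_deriv 0 T (frac_int (1 - \<gamma>) (\<lambda>t. r * u t + s * v t)) (\<lambda>t. r * g t + s * g' t)"
      by (elim is_distr_deriv_cong) (auto intro!: AE_I2)
    show "\<exists>H. set_integrable lborel {0<..<T} H \<and>
        (\<forall>t\<in>{0<..<T}. (\<forall>\<epsilon>>0. \<bar>Gt \<epsilon> (\<lambda>t. r * u t + s * v t) t\<bar> \<le> H t) \<and>
          (\<lambda>k. Gt (1 / Suc k) (\<lambda>t. r * u t + s * v t) t) \<longlonglongrightarrow> r * g t + s * g' t)"
    proof (intro exI[of _ "\<lambda>t. \<bar>r\<bar> * H t + \<bar>s\<bar> * H' t"] conjI ballI allI impI)
      show "set_integrable lborel {0<..<T} (\<lambda>t. \<bar>r\<bar> * H t + \<bar>s\<bar> * H' t)" using H(1) H'(1) by (intro set_integral_add set_integrable_mult_right)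
      fix t assume t: "t \<in> {0<..<T}"
      show "\<bar>Gt \<epsilon> (\<lambda>t. r * u t + s * v t) t\<bar> \<le> \<bar>r\<bar> * H t + \<bar>s\<bar> * H' t" if "\<epsilon> > 0" for \<epsilon>
      proof -
        have "\<bar>Gt \<epsilon> (\<lambda>t. r * u t + s * v t) t\<bar> \<le> \<bar>r\<bar> * \<bar>Gt \<epsilon> u t\<bar> + \<bar>s\<bar> * \<bar>Gt \<epsilon> v t\<bar>"
          unfolding lin[OF t that] by (metis abs_mult abs_triangle_ineq)
        also have "\<dots> \<le> \<bar>r\<bar> * H t + \<bar>s\<bar> * H' t" using H(2) H'(2) t that by (intro add_mono mult_left_mono) auto
        finally show ?thesis .
      qed
      have "(\<lambda>k. Gt (1 / Suc k) (\<lambda>t. r * u t + s * v t) t) = (\<lambda>k. r * Gt (1 / Suc k) u t + s * Gt (1 / Suc k) v t)"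
        by (rule ext, rule lin[OF t]) simp
      then show "(\<lambda>k. Gt (1 / Suc k) (\<lambda>t. r * u t + s * v t) t) \<longlonglongrightarrow> r * g t + s * g' t"
        using H(3)[OF t] H'(3)[OF t] by (simp only:) (intro tendsto_intros)
    qed
  qed
qed

lemma frac_ok_zero: "frac_ok T (\<lambda>t. 0) (\<lambda>t. 0)"
  unfolding frac_ok_def
  by (auto simp: Gt_def frac_int_def is_distr_deriv_def loc_integrable_def set_integrable_def
      set_lebesgue_integral_def intro!: exI[of _ "\<lambda>_. 0"])

text \<open>The shift s = c + h turns the integral over (c, t) into a Beta integral of length t -
  c.\<close>

lemma frac_int_tpow:
  assumes c: "0 \<le> c"
  shows "frac_int (1 - \<gamma>) (tpow c i) t =
    (if c < t then Beta (real i + 1) (1 - \<gamma>) / Gamma (1 - \<gamma>) * (t - c) powr (real i + 1 - \<gamma>) else 0)"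
proof (cases "c < t")
  case False
  then have "indicator {0<..<t} s *\<^sub>R ((t - s) powr (1 - \<gamma> - 1) * tpow c i s) = 0" for s
    by (auto simp: tpow_def indicator_def)
  then have "(LINT s:{0<..<t}|lebesgue. (t - s) powr (1 - \<gamma> - 1) * tpow c i s) = 0"
    unfolding set_lebesgue_integral_def by (simp only: Bochner_Integration.integral_zero)
  then show ?thesis using False by (simp only: frac_int_def) simp
next
  case True
  have B: "has_bochner_integral lborel (\<lambda>h. indicator {0<..<t - c} h * (h powr real i * (t - c - h) powr (- \<gamma>)))
      ((t - c) powr (real i + (- \<gamma>) + 1) * Beta (real i + 1) (- \<gamma> + 1))"
    using Beta_has_bochner_integral[of "real i" "- \<gamma>" "t - c"] g1 True by simp
  have eq: "indicator {0<..<t} (c + 1 * h) * ((t - (c + 1 * h)) powr (1 - \<gamma> - 1) * tpow c i (c + 1 * h)) =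
      indicator {0<..<t - c} h * (h powr real i * (t - c - h) powr (- \<gamma>))" for h
    using c True by (auto simp: indicator_def tpow_def powr_realpow diff_diff_eq)
  have "(LINT s:{0<..<t}|lebesgue. (t - s) powr (1 - \<gamma> - 1) * tpow c i s) =
      (LINT s|lborel. indicator {0<..<t} s * ((t - s) powr (1 - \<gamma> - 1) * tpow c i s))"
    unfolding set_lebesgue_integral_def by (subst integral_completion) auto
  also have "\<dots> = \<bar>1\<bar> *\<^sub>R (LINT h|lborel. indicator {0<..<t} (c + 1 * h) * ((t - (c + 1 * h)) powr (1 - \<gamma> - 1) * tpow c i (c + 1 * h)))"
    by (rule lborel_integral_real_affine) simp
  also have "\<dots> = (t - c) powr (real i + 1 - \<gamma>) * Beta (real i + 1) (1 - \<gamma>)"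
    unfolding eq using B by (simp add: has_bochner_integral_iff algebra_simps)
  finally show ?thesis using True by (simp add: frac_int_def)
qed

text \<open>
  On \<open>(0,u)\<close> the integrand is the derivative of $-h^{-\gamma}(u^i - (u-h)^i)$ plus a Beta
  integrand; the boundary term at \<open>u\<close> cancels against the tail.
\<close>

lemma Marchaud_power:
  assumes u: "0 < u"
  shows "has_bochner_integral lborel (\<lambda>h. qk h * indicator {0<..} h * (u ^ i - tpow 0 i (u - h)))
    ((real i + 1 - \<gamma>) * Beta (real i + 1) (1 - \<gamma>) / Gamma (1 - \<gamma>) * u powr (real i - \<gamma>))"
proof -
  have tail: "has_bochner_integral lborel (\<lambda>h. u ^ i * (qk h * indicator {u..} h)) (u ^ i * (u powr (- \<gamma>) / Gamma (1 - \<gamma>)))"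
    using qk_integral[OF u] by (intro has_bochner_integral_mult_right) (simp add: has_bochner_integral_iff)
  have up: "u ^ i * u powr (- \<gamma>) = u powr (real i - \<gamma>)" using u by (simp add: powr_realpow[symmetric] powr_add[symmetric])
  show ?thesis
  proof (cases "i = 0")
    case True
    \<comment> \<open>For i = 0 the integrand vanishes on (0, u) and only the tail remains, so the
      Beta factor of the statement has to cancel.\<close>
    have "Beta 1 (1 - \<gamma>) * (1 - \<gamma>) = 1"
    proof -
      have "Beta 1 (1 - \<gamma>) = Gamma 1 * Gamma (1 - \<gamma>) / Gamma (1 - \<gamma> + 1)"
        by (simp add: Beta_def add.commute)
      also have "Gamma (1 - \<gamma> + 1) = (1 - \<gamma>) * Gamma (1 - \<gamma>)"
        using g1 by (intro Gamma_plus1) (auto elim!: nonpos_Ints_cases)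
      finally show ?thesis using less_imp_neq[OF Gamma_pos, symmetric] g1 by simp
    qed
    then have v: "u ^ i * (u powr (- \<gamma>) / Gamma (1 - \<gamma>)) =
        (real i + 1 - \<gamma>) * Beta (real i + 1) (1 - \<gamma>) / Gamma (1 - \<gamma>) * u powr (real i - \<gamma>)"
      using True by (simp add: mult.commute)
    have "(\<lambda>h. u ^ i * (qk h * indicator {u..} h)) = (\<lambda>h. qk h * indicator {0<..} h * (u ^ i - tpow 0 i (u - h)))"
      using True u by (auto simp: tpow_def indicator_def)
    then show ?thesis using tail unfolding v by simp
  next
    case False
    define G where "G = Gamma (1 - \<gamma>)"
    have G: "0 < G" using Gamma_pos by (simp add: G_def)
    have B: "has_bochner_integral lborel (\<lambda>h. indicator {0<..<u} h * (h powr (- \<gamma>) * (u - h) powr (real i - 1)))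
      (u powr (- \<gamma> + (real i - 1) + 1) * Beta (- \<gamma> + 1) (real i - 1 + 1))"
      using Beta_has_bochner_integral[of "- \<gamma>" "real i - 1" u] g1 u False by simp
    define \<Phi> where "\<Phi> h = - (h powr (- \<gamma>) * (u ^ i - (u - h) ^ i)) / G" for h
    define b where "b h = h powr (- \<gamma>) * (u - h) ^ (i - 1)" for h
    have FTC: "((\<lambda>h. qk h * (u ^ i - (u - h) ^ i) - real i / G * b h) has_integral (\<Phi> u - \<Phi> 0)) {0..u}"
    proof (rule fundamental_theorem_of_calculus_interior)
      show "0 \<le> u" using u by simp
      \<comment> \<open>Continuity of \<Phi> at 0 is hidden by the factor h^(-\<gamma>). Extracting
        h from u^i - (u-h)^i leaves the positive exponent 1 - \<gamma>.\<close>
      have eq: "- (h powr (1 - \<gamma>) * (\<Sum>k<i. (u - h) ^ (i - Suc k) * u ^ k)) / G = \<Phi> h" if "h \<in> {0..u}" for h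
      proof -
        have "u ^ i - (u - h) ^ i = (u - (u - h)) * (\<Sum>k<i. (u - h) ^ (i - Suc k) * u ^ k)" by (rule power_diff_sumr2)
        moreover have "h powr (- \<gamma>) * h = h powr (1 - \<gamma>)"
          using that by (cases "h = 0") (auto simp: powr_mult_base mult.commute)
        ultimately show ?thesis by (simp add: \<Phi>_def mult.assoc[symmetric])
      qed
      have "continuous_on {0..u} (\<lambda>h. - (h powr (1 - \<gamma>) * (\<Sum>k<i. (u - h) ^ (i - Suc k) * u ^ k)) / G)"
        using G g1 by (intro continuous_intros continuous_on_powr') auto
      then show "continuous_on {0..u} \<Phi>" by (rule continuous_on_eq) (rule eq)
      fix h assume h: "h \<in> {0<..<u}"
      have "(\<Phi> has_real_derivative - (- \<gamma> * h powr (- \<gamma> - 1) * (u ^ i - (u - h) ^ i) +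
          (real i * (u - h) ^ (i - 1)) * h powr (- \<gamma>)) / G) (at h)"
        unfolding \<Phi>_def using h G by (auto intro!: derivative_eq_intros simp: field_simps)
      then show "(\<Phi> has_vector_derivative qk h * (u ^ i - (u - h) ^ i) - real i / G * b h) (at h)"
        unfolding has_real_derivative_iff_has_vector_derivative[symmetric]
        by (rule back_subst[of "\<lambda>D. (\<Phi> has_real_derivative D) (at h)"])
          (use G in \<open>simp add: qk_def b_def G_def[symmetric] diff_divide_distrib add_divide_distrib algebra_simps\<close>)
    qed
    have \<Phi>: "\<Phi> u - \<Phi> 0 = - (u powr (real i - \<gamma>)) / G" using False up by (simp add: \<Phi>_def mult.commute power_0_left)
    let ?Bv = "u powr (real i - \<gamma>) * Beta (1 - \<gamma>) (real i)"
    have Bv: "has_bochner_integral lborel (\<lambda>h. indicator {0<..<u} h * b h) ?Bv"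
    proof -
      have e: "(u - h) powr (real i - 1) = (u - h) ^ (i - 1)" if "h < u" for h
      proof -
        have "real i - 1 = real (i - 1)" using False by (simp add: of_nat_diff)
        then show ?thesis using that by (simp only: powr_realpow diff_gt_0_iff_gt)
      qed
      have "(\<lambda>h. indicator {0<..<u} h * (h powr (- \<gamma>) * (u - h) powr (real i - 1))) = (\<lambda>h. indicator {0<..<u} h * b h)"
        using e by (auto simp: indicator_def b_def)
      then show ?thesis using B by (simp add: algebra_simps)
    qed
    have "(b has_integral ?Bv) {0..u}"
    proof -
      have "((\<lambda>h. indicator {0<..<u} h * b h) has_integral ?Bv) UNIV"
        using has_integral_integral_lborel[of "\<lambda>h. indicator {0<..<u} h * b h"] Bv by (auto simp: has_bochner_integral_iff)
      moreover have "(\<lambda>h. indicator {0<..<u} h * b h) = (\<lambda>h. if h \<in> {0<..<u} then b h else 0)" by (auto simp: indicator_def)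
      ultimately have "(b has_integral ?Bv) {0<..<u}" by (simp only: has_integral_restrict_UNIV)
      then show ?thesis by (simp add: has_integral_Icc_iff_Ioo)
    qed
    from has_integral_add[OF FTC has_integral_mult_right[OF this, of "real i / G"]]
    have hi: "((\<lambda>h. qk h * (u ^ i - (u - h) ^ i)) has_integral (real i / G * ?Bv - u powr (real i - \<gamma>) / G)) {0..u}"
      unfolding \<Phi> by simp
    have si: "set_integrable lebesgue {0..u} (\<lambda>h. qk h * (u ^ i - (u - h) ^ i))"
    proof (rule nonnegative_absolutely_integrable_1)
      fix h assume "h \<in> {0..u}"
      then show "0 \<le> qk h * (u ^ i - (u - h) ^ i)" using qk_nonneg by (auto intro!: mult_nonneg_nonneg power_mono)
    qed (use hi in blast)
    have si': "set_integrable lebesgue {0<..<u} (\<lambda>h. qk h * (u ^ i - (u - h) ^ i))"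
      by (rule set_integrable_subset[OF si]) auto
    have "(LINT h:{0<..<u}|lebesgue. qk h * (u ^ i - (u - h) ^ i)) = real i / G * ?Bv - u powr (real i - \<gamma>) / G"
      using set_lebesgue_integral_eq_integral(2)[OF si] hi by (simp add: integral_unique set_integral_Icc_Ioo)
    then have inner: "has_bochner_integral lborel (\<lambda>h. indicator {0<..<u} h * (qk h * (u ^ i - (u - h) ^ i)))
        (real i / G * ?Bv - u powr (real i - \<gamma>) / G)"
      using si' unfolding set_integrable_def set_lebesgue_integral_def has_bochner_integral_iff
      by (simp add: integrable_completion integral_completion)
    have "has_bochner_integral lborel (\<lambda>h. indicator {0<..<u} h * (qk h * (u ^ i - (u - h) ^ i)) + u ^ i * (qk h * indicator {u..} h))
        (real i / G * ?Bv - u powr (real i - \<gamma>) / G + u ^ i * (u powr (- \<gamma>) / Gamma (1 - \<gamma>)))"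
      by (rule has_bochner_integral_add[OF inner tail])
    moreover have "(\<lambda>h. indicator {0<..<u} h * (qk h * (u ^ i - (u - h) ^ i)) + u ^ i * (qk h * indicator {u..} h)) =
        (\<lambda>h. qk h * indicator {0<..} h * (u ^ i - tpow 0 i (u - h)))"
      using u by (auto simp: tpow_def indicator_def fun_eq_iff)
    moreover have "real i / G * ?Bv - u powr (real i - \<gamma>) / G + u ^ i * (u powr (- \<gamma>) / Gamma (1 - \<gamma>)) =
        (real i + 1 - \<gamma>) * Beta (real i + 1) (1 - \<gamma>) / Gamma (1 - \<gamma>) * u powr (real i - \<gamma>)"
    proof -
      \<comment> \<open>The recurrence of the Beta function in its first argument relates B(i,
        1-\<gamma>), which comes from the integration by parts, to the stated B(i+1,
        1-\<gamma>).\<close>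
      have "(real i + (1 - \<gamma>)) * Beta (real i + 1) (1 - \<gamma>) = real i * Beta (real i) (1 - \<gamma>)"
        using False g1 by (intro Beta_plus1_left) (auto elim!: nonpos_Ints_cases)
      then have "(real i + 1 - \<gamma>) * Beta (real i + 1) (1 - \<gamma>) = real i * Beta (1 - \<gamma>) (real i)"
        by (simp add: Beta_commute add_diff_eq)
      then show ?thesis using up by (simp add: G_def[symmetric] field_simps)
    qed
    ultimately show ?thesis by simp
  qed
qed

text \<open>The derivative is a multiple of the truncated power of exponent i - \<gamma>. Truncated
  powers are increasing, so every Marchaud integrand is nonnegative and the cut-off integrals lie
  between 0 and the full one: the derivative is its own majorant.\<close>

lemma frac_ok_tpow:
  assumes c: "0 \<le> c"
  shows "\<exists>g. frac_ok T (tpow c i) g"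
proof (cases "0 < T")
  case False
  show ?thesis
  proof (rule exI[of _ "\<lambda>_. 0"])
    \<comment> \<open>For T \<le> 0 the time interval is empty, and the truncated power is still
      zero at every t < T.\<close>
    have "\<bar>tpow c i t\<bar> \<le> 0" if "t < T" for t using that False c by (simp add: tpow_def)
    then show "frac_ok T (tpow c i) (\<lambda>_. 0)"
      using False c by (auto simp: frac_ok_def tpow_def is_distr_deriv_def loc_integrable_def set_integrable_def set_lebesgue_integral_def
        intro!: exI[of _ 0])
  qed
next
  case T: True
  define K where "K = Beta (real i + 1) (1 - \<gamma>) / Gamma (1 - \<gamma>)"
  define g where "g t = (if c < t then (real i + 1 - \<gamma>) * K * (t - c) powr (real i - \<gamma>) else 0)" for t
  have Kpos: "0 < K" 
  proof -
    have "0 < Beta (real i + 1) (1 - \<gamma>)"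
      unfolding Beta_def using g1 by (intro divide_pos_pos mult_pos_pos Gamma_real_pos) auto
    then show ?thesis unfolding K_def by (rule divide_pos_pos[OF _ Gamma_pos])
  qed
  have [measurable]: "g \<in> borel_measurable borel" unfolding g_def[abs_def] by measurable
  have gint: "set_integrable lborel {0<..<T} g"
  proof -
    have "integrable lborel (\<lambda>x. (real i + 1 - \<gamma>) * K * (indicator {c<..<T} x * (x - c) powr (real i - \<gamma>)))"
      by (intro integrable_mult_right powr_shift_integrable) (use g1 in auto)
    moreover have "(\<lambda>x. (real i + 1 - \<gamma>) * K * (indicator {c<..<T} x * (x - c) powr (real i - \<gamma>))) = (\<lambda>x. indicator {0<..<T} x *\<^sub>R g x)"
      using c by (auto simp: g_def indicator_def fun_eq_iff)
    ultimately show ?thesis by (simp add: set_integrable_def)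
  qed
  have dd: "is_distr_deriv 0 T (frac_int (1 - \<gamma>) (tpow c i)) g"
  \<comment> \<open>The fractional integral is continuous at c since its exponent i + 1 - \<gamma>
    is positive, although its derivative is unbounded there for i = 0.\<close>
  proof (rule is_distr_deriv_FTC[where S="{c}"])
    have F: "frac_int (1 - \<gamma>) (tpow c i) = (\<lambda>t. K * (max 0 (t - c)) powr (real i + 1 - \<gamma>))"
      using c by (auto simp: frac_int_tpow K_def max_def)
    show "continuous_on {0<..<T} (frac_int (1 - \<gamma>) (tpow c i))"
      unfolding F using g1 by (intro continuous_intros continuous_on_powr') auto
    show "(frac_int (1 - \<gamma>) (tpow c i) has_real_derivative g x) (at x)" if "x \<in> {0<..<T} - {c}" for x
    proof (cases "c < x")
      case True
      have "((\<lambda>t. K * (t - c) powr (real i + 1 - \<gamma>)) has_real_derivative g x) (at x)"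
        using True by (auto intro!: derivative_eq_intros simp: g_def diff_diff_eq algebra_simps)
      then show ?thesis
        by (rule has_field_derivative_transform_within_open[where S="{c<..}"]) (use True c in \<open>auto simp: frac_int_tpow K_def\<close>)
    next
      case False
      then have x: "x < c" using that by auto
      have "((\<lambda>t. 0) has_real_derivative g x) (at x)" using x by (simp add: g_def)
      then show ?thesis
        by (rule has_field_derivative_transform_within_open[where S="{..<c}"]) (use x c in \<open>auto simp: frac_int_tpow\<close>)
    qed
    have "set_integrable lebesgue {0<..<T} g" using gint unfolding set_integrable_def by (simp add: integrable_completion)
    then show "loc_integrable 0 T g" unfolding loc_integrable_def by (auto intro: set_integrable_subset)
  qed (use T in auto)
  have G: "\<bar>Gt \<epsilon> (tpow c i) t\<bar> \<le> g t" "(\<lambda>k. Gt (1 / Suc k) (tpow c i) t) \<longlonglongrightarrow> g t" if e: "\<epsilon> > 0" for \<epsilon> t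
  proof -
    have main: "(\<forall>\<epsilon>>0. \<bar>Gt \<epsilon> (tpow c i) t\<bar> \<le> g t) \<and> (\<lambda>k. Gt (1 / Suc k) (tpow c i) t) \<longlonglongrightarrow> g t"
    proof (cases "c < t")
      case False
      have "Gt \<epsilon> (tpow c i) t = 0" if "\<epsilon> > 0" for \<epsilon>
      proof -
        have "(\<lambda>h. qk h * indicator {\<epsilon>..} h * tpow c i (t - h)) = (\<lambda>h. 0)"
          using False that by (auto simp: tpow_def indicator_def)
        moreover have "tpow c i t = 0" using False by (simp add: tpow_def)
        ultimately show ?thesis by (simp add: Gt_def)
      qed
      then show ?thesis using False by (simp add: g_def)
    next
      case True
      define u where "u = t - c"
      have u: "0 < u" using True by (simp add: u_def)
      define w where "w h = u ^ i - tpow 0 i (u - h)" for h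
      have w: "tpow c i (t - h) = u ^ i - w h" for h by (auto simp: w_def tpow_def u_def algebra_simps)
      have [measurable]: "w \<in> borel_measurable borel" unfolding w_def[abs_def] by measurable
      have w0: "0 \<le> w h" if "0 < h" for h
        using tpow_mono[of "u - h" u 0 i] that u by (simp add: w_def tpow_def split: if_splits)
      have HB: "has_bochner_integral lborel (\<lambda>h. qk h * indicator {0<..} h * w h) (g t)"
        using Marchaud_power[OF u, of i] True by (simp add: w_def g_def K_def u_def)
      have Gw: "Gt \<epsilon> (tpow c i) t = (LINT h|lborel. qk h * indicator {\<epsilon>..} h * w h)"
        and iw: "integrable lborel (\<lambda>h. qk h * indicator {\<epsilon>..} h * w h)" if e: "\<epsilon> > 0" for \<epsilon>
      proof -
        have i1: "integrable lborel (\<lambda>h. qk h * indicator {\<epsilon>..} h * tpow c i (t - h))"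
          by (rule integrable_qk_bounded[where M="tpow c i t"]) (use e tpow_mono tpow_nonneg in auto)
        have i2: "integrable lborel (\<lambda>h. u ^ i * (qk h * indicator {\<epsilon>..} h))" using qk_integral(1)[OF e] by simp
        have eq: "(\<lambda>h. qk h * indicator {\<epsilon>..} h * w h) = (\<lambda>h. u ^ i * (qk h * indicator {\<epsilon>..} h) - qk h * indicator {\<epsilon>..} h * tpow c i (t - h))"
          by (auto simp: w algebra_simps)
        show "integrable lborel (\<lambda>h. qk h * indicator {\<epsilon>..} h * w h)" unfolding eq by (intro Bochner_Integration.integrable_diff i1 i2)
        have "tpow c i t = u ^ i" using True by (simp add: tpow_def u_def)
        then show "Gt \<epsilon> (tpow c i) t = (LINT h|lborel. qk h * indicator {\<epsilon>..} h * w h)"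
          unfolding eq using i1 i2 qk_integral(2)[OF e] by (simp add: Gt_def)
      qed
      have le: "\<bar>Gt \<epsilon> (tpow c i) t\<bar> \<le> g t" if e: "\<epsilon> > 0" for \<epsilon>
      proof -
        have "0 \<le> Gt \<epsilon> (tpow c i) t" unfolding Gw[OF e]
          using w0 qk_nonneg e by (intro Bochner_Integration.integral_nonneg) (auto simp: indicator_def)
        moreover have "Gt \<epsilon> (tpow c i) t \<le> (LINT h|lborel. qk h * indicator {0<..} h * w h)" unfolding Gw[OF e]
          using iw[OF e] HB w0 qk_nonneg e by (intro integral_mono) (auto simp: has_bochner_integral_iff indicator_def)
        ultimately show ?thesis using HB by (simp add: has_bochner_integral_iff)
      qed
      have "(\<lambda>k. LINT h|lborel. qk h * indicator {1 / real (Suc k)..} h * w h) \<longlonglongrightarrow> (LINT h|lborel. qk h * indicator {0<..} h * w h)"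
      proof (rule integral_dominated_convergence)
        show "integrable lborel (\<lambda>h. qk h * indicator {0<..} h * w h)" using HB by (simp add: has_bochner_integral_iff)
        show "AE h in lborel. norm (qk h * indicator {1 / real (Suc k)..} h * w h) \<le> qk h * indicator {0<..} h * w h" for k
        proof (rule AE_I2)
          fix h
          have "0 < h" if "1 / real (Suc k) \<le> h" using that less_le_trans[of 0 "1 / real (Suc k)" h] by simp
          then show "norm (qk h * indicator {1 / real (Suc k)..} h * w h) \<le> qk h * indicator {0<..} h * w h"
            using w0[of h] qk_nonneg[of h] by (auto simp: indicator_def)
        qed
        show "AE h in lborel. (\<lambda>k. qk h * indicator {1 / real (Suc k)..} h * w h) \<longlonglongrightarrow> qk h * indicator {0<..} h * w h"
        proof (rule AE_I2)
          fix h
          show "(\<lambda>k. qk h * indicator {1 / real (Suc k)..} h * w h) \<longlonglongrightarrow> qk h * indicator {0<..} h * w h"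
          proof (rule Lim_transform_eventually[OF tendsto_const])
            show "\<forall>\<^sub>F k in sequentially. qk h * indicator {0<..} h * w h = qk h * indicator {1 / real (Suc k)..} h * w h"
              using eventually_inverse_Suc_le[of h] by eventually_elim (simp add: indicator_def)
          qed
        qed
      qed auto
      then have "(\<lambda>k. Gt (1 / Suc k) (tpow c i) t) \<longlonglongrightarrow> g t"
        using HB by (simp add: Gw has_bochner_integral_iff)
      then show ?thesis using le by blast
    qed
    then show "\<bar>Gt \<epsilon> (tpow c i) t\<bar> \<le> g t" "(\<lambda>k. Gt (1 / Suc k) (tpow c i) t) \<longlonglongrightarrow> g t" using e by auto
  qed
  have "\<bar>tpow c i t\<bar> \<le> tpow c i T" if "t < T" for t using tpow_mono[of t T c i] tpow_nonneg[of c i t] that by simp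
  moreover have "\<forall>t\<le>0. tpow c i t = 0" using c by (auto simp: tpow_def)
  ultimately have "frac_ok T (tpow c i) g"
    unfolding frac_ok_def using dd gint G(1) G(2)[of 1] by (intro conjI exI[of _ "tpow c i T"] exI[of _ g]) auto
  then show ?thesis by blast
qed

lemma frac_ok_sum:
  assumes "finite I" "\<And>i. i \<in> I \<Longrightarrow> frac_ok T (v i) (g i)"
  shows "frac_ok T (\<lambda>t. \<Sum>i\<in>I. c i * v i t) (\<lambda>t. \<Sum>i\<in>I. c i * g i t)"
  using assms
proof (induction I)
  case empty then show ?case using frac_ok_zero by simp
next
  case (insert i I)
  then have "frac_ok T (v i) (g i)" "frac_ok T (\<lambda>t. \<Sum>i\<in>I. c i * v i t) (\<lambda>t. \<Sum>i\<in>I. c i * g i t)" by auto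
  from frac_ok_lincomb[OF this, of "c i" 1] show ?case using insert(1,2) by simp
qed

lemma frac_ok_poly_after:
  assumes "0 \<le> c"
  shows "\<exists>g. frac_ok T (\<lambda>t. if c < t then poly p t else 0) g"
proof -
  \<comment> \<open>The Taylor shift to c: the coefficients of this polynomial are the weights of
    the truncated powers at c.\<close>
  let ?q = "pcompose p [:c, 1:]"
  have "(if c < t then poly p t else 0) = (\<Sum>i\<le>degree ?q. coeff ?q i * tpow c i t)" for t
  proof -
    have "poly p t = poly ?q (t - c)" by (simp add: poly_pcompose)
    also have "\<dots> = (\<Sum>i\<le>degree ?q. coeff ?q i * (t - c) ^ i)" by (rule poly_altdef)
    finally show ?thesis by (simp add: tpow_def)
  qed
  then have "(\<lambda>t. if c < t then poly p t else 0) = (\<lambda>t. \<Sum>i\<le>degree ?q. coeff ?q i * tpow c i t)" by auto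
  moreover obtain g where "\<And>i. frac_ok T (tpow c i) (g i)" using frac_ok_tpow[OF assms] by metis
  ultimately show ?thesis using frac_ok_sum[of "{..degree ?q}" T "tpow c" g "coeff ?q"] by auto
qed

lemma frac_ok_poly_piece:
  assumes "0 \<le> c" "c \<le> d"
  shows "\<exists>g. frac_ok T (\<lambda>t. indicator {c<..d} t * poly p t) g"
proof -
  obtain g1 g2 where "frac_ok T (\<lambda>t. if c < t then poly p t else 0) g1" "frac_ok T (\<lambda>t. if d < t then poly p t else 0) g2"
    using frac_ok_poly_after assms by (meson order_trans)
  from frac_ok_lincomb[OF this, of 1 "-1"]
  have "frac_ok T (\<lambda>t. 1 * (if c < t then poly p t else 0) + (-1) * (if d < t then poly p t else 0)) (\<lambda>t. 1 * g1 t + (-1) * g2 t)" .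
  moreover have "(\<lambda>t. 1 * (if c < t then poly p t else 0) + (-1) * (if d < t then poly p t else 0)) = (\<lambda>t. indicator {c<..d} t * poly p t)"
    using assms by (auto simp: indicator_def fun_eq_iff)
  ultimately show ?thesis by auto
qed

text \<open>\<open>frac_deriv\<close> is an arbitrary choice among weak derivatives, determined up
  to a null set. The fractional integral ignores null sets, so v itself may also be changed on one,
  for instance at the time nodes.\<close>

lemma frac_deriv_AE:
  assumes ok: "frac_ok T v g" and ae: "AE t in lebesgue. t \<in> {0<..<T} \<longrightarrow> v' t = v t"
  shows "AE t in lebesgue. t \<in> {0<..<T} \<longrightarrow> frac_deriv T \<gamma> v' t = g t"
proof -
  have "frac_int (1 - \<gamma>) v t = frac_int (1 - \<gamma>) v' t" if "t \<in> {0<..<T}" for t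
  proof -
    have "AE s in lebesgue. s \<in> {0<..<t} \<longrightarrow> (t - s) powr (1 - \<gamma> - 1) * v s = (t - s) powr (1 - \<gamma> - 1) * v' s"
      using ae by (rule AE_mp) (use that in \<open>auto intro!: AE_I2\<close>)
    from set_integral_cong_AE'[OF this] show ?thesis by (simp add: frac_int_def)
  qed
  then have "is_distr_deriv 0 T (frac_int (1 - \<gamma>) v') g"
    using ok unfolding frac_ok_def by (elim conjE is_distr_deriv_cong) (auto intro!: AE_I2)
  then show ?thesis unfolding frac_deriv_def by (rule distr_deriv_eq)
qed

end

subsection \<open>The Fourier seminorm\<close>

text \<open>The transform without its normalisation and over Borel measure, where products of
  measures and Fubini's theorem are at hand.\<close>

definition four_int :: "(real \<Rightarrow> real) \<Rightarrow> real \<Rightarrow> complex" where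
  "four_int w \<xi> = (LINT t|lborel. exp (- \<i> * complex_of_real (\<xi> * t)) * complex_of_real (w t))"

lemma fourier_borel:
  assumes "w \<in> borel_measurable borel"
  shows "fourier w \<xi> = four_int w \<xi> / complex_of_real (sqrt (2 * pi))"
proof -
  have [measurable]: "w \<in> borel_measurable borel" by fact
  have "(\<lambda>t. exp (- \<i> * complex_of_real (\<xi> * t)) * complex_of_real (w t)) \<in> borel_measurable lborel"
    by (intro borel_measurable_times borel_measurable_continuous_onI continuous_intros) auto
  then show ?thesis by (simp add: fourier_def four_int_def integral_completion)
qed

lemma four_int_integrable:
  assumes "integrable lborel w"
  shows "integrable lborel (\<lambda>t. exp (- \<i> * complex_of_real (\<xi> * t)) * complex_of_real (w t))"
proof (rule Bochner_Integration.integrable_bound[OF assms])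
  have [measurable]: "w \<in> borel_measurable borel" using assms by auto
  show "(\<lambda>t. exp (- \<i> * complex_of_real (\<xi> * t)) * complex_of_real (w t)) \<in> borel_measurable lborel"
    by (intro borel_measurable_times borel_measurable_continuous_onI continuous_intros) auto
qed (simp add: norm_mult)

lemma four_int_lincomb:
  assumes "integrable lborel u" "integrable lborel v"
  shows "four_int (\<lambda>t. r * u t + s * v t) \<xi> = complex_of_real r * four_int u \<xi> + complex_of_real s * four_int v \<xi>"
proof -
  have "(\<lambda>t. exp (- \<i> * complex_of_real (\<xi> * t)) * complex_of_real (r * u t + s * v t)) =
      (\<lambda>t. complex_of_real r * (exp (- \<i> * complex_of_real (\<xi> * t)) * complex_of_real (u t)) +
           complex_of_real s * (exp (- \<i> * complex_of_real (\<xi> * t)) * complex_of_real (v t)))"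
    by (auto simp: algebra_simps)
  then show ?thesis unfolding four_int_def
    using four_int_integrable[OF assms(1), of \<xi>] four_int_integrable[OF assms(2), of \<xi>] by simp
qed

lemma four_int_measurable [measurable]:
  assumes [measurable]: "w \<in> borel_measurable borel"
  shows "four_int w \<in> borel_measurable borel"
proof -
  have "(\<lambda>p::real \<times> real. exp (- \<i> * complex_of_real (fst p * snd p))) \<in> borel_measurable borel"
    by (intro borel_measurable_continuous_onI continuous_intros)
  then have "(\<lambda>p::real \<times> real. exp (- \<i> * complex_of_real (fst p * snd p))) \<in> borel_measurable (borel \<Otimes>\<^sub>M lborel)"
    by (simp add: borel_prod cong: measurable_cong_sets)
  then have "(\<lambda>(\<xi>, t). exp (- \<i> * complex_of_real (\<xi> * t)) * complex_of_real (w t)) \<in> borel_measurable (borel \<Otimes>\<^sub>M lborel)"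
    by (simp add: split_beta') measurable
  then show ?thesis unfolding four_int_def[abs_def] by (rule lborel.borel_measurable_lebesgue_integral)
qed

lemma four_int_parts:
  assumes "integrable lborel w"
  shows "Re (four_int w \<xi>) = (LINT t|lborel. cos (\<xi> * t) * w t)" "Im (four_int w \<xi>) = - (LINT t|lborel. sin (\<xi> * t) * w t)"
    "integrable lborel (\<lambda>t. cos (\<xi> * t) * w t)" "integrable lborel (\<lambda>t. sin (\<xi> * t) * w t)"
proof -
  note i = four_int_integrable[OF assms, of \<xi>]
  have e: "Re (exp (- \<i> * complex_of_real (\<xi> * t)) * complex_of_real (w t)) = cos (\<xi> * t) * w t"
    "Im (exp (- \<i> * complex_of_real (\<xi> * t)) * complex_of_real (w t)) = - (sin (\<xi> * t) * w t)" for t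
    by (simp_all add: Re_exp Im_exp)
  show "Re (four_int w \<xi>) = (LINT t|lborel. cos (\<xi> * t) * w t)"
    unfolding four_int_def by (subst integral_Re[OF i, symmetric]) (simp only: e)
  show "Im (four_int w \<xi>) = - (LINT t|lborel. sin (\<xi> * t) * w t)"
    unfolding four_int_def by (subst integral_Im[OF i, symmetric]) (simp only: e integral_minus)
  show "integrable lborel (\<lambda>t. cos (\<xi> * t) * w t)" using integrable_Re[OF i] by (simp only: e)
  show "integrable lborel (\<lambda>t. sin (\<xi> * t) * w t)" 
    using Bochner_Integration.integrable_minus[OF integrable_Im[OF i]] by (simp only: e minus_minus)
qed

lemma integral_pair_mult:
  fixes f g :: "real \<Rightarrow> real"
  assumes "integrable lborel f" "integrable lborel g"
  shows "(LINT p|(lborel \<Otimes>\<^sub>M lborel). f (fst p) * g (snd p)) = (LINT x|lborel. f x) * (LINT y|lborel. g y)"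
  using lborel_pair.integral_fst'[OF integrable_lborel_pair_mult[OF assms]] by (simp add: split_beta')

text \<open>The cosine addition theorem merges the squares of real and imaginary parts into one
  double integral. In this form a Gaussian average over \<xi> can be carried out explicitly.\<close>

lemma norm_four_int_square:
  assumes w: "integrable lborel w"
  shows "(cmod (four_int w \<xi>))\<^sup>2 = (LINT p|(lborel \<Otimes>\<^sub>M lborel). cos (\<xi> * (fst p - snd p)) * (w (fst p) * w (snd p)))"
proof -
  note pt = four_int_parts[OF w, of \<xi>]
  have "(cmod (four_int w \<xi>))\<^sup>2 = (LINT t|lborel. cos (\<xi> * t) * w t) * (LINT t|lborel. cos (\<xi> * t) * w t) +
      (LINT t|lborel. sin (\<xi> * t) * w t) * (LINT t|lborel. sin (\<xi> * t) * w t)"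
    unfolding cmod_power2 pt(1,2) by (simp add: power2_eq_square)
  also have "\<dots> = (LINT p|(lborel \<Otimes>\<^sub>M lborel). (cos (\<xi> * fst p) * w (fst p)) * (cos (\<xi> * snd p) * w (snd p))) +
      (LINT p|(lborel \<Otimes>\<^sub>M lborel). (sin (\<xi> * fst p) * w (fst p)) * (sin (\<xi> * snd p) * w (snd p)))"
    by (simp only: integral_pair_mult[OF pt(3,3)] integral_pair_mult[OF pt(4,4)])
  also have "\<dots> = (LINT p|(lborel \<Otimes>\<^sub>M lborel). (cos (\<xi> * fst p) * w (fst p)) * (cos (\<xi> * snd p) * w (snd p)) +
      (sin (\<xi> * fst p) * w (fst p)) * (sin (\<xi> * snd p) * w (snd p)))"
    using integrable_lborel_pair_mult[OF pt(3,3)] integrable_lborel_pair_mult[OF pt(4,4)]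
    by (intro Bochner_Integration.integral_add[symmetric]) (simp_all add: split_beta')
  also have "\<dots> = (LINT p|(lborel \<Otimes>\<^sub>M lborel). cos (\<xi> * (fst p - snd p)) * (w (fst p) * w (snd p)))"
    by (intro Bochner_Integration.integral_cong) (auto simp: right_diff_distrib cos_diff algebra_simps)
  finally show ?thesis .
qed

section \<open>Plancherel's inequality by Gaussian regularisation\<close>

lemma std_normal_cos: "(LINT \<eta>|std_normal_distribution. cos (\<eta> * x)) = exp (- x\<^sup>2 / 2)"
proof -
  interpret N: real_distribution std_normal_distribution by (rule real_dist_normal_dist)
  have "complex_of_real (exp (- x\<^sup>2 / 2)) = (CLINT \<eta>|std_normal_distribution. iexp (x * \<eta>))"
    using fun_cong[OF char_std_normal_distribution, of x] by (simp add: char_def)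
  then have "exp (- x\<^sup>2 / 2) = Re (CLINT \<eta>|std_normal_distribution. iexp (x * \<eta>))" by (metis Re_complex_of_real)
  also have "\<dots> = (LINT \<eta>|std_normal_distribution. Re (iexp (x * \<eta>)))"
    by (rule integral_Re[symmetric]) (rule N.integrable_iexp, auto)
  finally show ?thesis by (simp add: Re_exp mult.commute)
qed

lemma nn_integral_gauss:
  assumes s: "0 < \<sigma>"
  shows "(\<integral>\<^sup>+t. ennreal (exp (- ((s - t) / \<sigma>)\<^sup>2 / 2)) \<partial>lborel) = ennreal (\<sigma> * sqrt (2 * pi))"
proof -
  have "(\<integral>\<^sup>+t. ennreal (exp (- ((s - t) / \<sigma>)\<^sup>2 / 2)) \<partial>lborel) = (\<integral>\<^sup>+t. ennreal (\<sigma> * sqrt (2 * pi)) * ennreal (normal_density s \<sigma> t) \<partial>lborel)"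
  proof (rule nn_integral_cong)
    fix t
    have "exp (- ((s - t) / \<sigma>)\<^sup>2 / 2) = (\<sigma> * sqrt (2 * pi)) * normal_density s \<sigma> t"
      using s by (simp add: normal_density_def real_sqrt_mult power_divide power2_commute[of s t])
    then show "ennreal (exp (- ((s - t) / \<sigma>)\<^sup>2 / 2)) = ennreal (\<sigma> * sqrt (2 * pi)) * ennreal (normal_density s \<sigma> t)"
      using s by (simp add: ennreal_mult)
  qed
  also have "\<dots> = ennreal (\<sigma> * sqrt (2 * pi)) * (\<integral>\<^sup>+t. ennreal (normal_density s \<sigma> t) \<partial>lborel)"
    by (rule nn_integral_cmult) auto
  also have "(\<integral>\<^sup>+t. ennreal (normal_density s \<sigma> t) \<partial>lborel) = 1"
    using nn_integral_eq_integral[of lborel "normal_density s \<sigma>"] s by simp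
  finally show ?thesis by simp
qed

text \<open>
  With the Gaussian weight, the double integral of $w(s)w(t)$ is against the positive kernel
  $e^{-(s-t)^2/2\sigma^2}$, and $2w(s)w(t) \le w(s)^2 + w(t)^2$.
\<close>

lemma Plancherel_gauss:
  assumes w: "integrable lborel w" and s: "0 < \<sigma>"
  shows "(\<integral>\<^sup>+\<xi>. ennreal ((cmod (four_int w \<xi>))\<^sup>2 * exp (- (\<sigma> * \<xi>)\<^sup>2 / 2)) \<partial>lborel) \<le> ennreal (2 * pi) * (\<integral>\<^sup>+t. ennreal ((w t)\<^sup>2) \<partial>lborel)"
proof -
  interpret N: real_distribution std_normal_distribution by (rule real_dist_normal_dist)
  have [measurable]: "w \<in> borel_measurable borel" using w by auto
  let ?P = "lborel \<Otimes>\<^sub>M lborel :: (real \<times> real) measure"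
  let ?f = "\<lambda>\<eta> p. cos (\<eta> / \<sigma> * (fst p - snd p)) * (w (fst p) * w (snd p))"
  have ww: "integrable ?P (\<lambda>p. w (fst p) * w (snd p))"
    using integrable_lborel_pair_mult[OF w w] by (simp add: split_beta')
  interpret NP: pair_sigma_finite std_normal_distribution ?P
    by (intro pair_sigma_finite.intro N.sigma_finite_measure_axioms lborel_pair.P.sigma_finite_measure_axioms)
  have fm: "(\<lambda>(\<eta>, p). ?f \<eta> p) \<in> borel_measurable (std_normal_distribution \<Otimes>\<^sub>M ?P)"
  proof -
    have "(\<lambda>(\<eta>::real, p). ?f \<eta> p) \<in> borel_measurable (borel \<Otimes>\<^sub>M (borel \<Otimes>\<^sub>M borel))" by (simp add: split_beta') measurable
    then show ?thesis by (simp cong: measurable_cong_sets sets_pair_measure_cong)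
  qed
  have fb: "norm (?f \<eta> p) \<le> norm (w (fst p) * w (snd p))" for \<eta> p
    using abs_cos_le_one[of "\<eta> / \<sigma> * (fst p - snd p)"] by (simp add: abs_mult mult_left_le_one_le)
  have fi: "integrable ?P (?f \<eta>)" for \<eta>
  proof (rule Bochner_Integration.integrable_bound[OF ww])
    show "?f \<eta> \<in> borel_measurable ?P"
      using measurable_compose[OF measurable_Pair1' fm, of \<eta>] by simp
  qed (use fb in auto)
  have int: "integrable (std_normal_distribution \<Otimes>\<^sub>M ?P) (\<lambda>(\<eta>, p). ?f \<eta> p)"
  proof (rule NP.Fubini_integrable[OF fm])
    have fnm: "(\<lambda>\<eta>. LINT p|?P. norm (?f \<eta> p)) \<in> borel_measurable std_normal_distribution"
      by (rule lborel_pair.P.borel_measurable_lebesgue_integral) (use measurable_compose[OF fm borel_measurable_norm] in \<open>simp add: split_beta'\<close>)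
    show "integrable std_normal_distribution (\<lambda>\<eta>. LINT p|?P. norm (case (\<eta>, p) of (\<eta>, p) \<Rightarrow> ?f \<eta> p))"
    proof (rule N.integrable_const_bound[where B="LINT p|?P. norm (w (fst p) * w (snd p))"])
      show "AE \<eta> in std_normal_distribution. norm (LINT p|?P. norm (case (\<eta>, p) of (\<eta>, p) \<Rightarrow> ?f \<eta> p)) \<le> (LINT p|?P. norm (w (fst p) * w (snd p)))"
      proof (rule AE_I2)
        fix \<eta>
        have "(LINT p|?P. norm (?f \<eta> p)) \<le> (LINT p|?P. norm (w (fst p) * w (snd p)))"
          by (intro integral_mono integrable_norm fi ww fb)
        moreover have "0 \<le> (LINT p|?P. norm (?f \<eta> p))" by (rule Bochner_Integration.integral_nonneg) simp
        ultimately show "norm (LINT p|?P. norm (case (\<eta>, p) of (\<eta>, p) \<Rightarrow> ?f \<eta> p)) \<le> (LINT p|?P. norm (w (fst p) * w (snd p)))" by simp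
      qed
    qed (use fnm in simp)
    show "AE \<eta> in std_normal_distribution. integrable ?P (\<lambda>p. case (\<eta>, p) of (\<eta>, p) \<Rightarrow> ?f \<eta> p)" using fi by simp
  qed
  let ?I = "LINT p|?P. exp (- ((fst p - snd p) / \<sigma>)\<^sup>2 / 2) * (w (fst p) * w (snd p))"
  \<comment> \<open>The argument \<eta>/\<sigma> anticipates the substitution that turns the
    Gaussian weight in \<xi> into the standard normal law in \<eta>.\<close>
  have cm: "(\<lambda>\<eta>. (cmod (four_int w (\<eta> / \<sigma>)))\<^sup>2) = (\<lambda>\<eta>. LINT p|?P. ?f \<eta> p)"
    by (rule ext) (rule norm_four_int_square[OF w])
  have eqI: "(LINT \<eta>|std_normal_distribution. (cmod (four_int w (\<eta> / \<sigma>)))\<^sup>2) = ?I"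
  proof -
    have "(LINT \<eta>|std_normal_distribution. (cmod (four_int w (\<eta> / \<sigma>)))\<^sup>2) = (LINT p|?P. LINT \<eta>|std_normal_distribution. ?f \<eta> p)"
      unfolding cm by (rule NP.Fubini_integral[OF int, symmetric])
    also have "\<dots> = ?I"
    proof (rule Bochner_Integration.integral_cong[OF refl])
      fix p :: "real \<times> real"
      have "(LINT \<eta>|std_normal_distribution. ?f \<eta> p) = (LINT \<eta>|std_normal_distribution. cos (\<eta> * ((fst p - snd p) / \<sigma>))) * (w (fst p) * w (snd p))"
        by simp
      then show "(LINT \<eta>|std_normal_distribution. ?f \<eta> p) = exp (- ((fst p - snd p) / \<sigma>)\<^sup>2 / 2) * (w (fst p) * w (snd p))"
        unfolding std_normal_cos .
    qed
    finally show ?thesis .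
  qed
  have iN: "integrable std_normal_distribution (\<lambda>\<eta>. (cmod (four_int w (\<eta> / \<sigma>)))\<^sup>2)"
    unfolding cm using NP.integrable_fst[OF int] by simp
  have bound: "ennreal ?I \<le> ennreal (\<sigma> * sqrt (2 * pi)) * (\<integral>\<^sup>+t. ennreal ((w t)\<^sup>2) \<partial>lborel)"
  proof -
    let ?k = "\<lambda>x y. exp (- ((x - y) / \<sigma>)\<^sup>2 / 2)"
    have "ennreal ?I \<le> (\<integral>\<^sup>+p. ennreal (norm (?k (fst p) (snd p) * (w (fst p) * w (snd p)))) \<partial>?P)"
    proof -
      have "integrable ?P (\<lambda>p. ?k (fst p) (snd p) * (w (fst p) * w (snd p)))"
      proof (rule Bochner_Integration.integrable_bound[OF ww])
        show "AE p in ?P. norm (?k (fst p) (snd p) * (w (fst p) * w (snd p))) \<le> norm (w (fst p) * w (snd p))"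
          by (intro AE_I2) (simp add: abs_mult mult_left_le_one_le)
      qed measurable
      then have "norm ?I \<le> (\<integral>\<^sup>+p. ennreal (norm (?k (fst p) (snd p) * (w (fst p) * w (snd p)))) \<partial>?P)"
        by (rule integral_norm_bound_ennreal)
      moreover have "ennreal ?I \<le> ennreal (norm ?I)" by (rule ennreal_leI) simp
      ultimately show ?thesis by (rule order_trans[rotated])
    qed
    also have "\<dots> \<le> (\<integral>\<^sup>+p. (ennreal (1/2 * (w (fst p))\<^sup>2 * ?k (fst p) (snd p)) + ennreal (1/2 * (w (snd p))\<^sup>2 * ?k (snd p) (fst p))) \<partial>?P)"
    proof (rule nn_integral_mono)
      fix p :: "real \<times> real"
      have "norm (?k (fst p) (snd p) * (w (fst p) * w (snd p))) = ?k (fst p) (snd p) * (\<bar>w (fst p)\<bar> * \<bar>w (snd p)\<bar>)"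
        by (simp add: abs_mult)
      also have "\<bar>w (fst p)\<bar> * \<bar>w (snd p)\<bar> \<le> 1/2 * (w (fst p))\<^sup>2 + 1/2 * (w (snd p))\<^sup>2"
        using zero_le_power2[of "\<bar>w (fst p)\<bar> - \<bar>w (snd p)\<bar>"] by (simp add: power2_diff)
      finally have "norm (?k (fst p) (snd p) * (w (fst p) * w (snd p))) \<le> ?k (fst p) (snd p) * (1/2 * (w (fst p))\<^sup>2 + 1/2 * (w (snd p))\<^sup>2)"
        by simp
      also have "\<dots> = 1/2 * (w (fst p))\<^sup>2 * ?k (fst p) (snd p) + 1/2 * (w (snd p))\<^sup>2 * ?k (snd p) (fst p)"
      proof -
        have "((snd p - fst p) / \<sigma>)\<^sup>2 = ((fst p - snd p) / \<sigma>)\<^sup>2" by (simp add: power_divide power2_commute)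
        then show ?thesis by (simp add: algebra_simps)
      qed
      finally have le: "norm (?k (fst p) (snd p) * (w (fst p) * w (snd p))) \<le> 1/2 * (w (fst p))\<^sup>2 * ?k (fst p) (snd p) + 1/2 * (w (snd p))\<^sup>2 * ?k (snd p) (fst p)" .
      show "ennreal (norm (?k (fst p) (snd p) * (w (fst p) * w (snd p)))) \<le>
          ennreal (1/2 * (w (fst p))\<^sup>2 * ?k (fst p) (snd p)) + ennreal (1/2 * (w (snd p))\<^sup>2 * ?k (snd p) (fst p))"
        by (rule order_trans[OF ennreal_leI[OF le]], subst ennreal_plus) simp_all
    qed
    also have "\<dots> = (\<integral>\<^sup>+p. ennreal (1/2 * (w (fst p))\<^sup>2 * ?k (fst p) (snd p)) \<partial>?P) + (\<integral>\<^sup>+p. ennreal (1/2 * (w (snd p))\<^sup>2 * ?k (snd p) (fst p)) \<partial>?P)"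
      by (rule nn_integral_add) measurable
    also have "(\<integral>\<^sup>+p. ennreal (1/2 * (w (fst p))\<^sup>2 * ?k (fst p) (snd p)) \<partial>?P) =
        (\<integral>\<^sup>+x. \<integral>\<^sup>+y. ennreal (1/2 * (w x)\<^sup>2 * ?k x y) \<partial>lborel \<partial>lborel)"
      by (subst lborel.nn_integral_fst[symmetric]) simp_all
    also have "(\<integral>\<^sup>+p. ennreal (1/2 * (w (snd p))\<^sup>2 * ?k (snd p) (fst p)) \<partial>?P) =
        (\<integral>\<^sup>+x. \<integral>\<^sup>+y. ennreal (1/2 * (w x)\<^sup>2 * ?k x y) \<partial>lborel \<partial>lborel)"
      by (subst lborel_pair.nn_integral_snd[symmetric]) simp_all
    also have "(\<integral>\<^sup>+x. \<integral>\<^sup>+y. ennreal (1/2 * (w x)\<^sup>2 * ?k x y) \<partial>lborel \<partial>lborel) = (\<integral>\<^sup>+x. ennreal (1/2 * (\<sigma> * sqrt (2 * pi))) * ennreal ((w x)\<^sup>2) \<partial>lborel)"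
    proof (rule nn_integral_cong)
      fix x
      have "(\<integral>\<^sup>+y. ennreal (1/2 * (w x)\<^sup>2 * ?k x y) \<partial>lborel) = (\<integral>\<^sup>+y. ennreal (1/2 * (w x)\<^sup>2) * ennreal (?k x y) \<partial>lborel)"
        by (intro nn_integral_cong) (simp add: ennreal_mult[symmetric])
      also have "\<dots> = ennreal (1/2 * (w x)\<^sup>2) * ennreal (\<sigma> * sqrt (2 * pi))"
      proof -
        have "(\<lambda>y. ennreal (?k x y)) \<in> borel_measurable lborel" by measurable
        then show ?thesis by (simp only: nn_integral_cmult nn_integral_gauss[OF s])
      qed
      also have "\<dots> = ennreal (1/2 * (\<sigma> * sqrt (2 * pi))) * ennreal ((w x)\<^sup>2)"
        using s by (simp add: ennreal_mult[symmetric] mult_ac)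
      finally show "(\<integral>\<^sup>+y. ennreal (1/2 * (w x)\<^sup>2 * ?k x y) \<partial>lborel) = ennreal (1/2 * (\<sigma> * sqrt (2 * pi))) * ennreal ((w x)\<^sup>2)" .
    qed
    also have "\<dots> = ennreal (1/2 * (\<sigma> * sqrt (2 * pi))) * (\<integral>\<^sup>+t. ennreal ((w t)\<^sup>2) \<partial>lborel)"
      by (rule nn_integral_cmult) measurable
    also have "\<dots> + \<dots> = ennreal (\<sigma> * sqrt (2 * pi)) * (\<integral>\<^sup>+t. ennreal ((w t)\<^sup>2) \<partial>lborel)"
      using s by (simp add: distrib_right[symmetric] ennreal_plus[symmetric] del: ennreal_plus)
    finally show ?thesis .
  qed
  \<comment> \<open>Substituting \<xi> = \<eta>/\<sigma> gives a factor 1/\<sigma> and, from the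
    normal density, sqrt(2\<pi>). Together with the kernel mass \<sigma> sqrt(2\<pi>) from
    \<open>bound\<close> they multiply to 2\<pi>.\<close>
  have "(\<integral>\<^sup>+\<xi>. ennreal ((cmod (four_int w \<xi>))\<^sup>2 * exp (- (\<sigma> * \<xi>)\<^sup>2 / 2)) \<partial>lborel) =
      ennreal (1 / \<sigma>) * (\<integral>\<^sup>+\<eta>. ennreal ((cmod (four_int w (0 + (1 / \<sigma>) * \<eta>)))\<^sup>2 * exp (- (\<sigma> * (0 + (1 / \<sigma>) * \<eta>))\<^sup>2 / 2)) \<partial>lborel)"
    using s by (subst nn_integral_real_affine[where c="1 / \<sigma>" and t=0]) auto
  also have "(\<integral>\<^sup>+\<eta>. ennreal ((cmod (four_int w (0 + (1 / \<sigma>) * \<eta>)))\<^sup>2 * exp (- (\<sigma> * (0 + (1 / \<sigma>) * \<eta>))\<^sup>2 / 2)) \<partial>lborel) =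
      (\<integral>\<^sup>+\<eta>. ennreal (sqrt (2 * pi)) * (ennreal (std_normal_density \<eta>) * ennreal ((cmod (four_int w (\<eta> / \<sigma>)))\<^sup>2)) \<partial>lborel)"
  proof (rule nn_integral_cong)
    fix \<eta>
    have "(cmod (four_int w (0 + (1 / \<sigma>) * \<eta>)))\<^sup>2 * exp (- (\<sigma> * (0 + (1 / \<sigma>) * \<eta>))\<^sup>2 / 2) =
        sqrt (2 * pi) * (std_normal_density \<eta> * (cmod (four_int w (\<eta> / \<sigma>)))\<^sup>2)"
      using s by (simp add: std_normal_density_def)
    then show "ennreal ((cmod (four_int w (0 + (1 / \<sigma>) * \<eta>)))\<^sup>2 * exp (- (\<sigma> * (0 + (1 / \<sigma>) * \<eta>))\<^sup>2 / 2)) =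
        ennreal (sqrt (2 * pi)) * (ennreal (std_normal_density \<eta>) * ennreal ((cmod (four_int w (\<eta> / \<sigma>)))\<^sup>2))"
      by (simp add: ennreal_mult[symmetric])
  qed
  also have "\<dots> = ennreal (sqrt (2 * pi)) * (\<integral>\<^sup>+\<eta>. ennreal (std_normal_density \<eta>) * ennreal ((cmod (four_int w (\<eta> / \<sigma>)))\<^sup>2) \<partial>lborel)"
    by (rule nn_integral_cmult) measurable
  also have "(\<integral>\<^sup>+\<eta>. ennreal (std_normal_density \<eta>) * ennreal ((cmod (four_int w (\<eta> / \<sigma>)))\<^sup>2) \<partial>lborel) =
      (\<integral>\<^sup>+\<eta>. ennreal ((cmod (four_int w (\<eta> / \<sigma>)))\<^sup>2) \<partial>std_normal_distribution)"
    by (subst nn_integral_density) simp_all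
  also have "\<dots> = ennreal ?I"
    unfolding eqI[symmetric] by (rule nn_integral_eq_integral[OF iN]) simp
  finally have "(\<integral>\<^sup>+\<xi>. ennreal ((cmod (four_int w \<xi>))\<^sup>2 * exp (- (\<sigma> * \<xi>)\<^sup>2 / 2)) \<partial>lborel) = ennreal (1 / \<sigma>) * (ennreal (sqrt (2 * pi)) * ennreal ?I)" .
  also have "\<dots> \<le> ennreal (1 / \<sigma>) * (ennreal (sqrt (2 * pi)) * (ennreal (\<sigma> * sqrt (2 * pi)) * (\<integral>\<^sup>+t. ennreal ((w t)\<^sup>2) \<partial>lborel)))"
    by (intro mult_left_mono bound) auto
  also have "\<dots> = ennreal (1 / \<sigma> * (sqrt (2 * pi) * (\<sigma> * sqrt (2 * pi)))) * (\<integral>\<^sup>+t. ennreal ((w t)\<^sup>2) \<partial>lborel)"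
  proof -
    have "ennreal (1 / \<sigma> * (sqrt (2 * pi) * (\<sigma> * sqrt (2 * pi)))) = ennreal (1 / \<sigma>) * ennreal (sqrt (2 * pi) * (\<sigma> * sqrt (2 * pi)))"
      by (rule ennreal_mult) (use s in auto)
    also have "ennreal (sqrt (2 * pi) * (\<sigma> * sqrt (2 * pi))) = ennreal (sqrt (2 * pi)) * ennreal (\<sigma> * sqrt (2 * pi))"
      by (rule ennreal_mult) (use s in auto)
    finally show ?thesis by (simp only: mult.assoc)
  qed
  also have "1 / \<sigma> * (sqrt (2 * pi) * (\<sigma> * sqrt (2 * pi))) = 2 * pi" using s by simp
  finally show ?thesis .
qed

text \<open>For \<sigma> = 1/(k+1) the Gaussian weights increase to 1, so monotone convergence
  removes them from the uniform bound. This is the direction that bounds the Fourier side by the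
  energy.\<close>

lemma Plancherel_le:
  assumes w: "integrable lborel w"
  shows "(\<integral>\<^sup>+\<xi>. ennreal ((cmod (four_int w \<xi>))\<^sup>2) \<partial>lborel) \<le> ennreal (2 * pi) * (\<integral>\<^sup>+t. ennreal ((w t)\<^sup>2) \<partial>lborel)"
proof -
  have [measurable]: "w \<in> borel_measurable borel" using w by auto
  let ?F = "\<lambda>k \<xi>. ennreal ((cmod (four_int w \<xi>))\<^sup>2 * exp (- (1 / real (Suc k) * \<xi>)\<^sup>2 / 2))"
  have "(\<lambda>k. \<integral>\<^sup>+\<xi>. ?F k \<xi> \<partial>lborel) \<longlonglongrightarrow> (\<integral>\<^sup>+\<xi>. ennreal ((cmod (four_int w \<xi>))\<^sup>2) \<partial>lborel)"
  proof (rule nn_integral_LIMSEQ)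
    show "incseq ?F"
    proof (rule incseq_SucI, rule le_funI)
      fix k and \<xi> :: real
      have "\<bar>1 / real (Suc (Suc k)) * \<xi>\<bar> \<le> \<bar>1 / real (Suc k) * \<xi>\<bar>"
        by (simp add: abs_mult) (intro divide_left_mono, auto)
      then have "(1 / real (Suc (Suc k)) * \<xi>)\<^sup>2 \<le> (1 / real (Suc k) * \<xi>)\<^sup>2" by (simp only: abs_le_square_iff)
      then show "?F k \<xi> \<le> ?F (Suc k) \<xi>" by (intro ennreal_leI mult_left_mono) (auto simp del: of_nat_Suc)
    qed
    show "?F k \<in> borel_measurable lborel" for k by measurable
    show "(\<lambda>k. ?F k \<xi>) \<longlonglongrightarrow> ennreal ((cmod (four_int w \<xi>))\<^sup>2)" for \<xi>
    proof (rule tendsto_ennrealI)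
      have "(\<lambda>k. (cmod (four_int w \<xi>))\<^sup>2 * exp (- (1 / real (Suc k) * \<xi>)\<^sup>2 / 2)) \<longlonglongrightarrow> (cmod (four_int w \<xi>))\<^sup>2 * exp (- (0 * \<xi>)\<^sup>2 / 2)"
        by (intro tendsto_intros) (use LIMSEQ_inverse_real_of_nat in \<open>simp_all add: inverse_eq_divide\<close>)
      then show "(\<lambda>k. (cmod (four_int w \<xi>))\<^sup>2 * exp (- (1 / real (Suc k) * \<xi>)\<^sup>2 / 2)) \<longlonglongrightarrow> (cmod (four_int w \<xi>))\<^sup>2" by simp
    qed
  qed
  then show ?thesis by (rule LIMSEQ_le_const2) (intro exI[of _ 0] allI impI Plancherel_gauss[OF w], simp)
qed

text \<open>A shift by h multiplies the transform by exp(-i \<xi> h), and 2 - 2 cos(\<xi> h) is the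
  squared modulus of 1 - exp(-i \<xi> h).\<close>

lemma four_int_difference:
  assumes w: "integrable lborel w"
  shows "(cmod (four_int (\<lambda>t. w t - w (t - h)) \<xi>))\<^sup>2 = (2 - 2 * cos (\<xi> * h)) * (cmod (four_int w \<xi>))\<^sup>2"
proof -
  have sh: "integrable lborel (\<lambda>t. w (t - h))" using lborel_integrable_real_affine[OF w, of 1 "- h"] by simp
  have "four_int (\<lambda>t. w (t - h)) \<xi> = (LINT t|lborel. exp (- \<i> * complex_of_real (\<xi> * (h + 1 * t))) * complex_of_real (w (h + 1 * t - h)))"
    using lborel_integral_real_affine[of 1 "\<lambda>t. exp (- \<i> * complex_of_real (\<xi> * t)) * complex_of_real (w (t - h))" h]
    by (simp add: four_int_def)
  also have "\<dots> = (LINT t|lborel. exp (- \<i> * complex_of_real (\<xi> * h)) * (exp (- \<i> * complex_of_real (\<xi> * t)) * complex_of_real (w t)))"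
    by (simp add: distrib_left exp_add[symmetric] mult.assoc[symmetric])
  also have "\<dots> = exp (- \<i> * complex_of_real (\<xi> * h)) * four_int w \<xi>"
    unfolding four_int_def by (rule integral_mult_right_zero)
  finally have "four_int (\<lambda>t. 1 * w t + (-1) * w (t - h)) \<xi> = (1 - exp (- \<i> * complex_of_real (\<xi> * h))) * four_int w \<xi>"
    by (subst four_int_lincomb[OF w sh]) (simp add: algebra_simps)
  then have "(cmod (four_int (\<lambda>t. w t - w (t - h)) \<xi>))\<^sup>2 = (cmod (1 - exp (- \<i> * complex_of_real (\<xi> * h))))\<^sup>2 * (cmod (four_int w \<xi>))\<^sup>2"
    by (simp add: norm_mult power_mult_distrib)
  also have "(cmod (1 - exp (- \<i> * complex_of_real (\<xi> * h))))\<^sup>2 = 2 - 2 * cos (\<xi> * h)"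
  proof -
    have "(cmod (1 - exp (- \<i> * complex_of_real (\<xi> * h))))\<^sup>2 = (1 - cos (\<xi> * h))\<^sup>2 + (sin (\<xi> * h))\<^sup>2"
      by (simp add: cmod_power2 Re_exp Im_exp)
    also have "\<dots> = 1 - 2 * cos (\<xi> * h) + ((cos (\<xi> * h))\<^sup>2 + (sin (\<xi> * h))\<^sup>2)" by (simp add: power2_diff)
    finally show ?thesis by simp
  qed
  finally show ?thesis .
qed

context frac_order
begin

text \<open>On the window of h between 1/|\<xi>| and 2/|\<xi>|, this multiplies the kernel at the
  far end by the least value of 1 - cos(\<xi> h) and by the window length 1/|\<xi>|, with the
  resulting power |\<xi>|^\<gamma> split off.\<close>

definition cF :: real where "cF = \<gamma> * 2 powr (- \<gamma> - 1) * (1 - cos 1) / Gamma (1 - \<gamma>)"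

lemma cF_pos: "0 < cF"
proof -
  have "cos (1::real) < cos 0" by (rule cos_monotone_0_pi) (use pi_ge_two in auto)
  then show ?thesis using g0 Gamma_pos by (simp add: cF_def)
qed

text \<open>Only \<open>h\<close> between $1/|\xi|$ and $2/|\xi|$ is used, where $\cos(\xi h) \le \cos 1$.\<close>

lemma symbol_lower_bound:
  "ennreal (cF * \<bar>\<xi>\<bar> powr \<gamma>) \<le> (\<integral>\<^sup>+h. ennreal (qk h / 2) * indicator {0<..} h * ennreal (2 - 2 * cos (\<xi> * h)) \<partial>lborel)"
proof (cases "\<xi> = 0")
  case False
  define r where "r = \<bar>\<xi>\<bar>"
  have r: "0 < r" using False by (simp add: r_def)
  define K where "K = \<gamma> * (2 / r) powr (- \<gamma> - 1) / Gamma (1 - \<gamma>) * (1 - cos 1)"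
  have K0: "0 \<le> K" using g0 Gamma_pos by (simp add: K_def)
  have "ennreal (cF * \<bar>\<xi>\<bar> powr \<gamma>) = ennreal (K * (1 / r))"
  proof -
    have "(2 / r) powr (- \<gamma> - 1) * (1 / r) = 2 powr (- \<gamma> - 1) * r powr \<gamma>"
    proof -
      have "(2 / r) powr k = 2 powr k * r powr (- k)" for k
        using r powr_divide[of 2 r k] powr_minus_divide[of r k] by simp
      from this[of "- \<gamma> - 1"] have "(2 / r) powr (- \<gamma> - 1) = 2 powr (- \<gamma> - 1) * r powr (\<gamma> + 1)" by (simp add: add.commute)
      moreover have "r powr (\<gamma> + 1) = r powr \<gamma> * r" using r by (simp add: powr_add)
      ultimately show ?thesis using r by simp
    qed
    moreover have "K * (1 / r) = \<gamma> * ((2 / r) powr (- \<gamma> - 1) * (1 / r)) / Gamma (1 - \<gamma>) * (1 - cos 1)" by (simp add: K_def)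
    ultimately have "K * (1 / r) = \<gamma> * (2 powr (- \<gamma> - 1) * r powr \<gamma>) / Gamma (1 - \<gamma>) * (1 - cos 1)" by (simp only:)
    then have "K * (1 / r) = cF * r powr \<gamma>" unfolding cF_def by simp
    then show ?thesis by (simp add: r_def)
  qed
  also have "\<dots> = (\<integral>\<^sup>+h. ennreal K * indicator {1 / r..2 / r} h \<partial>lborel)"
  proof -
    have "2 / r - 1 / r = 1 / r" by (simp add: diff_divide_distrib[symmetric])
    then show ?thesis
      using r ennreal_mult[of K "1 / r"] K0 by (simp add: nn_integral_cmult_indicator divide_right_mono)
  qed
  also have "\<dots> \<le> (\<integral>\<^sup>+h. ennreal (qk h / 2) * indicator {0<..} h * ennreal (2 - 2 * cos (\<xi> * h)) \<partial>lborel)"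
  proof (rule nn_integral_mono)
    fix h
    show "ennreal K * indicator {1 / r..2 / r} h \<le> ennreal (qk h / 2) * indicator {0<..} h * ennreal (2 - 2 * cos (\<xi> * h))"
    proof (cases "h \<in> {1 / r..2 / r}")
      case True
      have h: "0 < h" using True r less_le_trans[of 0 "1 / r" h] by simp
      have rh: "1 \<le> r * h" "r * h \<le> 2" using True r by (auto simp: field_simps)
      have "cos (\<xi> * h) = cos (r * h)" by (cases "\<xi> \<ge> 0") (auto simp: r_def)
      \<comment> \<open>The window puts r h into [1, 2], where the cosine decreases because 2 \<le>
        \<pi>.\<close>
      also have "\<dots> \<le> cos 1" by (rule cos_monotone_0_pi_le) (use rh pi_ge_two in auto)
      finally have c: "1 - cos 1 \<le> 1 - cos (\<xi> * h)" by simp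
      have "(2 / r) powr (- \<gamma> - 1) \<le> h powr (- \<gamma> - 1)"
        by (rule powr_mono2') (use True h g0 in auto)
      then have "\<gamma> * (2 / r) powr (- \<gamma> - 1) / Gamma (1 - \<gamma>) \<le> qk h"
        unfolding qk_def using g0 Gamma_pos by (intro divide_right_mono mult_left_mono) auto
      then have "K \<le> qk h * (1 - cos (\<xi> * h))" unfolding K_def using c qk_nonneg by (intro mult_mono) auto
      also have "\<dots> = qk h / 2 * (2 - 2 * cos (\<xi> * h))" by simp
      finally have "ennreal K \<le> ennreal (qk h / 2 * (2 - 2 * cos (\<xi> * h)))" by (rule ennreal_leI)
      also have "\<dots> = ennreal (qk h / 2) * ennreal (2 - 2 * cos (\<xi> * h))"
        using qk_nonneg[of h] by (intro ennreal_mult) auto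
      finally show ?thesis using True h by simp
    qed simp
  qed
  finally show ?thesis .
qed simp

text \<open>For each h, Plancherel's inequality is applied to the increment of v. Tonelli moves the
  integral over h inside, where it becomes the symbol already bounded below by cF
  |\<xi>|^\<gamma>.\<close>

lemma fourier_energy:
  assumes v: "integrable lborel v"
  shows "ennreal cF * (\<integral>\<^sup>+\<xi>. ennreal (\<bar>\<xi>\<bar> powr \<gamma> * (cmod (fourier v \<xi>))\<^sup>2) \<partial>lebesgue) \<le> energy v"
proof -
  have [measurable]: "v \<in> borel_measurable borel" using v by auto
  have F: "(cmod (fourier v \<xi>))\<^sup>2 = (cmod (four_int v \<xi>))\<^sup>2 / (2 * pi)" for \<xi>
    by (simp add: fourier_borel norm_divide power_divide)
  let ?k = "\<lambda>h \<xi>. ennreal (qk h / 2) * indicator {0<..} h * ennreal (2 - 2 * cos (\<xi> * h)) * ennreal ((cmod (four_int v \<xi>))\<^sup>2 / (2 * pi))"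
  have km: "(\<lambda>(\<xi>, h). ?k h \<xi>) \<in> borel_measurable (lborel \<Otimes>\<^sub>M lborel)" by measurable
  have "ennreal cF * (\<integral>\<^sup>+\<xi>. ennreal (\<bar>\<xi>\<bar> powr \<gamma> * (cmod (fourier v \<xi>))\<^sup>2) \<partial>lebesgue) =
      ennreal cF * (\<integral>\<^sup>+\<xi>. ennreal (\<bar>\<xi>\<bar> powr \<gamma> * ((cmod (four_int v \<xi>))\<^sup>2 / (2 * pi))) \<partial>lborel)"
    unfolding F by (subst nn_integral_completion) simp_all
  also have "\<dots> = (\<integral>\<^sup>+\<xi>. ennreal cF * ennreal (\<bar>\<xi>\<bar> powr \<gamma> * ((cmod (four_int v \<xi>))\<^sup>2 / (2 * pi))) \<partial>lborel)"
    by (rule nn_integral_cmult[symmetric]) measurable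
  also have "\<dots> \<le> (\<integral>\<^sup>+\<xi>. \<integral>\<^sup>+h. ?k h \<xi> \<partial>lborel \<partial>lborel)"
  proof (rule nn_integral_mono)
    fix \<xi>
    have "ennreal cF * ennreal (\<bar>\<xi>\<bar> powr \<gamma> * ((cmod (four_int v \<xi>))\<^sup>2 / (2 * pi))) =
        ennreal (cF * \<bar>\<xi>\<bar> powr \<gamma>) * ennreal ((cmod (four_int v \<xi>))\<^sup>2 / (2 * pi))"
      using cF_pos by (simp add: ennreal_mult[symmetric] mult.assoc)
    also have "\<dots> \<le> (\<integral>\<^sup>+h. ennreal (qk h / 2) * indicator {0<..} h * ennreal (2 - 2 * cos (\<xi> * h)) \<partial>lborel) * ennreal ((cmod (four_int v \<xi>))\<^sup>2 / (2 * pi))"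
      by (intro mult_right_mono symbol_lower_bound) auto
    also have "\<dots> = (\<integral>\<^sup>+h. ?k h \<xi> \<partial>lborel)" by (rule nn_integral_multc[symmetric]) measurable
    finally show "ennreal cF * ennreal (\<bar>\<xi>\<bar> powr \<gamma> * ((cmod (four_int v \<xi>))\<^sup>2 / (2 * pi))) \<le> (\<integral>\<^sup>+h. ?k h \<xi> \<partial>lborel)" .
  qed
  also have "\<dots> = (\<integral>\<^sup>+h. \<integral>\<^sup>+\<xi>. ?k h \<xi> \<partial>lborel \<partial>lborel)" by (rule lborel_pair.Fubini'[OF km, symmetric])
  also have "\<dots> \<le> energy v" unfolding energy_def
  proof (rule nn_integral_mono)
    fix h
    have sh: "integrable lborel (\<lambda>t. v (t - h))" using lborel_integrable_real_affine[OF v, of 1 "- h"] by simp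
    have "(\<integral>\<^sup>+\<xi>. ?k h \<xi> \<partial>lborel) = (\<integral>\<^sup>+\<xi>. ennreal (qk h / 2) * indicator {0<..} h * (ennreal (1 / (2 * pi)) * ennreal ((cmod (four_int (\<lambda>t. v t - v (t - h)) \<xi>))\<^sup>2)) \<partial>lborel)"
    proof (rule nn_integral_cong)
      fix \<xi>
      have "ennreal (2 - 2 * cos (\<xi> * h)) * ennreal ((cmod (four_int v \<xi>))\<^sup>2 / (2 * pi)) = ennreal ((2 - 2 * cos (\<xi> * h)) * ((cmod (four_int v \<xi>))\<^sup>2 / (2 * pi)))"
        by (rule ennreal_mult[symmetric]) auto
      also have "(2 - 2 * cos (\<xi> * h)) * ((cmod (four_int v \<xi>))\<^sup>2 / (2 * pi)) = 1 / (2 * pi) * (cmod (four_int (\<lambda>t. v t - v (t - h)) \<xi>))\<^sup>2"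
        unfolding four_int_difference[OF v] by simp
      also have "ennreal \<dots> = ennreal (1 / (2 * pi)) * ennreal ((cmod (four_int (\<lambda>t. v t - v (t - h)) \<xi>))\<^sup>2)"
        by (rule ennreal_mult) auto
      finally show "?k h \<xi> = ennreal (qk h / 2) * indicator {0<..} h * (ennreal (1 / (2 * pi)) * ennreal ((cmod (four_int (\<lambda>t. v t - v (t - h)) \<xi>))\<^sup>2))"
        by (simp only: mult.assoc)
    qed
    also have "\<dots> = ennreal (qk h / 2) * indicator {0<..} h * (ennreal (1 / (2 * pi)) * (\<integral>\<^sup>+\<xi>. ennreal ((cmod (four_int (\<lambda>t. v t - v (t - h)) \<xi>))\<^sup>2) \<partial>lborel))"
      by (simp add: nn_integral_cmult)
    also have "\<dots> \<le> ennreal (qk h / 2) * indicator {0<..} h * (ennreal (1 / (2 * pi)) * (ennreal (2 * pi) * (\<integral>\<^sup>+t. ennreal ((v t - v (t - h))\<^sup>2) \<partial>lborel)))"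
      by (intro mult_left_mono Plancherel_le Bochner_Integration.integrable_diff v sh) auto
    also have "\<dots> = ennreal (qk h / 2) * indicator {0<..} h * (\<integral>\<^sup>+t. ennreal ((v t - v (t - h))\<^sup>2) \<partial>lborel)"
      by (simp add: mult.assoc[symmetric] ennreal_mult[symmetric])
    finally show "(\<integral>\<^sup>+\<xi>. ?k h \<xi> \<partial>lborel) \<le> ennreal (qk h / 2) * indicator {0<..} h * (\<integral>\<^sup>+t. ennreal ((v t - v (t - h))\<^sup>2) \<partial>lborel)" .
  qed
  finally show ?thesis .
qed

end

subsection \<open>Piecewise polynomials in time\<close>

text \<open>Coefficient vectors are functions on the whole index type; \<open>loc\<close> states
  that only the finitely many entries in I matter. Unit vectors then span without a vector space
  having to be constructed.\<close>

lemma linear_functional_expand: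
  fixes g :: "('i \<Rightarrow> real) \<Rightarrow> real"
  assumes fin: "finite I"
    and lin: "\<And>r s c e. g (\<lambda>i. r * c i + s * e i) = r * g c + s * g e"
    and loc: "\<And>c e. (\<And>i. i \<in> I \<Longrightarrow> c i = e i) \<Longrightarrow> g c = g e"
  shows "g c = (\<Sum>i\<in>I. c i * g (\<lambda>k. if k = i then 1 else 0))"
proof -
  have "g (\<lambda>i. if i \<in> S then c i else 0) = (\<Sum>i\<in>S. c i * g (\<lambda>k. if k = i then 1 else 0))" if "finite S" for S
    using that
  proof (induction S)
    case empty
    show ?case using lin[of 0 "\<lambda>_. 0" 0 "\<lambda>_. 0"] by simp
  next
    case (insert j S)
    have "(\<lambda>i. if i \<in> insert j S then c i else 0) = (\<lambda>i. c j * (if i = j then 1 else 0) + 1 * (if i \<in> S then c i else 0))"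
      using insert by auto
    then have "g (\<lambda>i. if i \<in> insert j S then c i else 0) =
        c j * g (\<lambda>i. if i = j then 1 else 0) + 1 * g (\<lambda>i. if i \<in> S then c i else 0)" by (simp only: lin)
    then show ?case using insert by simp
  qed
  from this[OF fin] show ?thesis using loc[of c "\<lambda>i. if i \<in> I then c i else 0"] by simp
qed

text \<open>Testing with unit vectors gives a square matrix whose rows belong to test functions and
  columns to unknowns. Trivial kernel of the form is injectivity of that matrix, hence
  solvability.\<close>

lemma finite_dim_solvable:
  fixes B :: "('i \<Rightarrow> real) \<Rightarrow> ('i \<Rightarrow> real) \<Rightarrow> real"
  assumes fin: "finite I"
    and lin1: "\<And>r s c c' e. B (\<lambda>i. r * c i + s * c' i) e = r * B c e + s * B c' e"
    and lin2: "\<And>r s c e e'. B c (\<lambda>i. r * e i + s * e' i) = r * B c e + s * B c e'"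
    and loc1: "\<And>c c' e. (\<And>i. i \<in> I \<Longrightarrow> c i = c' i) \<Longrightarrow> B c e = B c' e"
    and loc2: "\<And>c e e'. (\<And>i. i \<in> I \<Longrightarrow> e i = e' i) \<Longrightarrow> B c e = B c e'"
    and inj: "\<And>c. (\<And>e. B c e = 0) \<Longrightarrow> (\<forall>i\<in>I. c i = 0)"
    and L: "\<And>r s c e. L (\<lambda>i. r * c i + s * e i) = r * L c + s * L e"
      "\<And>c e. (\<And>i. i \<in> I \<Longrightarrow> c i = e i) \<Longrightarrow> L c = L e"
  shows "\<exists>c. \<forall>e. B c e = L e"
proof -
  let ?\<delta> = "\<lambda>i k. if k = i then 1 else (0::real)"
  define A where "A i j = B (?\<delta> j) (?\<delta> i)" for i j
  have Bc: "B c e = (\<Sum>j\<in>I. c j * B (?\<delta> j) e)" for c e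
    using linear_functional_expand[OF fin, of "\<lambda>c. B c e"] lin1 loc1 by blast
  have Be: "B c e = (\<Sum>i\<in>I. e i * B c (?\<delta> i))" for c e
    using linear_functional_expand[OF fin, of "B c"] lin2 loc2 by blast
  have Le: "L e = (\<Sum>i\<in>I. e i * L (?\<delta> i))" for e
    using linear_functional_expand[OF fin, of L] L by blast
  have A: "(\<Sum>j\<in>I. A i j * x j) = B x (?\<delta> i)" for x i
    unfolding Bc[of x "?\<delta> i"] A_def by (simp add: mult.commute)
  have "\<exists>x. \<forall>i\<in>I. (\<Sum>j\<in>I. A i j * x j) = L (?\<delta> i)"
  proof (rule square_system_solvable[OF fin])
    fix x assume "\<And>i. i \<in> I \<Longrightarrow> (\<Sum>j\<in>I. A i j * x j) = 0"
    then have "B x e = 0" for e unfolding Be[of x e] by (simp add: A)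
    then show "\<forall>j\<in>I. x j = 0" by (rule inj)
  qed
  then obtain x where x: "\<And>i. i \<in> I \<Longrightarrow> B x (?\<delta> i) = L (?\<delta> i)" unfolding A by blast
  have "B x e = L e" for e unfolding Be[of x e] Le[of e] using x by simp
  then show ?thesis by blast
qed

section \<open>Piecewise polynomials on a time grid and the time-stepping form\<close>

definition poly_int :: "real \<Rightarrow> real \<Rightarrow> real poly \<Rightarrow> real" where
  "poly_int c d p = integral {c..d} (poly p)"

lemma poly_int_lincomb: "poly_int c d (smult r p + smult s q) = r * poly_int c d p + s * poly_int c d q"
proof -
  have i: "poly p integrable_on {c..d}" for p :: "real poly" by (intro integrable_continuous_real continuous_intros)
  have "integral {c..d} (\<lambda>x. r * poly p x + s * poly q x) = r * integral {c..d} (poly p) + s * integral {c..d} (poly q)"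
    using i integrable_on_cmult_left by (subst integral_add) (auto intro!: integrable_on_mult_right)
  moreover have "poly (smult r p + smult s q) = (\<lambda>x. r * poly p x + s * poly q x)" by auto
  ultimately show ?thesis by (simp only: poly_int_def)
qed

lemma poly_int_pderiv: "c \<le> d \<Longrightarrow> poly_int c d (pderiv p) = poly p d - poly p c"
  unfolding poly_int_def
  by (intro integral_unique fundamental_theorem_of_calculus)
    (auto simp: has_real_derivative_iff_has_vector_derivative[symmetric] intro: has_field_derivative_at_within poly_DERIV)

locale time_mesh =
  fixes T \<sigma> :: real and J :: nat
  assumes T0: "0 < T" and J0: "0 < J" and s1: "1 \<le> \<sigma>"
begin

abbreviation \<tau> where "\<tau> \<equiv> time_node T J \<sigma>"

lemma \<tau>_0: "\<tau> 0 = 0" by (simp add: time_node_def)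

lemma \<tau>_J: "\<tau> J = T" using J0 by (simp add: time_node_def)

lemma \<tau>_Suc: "\<tau> j < \<tau> (Suc j)"
proof -
  have "(real j / real J) powr \<sigma> < (real (Suc j) / real J) powr \<sigma>"
    using J0 s1 by (intro powr_less_mono2 divide_strict_right_mono) auto
  then show ?thesis using T0 unfolding time_node_def by (rule mult_strict_right_mono)
qed

lemma \<tau>_less: "i < j \<Longrightarrow> \<tau> i < \<tau> j"
  by (induction j) (use \<tau>_Suc in \<open>force simp: less_Suc_eq intro: less_trans\<close>)+

lemma \<tau>_le: "i \<le> j \<Longrightarrow> \<tau> i \<le> \<tau> j"
  using \<tau>_less[of i j] by (cases "i = j") auto

lemma \<tau>_nonneg: "0 \<le> \<tau> j" using \<tau>_le[of 0 j] by (simp add: \<tau>_0)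

text \<open>The time grid is itself a mesh of (0, T). This supplies its open cells
  \<open>tm.P\<close> and the principle that what holds on them holds almost everywhere.\<close>

sublocale tm: mesh 0 T J "time_node T J \<sigma>" 0
  by standard (use T0 \<tau>_0 \<tau>_J \<tau>_Suc in \<open>auto simp: is_partition_def\<close>)

text \<open>Left-open, right-closed pieces are disjoint and are exactly the differences of two
  functions cut off at successive nodes. The extension by zero to all times is what the shifts in
  the energy act on.\<close>

definition pw :: "(nat \<Rightarrow> real poly) \<Rightarrow> real \<Rightarrow> real" where
  "pw p t = (\<Sum>j<J. indicator {\<tau> j<..\<tau> (Suc j)} t * poly (p j) t)"

lemma pw_piece:
  assumes j: "j < J" and t: "t \<in> {\<tau> j<..\<tau> (Suc j)}"
  shows "pw p t = poly (p j) t"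
proof -
  have "indicator {\<tau> i<..\<tau> (Suc i)} t * poly (p i) t = (if i = j then poly (p i) t else 0)" for i
  proof (cases "i = j")
    case False
    then consider "Suc i \<le> j" | "Suc j \<le> i" by linarith
    then have "t \<notin> {\<tau> i<..\<tau> (Suc i)}"
      by cases (use t \<tau>_le[of "Suc i" j] \<tau>_le[of "Suc j" i] in auto)
    then show ?thesis using False by simp
  qed (use t in simp)
  then show ?thesis using j by (simp add: pw_def)
qed

lemma pw_outside: "t \<notin> {0<..T} \<Longrightarrow> pw p t = 0"
proof -
  assume t: "t \<notin> {0<..T}"
  have "t \<notin> {\<tau> j<..\<tau> (Suc j)}" if "j < J" for j
    using t \<tau>_nonneg[of j] \<tau>_le[of "Suc j" J] that \<tau>_J by auto
  then show ?thesis by (simp add: pw_def)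
qed

lemma tm_P: "t \<in> tm.P \<longleftrightarrow> (\<exists>j<J. \<tau> j < t \<and> t < \<tau> (Suc j))"
  by (auto simp: tm.P_def)

lemma pw_lincomb: "pw (\<lambda>j. smult r (p j) + smult s (q j)) t = r * pw p t + s * pw q t"
  unfolding pw_def sum_distrib_left sum.distrib[symmetric] by (rule sum.cong) (simp_all add: algebra_simps)

lemma pw_mult: "pw p t * pw q t = pw (\<lambda>j. p j * q j) t"
proof (cases "\<exists>j<J. t \<in> {\<tau> j<..\<tau> (Suc j)}")
  case True then show ?thesis by (auto simp: pw_piece)
next
  case False
  then have "pw p t = 0" for p unfolding pw_def by (intro sum.neutral) auto
  then show ?thesis by simp
qed

lemma pw_measurable [measurable]: "pw p \<in> borel_measurable borel"
proof -
  have "poly q \<in> borel_measurable borel" for q :: "real poly"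
    by (intro borel_measurable_continuous_onI continuous_intros)
  note [measurable] = this
  show ?thesis unfolding pw_def[abs_def] by measurable
qed

lemma pw_bounded: obtains M where "\<And>t. \<bar>pw p t\<bar> \<le> M"
proof -
  have "\<exists>M. \<forall>t. \<bar>indicator {\<tau> j<..\<tau> (Suc j)} t * poly (p j) t\<bar> \<le> M" for j
  proof -
    have "compact (poly (p j) ` {\<tau> j..\<tau> (Suc j)})" by (intro compact_continuous_image continuous_intros) auto
    then obtain M where "\<And>t. t \<in> {\<tau> j..\<tau> (Suc j)} \<Longrightarrow> \<bar>poly (p j) t\<bar> \<le> M"
      by (metis bounded_real compact_imp_bounded imageI)
    then have "\<bar>indicator {\<tau> j<..\<tau> (Suc j)} t * poly (p j) t\<bar> \<le> max M 0" for t
      by (cases "t \<in> {\<tau> j<..\<tau> (Suc j)}") (auto intro: le_max_iff_disj[THEN iffD2])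
    then show ?thesis by blast
  qed
  then obtain M where M: "\<And>j t. \<bar>indicator {\<tau> j<..\<tau> (Suc j)} t * poly (p j) t\<bar> \<le> M j" by metis
  have "\<bar>pw p t\<bar> \<le> (\<Sum>j<J. M j)" for t
    unfolding pw_def by (rule order_trans[OF sum_abs]) (intro sum_mono M)
  then show thesis using that by blast
qed

lemma pw_integrable: "integrable lborel (\<lambda>t. pw p t * indicator S t)" if [measurable]: "S \<in> sets borel"
proof -
  obtain M where M: "\<And>t. \<bar>pw p t\<bar> \<le> M" by (rule pw_bounded[of p]) blast
  have "\<bar>pw p t * indicator S t\<bar> \<le> M" for t
    using M[of t] order_trans[OF abs_ge_zero M[of t]] by (auto simp: indicator_def)
  moreover have "pw p t * indicator S t = 0" if "t \<notin> {0..T}" for t using pw_outside[of t p] that by auto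
  ultimately show ?thesis by (intro integrable_bounded_support[where c=0 and d=T and M=M]) auto
qed

lemma pw_set_integrable: "set_integrable lebesgue {0<..<T} (pw p)"
  using pw_integrable[of "{0<..<T}" p] unfolding set_integrable_def
  by (simp add: integrable_completion mult.commute)

lemma integral_pw: "(LINT t:{0<..<T}|lebesgue. pw p t) = (\<Sum>j<J. poly_int (\<tau> j) (\<tau> (Suc j)) (p j))"
proof -
  have si: "set_integrable lebesgue {\<tau> j..\<tau> (Suc j)} (poly (p j))" for j
    by (intro absolutely_integrable_continuous_real continuous_intros)
  have "(LINT t:{0<..<T}|lebesgue. pw p t) = (LINT t:{0<..<T}|lebesgue. (\<Sum>j<J. indicator {\<tau> j..\<tau> (Suc j)} t *\<^sub>R poly (p j) t))"
  proof (rule set_integral_cong_AE', rule tm.AE_P_imp)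
    fix t assume "t \<in> tm.P"
    then obtain j where j: "j < J" "\<tau> j < t" "t < \<tau> (Suc j)" by (auto simp: tm_P)
    have "indicator {\<tau> i<..\<tau> (Suc i)} t = (indicator {\<tau> i..\<tau> (Suc i)} t :: real)" for i
    proof -
      have "t \<noteq> \<tau> i"
        using j \<tau>_le[of "Suc j" i] \<tau>_le[of i j] by (cases "i \<le> j") auto
      then show ?thesis by (auto simp: indicator_def)
    qed
    then show "pw p t = (\<Sum>j<J. indicator {\<tau> j..\<tau> (Suc j)} t *\<^sub>R poly (p j) t)" by (simp add: pw_def)
  qed
  also have "\<dots> = (LINT t|lebesgue. (\<Sum>j<J. indicator {\<tau> j..\<tau> (Suc j)} t *\<^sub>R poly (p j) t))"
  proof -
    have "AE t in lebesgue. t \<in> UNIV \<longrightarrow> indicator {0<..<T} t *\<^sub>R (\<Sum>j<J. indicator {\<tau> j..\<tau> (Suc j)} t *\<^sub>R poly (p j) t) =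
        (\<Sum>j<J. indicator {\<tau> j..\<tau> (Suc j)} t *\<^sub>R poly (p j) t)"
    proof -
      have "AE t in lebesgue. t \<noteq> 0 \<and> t \<noteq> T"
        using AE_conjI[OF AE_lborel_singleton[of 0] AE_lborel_singleton[of T]] by (rule AE_completion)
      then show ?thesis
      proof eventually_elim
        case (elim t)
        show ?case
        proof (cases "t \<in> {0<..<T}")
          case False
          have "t \<notin> {\<tau> j..\<tau> (Suc j)}" if "j < J" for j
            using elim False \<tau>_nonneg[of j] \<tau>_le[of "Suc j" J] that \<tau>_J by auto
          then have "(\<Sum>j<J. indicator {\<tau> j..\<tau> (Suc j)} t *\<^sub>R poly (p j) t) = 0" by (intro sum.neutral) auto
          then show ?thesis by simp
        qed simp
      qed
    qed
    from set_integral_cong_AE'[OF this] show ?thesis by (simp add: set_lebesgue_integral_def)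
  qed
  also have "\<dots> = (\<Sum>j<J. LINT t:{\<tau> j..\<tau> (Suc j)}|lebesgue. poly (p j) t)"
    unfolding set_lebesgue_integral_def
    using si by (intro Bochner_Integration.integral_sum) (auto simp: set_integrable_def)
  also have "\<dots> = (\<Sum>j<J. poly_int (\<tau> j) (\<tau> (Suc j)) (p j))"
    unfolding poly_int_def by (intro sum.cong refl set_lebesgue_integral_eq_integral(2) si)
  finally show ?thesis .
qed

definition rv :: "(nat \<Rightarrow> real poly) \<Rightarrow> nat \<Rightarrow> real" where "rv p j = poly (p j) (\<tau> j)"

text \<open>The value 0 for j = 0 encodes the convention V_0 = 0, so the first jump is the initial
  value itself.\<close>

definition lv :: "(nat \<Rightarrow> real poly) \<Rightarrow> nat \<Rightarrow> real" where "lv p j = (if j = 0 then 0 else poly (p (j - 1)) (\<tau> j))"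

text \<open>The derivative and jump terms for one pair of space coordinates; the mass matrix entry
  multiplying them is added later.\<close>

definition Tf :: "(nat \<Rightarrow> real poly) \<Rightarrow> (nat \<Rightarrow> real poly) \<Rightarrow> real" where
  "Tf p q = (\<Sum>j<J. poly_int (\<tau> j) (\<tau> (Suc j)) (pderiv (p j) * q j) + (rv p j - lv p j) * rv q j)"

text \<open>Discarding all pieces from t_r on leaves the degrees unchanged and only creates a jump,
  so the result is still an admissible test function.\<close>

definition tr :: "nat \<Rightarrow> (nat \<Rightarrow> real poly) \<Rightarrow> nat \<Rightarrow> real poly" where "tr r p j = (if j < r then p j else 0)"

lemma rv_lincomb: "rv (\<lambda>j. smult r (p j) + smult s (q j)) j = r * rv p j + s * rv q j"
  by (simp add: rv_def)

lemma lv_lincomb: "lv (\<lambda>j. smult r (p j) + smult s (q j)) j = r * lv p j + s * lv q j"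
  by (simp add: lv_def)

lemma Tf_lincomb_left: "Tf (\<lambda>j. smult r (p j) + smult s (p' j)) q = r * Tf p q + s * Tf p' q"
proof -
  have "poly_int c d (pderiv (smult r P + smult s P') * Q) = r * poly_int c d (pderiv P * Q) + s * poly_int c d (pderiv P' * Q)"
    for c d P P' Q by (simp add: pderiv_add pderiv_smult distrib_right poly_int_lincomb)
  then show ?thesis
    by (simp add: Tf_def rv_lincomb lv_lincomb sum_distrib_left sum.distrib[symmetric] algebra_simps)
qed

lemma Tf_lincomb_right: "Tf p (\<lambda>j. smult r (q j) + smult s (q' j)) = r * Tf p q + s * Tf p q'"
proof -
  have "poly_int c d (P * (smult r Q + smult s Q')) = r * poly_int c d (P * Q) + s * poly_int c d (P * Q')"
    for c d P Q Q' by (simp add: distrib_left poly_int_lincomb)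
  then have "Tf p (\<lambda>j. smult r (q j) + smult s (q' j)) = (\<Sum>j<J. (r * poly_int (\<tau> j) (\<tau> (Suc j)) (pderiv (p j) * q j) +
      s * poly_int (\<tau> j) (\<tau> (Suc j)) (pderiv (p j) * q' j)) + (rv p j - lv p j) * (r * rv q j + s * rv q' j))"
    unfolding Tf_def rv_lincomb by (simp only:)
  also have "\<dots> = r * Tf p q + s * Tf p q'"
    unfolding Tf_def sum_distrib_left sum.distrib[symmetric] by (rule sum.cong) (simp_all add: distrib_left)
  finally show ?thesis .
qed

text \<open>Polarised form of $\int U'U + \sum_j [\![U_j]\!] U_j^+ = \frac12 U(t_r)^2 + \frac12 \sum_j [\![U_j]\!]^2$.\<close>

lemma Tf_symmetrized:
  assumes r: "r \<le> J"
  shows "Tf p (tr r q) + Tf q (tr r p) = lv p r * lv q r + (\<Sum>j<r. (rv p j - lv p j) * (rv q j - lv q j))"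
proof -
  let ?S = "\<lambda>r p q. \<Sum>j<r. poly_int (\<tau> j) (\<tau> (Suc j)) (pderiv (p j) * q j) + (rv p j - lv p j) * rv q j"
  have z: "poly_int c d 0 = 0" for c d using poly_int_lincomb[of c d 0 0 0 0] by simp
  have T: "Tf p (tr r q) = ?S r p q" for p q
  proof -
    have "Tf p (tr r q) = (\<Sum>j<J. if j < r then poly_int (\<tau> j) (\<tau> (Suc j)) (pderiv (p j) * q j) + (rv p j - lv p j) * rv q j else 0)"
      unfolding Tf_def by (intro sum.cong) (auto simp: tr_def rv_def z)
    also have "\<dots> = ?S r p q"
      using r by (subst sum.inter_filter[symmetric]) (auto intro!: sum.cong)
    finally show ?thesis .
  qed
  have "?S r p q + ?S r q p = lv p r * lv q r + (\<Sum>j<r. (rv p j - lv p j) * (rv q j - lv q j))" for r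
  proof (induction r)
    case 0 then show ?case by (simp add: lv_def)
  next
    case (Suc r)
    \<comment> \<open>The product rule turns the two integrals into boundary values at both ends of
      the piece. With the jump terms, the old product \<open>lv p r * lv q r\<close> is completed to
      the product of the jumps at r.\<close>
    have "poly_int (\<tau> r) (\<tau> (Suc r)) (pderiv (p r) * q r) + poly_int (\<tau> r) (\<tau> (Suc r)) (pderiv (q r) * p r) =
        poly_int (\<tau> r) (\<tau> (Suc r)) (pderiv (p r * q r))"
      using poly_int_lincomb[of "\<tau> r" "\<tau> (Suc r)" 1 "pderiv (p r) * q r" 1 "pderiv (q r) * p r"]
      by (simp add: pderiv_mult algebra_simps)
    also have "\<dots> = lv p (Suc r) * lv q (Suc r) - rv p r * rv q r"
      using \<tau>_Suc[of r] by (subst poly_int_pderiv) (auto simp: lv_def rv_def)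
    finally have e: "poly_int (\<tau> r) (\<tau> (Suc r)) (pderiv (p r) * q r) + poly_int (\<tau> r) (\<tau> (Suc r)) (pderiv (q r) * p r) =
      lv p (Suc r) * lv q (Suc r) - rv p r * rv q r" .
    show ?case using Suc.IH e by (simp add: algebra_simps)
  qed
  then show ?thesis by (simp add: T)
qed

end

section \<open>The fractional form on piecewise polynomials\<close>

locale frac_time = time_mesh T \<sigma> J + frac_order \<gamma> for T \<sigma> :: real and J :: nat and \<gamma> :: real
begin

lemma frac_ok_pw_ex: "\<exists>g. frac_ok T (pw p) g"
proof -
  have "\<exists>g. frac_ok T (\<lambda>t. indicator {\<tau> j<..\<tau> (Suc j)} t * poly (p j) t) g" for j
    by (rule frac_ok_poly_piece) (use \<tau>_nonneg \<tau>_Suc less_imp_le in auto)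
  then obtain g where "\<And>j. frac_ok T (\<lambda>t. indicator {\<tau> j<..\<tau> (Suc j)} t * poly (p j) t) (g j)" by metis
  then have "frac_ok T (\<lambda>t. \<Sum>j\<in>{..<J}. 1 * (indicator {\<tau> j<..\<tau> (Suc j)} t * poly (p j) t)) (\<lambda>t. \<Sum>j\<in>{..<J}. 1 * g j t)"
    by (intro frac_ok_sum) auto
  then have "frac_ok T (pw p) (\<lambda>t. \<Sum>j\<in>{..<J}. 1 * g j t)" by (simp only: pw_def[abs_def] mult_1)
  then show ?thesis by blast
qed

text \<open>A representative chosen with all properties in \<open>frac_ok\<close>, in particular
  Borel measurability, which \<open>frac_deriv\<close> itself does not promise.\<close>

definition fd :: "(nat \<Rightarrow> real poly) \<Rightarrow> real \<Rightarrow> real" where "fd p = (SOME g. frac_ok T (pw p) g)"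

lemma frac_ok_pw: "frac_ok T (pw p) (fd p)"
  unfolding fd_def by (rule someI_ex[OF frac_ok_pw_ex])

definition Ff :: "(nat \<Rightarrow> real poly) \<Rightarrow> (nat \<Rightarrow> real poly) \<Rightarrow> real" where
  "Ff p q = (LINT t:{0<..<T}|lebesgue. fd p t * pw q t)"

lemma fd_pw_integrable: "set_integrable lebesgue {0<..<T} (\<lambda>t. fd p t * pw q t)"
proof -
  obtain M where M: "\<And>t. \<bar>pw q t\<bar> \<le> M" by (rule pw_bounded[of q]) blast
  have "set_integrable lebesgue {0<..<T} (fd p)"
    using frac_ok_integrable[OF frac_ok_pw[of p]] unfolding set_integrable_def by (simp add: integrable_completion)
  then show ?thesis
  proof (rule set_integrable_mult_bounded)
    have "pw q \<in> borel_measurable lebesgue" by (simp add: measurable_completion)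
    then show "set_borel_measurable lebesgue {0<..<T} (pw q)"
      unfolding set_borel_measurable_def by (intro borel_measurable_scaleR borel_measurable_indicator) auto
  qed (use M in auto)
qed

lemma frac_deriv_sum:
  assumes "\<And>t. t \<in> tm.P \<Longrightarrow> v t = (\<Sum>l<d. c l * pw (p l) t)"
  shows "AE t in lebesgue. t \<in> {0<..<T} \<longrightarrow> frac_deriv T \<gamma> v t = (\<Sum>l<(d::nat). c l * fd (p l) t)"
  by (rule frac_deriv_AE[OF frac_ok_sum[OF _ frac_ok_pw] tm.AE_P_imp]) (use assms in auto)

text \<open>Both sides represent the weak derivative of the same fractional integral. As
  \<open>fd\<close> is a choice for each p separately, linearity can hold only almost
  everywhere.\<close>

lemma fd_lincomb:
  "AE t in lebesgue. t \<in> {0<..<T} \<longrightarrow> fd (\<lambda>j. smult r (p j) + smult s (q j)) t = r * fd p t + s * fd q t"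
proof -
  let ?pq = "\<lambda>j. smult r (p j) + smult s (q j)"
  have "AE t in lebesgue. t \<in> {0<..<T} \<longrightarrow> frac_deriv T \<gamma> (pw ?pq) t = fd ?pq t"
    by (rule frac_deriv_AE[OF frac_ok_pw]) simp
  moreover have "AE t in lebesgue. t \<in> {0<..<T} \<longrightarrow> frac_deriv T \<gamma> (pw ?pq) t = r * fd p t + s * fd q t"
    by (rule frac_deriv_AE[OF frac_ok_lincomb[OF frac_ok_pw frac_ok_pw]]) (simp add: pw_lincomb)
  ultimately show ?thesis by eventually_elim auto
qed

lemma Ff_lincomb_left: "Ff (\<lambda>j. smult r (p j) + smult s (p' j)) q = r * Ff p q + s * Ff p' q"
proof -
  have "Ff (\<lambda>j. smult r (p j) + smult s (p' j)) q = (LINT t:{0<..<T}|lebesgue. r * (fd p t * pw q t) + s * (fd p' t * pw q t))"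
    unfolding Ff_def
  proof (rule set_integral_cong_AE')
    show "AE t in lebesgue. t \<in> {0<..<T} \<longrightarrow> fd (\<lambda>j. smult r (p j) + smult s (p' j)) t * pw q t = r * (fd p t * pw q t) + s * (fd p' t * pw q t)"
      using fd_lincomb[of r p s p'] by eventually_elim (auto simp: algebra_simps)
  qed
  then show ?thesis
    using fd_pw_integrable by (simp add: Ff_def set_integral_add set_integrable_mult_right)
qed

lemma Ff_lincomb_right: "Ff p (\<lambda>j. smult r (q j) + smult s (q' j)) = r * Ff p q + s * Ff p q'"
proof -
  have "Ff p (\<lambda>j. smult r (q j) + smult s (q' j)) = (LINT t:{0<..<T}|lebesgue. r * (fd p t * pw q t) + s * (fd p t * pw q' t))"
    unfolding Ff_def pw_lincomb by (simp add: algebra_simps)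
  then show ?thesis
    using fd_pw_integrable by (simp add: Ff_def set_integral_add set_integrable_mult_right)
qed

text \<open>Cutting off the test argument alone restricts the time integral to (0, t_r), and by
  causality the value there is the energy of the function restricted to the same interval.\<close>

lemma Ff_tr:
  assumes r: "0 < r" "r \<le> J"
  shows "0 \<le> Ff p (tr r p)" "ennreal (Ff p (tr r p)) = energy (\<lambda>t. pw p t * indicator {0<..<\<tau> r} t)"
proof -
  have R: "0 < \<tau> r" "\<tau> r \<le> T" using \<tau>_less[of 0 r] \<tau>_le[of r J] r by (auto simp: \<tau>_0 \<tau>_J)
  have "Ff p (tr r p) = (LINT t:{0<..<\<tau> r}|lebesgue. fd p t * pw p t)"
  proof -
    have "AE t in lebesgue. t \<in> {0<..<T} \<longrightarrow> fd p t * pw (tr r p) t = indicator {0<..<\<tau> r} t * (fd p t * pw p t)"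
    proof (rule tm.AE_P_imp)
      fix t assume "t \<in> tm.P"
      then obtain j where j: "j < J" "\<tau> j < t" "t < \<tau> (Suc j)" by (auto simp: tm_P)
      show "fd p t * pw (tr r p) t = indicator {0<..<\<tau> r} t * (fd p t * pw p t)"
      proof (cases "j < r")
        case True
        then have "t \<in> {0<..<\<tau> r}" using j \<tau>_le[of "Suc j" r] \<tau>_nonneg[of j] by auto
        then show ?thesis using True j by (simp add: pw_piece[of j] tr_def)
      next
        case False
        then have "t \<notin> {0<..<\<tau> r}" using j \<tau>_le[of r j] by auto
        then show ?thesis using False j by (simp add: pw_piece[of j] tr_def)
      qed
    qed
    then have "Ff p (tr r p) = (LINT t:{0<..<T}|lebesgue. indicator {0<..<\<tau> r} t * (fd p t * pw p t))"
      unfolding Ff_def by (rule set_integral_cong_AE')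
    also have "\<dots> = (LINT t:{0<..<\<tau> r}|lebesgue. fd p t * pw p t)"
      using R by (intro set_integral_cong') (auto simp: indicator_def)
    finally show ?thesis .
  qed
  also have "\<dots> = (LINT t:{0<..<\<tau> r}|lborel. fd p t * pw p t)"
  proof -
    have [measurable]: "fd p \<in> borel_measurable borel" using frac_ok_pw[of p] by (simp add: frac_ok_def)
    show ?thesis unfolding set_lebesgue_integral_def by (rule integral_completion) measurable
  qed
  finally have "Ff p (tr r p) = (LINT t:{0<..<\<tau> r}|lborel. fd p t * pw p t)" .
  then show "0 \<le> Ff p (tr r p)" "ennreal (Ff p (tr r p)) = energy (\<lambda>t. pw p t * indicator {0<..<\<tau> r} t)"
    using frac_ok_energy[OF frac_ok_pw R] by auto
qed

text \<open>The energy equals the real number \<open>Ff p (tr r p)\<close> and is therefore finite,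
  so Hardy's inequality between extended integrals yields integrability and a real bound.\<close>

lemma Hardy_pw:
  assumes r: "0 < r" "r \<le> J"
  shows "integrable lborel (\<lambda>t. indicator {0<..<\<tau> r} t * (t powr (- \<gamma>) * (pw p t)\<^sup>2))"
    "(LINT t|lborel. indicator {0<..<\<tau> r} t * (t powr (- \<gamma>) * (pw p t)\<^sup>2)) \<le> 2 * Gamma (1 - \<gamma>) * Ff p (tr r p)"
proof -
  let ?v = "\<lambda>t. pw p t * indicator {0<..<\<tau> r} t"
  have eq: "indicator {0<..<\<tau> r} t * (t powr (- \<gamma>) * (pw p t)\<^sup>2) = t powr (- \<gamma>) * (?v t)\<^sup>2" for t
    by (simp add: indicator_def)
  have "(\<integral>\<^sup>+t. ennreal (t powr (- \<gamma>) * (?v t)\<^sup>2) \<partial>lborel) \<le> ennreal (2 * Gamma (1 - \<gamma>)) * energy ?v"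
    by (rule Hardy) auto
  also have "\<dots> = ennreal (2 * Gamma (1 - \<gamma>) * Ff p (tr r p))"
    unfolding Ff_tr(2)[OF r, symmetric] by (rule ennreal_mult[symmetric]) (use Gamma_pos Ff_tr(1)[OF r] in auto)
  finally have le: "(\<integral>\<^sup>+t. ennreal (t powr (- \<gamma>) * (?v t)\<^sup>2) \<partial>lborel) \<le> ennreal (2 * Gamma (1 - \<gamma>) * Ff p (tr r p))" .
  show i: "integrable lborel (\<lambda>t. indicator {0<..<\<tau> r} t * (t powr (- \<gamma>) * (pw p t)\<^sup>2))"
    unfolding eq
  proof (rule integrableI_bounded)
    show "(\<integral>\<^sup>+t. ennreal (norm (t powr (- \<gamma>) * (?v t)\<^sup>2)) \<partial>lborel) < \<infinity>"
      using le_less_trans[OF le ennreal_less_top] by simp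
  qed measurable
  have "ennreal (LINT t|lborel. t powr (- \<gamma>) * (?v t)\<^sup>2) = (\<integral>\<^sup>+t. ennreal (t powr (- \<gamma>) * (?v t)\<^sup>2) \<partial>lborel)"
    by (rule nn_integral_eq_integral[symmetric]) (use i[unfolded eq] in auto)
  also note le
  finally show "(LINT t|lborel. indicator {0<..<\<tau> r} t * (t powr (- \<gamma>) * (pw p t)\<^sup>2)) \<le> 2 * Gamma (1 - \<gamma>) * Ff p (tr r p)"
    unfolding eq using Gamma_pos Ff_tr(1)[OF r, of p] by (subst (asm) ennreal_le_iff) auto
qed

text \<open>Definiteness comes from Hardy's inequality: zero energy forces the integral with the
  positive weight t^(-\<gamma>) to vanish, and a polynomial that is zero almost everywhere on a cell
  is zero.\<close>

lemma pw_zero_if_Ff_zero: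
  assumes z: "Ff p (tr J p) = 0" and j: "j < J"
  shows "p j = 0"
proof -
  have int: "integrable lborel (\<lambda>t. indicator {0<..<T} t * (t powr (- \<gamma>) * (pw p t)\<^sup>2))"
    and le: "(LINT t|lborel. indicator {0<..<T} t * (t powr (- \<gamma>) * (pw p t)\<^sup>2)) \<le> 0"
    using Hardy_pw[of J p] J0 z by (auto simp: \<tau>_J)
  have "0 \<le> (LINT t|lborel. indicator {0<..<T} t * (t powr (- \<gamma>) * (pw p t)\<^sup>2))"
    by (rule Bochner_Integration.integral_nonneg) auto
  with le have "(LINT t|lborel. indicator {0<..<T} t * (t powr (- \<gamma>) * (pw p t)\<^sup>2)) = 0" by (rule antisym)
  then have "AE t in lborel. indicator {0<..<T} t * (t powr (- \<gamma>) * (pw p t)\<^sup>2) = 0"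
    using integral_nonneg_eq_0_iff_AE[OF int] by simp
  then have ae: "AE t in lebesgue. indicator {0<..<T} t * (t powr (- \<gamma>) * (pw p t)\<^sup>2) = 0" by (rule AE_completion)
  show ?thesis
  proof (rule poly_AE_zero[OF \<tau>_Suc[of j]])
    show "AE t in lebesgue. t \<in> {\<tau> j<..<\<tau> (Suc j)} \<longrightarrow> poly (p j) t = 0"
      using ae
    proof eventually_elim
      case (elim t)
      show ?case
      proof
        assume t: "t \<in> {\<tau> j<..<\<tau> (Suc j)}"
        then have "0 < t" "t < T" using \<tau>_nonneg[of j] \<tau>_le[of "Suc j" J] j \<tau>_J by auto
        then have "pw p t = 0" using elim by simp
        then show "poly (p j) t = 0" using pw_piece[OF j, of t p] t by simp
      qed
    qed
  qed
qed

lemma fourier_pw: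
  assumes r: "0 < r" "r \<le> J"
  shows "(\<integral>\<^sup>+\<xi>. ennreal (\<bar>\<xi>\<bar> powr \<gamma> * (cmod (fourier (\<lambda>t. pw p t * indicator {0<..<\<tau> r} t) \<xi>))\<^sup>2) \<partial>lebesgue) \<le> ennreal (Ff p (tr r p) / cF)"
proof -
  let ?I = "\<integral>\<^sup>+\<xi>. ennreal (\<bar>\<xi>\<bar> powr \<gamma> * (cmod (fourier (\<lambda>t. pw p t * indicator {0<..<\<tau> r} t) \<xi>))\<^sup>2) \<partial>lebesgue"
  have "ennreal cF * ?I \<le> ennreal (Ff p (tr r p))"
    unfolding Ff_tr(2)[OF r] by (rule fourier_energy[OF pw_integrable]) simp
  then have "ennreal (1 / cF) * (ennreal cF * ?I) \<le> ennreal (1 / cF) * ennreal (Ff p (tr r p))" by (rule mult_left_mono) simp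
  also have "\<dots> = ennreal (Ff p (tr r p) / cF)" using cF_pos Ff_tr(1)[OF r, of p] by (simp add: ennreal_mult[symmetric])
  also have "ennreal (1 / cF) * (ennreal cF * ?I) = ?I" using cF_pos by (simp add: mult.assoc[symmetric] ennreal_mult[symmetric])
  finally show ?thesis .
qed

end

subsection \<open>The discrete problem in coordinates\<close>

lemma H1_space_cong:
  assumes v: "v \<in> H1_space a b" and ae: "AE x in lebesgue. x \<in> {a<..<b} \<longrightarrow> v' x = v x"
  shows "v' \<in> H1_space a b" "AE x in lebesgue. x \<in> {a<..<b} \<longrightarrow> distr_deriv a b v' x = distr_deriv a b v x"
proof -
  have ae': "AE x in lebesgue. x \<in> {a<..<b} \<longrightarrow> v x = v' x" using ae by eventually_elim auto
  have d: "is_distr_deriv a b v' (distr_deriv a b v)"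
    by (rule is_distr_deriv_cong[OF H1D(3)[OF v] ae']) simp
  then show "v' \<in> H1_space a b"
    using L2_space_cong[OF H1D(1)[OF v] ae'] H1D(2)[OF v] unfolding H1_space_def by blast
  show "AE x in lebesgue. x \<in> {a<..<b} \<longrightarrow> distr_deriv a b v' x = distr_deriv a b v x" by (rule distr_deriv_eq[OF d])
qed

lemma H1_inner_cong:
  assumes "u \<in> H1_space a b" "AE x in lebesgue. x \<in> {a<..<b} \<longrightarrow> u' x = u x"
    and "v \<in> H1_space a b" "AE x in lebesgue. x \<in> {a<..<b} \<longrightarrow> v' x = v x"
  shows "H1_inner a b u' v' = H1_inner a b u v" "Dir_inner a b u' v' = Dir_inner a b u v"
  using assms H1_space_cong(2)[OF assms(1,2)] H1_space_cong(2)[OF assms(3,4)]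
  unfolding H1_inner_eq Dir_inner_def by (auto intro!: arg_cong2[where f="(+)"] L2_inner_cong)

lemma H01_space_cong:
  assumes ab: "a < b" and v: "v \<in> H01_space a b" and ae: "AE x in lebesgue. x \<in> {a<..<b} \<longrightarrow> v' x = v x"
  shows "v' \<in> H01_space a b"
  unfolding H01_space_def
proof (intro CollectI conjI allI impI)
  show "v' \<in> H1_space a b" by (rule H1_space_cong(1)[OF H01_H1[OF v] ae])
  fix \<epsilon> :: real assume "0 < \<epsilon>"
  then obtain \<phi> where p: "test_fun a b \<phi>" "H1_norm a b (\<lambda>x. v x - \<phi> x) < \<epsilon>" using v unfolding H01_space_def by blast
  have h: "(\<lambda>x. v x - \<phi> x) \<in> H1_space a b"
    by (rule semi_ip.diff[OF semi_ip_H1 H01_H1[OF v] test_fun_H1(1)[OF ab p(1)]])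
  have ae': "AE x in lebesgue. x \<in> {a<..<b} \<longrightarrow> v' x - \<phi> x = v x - \<phi> x" using ae by eventually_elim auto
  have "H1_norm a b (\<lambda>x. v' x - \<phi> x) = H1_norm a b (\<lambda>x. v x - \<phi> x)"
    unfolding H1_norm_def H1_inner_cong(1)[OF h ae' h ae'] ..
  then show "\<exists>\<phi>. test_fun a b \<phi> \<and> H1_norm a b (\<lambda>x. v' x - \<phi> x) < \<epsilon>" using p by auto
qed

lemma Hm1_lincomb:
  assumes "F \<in> Hm1_space a b" "u \<in> H01_space a b" "v \<in> H01_space a b" "a < b"
  shows "F (\<lambda>x. r * u x + s * v x) = r * F u + s * F v"
proof -
  interpret H: semi_ip "H01_space a b" "H1_inner a b" by (rule semi_ip_H01[OF assms(4)])
  have 1: "\<And>u v. u \<in> H01_space a b \<Longrightarrow> v \<in> H01_space a b \<Longrightarrow> F (\<lambda>x. u x + v x) = F u + F v"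
    "\<And>c v. v \<in> H01_space a b \<Longrightarrow> F (\<lambda>x. c * v x) = c * F v"
    using assms(1) unfolding Hm1_space_def by blast+
  have "F (\<lambda>x. r * u x + s * v x) = F (\<lambda>x. r * u x) + F (\<lambda>x. s * v x)" by (rule 1(1)[OF H.scale[OF assms(2)] H.scale[OF assms(3)]])
  then show ?thesis using 1(2)[OF assms(2)] 1(2)[OF assms(3)] by simp
qed

lemma Hm1_sum:
  assumes F: "F \<in> Hm1_space a b" and ab: "a < b" and w: "\<And>l. l < d \<Longrightarrow> w l \<in> H01_space a b"
  shows "F (\<lambda>x. \<Sum>l<(d::nat). c l * w l x) = (\<Sum>l<d. c l * F (w l))"
  using w
proof (induction d)
  case 0
  show ?case using Hm1_lincomb[OF F H01_zero[OF ab] H01_zero[OF ab] ab, of 0 0] by simp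
next
  case (Suc d)
  have s: "(\<lambda>x. \<Sum>l<d. c l * w l x) \<in> H01_space a b"
    using Suc.prems by (intro semi_ip.sum_mem[OF semi_ip_H01[OF ab]]) auto
  show ?case using Hm1_lincomb[OF F s Suc.prems[of d] ab, of 1 "c d"] Suc.IH Suc.prems by simp
qed

text \<open>Boundedness of F is what makes the supremum in \<open>Hm1_norm\<close> a genuine upper
  bound. Scaling to unit norm then gives the first estimate, and the zero vector gives
  nonnegativity.\<close>

lemma Hm1_bound:
  assumes F: "F \<in> Hm1_space a b" and v: "v \<in> H01_space a b"
  shows "\<bar>F v\<bar> \<le> Hm1_norm a b F * H1_norm a b v" "0 \<le> Hm1_norm a b F"
proof -
  obtain M where M: "\<And>v. v \<in> H01_space a b \<Longrightarrow> \<bar>F v\<bar> \<le> M * H1_norm a b v" using F unfolding Hm1_space_def by blast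
  have nn: "0 \<le> H1_norm a b v" if "v \<in> H01_space a b" for v
    unfolding H1_norm_eq using that by (intro semi_ip.nrm_nonneg[OF semi_ip_H1] H01_H1)
  let ?S = "{\<bar>F v\<bar> |v. v \<in> H01_space a b \<and> H1_norm a b v \<le> 1}"
  have bdd: "bdd_above ?S"
  proof (rule bdd_aboveI[of _ "\<bar>M\<bar>"])
    fix y assume "y \<in> ?S"
    then obtain v where v: "y = \<bar>F v\<bar>" "v \<in> H01_space a b" "H1_norm a b v \<le> 1" by blast
    have "y \<le> M * H1_norm a b v" using M v by simp
    also have "\<dots> \<le> \<bar>M\<bar> * H1_norm a b v" using nn[OF v(2)] by (intro mult_right_mono) auto
    also have "\<dots> \<le> \<bar>M\<bar>" using nn[OF v(2)] v(3) by (simp add: mult_left_le)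
    finally show "y \<le> \<bar>M\<bar>" .
  qed
  have up: "\<bar>F v\<bar> \<le> Hm1_norm a b F" if "v \<in> H01_space a b" "H1_norm a b v \<le> 1" for v
    unfolding Hm1_norm_def using that by (intro cSup_upper bdd) auto
  have sc: "(\<lambda>x. c * v x) \<in> H01_space a b \<and> F (\<lambda>x. c * v x) = c * F v \<and> H1_norm a b (\<lambda>x. c * v x) = \<bar>c\<bar> * H1_norm a b v" for c
  proof (intro conjI)
    have h: "H1_norm a b (\<lambda>x. c * v x) = \<bar>c\<bar> * H1_norm a b v" for c
      unfolding H1_norm_eq by (rule semi_ip.nrm_scale[OF semi_ip_H1 H01_H1[OF v]])
    then show "H1_norm a b (\<lambda>x. c * v x) = \<bar>c\<bar> * H1_norm a b v" .
    show "F (\<lambda>x. c * v x) = c * F v" using F v unfolding Hm1_space_def by blast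
    show "(\<lambda>x. c * v x) \<in> H01_space a b"
    proof (cases "a < b")
      case True then show ?thesis by (rule semi_ip.scale[OF semi_ip_H01 v])
    next
      case False
      \<comment> \<open>On an empty interval every H1 norm is 0, so any test function approximates,
        and v provides one.\<close>
      have e: "{a<..<b} = {}" using False by auto
      have "H1_norm a b u = 0" for u by (simp add: H1_norm_def H1_inner_def e set_lebesgue_integral_def)
      moreover have "\<exists>\<phi>. test_fun a b \<phi>"
        using v zero_less_one[where 'a=real] unfolding H01_space_def by blast
      moreover have "(\<lambda>x. c * v x) \<in> H1_space a b" by (rule semi_ip.scale[OF semi_ip_H1 H01_H1[OF v]])
      ultimately show ?thesis unfolding H01_space_def by auto
    qed
  qed
  have "\<bar>F (\<lambda>x. 0 * v x)\<bar> \<le> Hm1_norm a b F" using sc[of 0] by (intro up) auto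
  then show "0 \<le> Hm1_norm a b F" using sc[of 0] by simp
  show "\<bar>F v\<bar> \<le> Hm1_norm a b F * H1_norm a b v"
  proof (cases "H1_norm a b v = 0")
    case True then show ?thesis using M[OF v] by simp
  next
    case False
    then have p: "0 < H1_norm a b v" using nn[OF v] by simp
    have "\<bar>F (\<lambda>x. (1 / H1_norm a b v) * v x)\<bar> \<le> Hm1_norm a b F" using sc[of "1 / H1_norm a b v"] p by (intro up) auto
    moreover have "F (\<lambda>x. (1 / H1_norm a b v) * v x) = (1 / H1_norm a b v) * F v" using sc by blast
    ultimately have "\<bar>(1 / H1_norm a b v) * F v\<bar> \<le> Hm1_norm a b F" by (simp only:)
    then show ?thesis using p by (simp add: abs_mult field_simps)
  qed
qed

text \<open>The difference has H1 norm zero, and a bounded functional vanishes on it. A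
  representative of \<open>Wht\<close> may thus be replaced by its basis expansion inside the
  load.\<close>

lemma Hm1_cong:
  assumes ab: "a < b" and F: "F \<in> Hm1_space a b" and u: "u \<in> H01_space a b"
    and ae: "AE x in lebesgue. x \<in> {a<..<b} \<longrightarrow> u' x = u x"
  shows "F u' = F u"
proof -
  have u': "u' \<in> H01_space a b" by (rule H01_space_cong[OF ab u ae])
  let ?z = "\<lambda>x. 1 * u' x + (-1) * u x"
  have z: "?z \<in> H01_space a b" by (rule H01_lincomb[OF ab u' u])
  have "AE x in lebesgue. x \<in> {a<..<b} \<longrightarrow> ?z x = 0" using ae by eventually_elim auto
  from H1_inner_cong(1)[OF H1_zero this H1_zero this] have "H1_norm a b ?z = 0"
    using semi_ip.ip_zero[OF semi_ip_H1 H1_zero, of a b] by (simp add: H1_norm_def)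
  then have "F ?z = 0" using Hm1_bound(1)[OF F z] by simp
  moreover have "F ?z = 1 * F u' + (-1) * F u" by (rule Hm1_lincomb[OF F u' u ab])
  ultimately show ?thesis by simp
qed

lemma Hm1_diff:
  assumes "F \<in> Hm1_space a b" "G \<in> Hm1_space a b"
  shows "(\<lambda>v. F v - G v) \<in> Hm1_space a b"
proof -
  obtain M where M: "\<forall>v\<in>H01_space a b. \<bar>F v\<bar> \<le> M * H1_norm a b v" using assms(1) unfolding Hm1_space_def by blast
  obtain M' where M': "\<forall>v\<in>H01_space a b. \<bar>G v\<bar> \<le> M' * H1_norm a b v" using assms(2) unfolding Hm1_space_def by blast
  have "\<bar>F v - G v\<bar> \<le> (M + M') * H1_norm a b v" if "v \<in> H01_space a b" for v
  proof -
    have "\<bar>F v\<bar> \<le> M * H1_norm a b v" "\<bar>G v\<bar> \<le> M' * H1_norm a b v" using M M' that by auto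
    then show ?thesis unfolding distrib_right by linarith
  qed
  then have "\<exists>M. \<forall>v\<in>H01_space a b. \<bar>F v - G v\<bar> \<le> M * H1_norm a b v" by blast
  moreover have "\<forall>u\<in>H01_space a b. \<forall>v\<in>H01_space a b. F (\<lambda>x. u x + v x) - G (\<lambda>x. u x + v x) = F u - G u + (F v - G v)"
    "\<forall>c. \<forall>v\<in>H01_space a b. F (\<lambda>x. c * v x) - G (\<lambda>x. c * v x) = c * (F v - G v)"
    using assms unfolding Hm1_space_def by (auto simp: algebra_simps)
  ultimately show ?thesis unfolding Hm1_space_def by blast
qed

text \<open>Strong measurability implies measurability of the pairing with a fixed v, because the
  pairing error is at most the dual norm of the error times the norm of v. Integrability follows
  from the same estimate.\<close>

lemma L1_Hm1_apply_integrable: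
  assumes f: "f \<in> L1_Hm1 a b T" and v: "v \<in> H01_space a b"
  shows "set_integrable lebesgue {0<..<T} (\<lambda>t. f t v)"
proof -
  let ?i = "indicator {0<..<T} :: real \<Rightarrow> real"
  obtain s where s: "\<And>i::nat. Hm1_simple a b T (s i)"
    "AE t in lebesgue. t \<in> {0<..<T} \<longrightarrow> (\<lambda>i. Hm1_norm a b (\<lambda>v. s i t v - f t v)) \<longlonglongrightarrow> 0"
    using f unfolding L1_Hm1_def Hm1_strongly_measurable_def by blast
  have fH: "AE t in lebesgue. t \<in> {0<..<T} \<longrightarrow> f t \<in> Hm1_space a b" using f by (simp add: L1_Hm1_def)
  have sm: "(\<lambda>t. ?i t * s i t v) \<in> borel_measurable lebesgue" for i
  proof -
    let ?R = "s i ` {0<..<T}"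
    have fin: "finite ?R" and meas: "\<And>F. {t \<in> {0<..<T}. s i t = F} \<in> sets lebesgue" using s(1)[of i] by (auto simp: Hm1_simple_def)
    \<comment> \<open>A simple function is expanded over its finitely many values; each level set is
      measurable by assumption.\<close>
    have "?i t * s i t v = (\<Sum>F\<in>?R. indicator {t \<in> {0<..<T}. s i t = F} t * F v)" for t
    proof (cases "t \<in> {0<..<T}")
      case True
      have "(\<Sum>F\<in>?R. indicator {t \<in> {0<..<T}. s i t = F} t * F v) = (\<Sum>F\<in>?R. if F = s i t then F v else 0)"
        using True by (intro sum.cong) auto
      then show ?thesis using True fin by simp
    next
      case False
      then have "(\<Sum>F\<in>?R. indicator {t \<in> {0<..<T}. s i t = F} t * F v) = 0" by (intro sum.neutral) auto
      then show ?thesis using False by (simp only: indicator_simps) simp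
    qed
    moreover have "(\<lambda>t. \<Sum>F\<in>?R. indicator {t \<in> {0<..<T}. s i t = F} t * F v) \<in> borel_measurable lebesgue"
      using meas by (intro borel_measurable_sum borel_measurable_times borel_measurable_indicator) auto
    ultimately show ?thesis by simp
  qed
  have "AE t in lebesgue. lim (\<lambda>i. ?i t * s i t v) = ?i t * f t v"
    using s(2) fH
  proof eventually_elim
    case (elim t)
    show ?case
    proof (cases "t \<in> {0<..<T}")
      case True
      have "s i t \<in> Hm1_space a b" for i using s(1)[of i] True by (auto simp: Hm1_simple_def)
      then have "(\<lambda>v. s i t v - f t v) \<in> Hm1_space a b" for i using elim True by (intro Hm1_diff) auto
      then have "\<bar>s i t v - f t v\<bar> \<le> Hm1_norm a b (\<lambda>v. s i t v - f t v) * H1_norm a b v" for i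
        by (rule Hm1_bound(1)[OF _ v])
      then have le: "\<forall>\<^sub>F i in sequentially. norm (s i t v - f t v) \<le> Hm1_norm a b (\<lambda>v. s i t v - f t v) * H1_norm a b v"
        by (simp only: real_norm_def eventually_True)
      have "(\<lambda>i. Hm1_norm a b (\<lambda>v. s i t v - f t v) * H1_norm a b v) \<longlonglongrightarrow> 0"
        using elim True by (intro tendsto_mult_left_zero) auto
      then have "(\<lambda>i. s i t v - f t v) \<longlonglongrightarrow> 0" by (rule Lim_null_comparison[OF le])
      then have "(\<lambda>i. s i t v) \<longlonglongrightarrow> f t v" by (rule LIM_zero_cancel)
      then show ?thesis using True by (simp add: limI)
    next
      case False then show ?thesis by (simp add: limI)
    qed
  qed
  then have fm: "(\<lambda>t. ?i t * f t v) \<in> borel_measurable lebesgue"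
    by (rule borel_measurable_AE[rotated]) (intro borel_measurable_lim_metric sm)
  have nI: "integrable lebesgue (\<lambda>t. H1_norm a b v * (?i t *\<^sub>R Hm1_norm a b (f t)))"
    using f by (simp add: L1_Hm1_def set_integrable_def)
  show ?thesis unfolding set_integrable_def
  proof (rule Bochner_Integration.integrable_bound[OF nI])
    show "(\<lambda>t. ?i t *\<^sub>R f t v) \<in> borel_measurable lebesgue" using fm by simp
    show "AE t in lebesgue. norm (?i t *\<^sub>R f t v) \<le> norm (H1_norm a b v * (?i t *\<^sub>R Hm1_norm a b (f t)))"
      using fH
    proof eventually_elim
      case (elim t)
      show ?case
      proof (cases "t \<in> {0<..<T}")
        case True
        then show ?thesis using Hm1_bound(1)[OF _ v, of "f t"] elim by (auto intro: order_trans[OF _ abs_ge_self] simp: mult.commute)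
      qed simp
    qed
  qed
qed

lemma set_integral_double_sum:
  fixes g :: "nat \<Rightarrow> nat \<Rightarrow> real \<Rightarrow> real"
  assumes "\<And>l k. l < d \<Longrightarrow> k < d \<Longrightarrow> set_integrable M A (g l k)"
  shows "(LINT t:A|M. (\<Sum>l<d. \<Sum>k<d. c l k * g l k t)) = (\<Sum>l<d. \<Sum>k<d. c l k * (LINT t:A|M. g l k t))"
proof -
  have i: "integrable M (\<lambda>t. c l k * (indicator A t *\<^sub>R g l k t))" if "l < d" "k < d" for l k
    using assms[OF that] by (simp add: set_integrable_def)
  have "(LINT t:A|M. (\<Sum>l<d. \<Sum>k<d. c l k * g l k t)) = (LINT t|M. (\<Sum>l<d. \<Sum>k<d. c l k * (indicator A t *\<^sub>R g l k t)))"
    unfolding set_lebesgue_integral_def by (intro Bochner_Integration.integral_cong) (auto simp: sum_distrib_left mult_ac)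
  also have "\<dots> = (\<Sum>l<d. \<Sum>k<d. (LINT t|M. c l k * (indicator A t *\<^sub>R g l k t)))"
    using i by (subst Bochner_Integration.integral_sum) (auto intro!: sum.cong Bochner_Integration.integral_sum)
  finally show ?thesis by (simp add: set_lebesgue_integral_def)
qed

text \<open>The space basis w is a parameter of the locale. It spans only in the sense of equality
  on the open cells, since nodal values are free.\<close>

locale disc = mesh a b N xs n + time_mesh T \<sigma> J
  for a b :: real and N :: nat and xs :: "nat \<Rightarrow> real" and n :: nat and T \<sigma> :: real and J :: nat +
  fixes m d :: nat and w :: "nat \<Rightarrow> real \<Rightarrow> real" and \<alpha> \<beta> \<kappa>1 \<kappa>2 :: real
    and u0 :: "real \<Rightarrow> real" and f :: "real \<Rightarrow> (real \<Rightarrow> real) \<Rightarrow> real"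
  assumes w: "\<And>l. l < d \<Longrightarrow> w l \<in> Sh a b N xs n"
    and orth: "\<And>k l. k < d \<Longrightarrow> l < d \<Longrightarrow> Dir_inner a b (w k) (w l) = (if k = l then 1 else 0)"
    and span: "\<And>v x. v \<in> Sh a b N xs n \<Longrightarrow> x \<in> P \<Longrightarrow> v x = (\<Sum>l<d. Dir_inner a b v (w l) * w l x)"
    and al: "0 < \<alpha>" "\<alpha> < 1" and be: "0 < \<beta>" "\<beta> < 1" and ka: "0 < \<kappa>1" "0 < \<kappa>2"
    and u0: "u0 \<in> H01_space a b" and f: "f \<in> L1_Hm1 a b T"
begin

sublocale A: frac_time T \<sigma> J \<alpha> by unfold_locales (use al in auto)
sublocale B: frac_time T \<sigma> J \<beta> by unfold_locales (use be in auto)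
sublocale L: semi_ip "L2_space a b" "L2_inner a b" by (rule semi_ip_L2)
sublocale D: semi_ip "H1_space a b" "Dir_inner a b" by (rule semi_ip_Dir)
sublocale H0: semi_ip "H01_space a b" "H1_inner a b" by (rule semi_ip_H01[OF ab])
sublocale S: semi_ip "Sh a b N xs n" "Dir_inner a b" by (rule semi_ip_Sh)

text \<open>The unknowns are indexed by space basis function, time piece and power of t. Collecting
  the powers gives, for each basis function, a polynomial on every time piece.\<close>

definition cp :: "(nat \<times> nat \<times> nat \<Rightarrow> real) \<Rightarrow> nat \<Rightarrow> nat \<Rightarrow> real poly" where
  "cp c l j = (\<Sum>i\<le>m. monom (c (l, j, i)) i)"

lemma coeff_cp: "coeff (cp c l j) i = (if i \<le> m then c (l, j, i) else 0)"
  by (simp add: cp_def coeff_sum)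

lemma cp_lincomb: "cp (\<lambda>i. r * c i + s * e i) l = (\<lambda>j. smult r (cp c l j) + smult s (cp e l j))"
  by (intro ext poly_eqI) (simp add: coeff_cp)

lemma poly_cp: "poly (cp c l j) t = (\<Sum>i\<le>m. c (l, j, i) * t ^ i)"
  by (simp add: cp_def poly_sum poly_monom)

definition uf :: "(nat \<times> nat \<times> nat \<Rightarrow> real) \<Rightarrow> real \<Rightarrow> real \<Rightarrow> real" where
  "uf c t x = (\<Sum>l<d. pw (cp c l) t * w l x)"

text \<open>Equality is demanded only on products of open cells. This determines every integral,
  one-sided limit and classical derivative that occurs in the discrete problem.\<close>

definition rep :: "(real \<Rightarrow> real \<Rightarrow> real) \<Rightarrow> (nat \<times> nat \<times> nat \<Rightarrow> real) \<Rightarrow> bool" where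
  "rep U c \<longleftrightarrow> (\<forall>t\<in>tm.P. \<forall>x\<in>P. U t x = uf c t x)"

lemma rep_uf: "rep (uf c) c" by (simp add: rep_def)

lemma rep_piece:
  assumes "rep U c" "j < J" "t \<in> {\<tau> j<..<\<tau> (Suc j)}" "x \<in> P"
  shows "U t x = (\<Sum>l<d. poly (cp c l j) t * w l x)"
proof -
  have "t \<in> tm.P" using assms by (auto simp: tm_P)
  then have "U t x = uf c t x" using assms by (simp add: rep_def)
  also have "\<dots> = (\<Sum>l<d. poly (cp c l j) t * w l x)" using pw_piece[of j t] assms(2,3) by (simp add: uf_def)
  finally show ?thesis .
qed

lemma rep_ex:
  assumes U: "U \<in> Wht a b N xs n m T J \<sigma>"
  shows "\<exists>c. rep U c"
proof -
  have "\<exists>q. (\<forall>i\<le>m. q i \<in> Sh a b N xs n) \<and>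
       (\<forall>t\<in>{\<tau> j<..<\<tau> (Suc j)}. \<forall>x\<in>{a<..<b}. U t x = (\<Sum>i\<le>m. t ^ i * q i x))" if "j < J" for j
  proof -
    have "Suc j \<in> {1..J}" using that by auto
    then show ?thesis using U unfolding Wht_def by (auto dest!: bspec[of _ _ "Suc j"])
  qed
  then obtain q where q: "\<And>j i. j < J \<Longrightarrow> i \<le> m \<Longrightarrow> q j i \<in> Sh a b N xs n"
    "\<And>j t x. j < J \<Longrightarrow> t \<in> {\<tau> j<..<\<tau> (Suc j)} \<Longrightarrow> x \<in> {a<..<b} \<Longrightarrow> U t x = (\<Sum>i\<le>m. t ^ i * q j i x)"
    by metis
  define c where "c = (\<lambda>(l, j, i). Dir_inner a b (q j i) (w l))"
  have "U t x = uf c t x" if t: "t \<in> tm.P" and x: "x \<in> P" for t x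
  proof -
    obtain j where j: "j < J" "t \<in> {\<tau> j<..<\<tau> (Suc j)}" using t by (auto simp: tm_P)
    have "U t x = (\<Sum>i\<le>m. t ^ i * q j i x)" using q(2)[OF j] x P_subset by auto
    also have "\<dots> = (\<Sum>i\<le>m. t ^ i * (\<Sum>l<d. c (l, j, i) * w l x))"
      by (rule sum.cong[OF refl]) (use span[OF q(1)[OF j(1)] x] in \<open>simp add: c_def\<close>)
    also have "\<dots> = (\<Sum>l<d. (\<Sum>i\<le>m. c (l, j, i) * t ^ i) * w l x)"
      unfolding sum_distrib_left sum_distrib_right by (subst sum.swap) (simp add: mult_ac)
    also have "\<dots> = uf c t x" using j pw_piece[of j t] by (simp add: uf_def poly_cp)
    finally show ?thesis .
  qed
  then show ?thesis unfolding rep_def by blast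
qed

lemma uf_Wht: "uf c \<in> Wht a b N xs n m T J \<sigma>"
  unfolding Wht_def
proof (intro CollectI ballI)
  fix j assume "j \<in> {1..J}"
  then obtain i where i: "j = Suc i" "i < J" by (cases j) auto
  show "\<exists>q. (\<forall>i\<le>m. q i \<in> Sh a b N xs n) \<and> (\<forall>t\<in>{\<tau> (j - 1)<..<\<tau> j}. \<forall>x\<in>{a<..<b}. uf c t x = (\<Sum>i\<le>m. t ^ i * q i x))"
  proof (intro exI[of _ "\<lambda>k x. \<Sum>l<d. c (l, i, k) * w l x"] conjI allI impI ballI)
    fix k show "(\<lambda>x. \<Sum>l<d. c (l, i, k) * w l x) \<in> Sh a b N xs n"
      by (rule S.sum_mem[of d w "\<lambda>l. c (l, i, k)"]) (rule w)
  next
    fix t x assume t: "t \<in> {\<tau> (j - 1)<..<\<tau> j}"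
    have "uf c t x = (\<Sum>l<d. (\<Sum>k\<le>m. c (l, i, k) * t ^ k) * w l x)"
      using t i pw_piece[of i t] by (simp add: uf_def poly_cp)
    also have "\<dots> = (\<Sum>k\<le>m. t ^ k * (\<Sum>l<d. c (l, i, k) * w l x))"
      unfolding sum_distrib_left sum_distrib_right by (subst sum.swap) (simp add: mult_ac)
    finally show "uf c t x = (\<Sum>k\<le>m. t ^ k * (\<Sum>l<d. c (l, i, k) * w l x))" .
  qed
qed

definition Mm :: "nat \<Rightarrow> nat \<Rightarrow> real" where "Mm l k = L2_inner a b (w l) (w k)"

definition \<rho> :: "real \<Rightarrow> real" where "\<rho> = ritz_proj a b N xs n u0"

text \<open>The time terms keep all pairs (l, k), weighted with the mass matrix, because w is in
  general not orthogonal in L2. The fractional terms keep only the diagonal.\<close>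

definition Bil where
  "Bil c e = (\<Sum>l<d. \<Sum>k<d. Tf (cp c l) (cp e k) * Mm l k) + (\<Sum>l<d. \<kappa>1 * A.Ff (cp c l) (cp e l) + \<kappa>2 * B.Ff (cp c l) (cp e l))"

definition Lf where
  "Lf e = (\<Sum>k<d. rv (cp e k) 0 * L2_inner a b \<rho> (w k)) + (\<Sum>k<d. LINT t:{0<..<T}|lebesgue. f t (w k) * pw (cp e k) t)"

lemma w_L2: "l < d \<Longrightarrow> w l \<in> L2_space a b" by (rule Sh_L2[OF w])
lemma w_H01: "l < d \<Longrightarrow> w l \<in> H01_space a b" by (rule Sh_H01[OF w])
lemma w_H1: "l < d \<Longrightarrow> w l \<in> H1_space a b" by (rule Sh_H1[OF w])

text \<open>\<open>ritz_proj\<close> is a choice, so a projection must be exhibited before anything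
  is known about it. The expansion of u0 with its Dirichlet coefficients against w is one.\<close>

lemma ritz: "is_ritz_proj a b N xs n u0 \<rho>"
  unfolding \<rho>_def ritz_proj_def
proof (rule someI[of "is_ritz_proj a b N xs n u0"])
  let ?r = "\<lambda>x. \<Sum>l<d. Dir_inner a b u0 (w l) * w l x"
  have u1: "u0 \<in> H1_space a b" by (rule H01_H1[OF u0])
  have r: "?r \<in> Sh a b N xs n" by (rule S.sum_mem[of d w "\<lambda>l. Dir_inner a b u0 (w l)"]) (rule w)
  let ?z = "\<lambda>y. u0 y - ?r y"
  have z: "?z \<in> H1_space a b" by (rule D.diff[OF u1 Sh_H1[OF r]])
  have zl: "Dir_inner a b ?z (w k) = 0" if k: "k < d" for k
  proof -
    have "Dir_inner a b ?r (w k) = (\<Sum>l<d. Dir_inner a b u0 (w l) * Dir_inner a b (w l) (w k))"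
      by (rule S.ip_sum[of d w "w k" "\<lambda>l. Dir_inner a b u0 (w l)"]) (auto intro: w k)
    also have "\<dots> = (\<Sum>l<d. if l = k then Dir_inner a b u0 (w l) else 0)" using orth k by (intro sum.cong) auto
    finally show ?thesis using D.ip_diff[OF u1 Sh_H1[OF r] w_H1[OF k]] k by simp
  qed
  have "Dir_inner a b ?z v = 0" if v: "v \<in> Sh a b N xs n" for v
  proof -
    let ?s = "\<lambda>x. \<Sum>l<d. Dir_inner a b v (w l) * w l x"
    have s: "?s \<in> H1_space a b" by (rule Sh_H1[OF S.sum_mem[of d w "\<lambda>l. Dir_inner a b v (w l)"]]) (rule w)
    have "Dir_inner a b ?z v = Dir_inner a b ?z ?s"
      by (rule H1_inner_cong(2)[OF z _ s AE_P_imp]) (use span[OF v] in auto)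
    also have "\<dots> = (\<Sum>l<d. Dir_inner a b v (w l) * Dir_inner a b ?z (w l))"
      by (rule D.ip_sum_right[of d w ?z "\<lambda>l. Dir_inner a b v (w l)"]) (auto intro: w_H1 z)
    finally show ?thesis using zl by simp
  qed
  then show "is_ritz_proj a b N xs n u0 ?r" unfolding is_ritz_proj_def using r by (simp add: Dir_inner_def L2_inner_def)
qed

lemma \<rho>_Sh: "\<rho> \<in> Sh a b N xs n" using ritz by (simp add: is_ritz_proj_def)

text \<open>Galerkin orthogonality makes the projection a contraction in the Dirichlet seminorm. The
  Poincare inequality then returns to L2, which is the source of the factor b - a in the final
  constant.\<close>

lemma \<rho>_bound: "L2_inner a b \<rho> \<rho> \<le> (b - a)\<^sup>2 * (H1_norm a b u0)\<^sup>2"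
proof -
  have u1: "u0 \<in> H1_space a b" by (rule H01_H1[OF u0])
  have r1: "\<rho> \<in> H1_space a b" by (rule Sh_H1[OF \<rho>_Sh])
  have "Dir_inner a b (\<lambda>y. u0 y - \<rho> y) \<rho> = 0" using ritz \<rho>_Sh by (simp add: is_ritz_proj_def Dir_inner_def L2_inner_def)
  then have "Dir_inner a b \<rho> \<rho> = Dir_inner a b u0 \<rho>" using D.ip_diff[OF u1 r1 r1] by simp
  then have "(D.nrm \<rho>)\<^sup>2 \<le> D.nrm u0 * D.nrm \<rho>" using D.abs_ip_le[OF u1 r1] D.nrm_square[OF r1] by simp
  then have le: "D.nrm \<rho> \<le> D.nrm u0"
    using D.nrm_nonneg[OF r1] D.nrm_nonneg[OF u1] by (cases "D.nrm \<rho> = 0") (auto simp: power2_eq_square)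
  have "Dir_inner a b \<rho> \<rho> = (D.nrm \<rho>)\<^sup>2" by (rule D.nrm_square[OF r1, symmetric])
  also have "\<dots> \<le> (D.nrm u0)\<^sup>2" using le D.nrm_nonneg[OF r1] by (rule power_mono)
  also have "\<dots> = Dir_inner a b u0 u0" by (rule D.nrm_square[OF u1])
  also have "\<dots> \<le> H1_inner a b u0 u0" using L.nonneg[OF H1D(1)[OF u1]] by (simp add: H1_inner_eq)
  also have "\<dots> = (H1_norm a b u0)\<^sup>2" using H0.nonneg[OF u0] by (simp add: H1_norm_def)
  finally show ?thesis using Poincare[OF ab Sh_H01[OF \<rho>_Sh]] by (meson mult_left_mono order_trans zero_le_power2)
qed

lemma right_val_rep:
  assumes V: "rep V e" and j: "j < J" and x: "x \<in> P"
  shows "right_val T J \<sigma> V j x = (\<Sum>k<d. rv (cp e k) j * w k x)"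
proof -
  let ?G = "\<lambda>t. \<Sum>k<d. poly (cp e k j) t * w k x"
  have "isCont ?G (\<tau> j)" by (intro continuous_intros)
  then have "(?G \<longlongrightarrow> ?G (\<tau> j)) (at_right (\<tau> j))" unfolding isCont_def by (rule tendsto_within_subset) auto
  moreover have "\<forall>\<^sub>F t in at_right (\<tau> j). ?G t = V t x"
    unfolding eventually_at_right[OF \<tau>_Suc[of j]]
    using rep_piece[OF V j _ x] \<tau>_Suc[of j] by (intro exI[of _ "\<tau> (Suc j)"]) auto
  ultimately have "((\<lambda>t. V t x) \<longlongrightarrow> ?G (\<tau> j)) (at_right (\<tau> j))" by (rule Lim_transform_eventually)
  then have "Lim (at_right (\<tau> j)) (\<lambda>t. V t x) = ?G (\<tau> j)" by (intro tendsto_Lim) auto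
  then show ?thesis by (simp add: right_val_def rv_def)
qed

lemma left_val_rep:
  assumes V: "rep V e" and j: "j \<le> J" and x: "x \<in> P"
  shows "left_val T J \<sigma> V j x = (\<Sum>k<d. lv (cp e k) j * w k x)"
proof (cases j)
  case 0 then show ?thesis by (simp add: left_val_def lv_def)
next
  case (Suc i)
  let ?G = "\<lambda>t. \<Sum>k<d. poly (cp e k i) t * w k x"
  have "isCont ?G (\<tau> j)" by (intro continuous_intros)
  then have "(?G \<longlongrightarrow> ?G (\<tau> j)) (at_left (\<tau> j))" unfolding isCont_def by (rule tendsto_within_subset) auto
  moreover have "\<forall>\<^sub>F t in at_left (\<tau> j). ?G t = V t x"
    unfolding Suc eventually_at_left[OF \<tau>_Suc[of i]]
    using rep_piece[OF V _ _ x, of i] \<tau>_Suc[of i] j Suc by (intro exI[of _ "\<tau> i"]) auto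
  ultimately have "((\<lambda>t. V t x) \<longlongrightarrow> ?G (\<tau> j)) (at_left (\<tau> j))" by (rule Lim_transform_eventually)
  then have "Lim (at_left (\<tau> j)) (\<lambda>t. V t x) = ?G (\<tau> j)" by (intro tendsto_Lim) auto
  then show ?thesis using Suc by (simp add: left_val_def lv_def)
qed

lemma dt_rep:
  assumes U: "rep U c" and t: "t \<in> tm.P" and x: "x \<in> P"
  shows "dt U t x = (\<Sum>l<d. pw (\<lambda>j. pderiv (cp c l j)) t * w l x)"
proof -
  obtain j where j: "j < J" "t \<in> {\<tau> j<..<\<tau> (Suc j)}" using t by (auto simp: tm_P)
  have "((\<lambda>s. \<Sum>l<d. poly (cp c l j) s * w l x) has_real_derivative (\<Sum>l<d. poly (pderiv (cp c l j)) t * w l x)) (at t)"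
    by (intro DERIV_sum DERIV_cmult_right poly_DERIV)
  then have "((\<lambda>s. U s x) has_real_derivative (\<Sum>l<d. poly (pderiv (cp c l j)) t * w l x)) (at t)"
    by (rule has_field_derivative_transform_within_open[OF _ _ j(2)]) (auto simp: rep_piece[OF U j(1) _ x])
  then show ?thesis using j pw_piece[of j t] by (simp add: dt_def DERIV_imp_deriv)
qed

lemma open_P: "open P" unfolding P_def by auto

lemma dx_rep:
  assumes U: "rep U c" and t: "t \<in> tm.P" and x: "x \<in> P"
  shows "dx U t x = (\<Sum>l<d. deriv (w l) x * pw (cp c l) t)"
proof -
  have "((\<lambda>y. uf c t y) has_real_derivative (\<Sum>l<d. pw (cp c l) t * deriv (w l) x)) (at x)"
    unfolding uf_def using Sh_DERIV[OF w x] by (intro DERIV_sum DERIV_cmult) auto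
  then have "(U t has_real_derivative (\<Sum>l<d. pw (cp c l) t * deriv (w l) x)) (at x)"
    by (rule has_field_derivative_transform_within_open[OF _ open_P x]) (use U t in \<open>auto simp: rep_def\<close>)
  then show ?thesis by (simp add: dx_def DERIV_imp_deriv mult.commute)
qed

lemma space_double_sum:
  "(\<And>x. x \<in> P \<Longrightarrow> F x = (\<Sum>l<d. \<Sum>k<d. C l k * (w l x * w k x))) \<Longrightarrow>
    (LINT x:{a<..<b}|lebesgue. F x) = (\<Sum>l<d. \<Sum>k<d. C l k * Mm l k)"
proof -
  assume F: "\<And>x. x \<in> P \<Longrightarrow> F x = (\<Sum>l<d. \<Sum>k<d. C l k * (w l x * w k x))"
  have "(LINT x:{a<..<b}|lebesgue. F x) = (LINT x:{a<..<b}|lebesgue. (\<Sum>l<d. \<Sum>k<d. C l k * (w l x * w k x)))"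
    by (intro set_integral_cong_AE' AE_P_imp F)
  also have "\<dots> = (\<Sum>l<d. \<Sum>k<d. C l k * Mm l k)"
    unfolding Mm_def L2_inner_def by (intro set_integral_double_sum L2_mult w_L2)
  finally show ?thesis .
qed

lemma time_part:
  assumes U: "rep U c" and V: "rep V e"
  shows "spacetime_int a b T (\<lambda>t x. dt U t x * V t x) +
      (\<Sum>j<J. LINT x:{a<..<b}|lebesgue. jump T J \<sigma> U j x * right_val T J \<sigma> V j x) =
    (\<Sum>l<d. \<Sum>k<d. Tf (cp c l) (cp e k) * Mm l k)"
proof -
  let ?I = "\<lambda>l k j. poly_int (\<tau> j) (\<tau> (Suc j)) (pderiv (cp c l j) * cp e k j)"
  let ?R = "\<lambda>l k j. (rv (cp c l) j - lv (cp c l) j) * rv (cp e k) j"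
  have inner: "(LINT t:{0<..<T}|lebesgue. dt U t x * V t x) = (\<Sum>l<d. \<Sum>k<d. (\<Sum>j<J. ?I l k j) * (w l x * w k x))" if x: "x \<in> P" for x
  proof -
    have "(LINT t:{0<..<T}|lebesgue. dt U t x * V t x) =
        (LINT t:{0<..<T}|lebesgue. (\<Sum>l<d. \<Sum>k<d. (w l x * w k x) * pw (\<lambda>j. pderiv (cp c l j) * cp e k j) t))"
    proof (intro set_integral_cong_AE' tm.AE_P_imp)
      fix t assume t: "t \<in> tm.P"
      have "V t x = (\<Sum>k<d. pw (cp e k) t * w k x)" using V t x by (simp add: rep_def uf_def)
      then show "dt U t x * V t x = (\<Sum>l<d. \<Sum>k<d. (w l x * w k x) * pw (\<lambda>j. pderiv (cp c l j) * cp e k j) t)"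
        unfolding dt_rep[OF U t x] pw_mult[symmetric] by (simp only: sum_product) (intro sum.cong refl, simp only: mult_ac)
    qed
    also have "\<dots> = (\<Sum>l<d. \<Sum>k<d. (w l x * w k x) * (\<Sum>j<J. ?I l k j))"
      by (subst set_integral_double_sum[OF pw_set_integrable]) (simp add: integral_pw)
    finally show ?thesis by (simp add: mult.commute)
  qed
  have 1: "spacetime_int a b T (\<lambda>t x. dt U t x * V t x) = (\<Sum>l<d. \<Sum>k<d. (\<Sum>j<J. ?I l k j) * Mm l k)"
    unfolding spacetime_int_def by (rule space_double_sum[OF inner])
  have 2: "(LINT x:{a<..<b}|lebesgue. jump T J \<sigma> U j x * right_val T J \<sigma> V j x) = (\<Sum>l<d. \<Sum>k<d. ?R l k j * Mm l k)" if j: "j < J" for j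
  proof (rule space_double_sum)
    fix x assume x: "x \<in> P"
    have "jump T J \<sigma> U j x = (\<Sum>l<d. (rv (cp c l) j - lv (cp c l) j) * w l x)"
      using right_val_rep[OF U j x] left_val_rep[OF U _ x, of j] j
      by (simp add: jump_def left_diff_distrib sum_subtractf)
    then show "jump T J \<sigma> U j x * right_val T J \<sigma> V j x = (\<Sum>l<d. \<Sum>k<d. ?R l k j * (w l x * w k x))"
      unfolding right_val_rep[OF V j x] by (simp only: sum_product) (intro sum.cong refl, simp only: mult_ac)
  qed
  have "(\<Sum>j<J. LINT x:{a<..<b}|lebesgue. jump T J \<sigma> U j x * right_val T J \<sigma> V j x) = (\<Sum>j<J. \<Sum>l<d. \<Sum>k<d. ?R l k j * Mm l k)"
    using 2 by (intro sum.cong) auto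
  also have "\<dots> = (\<Sum>l<d. \<Sum>j<J. \<Sum>k<d. ?R l k j * Mm l k)" by (rule sum.swap)
  also have "\<dots> = (\<Sum>l<d. \<Sum>k<d. \<Sum>j<J. ?R l k j * Mm l k)" by (intro sum.cong refl sum.swap)
  finally have 3: "(\<Sum>j<J. LINT x:{a<..<b}|lebesgue. jump T J \<sigma> U j x * right_val T J \<sigma> V j x) = (\<Sum>l<d. \<Sum>k<d. (\<Sum>j<J. ?R l k j) * Mm l k)"
    by (simp add: sum_distrib_right)
  show ?thesis unfolding 1 3 Tf_def sum.distrib distrib_right by simp
qed

text \<open>For fixed x the values of the basis derivatives are constants in time, so the fractional
  derivative of the expansion is known almost everywhere in t. Integrating over time first leaves
  products of basis derivatives, whose space integrals are Dirichlet products.\<close>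

lemma frac_part:
  assumes U: "rep U c" and V: "rep V e"
  shows "spacetime_int a b T (\<lambda>t x. (\<kappa>1 * frac_deriv T \<alpha> (\<lambda>s. dx U s x) t + \<kappa>2 * frac_deriv T \<beta> (\<lambda>s. dx U s x) t) * dx V t x) =
    (\<Sum>l<d. \<kappa>1 * A.Ff (cp c l) (cp e l) + \<kappa>2 * B.Ff (cp c l) (cp e l))"
proof -
  let ?C = "\<lambda>l k. \<kappa>1 * A.Ff (cp c l) (cp e k) + \<kappa>2 * B.Ff (cp c l) (cp e k)"
  have inner: "(LINT t:{0<..<T}|lebesgue. (\<kappa>1 * frac_deriv T \<alpha> (\<lambda>s. dx U s x) t + \<kappa>2 * frac_deriv T \<beta> (\<lambda>s. dx U s x) t) * dx V t x) =
      (\<Sum>l<d. \<Sum>k<d. ?C l k * (deriv (w l) x * deriv (w k) x))" if x: "x \<in> P" for x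
  proof -
    let ?g = "\<lambda>l k t. \<kappa>1 * (A.fd (cp c l) t * pw (cp e k) t) + \<kappa>2 * (B.fd (cp c l) t * pw (cp e k) t)"
    have gi: "set_integrable lebesgue {0<..<T} (?g l k)" for l k
      using A.fd_pw_integrable B.fd_pw_integrable by (intro set_integral_add set_integrable_mult_right)
    have gI: "(LINT t:{0<..<T}|lebesgue. ?g l k t) = ?C l k" for l k
      using A.fd_pw_integrable B.fd_pw_integrable by (simp add: A.Ff_def B.Ff_def set_integral_add set_integrable_mult_right)
    have "(LINT t:{0<..<T}|lebesgue. (\<kappa>1 * frac_deriv T \<alpha> (\<lambda>s. dx U s x) t + \<kappa>2 * frac_deriv T \<beta> (\<lambda>s. dx U s x) t) * dx V t x) =
        (LINT t:{0<..<T}|lebesgue. (\<Sum>l<d. \<Sum>k<d. (deriv (w l) x * deriv (w k) x) * ?g l k t))"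
    proof (rule set_integral_cong_AE')
      have "AE t in lebesgue. t \<in> {0<..<T} \<longrightarrow> dx V t x = (\<Sum>k<d. deriv (w k) x * pw (cp e k) t)"
        using dx_rep[OF V _ x] by (rule tm.AE_P_imp)
      moreover have "AE t in lebesgue. t \<in> {0<..<T} \<longrightarrow> frac_deriv T \<alpha> (\<lambda>s. dx U s x) t = (\<Sum>l<d. deriv (w l) x * A.fd (cp c l) t)"
        by (rule A.frac_deriv_sum) (rule dx_rep[OF U _ x])
      moreover have "AE t in lebesgue. t \<in> {0<..<T} \<longrightarrow> frac_deriv T \<beta> (\<lambda>s. dx U s x) t = (\<Sum>l<d. deriv (w l) x * B.fd (cp c l) t)"
        by (rule B.frac_deriv_sum) (rule dx_rep[OF U _ x])
      ultimately show "AE t in lebesgue. t \<in> {0<..<T} \<longrightarrow>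
        (\<kappa>1 * frac_deriv T \<alpha> (\<lambda>s. dx U s x) t + \<kappa>2 * frac_deriv T \<beta> (\<lambda>s. dx U s x) t) * dx V t x =
        (\<Sum>l<d. \<Sum>k<d. (deriv (w l) x * deriv (w k) x) * ?g l k t)"
      proof eventually_elim
        case (elim t)
        show ?case
        proof
          assume "t \<in> {0<..<T}"
          then have e1: "(\<kappa>1 * frac_deriv T \<alpha> (\<lambda>s. dx U s x) t + \<kappa>2 * frac_deriv T \<beta> (\<lambda>s. dx U s x) t) * dx V t x =
             (\<Sum>l<d. deriv (w l) x * (\<kappa>1 * A.fd (cp c l) t + \<kappa>2 * B.fd (cp c l) t)) * (\<Sum>k<d. deriv (w k) x * pw (cp e k) t)"
            using elim by (simp add: sum_distrib_left sum.distrib algebra_simps)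
          show "(\<kappa>1 * frac_deriv T \<alpha> (\<lambda>s. dx U s x) t + \<kappa>2 * frac_deriv T \<beta> (\<lambda>s. dx U s x) t) * dx V t x =
            (\<Sum>l<d. \<Sum>k<d. (deriv (w l) x * deriv (w k) x) * ?g l k t)"
            by (rule trans[OF e1], unfold sum_product, intro sum.cong refl) (simp add: algebra_simps)
        qed
      qed
    qed
    also have "\<dots> = (\<Sum>l<d. \<Sum>k<d. (deriv (w l) x * deriv (w k) x) * ?C l k)"
      by (subst set_integral_double_sum[OF gi]) (simp only: gI)
    finally show ?thesis by (simp add: mult.commute)
  qed
  have "spacetime_int a b T (\<lambda>t x. (\<kappa>1 * frac_deriv T \<alpha> (\<lambda>s. dx U s x) t + \<kappa>2 * frac_deriv T \<beta> (\<lambda>s. dx U s x) t) * dx V t x) =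
      (LINT x:{a<..<b}|lebesgue. (\<Sum>l<d. \<Sum>k<d. ?C l k * (deriv (w l) x * deriv (w k) x)))"
    unfolding spacetime_int_def by (intro set_integral_cong_AE' AE_P_imp inner)
  also have "\<dots> = (\<Sum>l<d. \<Sum>k<d. ?C l k * (LINT x:{a<..<b}|lebesgue. deriv (w l) x * deriv (w k) x))"
    using Sh_deriv_L2[OF w] by (intro set_integral_double_sum L2_mult) auto
  also have "\<dots> = (\<Sum>l<d. \<Sum>k<d. if k = l then ?C l k else 0)"
  proof (intro sum.cong refl)
    fix l k assume "l \<in> {..<d}" "k \<in> {..<d}"
    then show "?C l k * (LINT x:{a<..<b}|lebesgue. deriv (w l) x * deriv (w k) x) = (if k = l then ?C l k else 0)"
      using Dir_inner_Sh[OF w w, of l k] orth[of l k] by auto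
  qed
  finally show ?thesis by simp
qed

lemma f_uf:
  assumes V: "rep V e"
  shows "AE t in lebesgue. t \<in> {0<..<T} \<longrightarrow> f t (V t) = (\<Sum>k<d. f t (w k) * pw (cp e k) t)"
proof -
  have "AE t in lebesgue. t \<in> {0<..<T} \<longrightarrow> f t \<in> Hm1_space a b" using f by (simp add: L1_Hm1_def)
  with tm.AE_P show ?thesis
  proof eventually_elim
    case (elim t)
    show ?case
    proof
      assume t: "t \<in> {0<..<T}"
      have F: "f t \<in> Hm1_space a b" and tP: "t \<in> tm.P" using elim t by auto
      have "f t (V t) = f t (uf e t)"
      proof (rule Hm1_cong[OF ab F _ AE_P_imp])
        show "uf e t \<in> H01_space a b" unfolding uf_def[abs_def] by (rule H0.sum_mem[of d w "\<lambda>l. pw (cp e l) t"]) (rule w_H01)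
      qed (use V tP in \<open>auto simp: rep_def\<close>)
      also have "\<dots> = (\<Sum>k<d. pw (cp e k) t * f t (w k))"
        unfolding uf_def[abs_def] by (rule Hm1_sum[OF F ab w_H01])
      finally show "f t (V t) = (\<Sum>k<d. f t (w k) * pw (cp e k) t)" by (simp add: mult.commute)
    qed
  qed
qed

lemma f_pw_integrable: assumes "k < d" shows "set_integrable lebesgue {0<..<T} (\<lambda>t. f t (w k) * pw p t)"
proof -
  obtain M where M: "\<And>t. \<bar>pw p t\<bar> \<le> M" by (rule pw_bounded[of p]) blast
  show ?thesis
  proof (rule set_integrable_mult_bounded[OF L1_Hm1_apply_integrable[OF f w_H01[OF assms]]])
    have "pw p \<in> borel_measurable lebesgue" by (simp add: measurable_completion)
    then show "set_borel_measurable lebesgue {0<..<T} (pw p)"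
      unfolding set_borel_measurable_def by (intro borel_measurable_scaleR borel_measurable_indicator) auto
  qed (use M in auto)
qed

lemma rhs_part:
  assumes V: "rep V e"
  shows "(LINT x:{a<..<b}|lebesgue. ritz_proj a b N xs n u0 x * right_val T J \<sigma> V 0 x) +
        (LINT t:{0<..<T}|lebesgue. f t (V t)) = Lf e"
proof -
  have "(LINT x:{a<..<b}|lebesgue. \<rho> x * right_val T J \<sigma> V 0 x) = L2_inner a b \<rho> (\<lambda>x. \<Sum>k<d. rv (cp e k) 0 * w k x)"
    unfolding L2_inner_def using right_val_rep[OF V J0] by (intro set_integral_cong_AE' AE_P_imp) simp
  also have "\<dots> = (\<Sum>k<d. rv (cp e k) 0 * L2_inner a b \<rho> (w k))"
    by (rule L.ip_sum_right[of d w \<rho> "\<lambda>k. rv (cp e k) 0"]) (auto intro: w_L2 Sh_L2[OF \<rho>_Sh])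
  finally have 1: "(LINT x:{a<..<b}|lebesgue. \<rho> x * right_val T J \<sigma> V 0 x) = (\<Sum>k<d. rv (cp e k) 0 * L2_inner a b \<rho> (w k))" .
  have "(LINT t:{0<..<T}|lebesgue. f t (V t)) = (LINT t:{0<..<T}|lebesgue. (\<Sum>k<d. f t (w k) * pw (cp e k) t))"
    by (rule set_integral_cong_AE'[OF f_uf[OF V]])
  also have "\<dots> = (\<Sum>k<d. LINT t:{0<..<T}|lebesgue. f t (w k) * pw (cp e k) t)"
    using f_pw_integrable unfolding set_lebesgue_integral_def set_integrable_def scaleR_sum_right
    by (intro Bochner_Integration.integral_sum) auto
  finally show ?thesis using 1 by (simp add: Lf_def \<rho>_def)
qed

text \<open>Every member of \<open>Wht\<close> has coordinates and every coordinate vector gives a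
  member, so quantifying over test functions is the same as quantifying over vectors.\<close>

lemma solution_iff:
  assumes "rep U c" "U \<in> Wht a b N xs n m T J \<sigma>"
  shows "is_discrete_solution a b T \<alpha> \<beta> m n \<kappa>1 \<kappa>2 N xs J \<sigma> u0 f U \<longleftrightarrow> (\<forall>e. Bil c e = Lf e)"
proof -
  have eq: "spacetime_int a b T (\<lambda>t x. dt U t x * V t x) +
        (\<Sum>j<J. LINT x:{a<..<b}|lebesgue. jump T J \<sigma> U j x * right_val T J \<sigma> V j x) +
        spacetime_int a b T (\<lambda>t x. (\<kappa>1 * frac_deriv T \<alpha> (\<lambda>s. dx U s x) t + \<kappa>2 * frac_deriv T \<beta> (\<lambda>s. dx U s x) t) * dx V t x) = Bil c e"
    if "rep V e" for V e
    unfolding time_part[OF assms(1) that] frac_part[OF assms(1) that] Bil_def ..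
  show ?thesis
    unfolding is_discrete_solution_def
  proof (intro iffI conjI ballI allI)
    fix e
    assume *: "U \<in> Wht a b N xs n m T J \<sigma> \<and> (\<forall>V\<in>Wht a b N xs n m T J \<sigma>.
        spacetime_int a b T (\<lambda>t x. dt U t x * V t x) +
        (\<Sum>j<J. LINT x:{a<..<b}|lebesgue. jump T J \<sigma> U j x * right_val T J \<sigma> V j x) +
        spacetime_int a b T (\<lambda>t x. (\<kappa>1 * frac_deriv T \<alpha> (\<lambda>s. dx U s x) t + \<kappa>2 * frac_deriv T \<beta> (\<lambda>s. dx U s x) t) * dx V t x) =
        (LINT x:{a<..<b}|lebesgue. ritz_proj a b N xs n u0 x * right_val T J \<sigma> V 0 x) + (LINT t:{0<..<T}|lebesgue. f t (V t)))"
    show "Bil c e = Lf e"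
      using bspec[OF conjunct2[OF *] uf_Wht[of e]] unfolding eq[OF rep_uf] rhs_part[OF rep_uf] .
  next
    fix V assume *: "\<forall>e. Bil c e = Lf e" and V: "V \<in> Wht a b N xs n m T J \<sigma>"
    obtain e where e: "rep V e" using rep_ex[OF V] by blast
    show "spacetime_int a b T (\<lambda>t x. dt U t x * V t x) +
        (\<Sum>j<J. LINT x:{a<..<b}|lebesgue. jump T J \<sigma> U j x * right_val T J \<sigma> V j x) +
        spacetime_int a b T (\<lambda>t x. (\<kappa>1 * frac_deriv T \<alpha> (\<lambda>s. dx U s x) t + \<kappa>2 * frac_deriv T \<beta> (\<lambda>s. dx U s x) t) * dx V t x) =
        (LINT x:{a<..<b}|lebesgue. ritz_proj a b N xs n u0 x * right_val T J \<sigma> V 0 x) + (LINT t:{0<..<T}|lebesgue. f t (V t))"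
      unfolding eq[OF e] rhs_part[OF e] using * by simp
  qed (rule assms(2))
qed

end

subsection \<open>Stability\<close>

context disc
begin

text \<open>The cut-off at node r, performed on coordinates. It is the test vector for both the
  stability estimate and, with r = J, uniqueness.\<close>

definition trc :: "nat \<Rightarrow> (nat \<times> nat \<times> nat \<Rightarrow> real) \<Rightarrow> nat \<times> nat \<times> nat \<Rightarrow> real" where
  "trc r c = (\<lambda>(l, j, i). if j < r then c (l, j, i) else 0)"

lemma cp_trc: "cp (trc r c) l = tr r (cp c l)"
  by (intro ext poly_eqI) (simp add: coeff_cp tr_def trc_def)

lemma quad_form:
  "L2_inner a b (\<lambda>x. \<Sum>l<d. s l * w l x) (\<lambda>x. \<Sum>k<d. s k * w k x) = (\<Sum>l<d. \<Sum>k<d. (s l * s k) * Mm l k)"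
proof -
  let ?u = "\<lambda>x. \<Sum>l<d. s l * w l x"
  have u: "?u \<in> L2_space a b" by (rule L.sum_mem[of d w s]) (rule w_L2)
  have "L2_inner a b ?u ?u = (\<Sum>l<d. s l * L2_inner a b (w l) ?u)"
    by (rule L.ip_sum[of d w ?u s]) (auto intro: w_L2 u)
  also have "\<dots> = (\<Sum>l<d. s l * (\<Sum>k<d. s k * L2_inner a b (w l) (w k)))"
    by (intro sum.cong refl arg_cong2[where f="(*)"] L.ip_sum_right[of d w _ s]) (auto intro: w_L2)
  finally show ?thesis by (simp add: Mm_def sum_distrib_left mult.assoc)
qed

definition LV where "LV c r x = (\<Sum>l<d. lv (cp c l) r * w l x)"
definition RV where "RV c x = (\<Sum>l<d. rv (cp c l) 0 * w l x)"

lemma LV_L2: "LV c r \<in> L2_space a b"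
  unfolding LV_def[abs_def] by (rule L.sum_mem[of d w "\<lambda>l. lv (cp c l) r"]) (rule w_L2)

lemma RV_L2: "RV c \<in> L2_space a b"
  unfolding RV_def[abs_def] by (rule L.sum_mem[of d w "\<lambda>l. rv (cp c l) 0"]) (rule w_L2)

text \<open>Since the mass matrix is symmetric, twice the sum may be symmetrised in (l, k). The
  polarised telescoping identity then leaves the quadratic form of the mass matrix at the final left
  values and at each jump, and every such form is a squared L2 norm.\<close>

lemma time_energy:
  assumes r: "0 < r" "r \<le> J"
  shows "1/2 * L2_inner a b (LV c r) (LV c r) + 1/2 * L2_inner a b (RV c) (RV c)
    \<le> (\<Sum>l<d. \<Sum>k<d. Tf (cp c l) (tr r (cp c k)) * Mm l k)"
proof -
  let ?t = "\<lambda>l k. Tf (cp c l) (tr r (cp c k))"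
  let ?g = "\<lambda>j l. rv (cp c l) j - lv (cp c l) j"
  let ?Q = "\<lambda>s. \<Sum>l<d. \<Sum>k<d. (s l * s k) * Mm l k"
  have Q0: "0 \<le> ?Q s" for s
    unfolding quad_form[symmetric] by (rule L.nonneg[OF L.sum_mem[of d w s]]) (rule w_L2)
  \<comment> \<open>The summation indices are exchanged and the symmetry of the mass matrix is
    used.\<close>
  have "(\<Sum>l<d. \<Sum>k<d. ?t l k * Mm l k) = (\<Sum>l<d. \<Sum>k<d. ?t k l * Mm l k)"
  proof -
    have "(\<Sum>l<d. \<Sum>k<d. ?t l k * Mm l k) = (\<Sum>k<d. \<Sum>l<d. ?t l k * Mm l k)" by (rule sum.swap)
    also have "\<dots> = (\<Sum>l<d. \<Sum>k<d. ?t k l * Mm l k)"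
      by (intro sum.cong refl) (simp add: Mm_def L2_inner_def mult.commute)
    finally show ?thesis .
  qed
  then have "2 * (\<Sum>l<d. \<Sum>k<d. ?t l k * Mm l k) = (\<Sum>l<d. \<Sum>k<d. ?t l k * Mm l k) + (\<Sum>l<d. \<Sum>k<d. ?t k l * Mm l k)" by simp
  also have "\<dots> = (\<Sum>l<d. \<Sum>k<d. (?t l k + ?t k l) * Mm l k)" by (simp only: sum.distrib distrib_right)
  also have "\<dots> = (\<Sum>l<d. \<Sum>k<d. (lv (cp c l) r * lv (cp c k) r + (\<Sum>j<r. ?g j l * ?g j k)) * Mm l k)"
    by (simp only: Tf_symmetrized[OF r(2)])
  also have "\<dots> = ?Q (\<lambda>l. lv (cp c l) r) + (\<Sum>l<d. \<Sum>k<d. \<Sum>j<r. (?g j l * ?g j k) * Mm l k)"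
    by (simp only: sum.distrib distrib_right sum_distrib_right)
  also have "(\<Sum>l<d. \<Sum>k<d. \<Sum>j<r. (?g j l * ?g j k) * Mm l k) = (\<Sum>l<d. \<Sum>j<r. \<Sum>k<d. (?g j l * ?g j k) * Mm l k)"
    by (intro sum.cong refl sum.swap)
  also have "\<dots> = (\<Sum>j<r. ?Q (?g j))" by (rule sum.swap)
  finally have eq: "2 * (\<Sum>l<d. \<Sum>k<d. ?t l k * Mm l k) = ?Q (\<lambda>l. lv (cp c l) r) + (\<Sum>j<r. ?Q (?g j))" .
  \<comment> \<open>Of all the jumps only the first is kept. It equals the right value at 0, since
    the left value there is 0 by convention.\<close>
  have "?Q (?g 0) \<le> (\<Sum>j<r. ?Q (?g j))" by (rule member_le_sum) (use r Q0 in auto)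
  moreover have "?Q (?g 0) = L2_inner a b (RV c) (RV c)"
    unfolding RV_def[abs_def] quad_form by (simp add: lv_def)
  moreover have "?Q (\<lambda>l. lv (cp c l) r) = L2_inner a b (LV c r) (LV c r)" unfolding LV_def[abs_def] quad_form ..
  ultimately show ?thesis using eq by linarith
qed

section \<open>Coercivity\<close>

definition EA where "EA c r = (\<Sum>l<d. A.Ff (cp c l) (tr r (cp c l)))"
definition EB where "EB c r = (\<Sum>l<d. B.Ff (cp c l) (tr r (cp c l)))"

lemma EA_nonneg: "0 < r \<Longrightarrow> r \<le> J \<Longrightarrow> 0 \<le> EA c r" unfolding EA_def by (intro sum_nonneg A.Ff_tr)
lemma EB_nonneg: "0 < r \<Longrightarrow> r \<le> J \<Longrightarrow> 0 \<le> EB c r" unfolding EB_def by (intro sum_nonneg B.Ff_tr)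

text \<open>All nonnegative contributions of the cut-off test are recorded separately: the initial
  value will absorb the datum, and the \<beta>-energy the load.\<close>

lemma Bil_lower:
  assumes r: "0 < r" "r \<le> J"
  shows "1/2 * L2_inner a b (LV c r) (LV c r) + 1/2 * L2_inner a b (RV c) (RV c) + \<kappa>1 * EA c r + \<kappa>2 * EB c r \<le> Bil c (trc r c)"
  using time_energy[OF r, of c] by (simp add: Bil_def cp_trc EA_def EB_def sum.distrib sum_distrib_left)

lemma Bil_lincomb_left: "Bil (\<lambda>i. r * c i + s * c' i) e = r * Bil c e + s * Bil c' e"
proof -
  have "(\<Sum>l<d. \<Sum>k<d. (r * Tf (cp c l) (cp e k) + s * Tf (cp c' l) (cp e k)) * Mm l k) =
      r * (\<Sum>l<d. \<Sum>k<d. Tf (cp c l) (cp e k) * Mm l k) + s * (\<Sum>l<d. \<Sum>k<d. Tf (cp c' l) (cp e k) * Mm l k)"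
    by (simp only: sum_distrib_left distrib_right sum.distrib mult.assoc)
  moreover have "(\<Sum>l<d. \<kappa>1 * (r * A.Ff (cp c l) (cp e l) + s * A.Ff (cp c' l) (cp e l)) + \<kappa>2 * (r * B.Ff (cp c l) (cp e l) + s * B.Ff (cp c' l) (cp e l))) =
      r * (\<Sum>l<d. \<kappa>1 * A.Ff (cp c l) (cp e l) + \<kappa>2 * B.Ff (cp c l) (cp e l)) + s * (\<Sum>l<d. \<kappa>1 * A.Ff (cp c' l) (cp e l) + \<kappa>2 * B.Ff (cp c' l) (cp e l))"
    unfolding sum_distrib_left sum.distrib[symmetric] by (intro sum.cong refl) (simp add: algebra_simps)
  ultimately show ?thesis
    unfolding Bil_def cp_lincomb Tf_lincomb_left A.Ff_lincomb_left B.Ff_lincomb_left by (simp add: algebra_simps)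
qed

lemma Bil_lincomb_right: "Bil c (\<lambda>i. r * e i + s * e' i) = r * Bil c e + s * Bil c e'"
proof -
  have "(\<Sum>l<d. \<Sum>k<d. (r * Tf (cp c l) (cp e k) + s * Tf (cp c l) (cp e' k)) * Mm l k) =
      r * (\<Sum>l<d. \<Sum>k<d. Tf (cp c l) (cp e k) * Mm l k) + s * (\<Sum>l<d. \<Sum>k<d. Tf (cp c l) (cp e' k) * Mm l k)"
    by (simp only: sum_distrib_left distrib_right sum.distrib mult.assoc)
  moreover have "(\<Sum>l<d. \<kappa>1 * (r * A.Ff (cp c l) (cp e l) + s * A.Ff (cp c l) (cp e' l)) + \<kappa>2 * (r * B.Ff (cp c l) (cp e l) + s * B.Ff (cp c l) (cp e' l))) =
      r * (\<Sum>l<d. \<kappa>1 * A.Ff (cp c l) (cp e l) + \<kappa>2 * B.Ff (cp c l) (cp e l)) + s * (\<Sum>l<d. \<kappa>1 * A.Ff (cp c l) (cp e' l) + \<kappa>2 * B.Ff (cp c l) (cp e' l))"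
    unfolding sum_distrib_left sum.distrib[symmetric] by (intro sum.cong refl) (simp add: algebra_simps)
  ultimately show ?thesis
    unfolding Bil_def cp_lincomb Tf_lincomb_right A.Ff_lincomb_right B.Ff_lincomb_right by (simp add: algebra_simps)
qed

lemma Lf_lincomb: "Lf (\<lambda>i. r * e i + s * e' i) = r * Lf e + s * Lf e'"
proof -
  have "(LINT t:{0<..<T}|lebesgue. f t (w k) * pw (cp (\<lambda>i. r * e i + s * e' i) k) t) =
      r * (LINT t:{0<..<T}|lebesgue. f t (w k) * pw (cp e k) t) + s * (LINT t:{0<..<T}|lebesgue. f t (w k) * pw (cp e' k) t)" if k: "k < d" for k
  proof -
    have "(LINT t:{0<..<T}|lebesgue. f t (w k) * pw (cp (\<lambda>i. r * e i + s * e' i) k) t) =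
      (LINT t:{0<..<T}|lebesgue. r * (f t (w k) * pw (cp e k) t) + s * (f t (w k) * pw (cp e' k) t))"
      unfolding cp_lincomb pw_lincomb by (simp add: algebra_simps)
    then show ?thesis using f_pw_integrable[OF k] by (simp add: set_integral_add set_integrable_mult_right)
  qed
  then have "(\<Sum>k<d. LINT t:{0<..<T}|lebesgue. f t (w k) * pw (cp (\<lambda>i. r * e i + s * e' i) k) t) =
      (\<Sum>k<d. r * (LINT t:{0<..<T}|lebesgue. f t (w k) * pw (cp e k) t) + s * (LINT t:{0<..<T}|lebesgue. f t (w k) * pw (cp e' k) t))"
    by (intro sum.cong) auto
  moreover have "(\<Sum>k<d. rv (cp (\<lambda>i. r * e i + s * e' i) k) 0 * L2_inner a b \<rho> (w k)) =
      (\<Sum>k<d. r * (rv (cp e k) 0 * L2_inner a b \<rho> (w k)) + s * (rv (cp e' k) 0 * L2_inner a b \<rho> (w k)))"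
    unfolding cp_lincomb rv_lincomb by (intro sum.cong refl) (simp add: algebra_simps)
  ultimately show ?thesis unfolding Lf_def by (simp add: sum.distrib sum_distrib_left algebra_simps)
qed

section \<open>Existence and uniqueness\<close>

definition Ix :: "(nat \<times> nat \<times> nat) set" where "Ix = {..<d} \<times> {..<J} \<times> {..m}"

lemma cp_cong:
  assumes "\<And>i. i \<in> Ix \<Longrightarrow> c i = e i" "l < d" "j < J" shows "cp c l j = cp e l j"
  unfolding cp_def using assms by (intro sum.cong) (auto simp: Ix_def)

text \<open>Testing c against itself makes a sum of nonnegative terms nonpositive, so the
  \<beta>-energy vanishes, and its definiteness annihilates every polynomial piece and hence every
  coordinate.\<close>

lemma zero_if_Bil_zero:
  assumes "\<And>e. Bil c e = 0"
  shows "\<forall>i\<in>Ix. c i = 0"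
proof -
  have "1/2 * L2_inner a b (LV c J) (LV c J) + 1/2 * L2_inner a b (RV c) (RV c) + \<kappa>1 * EA c J + \<kappa>2 * EB c J \<le> 0"
    using Bil_lower[of J c] J0 assms by simp
  then have "\<kappa>2 * EB c J \<le> 0"
    using L.nonneg[OF LV_L2, of c J] L.nonneg[OF RV_L2, of c] mult_nonneg_nonneg[of \<kappa>1 "EA c J"] EA_nonneg[of J c] J0 ka by linarith
  then have "EB c J = 0" using EB_nonneg[of J c] J0 ka by (simp add: mult_le_0_iff)
  then have "B.Ff (cp c l) (tr J (cp c l)) = 0" if "l < d" for l
    using B.Ff_tr(1)[of J] J0 that unfolding EB_def by (subst (asm) sum_nonneg_eq_0_iff) auto
  then have "cp c l j = 0" if "l < d" "j < J" for l j using B.pw_zero_if_Ff_zero that by blast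
  then have "c (l, j, i) = 0" if "l < d" "j < J" "i \<le> m" for l j i
    using that coeff_cp[of c l j i] by simp
  then show ?thesis by (auto simp: Ix_def)
qed

lemma pw_cp_cong:
  assumes "\<And>i. i \<in> Ix \<Longrightarrow> c i = e i" "l < d" shows "pw (cp c l) t = pw (cp e l) t"
  unfolding pw_def using cp_cong[OF assms] by simp

lemma Tf_cong:
  assumes "\<And>j. j < J \<Longrightarrow> p j = p' j" "\<And>j. j < J \<Longrightarrow> q j = q' j" shows "Tf p q = Tf p' q'"
  unfolding Tf_def using assms by (intro sum.cong) (auto simp: rv_def lv_def)

lemma Bil_cong:
  assumes 1: "\<And>i. i \<in> Ix \<Longrightarrow> c i = c' i" and 2: "\<And>i. i \<in> Ix \<Longrightarrow> e i = e' i"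
  shows "Bil c e = Bil c' e'"
proof -
  have p: "pw (cp c l) = pw (cp c' l)" "pw (cp e l) = pw (cp e' l)" if "l < d" for l
    using pw_cp_cong[of c c' l] pw_cp_cong[of e e' l] 1 2 that by auto
  have "A.Ff (cp c l) (cp e l) = A.Ff (cp c' l) (cp e' l)" "B.Ff (cp c l) (cp e l) = B.Ff (cp c' l) (cp e' l)" if "l < d" for l
    unfolding A.Ff_def B.Ff_def A.fd_def B.fd_def p[OF that] by auto
  moreover have "Tf (cp c l) (cp e k) = Tf (cp c' l) (cp e' k)" if "l < d" "k < d" for l k
    using cp_cong[of c c' l] cp_cong[of e e' k] 1 2 that by (intro Tf_cong) auto
  ultimately show ?thesis unfolding Bil_def by simp
qed

lemma Lf_cong:
  assumes "\<And>i. i \<in> Ix \<Longrightarrow> e i = e' i" shows "Lf e = Lf e'"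
proof -
  have "rv (cp e k) 0 = rv (cp e' k) 0" "pw (cp e k) t = pw (cp e' k) t" if "k < d" for k t
    using cp_cong[of e e' k 0] pw_cp_cong[of e e' k] assms that J0 by (auto simp: rv_def)
  then show ?thesis unfolding Lf_def by simp
qed

lemma Bil_solvable: "\<exists>c. \<forall>e. Bil c e = Lf e"
proof (rule finite_dim_solvable)
  show "finite Ix" by (simp add: Ix_def)
  show "Bil (\<lambda>i. r * c i + s * c' i) e = r * Bil c e + s * Bil c' e" for r s c c' e by (rule Bil_lincomb_left)
  show "Bil c (\<lambda>i. r * e i + s * e' i) = r * Bil c e + s * Bil c e'" for r s c e e' by (rule Bil_lincomb_right)
  show "Bil c e = Bil c' e" if "\<And>i. i \<in> Ix \<Longrightarrow> c i = c' i" for c c' e by (rule Bil_cong[OF that refl])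
  show "Bil c e = Bil c e'" if "\<And>i. i \<in> Ix \<Longrightarrow> e i = e' i" for c e e' by (rule Bil_cong[OF refl that])
  show "\<forall>i\<in>Ix. c i = 0" if "\<And>e. Bil c e = 0" for c by (rule zero_if_Bil_zero[OF that])
  show "Lf (\<lambda>i. r * c i + s * e i) = r * Lf c + s * Lf e" for r s c e by (rule Lf_lincomb)
  show "Lf c = Lf e" if "\<And>i. i \<in> Ix \<Longrightarrow> c i = e i" for c e by (rule Lf_cong[OF that])
qed

lemma solution_exists: "\<exists>U. is_discrete_solution a b T \<alpha> \<beta> m n \<kappa>1 \<kappa>2 N xs J \<sigma> u0 f U"
  using Bil_solvable solution_iff[OF rep_uf uf_Wht] by blast

lemma solution_unique:
  assumes U: "is_discrete_solution a b T \<alpha> \<beta> m n \<kappa>1 \<kappa>2 N xs J \<sigma> u0 f U"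
    and U': "is_discrete_solution a b T \<alpha> \<beta> m n \<kappa>1 \<kappa>2 N xs J \<sigma> u0 f U'"
  shows "ae_equal a b T U U'"
proof -
  have W: "U \<in> Wht a b N xs n m T J \<sigma>" "U' \<in> Wht a b N xs n m T J \<sigma>" using U U' by (simp_all add: is_discrete_solution_def)
  obtain c c' where c: "rep U c" "rep U' c'" using rep_ex W by blast
  have "Bil (\<lambda>i. 1 * c i + (-1) * c' i) e = 0" for e
    unfolding Bil_lincomb_left using solution_iff[OF c(1) W(1)] solution_iff[OF c(2) W(2)] U U' by simp
  from zero_if_Bil_zero[OF this] have "\<And>i. i \<in> Ix \<Longrightarrow> c i = c' i" by simp
  then have uf: "uf c t x = uf c' t x" for t x unfolding uf_def using pw_cp_cong[of c c'] by simp
  show ?thesis unfolding ae_equal_def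
  proof (rule tm.AE_P_imp)
    fix t assume "t \<in> tm.P"
    then show "AE x in lebesgue. x \<in> {a<..<b} \<longrightarrow> U t x = U' t x"
      using c uf by (intro AE_P_imp) (simp add: rep_def)
  qed
qed

section \<open>Estimate of the load and the energy bound\<close>

definition K2 :: real where "K2 = 1 + (b - a)\<^sup>2"

lemma K2_pos: "0 < K2" unfolding K2_def by (rule add_pos_nonneg) auto

text \<open>Dirichlet orthonormality identifies the Dirichlet square of the combination with the sum
  of squares; \<open>K2\<close> then comes from the Poincare inequality.\<close>

lemma H1_sum_le: "H1_inner a b (\<lambda>x. \<Sum>l<d. s l * w l x) (\<lambda>x. \<Sum>l<d. s l * w l x) \<le> K2 * (\<Sum>l<d. (s l)\<^sup>2)"
proof -
  let ?u = "\<lambda>x. \<Sum>l<d. s l * w l x"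
  have u: "?u \<in> Sh a b N xs n" by (rule S.sum_mem[of d w s]) (rule w)
  have "Dir_inner a b (w k) ?u = s k" if k: "k < d" for k
  proof -
    have "Dir_inner a b (w k) ?u = (\<Sum>l<d. s l * Dir_inner a b (w k) (w l))"
      by (rule S.ip_sum_right[of d w "w k" s]) (auto intro: w k)
    also have "\<dots> = (\<Sum>l<d. if l = k then s l else 0)" using orth k by (intro sum.cong) auto
    finally show ?thesis using k by simp
  qed
  moreover have "Dir_inner a b ?u ?u = (\<Sum>l<d. s l * Dir_inner a b (w l) ?u)"
    by (rule S.ip_sum[of d w ?u s]) (auto intro: w u)
  ultimately have "Dir_inner a b ?u ?u = (\<Sum>l<d. (s l)\<^sup>2)" by (simp add: power2_eq_square)
  then show ?thesis using H1_inner_le_Dir[OF ab Sh_H01[OF u]] by (simp add: K2_def)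
qed

text \<open>With p = t^(\<beta>/2), this expands the square of p x/\<mu> - y/p, multiplied by
  \<mu>/2. The weights of the two terms are reciprocal, so none appears on the product x y.\<close>

lemma Young_weighted:
  fixes t \<mu> x y :: real
  assumes "0 < t" "0 < \<mu>"
  shows "x * y \<le> 1 / (2 * \<mu>) * (t powr \<beta> * x\<^sup>2) + \<mu> / 2 * (t powr (- \<beta>) * y\<^sup>2)"
proof -
  define p where "p = t powr (\<beta> / 2)"
  have p1: "0 < p" using assms by (simp add: p_def)
  have p2: "t powr \<beta> = p\<^sup>2" unfolding p_def power2_eq_square powr_add[symmetric] by simp
  have p3: "t powr (- \<beta>) = 1 / p\<^sup>2" unfolding p2[symmetric] by (rule powr_minus_divide)
  have "0 \<le> (p * x / \<mu> - y / p)\<^sup>2" by simp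
  also have "\<dots> = (p\<^sup>2 * x\<^sup>2) / \<mu>\<^sup>2 - 2 * (x * y) / \<mu> + y\<^sup>2 / p\<^sup>2"
    using p1 by (simp add: power2_diff power_divide power_mult_distrib)
  finally have "0 \<le> \<mu> / 2 * ((p\<^sup>2 * x\<^sup>2) / \<mu>\<^sup>2 - 2 * (x * y) / \<mu> + y\<^sup>2 / p\<^sup>2)" using assms by simp
  also have "\<dots> = 1 / (2 * \<mu>) * (p\<^sup>2 * x\<^sup>2) + \<mu> / 2 * (1 / p\<^sup>2 * y\<^sup>2) - x * y"
    using assms by (simp add: power2_eq_square field_simps)
  finally show ?thesis unfolding p2 p3 by linarith
qed

text \<open>At almost every time the load is at most the dual norm of f times the H1 norm of the
  solution. Young's inequality splits this product into the weighted norm of f and a term with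
  weight t^(-\<beta>), which Hardy's inequality bounds by the \<beta>-energy.\<close>

lemma load_bound:
  assumes r: "0 < r" "r \<le> J" and f2: "f \<in> L2w_Hm1 a b \<beta> T" and la: "0 < \<mu>"
  shows "(\<Sum>k<d. LINT t:{0<..<T}|lebesgue. f t (w k) * pw (tr r (cp c k)) t) \<le>
    1 / (2 * \<mu>) * (L2w_Hm1_norm a b \<beta> (\<tau> r) f)\<^sup>2 + \<mu> * K2 * Gamma (1 - \<beta>) * EB c r"
proof -
  let ?N = "\<lambda>t. Hm1_norm a b (f t)"
  let ?i = "indicator {0<..<\<tau> r} :: real \<Rightarrow> real"
  have R: "\<tau> r \<le> T" "0 < \<tau> r" using \<tau>_le[OF r(2)] \<tau>_less[OF r(1)] by (auto simp: \<tau>_0 \<tau>_J)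
  define G where "G t = (\<Sum>k<d. f t (w k) * pw (tr r (cp c k)) t)" for t
  define X where "X t = ?i t * (\<bar>t\<bar> powr \<beta> * (?N t)\<^sup>2)" for t
  define Y where "Y t = (\<Sum>l<d. ?i t * (t powr (- \<beta>) * (pw (cp c l) t)\<^sup>2))" for t
  have iG: "set_integrable lebesgue {0<..<T} G"
    unfolding G_def[abs_def] set_integrable_def scaleR_sum_right
    using f_pw_integrable by (intro Bochner_Integration.integrable_sum) (auto simp: set_integrable_def)
  have iX: "integrable lebesgue X"
  proof -
    have "set_integrable lebesgue {0<..<T} (\<lambda>t. \<bar>t\<bar> powr \<beta> * (?N t)\<^sup>2)" using f2 by (simp add: L2w_Hm1_def)
    then have "set_integrable lebesgue {0<..<\<tau> r} (\<lambda>t. \<bar>t\<bar> powr \<beta> * (?N t)\<^sup>2)" by (rule set_integrable_subset) (use R in auto)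
    then show ?thesis by (simp add: set_integrable_def X_def[abs_def])
  qed
  have X: "(LINT t|lebesgue. X t) = (L2w_Hm1_norm a b \<beta> (\<tau> r) f)\<^sup>2"
  proof -
    have "0 \<le> (LINT t|lebesgue. X t)" unfolding X_def by (intro Bochner_Integration.integral_nonneg) auto
    then show ?thesis by (simp add: L2w_Hm1_norm_def set_lebesgue_integral_def X_def)
  qed
  have hl: "integrable lebesgue (\<lambda>t. ?i t * (t powr (- \<beta>) * (pw (cp c l) t)\<^sup>2))"
    "(LINT t|lebesgue. ?i t * (t powr (- \<beta>) * (pw (cp c l) t)\<^sup>2)) \<le> 2 * Gamma (1 - \<beta>) * B.Ff (cp c l) (tr r (cp c l))" for l
    \<comment> \<open>Hardy's inequality is applied coordinate by coordinate and carried over to the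
      completed measure, because f is only Lebesgue measurable.\<close>
    using B.Hardy_pw[OF r, of "cp c l"] by (simp_all add: integrable_completion integral_completion)
  have iY: "integrable lebesgue Y" unfolding Y_def[abs_def] using hl(1) by (intro Bochner_Integration.integrable_sum)
  have Y: "(LINT t|lebesgue. Y t) \<le> 2 * Gamma (1 - \<beta>) * EB c r"
    unfolding Y_def EB_def sum_distrib_left using hl by (subst Bochner_Integration.integral_sum) (auto intro!: sum_mono)
  have "(\<Sum>k<d. LINT t:{0<..<T}|lebesgue. f t (w k) * pw (tr r (cp c k)) t) = (LINT t:{0<..<T}|lebesgue. G t)"
    unfolding G_def set_lebesgue_integral_def scaleR_sum_right
    using f_pw_integrable by (intro Bochner_Integration.integral_sum[symmetric]) (auto simp: set_integrable_def)
  also have "\<dots> \<le> (LINT t|lebesgue. 1 / (2 * \<mu>) * X t + \<mu> / 2 * K2 * Y t)"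
    unfolding set_lebesgue_integral_def
  proof (rule integral_mono_AE)
    show "integrable lebesgue (\<lambda>t. indicator {0<..<T} t *\<^sub>R G t)" using iG by (simp add: set_integrable_def)
    show "integrable lebesgue (\<lambda>t. 1 / (2 * \<mu>) * X t + \<mu> / 2 * K2 * Y t)" using iX iY by simp
    have "AE t in lebesgue. t \<in> {0<..<T} \<longrightarrow> f t \<in> Hm1_space a b" using f by (simp add: L1_Hm1_def)
    with tm.AE_P show "AE t in lebesgue. indicator {0<..<T} t *\<^sub>R G t \<le> 1 / (2 * \<mu>) * X t + \<mu> / 2 * K2 * Y t"
    proof eventually_elim
      case (elim t)
      \<comment> \<open>Outside (0, T) and on the pieces removed by the cut-off the left side is 0,
        so there nonnegativity of the majorant is all that is required.\<close>
      have nn: "0 \<le> 1 / (2 * \<mu>) * X t + \<mu> / 2 * K2 * Y t"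
        using la K2_pos by (auto simp: X_def Y_def intro!: add_nonneg_nonneg mult_nonneg_nonneg sum_nonneg)
      show ?case
      proof (cases "t \<in> {0<..<T}")
        case False then show ?thesis using nn by simp
      next
        case True
        then obtain j where j: "j < J" "\<tau> j < t" "t < \<tau> (Suc j)" using elim by (auto simp: tm_P)
        show ?thesis
        proof (cases "j < r")
          case False
          then have "G t = 0" using pw_piece[OF j(1), of t] j by (simp add: G_def tr_def)
          then show ?thesis using nn by simp
        next
          case jr: True
          have t: "t \<in> {0<..<\<tau> r}" using True j \<tau>_le[of "Suc j" r] jr by auto
          have F: "f t \<in> Hm1_space a b" using elim True by simp
          let ?u = "\<lambda>x. \<Sum>l<d. pw (cp c l) t * w l x"
          let ?s = "\<Sum>l<d. (pw (cp c l) t)\<^sup>2"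
          have u: "?u \<in> H01_space a b" by (rule H0.sum_mem[of d w "\<lambda>l. pw (cp c l) t"]) (rule w_H01)
          have "pw (tr r (cp c k)) t = pw (cp c k) t" for k using pw_piece[OF j(1), of t] j jr by (simp add: tr_def)
          then have "G t = (\<Sum>k<d. pw (cp c k) t * f t (w k))" by (simp add: G_def mult.commute)
          also have "\<dots> = f t ?u" by (rule Hm1_sum[OF F ab w_H01, symmetric])
          also have "\<dots> \<le> ?N t * H1_norm a b ?u" using Hm1_bound(1)[OF F u] by simp
          also have "\<dots> \<le> 1 / (2 * \<mu>) * (t powr \<beta> * (?N t)\<^sup>2) + \<mu> / 2 * (t powr (- \<beta>) * (H1_norm a b ?u)\<^sup>2)"
            by (rule Young_weighted) (use t la in auto)
          also have "(H1_norm a b ?u)\<^sup>2 \<le> K2 * ?s"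
            using H1_sum_le[of "\<lambda>l. pw (cp c l) t"] H0.nonneg[OF u] by (simp add: H1_norm_def)
          then have "1 / (2 * \<mu>) * (t powr \<beta> * (?N t)\<^sup>2) + \<mu> / 2 * (t powr (- \<beta>) * (H1_norm a b ?u)\<^sup>2) \<le>
              1 / (2 * \<mu>) * (t powr \<beta> * (?N t)\<^sup>2) + \<mu> / 2 * (t powr (- \<beta>) * (K2 * ?s))"
            using la by (intro add_left_mono mult_left_mono) auto
          also have "\<dots> = 1 / (2 * \<mu>) * X t + \<mu> / 2 * K2 * Y t"
            using t by (simp add: X_def Y_def sum_distrib_left[symmetric] mult_ac)
          finally show ?thesis using True by simp
        qed
      qed
    qed
  qed
  also have "\<dots> = 1 / (2 * \<mu>) * (L2w_Hm1_norm a b \<beta> (\<tau> r) f)\<^sup>2 + \<mu> / 2 * K2 * (LINT t|lebesgue. Y t)"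
    using iX iY X by simp
  also have "\<dots> \<le> 1 / (2 * \<mu>) * (L2w_Hm1_norm a b \<beta> (\<tau> r) f)\<^sup>2 + \<mu> / 2 * K2 * (2 * Gamma (1 - \<beta>) * EB c r)"
    using la K2_pos Y by (intro add_left_mono mult_left_mono) auto
  finally show ?thesis by simp
qed

text \<open>A sum of two squares, one of the initial datum and one of the load; its root will be
  bounded by the sum of their roots.\<close>

definition Z :: "nat \<Rightarrow> real" where
  "Z r = (b - a)\<^sup>2 * (H1_norm a b u0)\<^sup>2 + 2 * K2 * Gamma (1 - \<beta>) * ((L2w_Hm1_norm a b \<beta> (\<tau> r) f)\<^sup>2 / \<kappa>2)"

lemma energy_bound:
  assumes r: "0 < r" "r \<le> J" and f2: "f \<in> L2w_Hm1 a b \<beta> T" and sol: "\<And>e. Bil c e = Lf e"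
  shows "L2_inner a b (LV c r) (LV c r) + \<kappa>1 * EA c r + \<kappa>2 * EB c r \<le> Z r"
proof -
  let ?F = "(L2w_Hm1_norm a b \<beta> (\<tau> r) f)\<^sup>2"
  let ?G = "Gamma (1 - \<beta>)"
  have G: "0 < ?G" by (rule B.Gamma_pos)
  \<comment> \<open>Chosen so that \<mu> K2 \<Gamma>(1-\<beta>) = \<kappa>2/2: the load then
    consumes exactly half of the \<beta>-energy on the left.\<close>
  define \<mu> where "\<mu> = \<kappa>2 / (2 * K2 * ?G)"
  have la: "0 < \<mu>" using ka K2_pos G by (simp add: \<mu>_def)
  have "1/2 * L2_inner a b (LV c r) (LV c r) + 1/2 * L2_inner a b (RV c) (RV c) + \<kappa>1 * EA c r + \<kappa>2 * EB c r \<le> Lf (trc r c)"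
    using Bil_lower[OF r, of c] sol by simp
  also have "Lf (trc r c) = (\<Sum>k<d. rv (cp c k) 0 * L2_inner a b \<rho> (w k)) + (\<Sum>k<d. LINT t:{0<..<T}|lebesgue. f t (w k) * pw (tr r (cp c k)) t)"
    using r by (simp add: Lf_def cp_trc rv_def tr_def)
  also have "(\<Sum>k<d. rv (cp c k) 0 * L2_inner a b \<rho> (w k)) = L2_inner a b \<rho> (RV c)"
    unfolding RV_def[abs_def]
    by (rule L.ip_sum_right[of d w \<rho> "\<lambda>k. rv (cp c k) 0", symmetric]) (auto intro: w_L2 Sh_L2[OF \<rho>_Sh])
  also have "L2_inner a b \<rho> (RV c) \<le> 1/2 * L2_inner a b \<rho> \<rho> + 1/2 * L2_inner a b (RV c) (RV c)"
  proof -
    have "0 \<le> L2_inner a b (\<lambda>x. 1 * \<rho> x + (-1) * RV c x) (\<lambda>x. 1 * \<rho> x + (-1) * RV c x)"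
      by (intro L.nonneg L.lincomb Sh_L2[OF \<rho>_Sh] RV_L2)
    then show ?thesis using L.ip_square_lincomb[OF Sh_L2[OF \<rho>_Sh] RV_L2, of 1 "-1" c] by simp
  qed
  also note load_bound[OF r f2 la, of c]
  finally have "1/2 * L2_inner a b (LV c r) (LV c r) + 1/2 * L2_inner a b (RV c) (RV c) + \<kappa>1 * EA c r + \<kappa>2 * EB c r \<le>
      1/2 * L2_inner a b \<rho> \<rho> + 1/2 * L2_inner a b (RV c) (RV c) + (1 / (2 * \<mu>) * ?F + \<mu> * K2 * ?G * EB c r)" by simp
  moreover have "\<mu> * K2 * ?G = \<kappa>2 / 2" "1 / (2 * \<mu>) = K2 * ?G / \<kappa>2"
    using K2_pos G ka by (simp_all add: \<mu>_def field_simps)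
  ultimately have "1/2 * L2_inner a b (LV c r) (LV c r) + \<kappa>1 * EA c r + \<kappa>2 * EB c r \<le> 1/2 * L2_inner a b \<rho> \<rho> + K2 * ?G / \<kappa>2 * ?F + \<kappa>2 / 2 * EB c r"
    by simp
  moreover have "0 \<le> \<kappa>1 * EA c r" using EA_nonneg[OF r] ka by simp
  \<comment> \<open>The inequality is doubled, and one of the two copies of
    \<open>\<kappa>1 * EA c r\<close> is dropped.\<close>
  ultimately have "L2_inner a b (LV c r) (LV c r) + \<kappa>1 * EA c r + \<kappa>2 * EB c r \<le> L2_inner a b \<rho> \<rho> + 2 * (K2 * ?G / \<kappa>2 * ?F)" by simp
  also have "\<dots> \<le> Z r" using \<rho>_bound by (simp add: Z_def)
  finally show ?thesis .
qed

lemma L2_norm_left_val: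
  assumes "rep U c" "r \<le> J"
  shows "(L2_norm_on a b (left_val T J \<sigma> U r))\<^sup>2 = L2_inner a b (LV c r) (LV c r)"
proof -
  have "AE x in lebesgue. x \<in> {a<..<b} \<longrightarrow> left_val T J \<sigma> U r x = LV c r x"
    using left_val_rep[OF assms] by (intro AE_P_imp) (simp add: LV_def)
  from L2_inner_cong[OF this this] show ?thesis using L.nonneg[OF LV_L2] by (simp add: L2_norm_eq)
qed

end

section \<open>The seminorm of functions with values in H01\<close>

lemma enn_sqrt_square: "(enn_sqrt x)\<^sup>2 = x"
  by (cases x) (auto simp: enn_sqrt_def ennreal_power[symmetric] power2_eq_square ennreal_mult[symmetric])

lemma enn_sqrt_le:
  assumes "x \<le> ennreal y" shows "enn_sqrt x \<le> ennreal (sqrt y)"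
proof -
  have "x \<noteq> \<infinity>" using assms by (auto simp: top_unique)
  then obtain z where z: "x = ennreal z" "0 \<le> z" by (cases x) auto
  show ?thesis
  proof (cases "0 \<le> y")
    case True then show ?thesis using z assms by (simp add: enn_sqrt_def ennreal_leI)
  next
    case False
    then have "x = 0" using assms by (simp add: ennreal_neg)
    then show ?thesis by (simp add: enn_sqrt_def)
  qed
qed

text \<open>The values of U at the time nodes are arbitrary, so its coefficients agree with
  piecewise polynomials only almost everywhere; the transform must not notice this.\<close>

lemma fourier_cong_AE:
  assumes "AE t in lebesgue. u t = v t" "u \<in> borel_measurable lebesgue"
  shows "fourier u \<xi> = fourier v \<xi>"
proof -
  have v: "v \<in> borel_measurable lebesgue" by (rule borel_measurable_AE[OF assms(2,1)])
  have cr: "complex_of_real \<in> borel_measurable borel" by (intro borel_measurable_continuous_onI continuous_intros)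
  have e: "(\<lambda>t. exp (- \<i> * complex_of_real (\<xi> * t))) \<in> borel_measurable lebesgue"
  proof -
    have "(\<lambda>t. exp (- \<i> * complex_of_real (\<xi> * t))) \<in> borel_measurable borel"
      by (intro borel_measurable_continuous_onI continuous_intros)
    then have "(\<lambda>t. exp (- \<i> * complex_of_real (\<xi> * t))) \<in> borel_measurable lborel" by simp
    then show ?thesis by (rule measurable_completion)
  qed
  have "(LINT t|lebesgue. exp (- \<i> * complex_of_real (\<xi> * t)) * complex_of_real (u t)) =
     (LINT t|lebesgue. exp (- \<i> * complex_of_real (\<xi> * t)) * complex_of_real (v t))"
  proof (rule integral_cong_AE)
    show "(\<lambda>t. exp (- \<i> * complex_of_real (\<xi> * t)) * complex_of_real (u t)) \<in> borel_measurable lebesgue"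
      by (intro borel_measurable_times e measurable_compose[OF assms(2) cr])
    show "(\<lambda>t. exp (- \<i> * complex_of_real (\<xi> * t)) * complex_of_real (v t)) \<in> borel_measurable lebesgue"
      by (intro borel_measurable_times e measurable_compose[OF v cr])
    show "AE t in lebesgue. exp (- \<i> * complex_of_real (\<xi> * t)) * complex_of_real (u t) = exp (- \<i> * complex_of_real (\<xi> * t)) * complex_of_real (v t)"
      using assms(1) by eventually_elim simp
  qed
  then show ?thesis by (simp add: fourier_def)
qed

lemma fourier_sum:
  assumes "\<And>l. l < d \<Longrightarrow> integrable lborel (v l)"
  shows "fourier (\<lambda>t. \<Sum>l<(d::nat). h l * v l t) \<xi> = (\<Sum>l<d. complex_of_real (h l) * fourier (v l) \<xi>)"
proof -
  have "integrable lborel (\<lambda>t. \<Sum>l<d. h l * v l t) \<and> four_int (\<lambda>t. \<Sum>l<d. h l * v l t) \<xi> = (\<Sum>l<d. complex_of_real (h l) * four_int (v l) \<xi>)"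
    using assms
  proof (induction d)
    case 0 then show ?case by (simp add: four_int_def)
  next
    case (Suc d)
    then have "integrable lborel (\<lambda>t. \<Sum>l<d. h l * v l t)" "four_int (\<lambda>t. \<Sum>l<d. h l * v l t) \<xi> = (\<Sum>l<d. complex_of_real (h l) * four_int (v l) \<xi>)"
      "integrable lborel (v d)" by auto
    then show ?case using four_int_lincomb[of "\<lambda>t. \<Sum>l<d. h l * v l t" "v d" 1 "h d" \<xi>] by simp
  qed
  moreover have "fourier (v l) \<xi> = four_int (v l) \<xi> / complex_of_real (sqrt (2 * pi))" if "l < d" for l
    using assms[OF that] by (intro fourier_borel) auto
  ultimately show ?thesis by (subst fourier_borel) (auto simp: sum_divide_distrib)
qed

context disc
begin

text \<open>At each frequency the transforms of the basis coefficients are inner products of one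
  combination of the w l with the e k. Bessel's inequality bounds their squared sum independently of
  the basis e, \<open>K2\<close> leads back to the coordinates, and each coordinate is controlled by
  its scalar energy.\<close>

lemma frac_seminorm_bound:
  assumes r: "0 < r" "r \<le> J" and U: "rep U c" and e: "H01_onb a b e" and fo: "frac_time T \<sigma> J \<gamma>"
  shows "frac_seminorm_H01 a b e (\<gamma> / 2) {0<..<\<tau> r} U \<le>
    ennreal (sqrt (K2 / frac_order.cF \<gamma> * (\<Sum>l<d. frac_time.Ff T \<sigma> J \<gamma> (cp c l) (tr r (cp c l)))))"
proof -
  interpret G: frac_time T \<sigma> J \<gamma> by (rule fo)
  have R: "\<tau> r \<le> T" using \<tau>_le[OF r(2)] by (simp add: \<tau>_J)
  define v where "v l t = pw (cp c l) t * indicator {0<..<\<tau> r} t" for l t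
  define h where "h k l = H1_inner a b (w l) (e k)" for k l
  have e1: "\<And>k. e k \<in> H01_space a b" "\<And>k l. H1_inner a b (e k) (e l) = (if k = l then 1 else 0)"
    using e by (auto simp: H01_onb_def)
  have vi: "integrable lborel (v l)" for l unfolding v_def[abs_def] by (rule pw_integrable) simp
  have F: "fourier (\<lambda>t. H1_inner a b (U t) (e k) * indicator {0<..<\<tau> r} t) \<xi> = (\<Sum>l<d. complex_of_real (h k l) * fourier (v l) \<xi>)" for k \<xi>
  proof -
    have "AE t in lebesgue. (\<Sum>l<d. h k l * v l t) = H1_inner a b (U t) (e k) * indicator {0<..<\<tau> r} t"
      using tm.AE_P
    proof eventually_elim
      case (elim t)
      show ?case
      proof (cases "t \<in> {0<..<\<tau> r}")
        case True
        then have t: "t \<in> tm.P" using elim R by auto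
        let ?u = "\<lambda>x. \<Sum>l<d. pw (cp c l) t * w l x"
        have u: "?u \<in> H01_space a b" by (rule H0.sum_mem[of d w "\<lambda>l. pw (cp c l) t"]) (rule w_H01)
        have "H1_inner a b (U t) (e k) = H1_inner a b ?u (e k)"
          by (rule H1_inner_cong(1)[OF H01_H1[OF u] AE_P_imp H01_H1[OF e1(1)]])
            (use U t in \<open>auto simp: rep_def uf_def\<close>)
        also have "\<dots> = (\<Sum>l<d. pw (cp c l) t * H1_inner a b (w l) (e k))"
          by (rule H0.ip_sum[of d w "e k" "\<lambda>l. pw (cp c l) t"]) (auto intro: w_H01 e1)
        finally show ?thesis using True by (simp add: v_def h_def mult.commute)
      next
        case False then show ?thesis by (simp add: v_def)
      qed
    qed
    moreover have "(\<lambda>t. \<Sum>l<d. h k l * v l t) \<in> borel_measurable lebesgue"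
    proof -
      have "(\<lambda>t. \<Sum>l<d. h k l * v l t) \<in> borel_measurable lborel" using vi by (intro borel_measurable_sum borel_measurable_times) auto
      then show ?thesis by (rule measurable_completion)
    qed
    ultimately have "fourier (\<lambda>t. H1_inner a b (U t) (e k) * indicator {0<..<\<tau> r} t) \<xi> = fourier (\<lambda>t. \<Sum>l<d. h k l * v l t) \<xi>"
      by (rule fourier_cong_AE[symmetric])
    then show ?thesis by (simp add: fourier_sum[OF vi])
  qed
  have bes: "(\<Sum>k<n'. (cmod (\<Sum>l<d. complex_of_real (h k l) * z l))\<^sup>2) \<le> K2 * (\<Sum>l<d. (cmod (z l))\<^sup>2)" for z :: "nat \<Rightarrow> complex" and n' :: nat
  proof -
    have real: "(\<Sum>k<n'. (\<Sum>l<d. h k l * s l)\<^sup>2) \<le> K2 * (\<Sum>l<d. (s l)\<^sup>2)" for s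
    proof -
      let ?u = "\<lambda>x. \<Sum>l<d. s l * w l x"
      have u: "?u \<in> H01_space a b" by (rule H0.sum_mem[of d w s]) (rule w_H01)
      have "(\<Sum>l<d. h k l * s l) = H1_inner a b ?u (e k)" for k
        using H0.ip_sum[of d w "e k" s] w_H01 e1(1) by (simp add: h_def mult.commute)
      then have "(\<Sum>k<n'. (\<Sum>l<d. h k l * s l)\<^sup>2) = (\<Sum>k<n'. (H1_inner a b ?u (e k))\<^sup>2)" by simp
      also have "\<dots> \<le> H1_inner a b ?u ?u" by (rule H0.Bessel) (use e1 u in auto)
      also note H1_sum_le[of s]
      finally show ?thesis .
    qed
    \<comment> \<open>The spaces are real, whereas the transforms are complex; Bessel's inequality
      is used for real and imaginary parts separately.\<close>
    have "(cmod (\<Sum>l<d. complex_of_real (h k l) * z l))\<^sup>2 = (\<Sum>l<d. h k l * Re (z l))\<^sup>2 + (\<Sum>l<d. h k l * Im (z l))\<^sup>2" for k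
      by (simp add: cmod_power2 Re_sum Im_sum)
    then have "(\<Sum>k<n'. (cmod (\<Sum>l<d. complex_of_real (h k l) * z l))\<^sup>2) = (\<Sum>k<n'. (\<Sum>l<d. h k l * Re (z l))\<^sup>2) + (\<Sum>k<n'. (\<Sum>l<d. h k l * Im (z l))\<^sup>2)"
      by (simp add: sum.distrib)
    also have "\<dots> \<le> K2 * (\<Sum>l<d. (Re (z l))\<^sup>2) + K2 * (\<Sum>l<d. (Im (z l))\<^sup>2)" by (intro add_mono real)
    also have "\<dots> = K2 * (\<Sum>l<d. (cmod (z l))\<^sup>2)" by (simp add: cmod_power2 sum.distrib distrib_left)
    finally show ?thesis .
  qed
  have Fm: "fourier (v l) \<in> borel_measurable borel" for l
  proof -
    have "fourier (v l) = (\<lambda>\<xi>. four_int (v l) \<xi> / complex_of_real (sqrt (2 * pi)))"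
      using fourier_borel[of "v l"] vi[of l] by auto
    moreover have "four_int (v l) \<in> borel_measurable borel" using vi[of l] by (intro four_int_measurable) auto
    ultimately show ?thesis by simp
  qed
  let ?X = "\<lambda>k \<xi>. ennreal (\<bar>\<xi>\<bar> powr \<gamma> * (cmod (\<Sum>l<d. complex_of_real (h k l) * fourier (v l) \<xi>))\<^sup>2)"
  have Xm: "?X k \<in> borel_measurable lebesgue" for k
  proof -
    note [measurable] = Fm
    have "?X k \<in> borel_measurable lborel" by measurable
    then show ?thesis by (rule measurable_completion)
  qed
  have "(\<Sum>k. (frac_seminorm (\<gamma> / 2) {0<..<\<tau> r} (\<lambda>t. H1_inner a b (U t) (e k)))\<^sup>2) = (\<Sum>k. \<integral>\<^sup>+\<xi>. ?X k \<xi> \<partial>lebesgue)"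
    unfolding frac_seminorm_def enn_sqrt_square F by simp
  \<comment> \<open>All terms are nonnegative, so the sum over the basis moves under the integral,
    where Bessel's inequality acts at each fixed frequency.\<close>
  also have "\<dots> = (\<integral>\<^sup>+\<xi>. (\<Sum>k. ?X k \<xi>) \<partial>lebesgue)" by (rule nn_integral_suminf[symmetric, OF Xm])
  also have "\<dots> \<le> (\<integral>\<^sup>+\<xi>. (\<Sum>l<d. ennreal K2 * ennreal (\<bar>\<xi>\<bar> powr \<gamma> * (cmod (fourier (v l) \<xi>))\<^sup>2)) \<partial>lebesgue)"
  proof (rule nn_integral_mono)
    fix \<xi> :: real
    show "(\<Sum>k. ?X k \<xi>) \<le> (\<Sum>l<d. ennreal K2 * ennreal (\<bar>\<xi>\<bar> powr \<gamma> * (cmod (fourier (v l) \<xi>))\<^sup>2))"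
    proof (rule suminf_le_const[OF summableI])
      fix n' :: nat
      have "(\<Sum>k<n'. ?X k \<xi>) = ennreal (\<bar>\<xi>\<bar> powr \<gamma> * (\<Sum>k<n'. (cmod (\<Sum>l<d. complex_of_real (h k l) * fourier (v l) \<xi>))\<^sup>2))"
        by (subst sum_ennreal) (auto simp: sum_distrib_left)
      also have "\<dots> \<le> ennreal (\<bar>\<xi>\<bar> powr \<gamma> * (K2 * (\<Sum>l<d. (cmod (fourier (v l) \<xi>))\<^sup>2)))"
        by (intro ennreal_leI mult_left_mono bes) auto
      also have "\<dots> = ennreal (\<Sum>l<d. K2 * (\<bar>\<xi>\<bar> powr \<gamma> * (cmod (fourier (v l) \<xi>))\<^sup>2))"
        by (simp add: sum_distrib_left mult_ac)
      also have "\<dots> = (\<Sum>l<d. ennreal (K2 * (\<bar>\<xi>\<bar> powr \<gamma> * (cmod (fourier (v l) \<xi>))\<^sup>2)))"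
        using K2_pos by (intro sum_ennreal[symmetric]) auto
      also have "\<dots> = (\<Sum>l<d. ennreal K2 * ennreal (\<bar>\<xi>\<bar> powr \<gamma> * (cmod (fourier (v l) \<xi>))\<^sup>2))"
        using K2_pos by (intro sum.cong refl ennreal_mult) auto
      finally show "(\<Sum>k<n'. ?X k \<xi>) \<le> (\<Sum>l<d. ennreal K2 * ennreal (\<bar>\<xi>\<bar> powr \<gamma> * (cmod (fourier (v l) \<xi>))\<^sup>2))" .
    qed
  qed
  also have "\<dots> = (\<Sum>l<d. ennreal K2 * (\<integral>\<^sup>+\<xi>. ennreal (\<bar>\<xi>\<bar> powr \<gamma> * (cmod (fourier (v l) \<xi>))\<^sup>2) \<partial>lebesgue))"
  proof -
    have m: "(\<lambda>\<xi>. ennreal (\<bar>\<xi>\<bar> powr \<gamma> * (cmod (fourier (v l) \<xi>))\<^sup>2)) \<in> borel_measurable lebesgue" for l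
    proof -
      note [measurable] = Fm
      have "(\<lambda>\<xi>. ennreal (\<bar>\<xi>\<bar> powr \<gamma> * (cmod (fourier (v l) \<xi>))\<^sup>2)) \<in> borel_measurable lborel" by measurable
      then show ?thesis by (rule measurable_completion)
    qed
    show ?thesis using m by (subst nn_integral_sum) (auto simp: nn_integral_cmult)
  qed
  also have "\<dots> \<le> (\<Sum>l<d. ennreal K2 * ennreal (G.Ff (cp c l) (tr r (cp c l)) / G.cF))"
    unfolding v_def by (intro sum_mono mult_left_mono G.fourier_pw[OF r]) auto
  also have "\<dots> = ennreal (K2 / G.cF * (\<Sum>l<d. G.Ff (cp c l) (tr r (cp c l))))"
  proof -
    have nn: "0 \<le> G.Ff (cp c l) (tr r (cp c l)) / G.cF" for l using G.Ff_tr(1)[OF r, of "cp c l"] G.cF_pos by simp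
    have "(\<Sum>l<d. ennreal K2 * ennreal (G.Ff (cp c l) (tr r (cp c l)) / G.cF)) = (\<Sum>l<d. ennreal (K2 * (G.Ff (cp c l) (tr r (cp c l)) / G.cF)))"
      using K2_pos nn by (intro sum.cong refl ennreal_mult[symmetric]) auto
    also have "\<dots> = ennreal (\<Sum>l<d. K2 * (G.Ff (cp c l) (tr r (cp c l)) / G.cF))"
      using K2_pos nn by (intro sum_ennreal) (auto intro!: mult_nonneg_nonneg simp del: times_divide_eq_right)
    finally show ?thesis by (simp add: sum_distrib_left)
  qed
  finally show ?thesis unfolding frac_seminorm_H01_def by (rule enn_sqrt_le)
qed

text \<open>The first factor of the constant adds up the three quantities on the left, each a
  multiple of the root of \<open>Z r\<close>: 1 for the L2 norm and sqrt(K2/cF) for each seminorm.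
  The second factor comes from bounding that root by the data.\<close>

lemma stability:
  assumes sol: "is_discrete_solution a b T \<alpha> \<beta> m n \<kappa>1 \<kappa>2 N xs J \<sigma> u0 f U" and f2: "f \<in> L2w_Hm1 a b \<beta> T"
    and r: "r \<in> {1..J}" and e: "H01_onb a b e"
  shows "ennreal (L2_norm_on a b (left_val T J \<sigma> U r)) +
      ennreal (sqrt \<kappa>1) * frac_seminorm_H01 a b e (\<alpha> / 2) {0<..<\<tau> r} U +
      ennreal (sqrt \<kappa>2) * frac_seminorm_H01 a b e (\<beta> / 2) {0<..<\<tau> r} U
    \<le> ennreal ((1 + sqrt (K2 / A.cF) + sqrt (K2 / B.cF)) * ((b - a) + sqrt (2 * K2 * Gamma (1 - \<beta>))) *
        (H1_norm a b u0 + 1 / sqrt \<kappa>2 * L2w_Hm1_norm a b \<beta> (\<tau> r) f))"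
proof -
  have r': "0 < r" "r \<le> J" using r by auto
  have W: "U \<in> Wht a b N xs n m T J \<sigma>" using sol by (simp add: is_discrete_solution_def)
  obtain c where c: "rep U c" using rep_ex[OF W] by blast
  have BL: "\<And>e. Bil c e = Lf e" using solution_iff[OF c W] sol by simp
  note eb = energy_bound[OF r' f2 BL]
  have pos: "0 \<le> L2_inner a b (LV c r) (LV c r)" "0 \<le> \<kappa>1 * EA c r" "0 \<le> \<kappa>2 * EB c r"
    using L.nonneg[OF LV_L2] EA_nonneg[OF r'] EB_nonneg[OF r'] ka by auto
  let ?z = "sqrt (Z r)"
  have Z0: "0 \<le> Z r" using eb pos by linarith
  have "L2_norm_on a b (left_val T J \<sigma> U r) \<le> ?z"
    using L2_norm_left_val[OF c r'(2)] eb pos by (intro real_le_rsqrt) linarith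
  then have 1: "ennreal (L2_norm_on a b (left_val T J \<sigma> U r)) \<le> ennreal ?z" by (rule ennreal_leI)
  have semi: "ennreal (sqrt \<kappa>) * X \<le> ennreal (sqrt (K2 / C) * ?z)"
    if "X \<le> ennreal (sqrt (K2 / C * E))" "\<kappa> * E \<le> Z r" "0 < \<kappa>" "0 < C" for X \<kappa> C E
  proof -
    have "ennreal (sqrt \<kappa>) * X \<le> ennreal (sqrt \<kappa>) * ennreal (sqrt (K2 / C * E))" by (rule mult_left_mono[OF that(1)]) simp
    also have "\<dots> \<le> ennreal (sqrt \<kappa> * sqrt (K2 / C * E))"
    proof (cases "0 \<le> E")
      case True then show ?thesis using K2_pos that by (simp add: ennreal_mult[symmetric])
    next
      \<comment> \<open>\<open>ennreal\<close> sends negative numbers to 0, so a negative E makes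
        the right-hand side of the seminorm bound vanish.\<close>
      case False
      then have "K2 / C * E \<le> 0" using K2_pos that by (intro mult_nonneg_nonpos) auto
      then have "ennreal (sqrt (K2 / C * E)) = 0" by (intro ennreal_neg) simp
      then show ?thesis by simp
    qed
    also have "sqrt \<kappa> * sqrt (K2 / C * E) = sqrt (K2 / C) * sqrt (\<kappa> * E)" 
      unfolding real_sqrt_mult[of "K2 / C" E] real_sqrt_mult[of \<kappa> E] by (simp only: mult_ac)
    also have "ennreal \<dots> \<le> ennreal (sqrt (K2 / C) * ?z)"
      using that K2_pos by (intro ennreal_leI mult_left_mono real_sqrt_le_mono) auto
    finally show ?thesis .
  qed
  have 2: "ennreal (sqrt \<kappa>1) * frac_seminorm_H01 a b e (\<alpha> / 2) {0<..<\<tau> r} U \<le> ennreal (sqrt (K2 / A.cF) * ?z)"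
    by (rule semi[OF frac_seminorm_bound[OF r' c e A.frac_time_axioms]])
      (use eb pos ka A.cF_pos in \<open>auto simp: EA_def\<close>)
  have 3: "ennreal (sqrt \<kappa>2) * frac_seminorm_H01 a b e (\<beta> / 2) {0<..<\<tau> r} U \<le> ennreal (sqrt (K2 / B.cF) * ?z)"
    by (rule semi[OF frac_seminorm_bound[OF r' c e B.frac_time_axioms]])
      (use eb pos ka B.cF_pos in \<open>auto simp: EB_def\<close>)
  have s0: "0 \<le> sqrt (K2 / A.cF)" "0 \<le> sqrt (K2 / B.cF)" using K2_pos A.cF_pos B.cF_pos by auto
  let ?A = "H1_norm a b u0" and ?B = "1 / sqrt \<kappa>2 * L2w_Hm1_norm a b \<beta> (\<tau> r) f"
  let ?p = "b - a" and ?q = "sqrt (2 * K2 * Gamma (1 - \<beta>))"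
  have A0: "0 \<le> ?A" unfolding H1_norm_def using H0.nonneg[OF u0] by simp
  have B0: "0 \<le> ?B"
  proof -
    have "0 \<le> L2w_Hm1_norm a b \<beta> (\<tau> r) f"
      unfolding L2w_Hm1_norm_def set_lebesgue_integral_def by (intro real_sqrt_ge_zero Bochner_Integration.integral_nonneg) auto
    then show ?thesis using ka by simp
  qed
  have p0: "0 \<le> ?p" using ab by simp
  have q0: "0 \<le> ?q" using K2_pos B.Gamma_pos by simp
  \<comment> \<open>In terms of the two data norms \<open>Z r\<close> is a sum of squares, so its
    root is at most the sum of the two terms; cross terms are then added to factor the constants
    out.\<close>
  have "Z r = (?p * ?A)\<^sup>2 + (?q * ?B)\<^sup>2"
    using K2_pos B.Gamma_pos ka by (simp add: Z_def power_mult_distrib power_divide)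
  also have "\<dots> \<le> (?p * ?A + ?q * ?B)\<^sup>2"
    using mult_nonneg_nonneg[OF mult_nonneg_nonneg[OF p0 A0] mult_nonneg_nonneg[OF q0 B0]] by (simp add: power2_sum)
  finally have "?z \<le> ?p * ?A + ?q * ?B"
    using mult_nonneg_nonneg[OF p0 A0] mult_nonneg_nonneg[OF q0 B0] by (intro real_le_lsqrt[OF _ ]) auto
  also have "\<dots> \<le> (?p + ?q) * (?A + ?B)"
  proof -
    have "(p + q) * (x + y) = p * x + q * y + (p * y + q * x)" for p q x y :: real by (simp add: algebra_simps)
    from this[of ?p ?q ?A ?B] show ?thesis using mult_nonneg_nonneg[OF p0 B0] mult_nonneg_nonneg[OF q0 A0] by linarith
  qed
  finally have z: "?z \<le> (?p + ?q) * (?A + ?B)" .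
  have z0: "0 \<le> ?z" using Z0 by simp
  have "ennreal (L2_norm_on a b (left_val T J \<sigma> U r)) +
      ennreal (sqrt \<kappa>1) * frac_seminorm_H01 a b e (\<alpha> / 2) {0<..<\<tau> r} U +
      ennreal (sqrt \<kappa>2) * frac_seminorm_H01 a b e (\<beta> / 2) {0<..<\<tau> r} U
    \<le> ennreal ?z + ennreal (sqrt (K2 / A.cF) * ?z) + ennreal (sqrt (K2 / B.cF) * ?z)"
    by (intro add_mono 1 2 3)
  also have "\<dots> = ennreal (?z + sqrt (K2 / A.cF) * ?z + sqrt (K2 / B.cF) * ?z)"
    using s0 z0 by (subst ennreal_plus, simp, simp, subst ennreal_plus) auto
  also have "?z + sqrt (K2 / A.cF) * ?z + sqrt (K2 / B.cF) * ?z = (1 + sqrt (K2 / A.cF) + sqrt (K2 / B.cF)) * ?z"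
    by (simp only: distrib_right mult_1)
  also have "ennreal \<dots> \<le> ennreal ((1 + sqrt (K2 / A.cF) + sqrt (K2 / B.cF)) * ((?p + ?q) * (?A + ?B)))"
    using s0 z by (intro ennreal_leI mult_left_mono) auto
  finally show ?thesis by (simp only: mult.assoc)
qed

end

theorem theorem3p1:
  fixes a b \<alpha> \<beta> :: real and m n :: nat
  assumes "a < b" and "0 < \<alpha>" and "\<alpha> < \<beta>" and "\<beta> < 1" and "1 \<le> n"
  shows "\<exists>C>0. \<forall>(T::real) (\<kappa>1::real) (\<kappa>2::real) u0 f (N::nat) xs (J::nat) (\<sigma>::real).
    0 < T \<and> 0 < \<kappa>1 \<and> 0 < \<kappa>2 \<and> u0 \<in> H01_space a b \<and> f \<in> L1_Hm1 a b T \<and>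
    is_partition a b N xs \<and> 0 < J \<and> 1 \<le> \<sigma> \<longrightarrow>
    (\<exists>U. is_discrete_solution a b T \<alpha> \<beta> m n \<kappa>1 \<kappa>2 N xs J \<sigma> u0 f U) \<and>
    (\<forall>U U'. is_discrete_solution a b T \<alpha> \<beta> m n \<kappa>1 \<kappa>2 N xs J \<sigma> u0 f U \<and>
            is_discrete_solution a b T \<alpha> \<beta> m n \<kappa>1 \<kappa>2 N xs J \<sigma> u0 f U' \<longrightarrow>
            ae_equal a b T U U') \<and>
    (\<forall>U. is_discrete_solution a b T \<alpha> \<beta> m n \<kappa>1 \<kappa>2 N xs J \<sigma> u0 f U \<and>
         f \<in> L2w_Hm1 a b \<beta> T \<longrightarrow>
         (\<forall>j \<in> {1..J}. \<forall>e. H01_onb a b e \<longrightarrow>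
            ennreal (L2_norm_on a b (left_val T J \<sigma> U j)) +
            ennreal (sqrt \<kappa>1) *
              frac_seminorm_H01 a b e (\<alpha> / 2) {0<..<time_node T J \<sigma> j} U +
            ennreal (sqrt \<kappa>2) *
              frac_seminorm_H01 a b e (\<beta> / 2) {0<..<time_node T J \<sigma> j} U
            \<le> ennreal (C * (H1_norm a b u0 +
                 1 / sqrt \<kappa>2 * L2w_Hm1_norm a b \<beta> (time_node T J \<sigma> j) f))))"
proof -
  let ?K = "1 + (b - a)\<^sup>2"
  \<comment> \<open>The constant is fixed before T, the coefficients, the data and both meshes; it
    is formed from \<alpha>, \<beta> and the length b - a.\<close>
  let ?C = "(1 + sqrt (?K / frac_order.cF \<alpha>) + sqrt (?K / frac_order.cF \<beta>)) * ((b - a) + sqrt (2 * ?K * Gamma (1 - \<beta>)))"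
  interpret A: frac_order \<alpha> by unfold_locales (use assms in auto)
  interpret B: frac_order \<beta> by unfold_locales (use assms in auto)
  have K: "0 < ?K" by (rule add_pos_nonneg) auto
  have C: "0 < ?C"
    using K A.cF_pos B.cF_pos B.Gamma_pos assms(1)
    by (intro mult_pos_pos add_pos_nonneg) auto
  show ?thesis
  proof (intro exI[of _ ?C] conjI[OF C] allI impI)
    fix T \<kappa>1 \<kappa>2 :: real and u0 :: "real \<Rightarrow> real" and f :: "real \<Rightarrow> (real \<Rightarrow> real) \<Rightarrow> real"
      and N :: nat and xs :: "nat \<Rightarrow> real" and J :: nat and \<sigma> :: real
    assume H: "0 < T \<and> 0 < \<kappa>1 \<and> 0 < \<kappa>2 \<and> u0 \<in> H01_space a b \<and> f \<in> L1_Hm1 a b T \<and>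
      is_partition a b N xs \<and> 0 < J \<and> 1 \<le> \<sigma>"
    interpret me: mesh a b N xs n by unfold_locales (use H assms in auto)
    \<comment> \<open>The dimension and the basis depend on the mesh, so they are chosen only now,
      after the constant.\<close>
    obtain d :: nat and w where w: "\<And>l. l < d \<Longrightarrow> w l \<in> Sh a b N xs n"
      "\<And>k l. k < d \<Longrightarrow> l < d \<Longrightarrow> Dir_inner a b (w k) (w l) = (if k = l then 1 else 0)"
      "\<And>v x. v \<in> Sh a b N xs n \<Longrightarrow> x \<in> me.P \<Longrightarrow> v x = (\<Sum>l<d. Dir_inner a b v (w l) * w l x)"
      by (rule me.basis) blast+
    interpret X: disc a b N xs n T \<sigma> J m d w \<alpha> \<beta> \<kappa>1 \<kappa>2 u0 f
    proof unfold_locales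
      show "w l \<in> Sh a b N xs n" if "l < d" for l using w(1) that .
      show "Dir_inner a b (w k) (w l) = (if k = l then 1 else 0)" if "k < d" "l < d" for k l using w(2) that .
      show "v x = (\<Sum>l<d. Dir_inner a b v (w l) * w l x)" if "v \<in> Sh a b N xs n" "x \<in> me.P" for v x using w(3) that .
    qed (use H assms in auto)
    show "(\<exists>U. is_discrete_solution a b T \<alpha> \<beta> m n \<kappa>1 \<kappa>2 N xs J \<sigma> u0 f U) \<and>
    (\<forall>U U'. is_discrete_solution a b T \<alpha> \<beta> m n \<kappa>1 \<kappa>2 N xs J \<sigma> u0 f U \<and>
            is_discrete_solution a b T \<alpha> \<beta> m n \<kappa>1 \<kappa>2 N xs J \<sigma> u0 f U' \<longrightarrow>
            ae_equal a b T U U') \<and>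
    (\<forall>U. is_discrete_solution a b T \<alpha> \<beta> m n \<kappa>1 \<kappa>2 N xs J \<sigma> u0 f U \<and>
         f \<in> L2w_Hm1 a b \<beta> T \<longrightarrow>
         (\<forall>j \<in> {1..J}. \<forall>e. H01_onb a b e \<longrightarrow>
            ennreal (L2_norm_on a b (left_val T J \<sigma> U j)) +
            ennreal (sqrt \<kappa>1) *
              frac_seminorm_H01 a b e (\<alpha> / 2) {0<..<time_node T J \<sigma> j} U +
            ennreal (sqrt \<kappa>2) *
              frac_seminorm_H01 a b e (\<beta> / 2) {0<..<time_node T J \<sigma> j} U
            \<le> ennreal (?C * (H1_norm a b u0 +
                 1 / sqrt \<kappa>2 * L2w_Hm1_norm a b \<beta> (time_node T J \<sigma> j) f))))"
      using X.solution_exists X.solution_unique X.stability[unfolded X.K2_def] by blast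
  qed
qed

end
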